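(* Let $\rho_0\in\mathcal{P}_2(\mathbb{R})$ and $v_0\in C_b(\mathbb{R})$, and let $(\rho,v)$ be the sticky particles solution (SPS) on $\mathbb{R}$ with initial data $(\rho_0,v_0)$. For $t\ge0$ let $N(t,\cdot)$ be the right-continuous nondecreasing map pushing Lebesgue measure on $(0,1)$ forward to $\rho(t,\cdot)$, and set $N_0:=N(0,\cdot)$, $V_0:=v_0\circ N_0$. Let $\mathcal{K}\subset L^2(0,1)$ be the closed convex cone of nondecreasing functions, and $\mathrm{proj}_{\mathcal{K}}$ the metric projection onto it. Then $$\Big\|\frac{N(t,\cdot)}{t}-\mathrm{proj}_{\mathcal{K}}V_0\Big\|_{L^2(0,1)}\le\frac{\|N_0\|_{L^2(0,1)}}{t}\quad\text{for all }t>0.$$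
   Context: $\mathcal{P}(\mathbb{R})$ denotes Borel probability measures on $\mathbb{R}$, $\mathcal{P}_2(\mathbb{R})$ those with finite second moment, $C_b(\mathbb{R})$ the bounded continuous functions; narrow convergence is convergence against $C_b(\mathbb{R})$. For $\rho_0\in\mathcal{P}_2(\mathbb{R})$ and $v_0\in C_b(\mathbb{R})$, the sticky particles solution (SPS) on $\mathbb{R}$ with data $(\rho_0,v_0)$ is a pair $(\rho,v)$, with $\rho:[0,\infty)\to\mathcal{P}(\mathbb{R})$ narrowly continuous and $v:[0,\infty)\times\mathbb{R}\to\mathbb{R}$ Borel, such that: (1) $\int_0^T\int v^2\,\rho(t,dy)\,dt<\infty$ for all $T>0$; (2) $\int_0^\infty\int(\partial_t\phi+v\partial_y\phi)\,\rho(t,dy)\,dt+\int\phi(0,y)\,\rho_0(dy)=0$ for all $\phi\in C^1_c([0,\infty)\times\mathbb{R})$; (3) $\int_0^\infty\int(v\partial_t\phi+v^2\partial_y\phi)\,\rho(t,dy)\,dt+\int\phi(0,y)v_0(y)\,\rho_0(dy)=0$ for all $\phi\in C^1_c([0,\infty)\times\mathbb{R})$; (4) for all $t>0$ and all $y_1<y_2$, $\frac{v(t,y_2)-v(t,y_1)}{y_2-y_1}\le\frac1t$; (5) for all $\phi\in C_b(\mathbb{R})$, $\int v^2(t,y)\phi(y)\,\rho(t,dy)\to\int v_0^2(y)\phi(y)\,\rho_0(dy)$ as $t\to0^+$. Such a pair exists and $\rho$ is uniquely determined. *)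

theory Defs
  imports "HOL-Probability.Probability"
begin

section \<open>Probability measures on the line\<close>

text \<open>Here \<open>real_distribution\<close> is the predicate of being a Borel probability measure on
  the reals, and \<open>bcontfun\<close> is the set of bounded continuous functions.\<close>

definition P2 :: "real measure set" where
  "P2 = {\<mu>. real_distribution \<mu> \<and> integrable \<mu> (\<lambda>y. y\<^sup>2)}"

definition narrowly_continuous :: "(real \<Rightarrow> real measure) \<Rightarrow> bool" where
  "narrowly_continuous \<rho> \<longleftrightarrow>
     (\<forall>\<phi> \<in> (bcontfun :: (real \<Rightarrow> real) set). continuous_on {0..} (\<lambda>t. \<integral>y. \<phi> y \<partial>\<rho> t))"


section \<open>Sticky particles solutions\<close>

abbreviation half_plane :: "(real \<times> real) set" where
  "half_plane \<equiv> {0..} \<times> UNIV"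

text \<open>\<open>C1c_test \<phi> \<phi>\<^sub>t \<phi>\<^sub>y\<close>: the function \<open>\<phi>\<close> is compactly supported and continuously
  differentiable on the closed half plane (up to and including \<open>t = 0\<close>, where it need not
  vanish), with partial derivatives \<open>\<phi>\<^sub>t\<close> and \<open>\<phi>\<^sub>y\<close>. Values outside the half plane are
  unconstrained.\<close>

definition C1c_test ::
  "(real \<Rightarrow> real \<Rightarrow> real) \<Rightarrow> (real \<Rightarrow> real \<Rightarrow> real) \<Rightarrow> (real \<Rightarrow> real \<Rightarrow> real) \<Rightarrow> bool" where
  "C1c_test \<phi> \<phi>\<^sub>t \<phi>\<^sub>y \<longleftrightarrow>
     (\<forall>t\<ge>0. \<forall>y. ((\<lambda>(s, x). \<phi> s x) has_derivative (\<lambda>(h, k). \<phi>\<^sub>t t y * h + \<phi>\<^sub>y t y * k))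
                  (at (t, y) within half_plane)) \<and>
     continuous_on half_plane (\<lambda>(t, y). \<phi>\<^sub>t t y) \<and>
     continuous_on half_plane (\<lambda>(t, y). \<phi>\<^sub>y t y) \<and>
     compact (closure {(t, y). (t, y) \<in> half_plane \<and> \<phi> t y \<noteq> 0})"

text \<open>In the last condition, the convergence presupposes that the integrals of \<open>v\<^sup>2 \<phi>\<close> are
  defined for small \<open>t > 0\<close>. This is stated explicitly, since the Bochner integral of a
  non-integrable function is 0 by convention. In the weak equations integrability follows from
  the finiteness of the kinetic energy.\<close>

definition sticky_particles_solution ::
  "real measure \<Rightarrow> (real \<Rightarrow> real) \<Rightarrow> (real \<Rightarrow> real measure) \<Rightarrow> (real \<Rightarrow> real \<Rightarrow> real) \<Rightarrow> bool" where
  "sticky_particles_solution \<rho>\<^sub>0 v\<^sub>0 \<rho> v \<longleftrightarrow>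
     (\<forall>t\<ge>0. real_distribution (\<rho> t)) \<and>
     narrowly_continuous \<rho> \<and>
     (\<lambda>(t, y). v t y) \<in> borel_measurable (restrict_space borel half_plane) \<and>
     (\<forall>T>0. (\<integral>\<^sup>+ t\<in>{0..T}. (\<integral>\<^sup>+ y. ennreal ((v t y)\<^sup>2) \<partial>\<rho> t) \<partial>lborel) < \<infinity>) \<and>
     (\<forall>\<phi> \<phi>\<^sub>t \<phi>\<^sub>y. C1c_test \<phi> \<phi>\<^sub>t \<phi>\<^sub>y \<longrightarrow>
        (LINT t:{0..}|lborel. (\<integral>y. \<phi>\<^sub>t t y + v t y * \<phi>\<^sub>y t y \<partial>\<rho> t))
          + (\<integral>y. \<phi> 0 y \<partial>\<rho>\<^sub>0) = 0) \<and>
     (\<forall>\<phi> \<phi>\<^sub>t \<phi>\<^sub>y. C1c_test \<phi> \<phi>\<^sub>t \<phi>\<^sub>y \<longrightarrow>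
        (LINT t:{0..}|lborel. (\<integral>y. v t y * \<phi>\<^sub>t t y + (v t y)\<^sup>2 * \<phi>\<^sub>y t y \<partial>\<rho> t))
          + (\<integral>y. \<phi> 0 y * v\<^sub>0 y \<partial>\<rho>\<^sub>0) = 0) \<and>
     (\<forall>t>0. \<forall>y\<^sub>1 y\<^sub>2. y\<^sub>1 < y\<^sub>2 \<longrightarrow> (v t y\<^sub>2 - v t y\<^sub>1) / (y\<^sub>2 - y\<^sub>1) \<le> 1 / t) \<and>
     (\<forall>\<^sub>F t in at_right 0. integrable (\<rho> t) (\<lambda>y. (v t y)\<^sup>2)) \<and>
     (\<forall>\<phi> \<in> bcontfun.
        ((\<lambda>t. \<integral>y. (v t y)\<^sup>2 * \<phi> y \<partial>\<rho> t) \<longlongrightarrow> (\<integral>y. (v\<^sub>0 y)\<^sup>2 * \<phi> y \<partial>\<rho>\<^sub>0)) (at_right 0))"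


section \<open>Monotone rearrangements\<close>

abbreviation leb01 :: "real measure" where
  "leb01 \<equiv> lebesgue_on {0<..<1}"

text \<open>These conditions determine the values of \<open>X\<close> on the interval \<open>(0,1)\<close>; elsewhere they
  are irrelevant.\<close>

definition monotone_rearrangement :: "real measure \<Rightarrow> (real \<Rightarrow> real) \<Rightarrow> bool" where
  "monotone_rearrangement \<mu> X \<longleftrightarrow>
     mono_on {0<..<1} X \<and>
     (\<forall>s\<in>{0<..<1}. continuous (at_right s) X) \<and>
     distr leb01 borel X = \<mu>"


section \<open>Square-integrable functions and the cone of nondecreasing functions\<close>

text \<open>Elements of \<open>L\<^sup>2(0,1)\<close> are represented by functions, not by almost-everywhere classes.\<close>

definition L2 :: "(real \<Rightarrow> real) set" where
  "L2 = {f. f \<in> borel_measurable leb01 \<and> integrable leb01 (\<lambda>s. (f s)\<^sup>2)}"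

text \<open>Meaningful on \<open>L2\<close> only.\<close>

definition L2_norm :: "(real \<Rightarrow> real) \<Rightarrow> real" where
  "L2_norm f = sqrt (\<integral>s. (f s)\<^sup>2 \<partial>leb01)"

definition mono_cone :: "(real \<Rightarrow> real) set" where
  "mono_cone = {f \<in> L2. \<exists>g. mono_on {0<..<1} g \<and> (AE s in leb01. f s = g s)}"

text \<open>A representative of the metric projection, which is unique up to null sets.\<close>

definition proj_mono_cone :: "(real \<Rightarrow> real) \<Rightarrow> (real \<Rightarrow> real)" where
  "proj_mono_cone f = arg_min_on (\<lambda>g. L2_norm (\<lambda>s. f s - g s)) mono_cone"

end

theory Submission
  imports Defs
begin

text \<open>
  Write \<open>X\<^sub>t\<close> for the rearrangement \<open>N t\<close>, \<open>V\<^sub>t = v t \<circ> X\<^sub>t\<close> and \<open>\<E>\<close> for the mean over \<open>(0,1)\<close>.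
  The estimate is a consequence of one variational fact: the defect
  \<open>R\<^sub>t = X\<^sub>0 + t V\<^sub>0 - X\<^sub>t\<close> of free flight satisfies \<open>\<E> R\<^sub>t X\<^sub>t = 0\<close> and \<open>\<E> R\<^sub>t k \<le> 0\<close> for every
  square integrable nondecreasing \<open>k\<close>. In other words \<open>n\<^sub>t = X\<^sub>t / t\<close> is the projection of
  \<open>V\<^sub>0 + X\<^sub>0 / t\<close> onto the cone. Comparing two times gives
  \<open>\<parallel>n\<^sub>t - n\<^sub>r\<parallel> \<le> \<bar>1/t - 1/r\<bar> \<parallel>X\<^sub>0\<parallel>\<close>, and \<open>r \<rightarrow> \<infinity>\<close> yields the claim, the limit of \<open>n\<^sub>r\<close> being
  characterised by the variational inequality of the projection of \<open>V\<^sub>0\<close>.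

  The variational fact follows from the weak equations and the one-sided Lipschitz bound by these
  steps.

  \<^item> The conservation of mass, tested with truncations moving at constant speed, bounds the
    displacement: \<open>\<E> (X\<^sub>t - X\<^sub>c)\<^sup>2 \<le> (t - c) \<integral>\<E> V\<^sup>2\<close> (\<open>displacement_square\<close>).
  \<^item> In \<open>L\<^sup>2\<close> of the flow the velocity is close to a Lipschitz field, and with its help the equations
    are linearised on short time windows, with errors that disappear when the windows are summed
    over a fine subdivision. This gives \<open>d/dt \<E> X k = \<E> V k\<close> for bounded \<open>k\<close>
    (\<open>velocity_balance\<close>) and, from the momentum equation, that \<open>\<E> X\<^sub>t K\<close> is affine in time as long as
    \<open>K\<close> is a Lipschitz function of the current position (\<open>midpoint_affine\<close>).
  \<^item> The one-sided Lipschitz bound makes the gaps of \<open>n\<^sub>t\<close> nonincreasing in time (\<open>sticky\<close>). Therefore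
    a Lipschitz function of \<open>X\<^sub>t\<close> is a Lipschitz function of all earlier positions, and
    \<open>\<E> R\<^sub>r \<psi>(X\<^sub>t) = 0\<close> for \<open>r \<le> t\<close> (\<open>terminal_lipschitz\<close>). Letting \<open>\<psi>\<close> approximate the identity
    gives \<open>\<E> R\<^sub>t X\<^sub>t = 0\<close>.
  \<^item> For \<open>k = 1\<^bsub>(m,1)\<^esub>\<close> the quotient \<open>\<E> (X\<^sub>t - X\<^sub>0) k / t\<close> is nondecreasing (\<open>mean_displacement_mono\<close>)
    and tends to \<open>\<E> V\<^sub>0 k\<close> as \<open>t \<rightarrow> 0\<close> (\<open>initial_velocity\<close>), so \<open>\<E> R\<^sub>t k \<le> 0\<close>; a layer decomposition
    extends this to the cone (\<open>defect_polar\<close>).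
\<close>

section \<open>Square integrable functions\<close>

text \<open>The weight \<open>\<theta>\<close> is left free because later bounds balance a large against
 a small square.\<close>

lemma young_ineq:
 fixes x y \<theta> :: real
 assumes "\<theta> > 0"
 shows "\<bar>x * y\<bar> <= \<theta> / 2 * x\<^sup>2 + y\<^sup>2 / (2 * \<theta>)"
proof -
 have "0 <= (\<theta> * \<bar>x\<bar> - \<bar>y\<bar>)\<^sup>2" by simp
 then have "2 * \<theta> * \<bar>x * y\<bar> <= \<theta>\<^sup>2 * x\<^sup>2 + y\<^sup>2"
  by (simp add: power2_diff power_mult_distrib abs_mult algebra_simps)
 then show ?thesis using assms by (simp add: field_simps power2_eq_square)
qed

lemma integrable_mult_of_squares:
 fixes f g :: "'a => real"
 assumes [measurable]: "f \<in> borel_measurable M" "g \<in> borel_measurable M"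
  and "integrable M (\<lambda>x. (f x)\<^sup>2)" "integrable M (\<lambda>x. (g x)\<^sup>2)"
 shows "integrable M (\<lambda>x. f x * g x)"
proof (rule Bochner_Integration.integrable_bound)
 show "integrable M (\<lambda>x. 1/2 * (f x)\<^sup>2 + (g x)\<^sup>2 / (2 * 1))"
  using assms by (intro Bochner_Integration.integrable_add) auto
 show "AE x in M. norm (f x * g x) <= norm (1/2 * (f x)\<^sup>2 + (g x)\<^sup>2 / (2 * 1))"
  by (rule AE_I2) (use young_ineq[of 1] in \<open>force\<close>)
qed simp

lemma integrable_square_add:
 fixes f g :: "'a => real"
 assumes [measurable]: "f \<in> borel_measurable M" "g \<in> borel_measurable M"
  and "integrable M (\<lambda>x. (f x)\<^sup>2)" "integrable M (\<lambda>x. (g x)\<^sup>2)"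
 shows "integrable M (\<lambda>x. (f x + g x)\<^sup>2)"
 using assms integrable_mult_of_squares[OF assms]
 by (simp add: power2_sum mult.assoc)

lemma integrable_square_cmult:
 fixes f :: "'a => real"
 assumes "integrable M (\<lambda>x. (f x)\<^sup>2)"
 shows "integrable M (\<lambda>x. (c * f x)\<^sup>2)" "integrable M (\<lambda>x. (f x * c)\<^sup>2)"
  "integrable M (\<lambda>x. (f x / c)\<^sup>2)"
 using assms by (auto simp: power_mult_distrib power_divide)

lemma integrable_square_diff:
 fixes f g :: "'a => real"
 assumes [measurable]: "f \<in> borel_measurable M" "g \<in> borel_measurable M"
  and "integrable M (\<lambda>x. (f x)\<^sup>2)" "integrable M (\<lambda>x. (g x)\<^sup>2)"
 shows "integrable M (\<lambda>x. (f x - g x)\<^sup>2)"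
 using integrable_square_add[of f M "\<lambda>x. - g x"] assms by simp

lemma (in finite_measure) integrable_of_square:
 fixes f :: "'a => real"
 assumes [measurable]: "f \<in> borel_measurable M" and "integrable M (\<lambda>x. (f x)\<^sup>2)"
 shows "integrable M f"
 using integrable_mult_of_squares[of f M "\<lambda>_. 1"] assms by simp

lemma (in finite_measure) integrable_square_bounded:
 fixes f :: "'a => real"
 assumes [measurable]: "f \<in> borel_measurable M" and "\<And>x. \<bar>f x\<bar> <= B"
 shows "integrable M (\<lambda>x. (f x)\<^sup>2)"
proof (rule integrable_const_bound[where B="B\<^sup>2"])
 show "AE x in M. norm ((f x)\<^sup>2) <= B\<^sup>2"
  using assms(2) by (auto intro!: AE_I2 simp: abs_le_square_iff[symmetric] order_trans[OF _ abs_ge_self])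
qed simp

lemma integral_abs_mult_le:
 fixes f g :: "'a => real"
 assumes [measurable]: "f \<in> borel_measurable M" "g \<in> borel_measurable M"
  and f: "integrable M (\<lambda>x. (f x)\<^sup>2)" and g: "integrable M (\<lambda>x. (g x)\<^sup>2)" and "\<theta> > 0"
 shows "(\<integral>x. \<bar>f x * g x\<bar> \<partial>M) <= \<theta> / 2 * (\<integral>x. (f x)\<^sup>2 \<partial>M) + (\<integral>x. (g x)\<^sup>2 \<partial>M) / (2 * \<theta>)"
proof -
 have "(\<integral>x. \<bar>f x * g x\<bar> \<partial>M) <= (\<integral>x. \<theta> / 2 * (f x)\<^sup>2 + (g x)\<^sup>2 / (2 * \<theta>) \<partial>M)"
  using integrable_mult_of_squares[OF assms(1-4)] f g young_ineq[OF \<open>\<theta> > 0\<close>]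
  by (intro integral_mono) auto
 also have "... = \<theta> / 2 * (\<integral>x. (f x)\<^sup>2 \<partial>M) + (\<integral>x. (g x)\<^sup>2 \<partial>M) / (2 * \<theta>)"
  using f g by simp
 finally show ?thesis .
qed

lemma power2_sum_le: "((x::real) + y)\<^sup>2 <= 2 * x\<^sup>2 + 2 * y\<^sup>2"
 using sum_squares_bound[of x y] by (simp add: power2_sum)

text \<open>Outer and inner regularity approximate indicators by distance functions, and truncation
 reduces the general case to these. Bounded support makes the primitives in position of the
 approximating field bounded, hence admissible test functions.\<close>

lemma lipschitz_dense_L2:
 fixes M :: "'a::euclidean_space measure" and f :: "'a => real"
 assumes sets: "sets M = sets borel" and fin: "finite_measure M"
  and meas: "f \<in> borel_measurable M" and sq: "integrable M (\<lambda>x. (f x)\<^sup>2)" and "\<epsilon> > 0"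
 shows "\<exists>w L. L-lipschitz_on UNIV w \<and> bounded {x. w x \<noteq> 0} \<and>
     integrable M (\<lambda>x. (f x - w x)\<^sup>2) \<and> (\<integral>x. (f x - w x)\<^sup>2 \<partial>M) < \<epsilon>"
proof -
 interpret finite_measure M by fact
 have [measurable_cong]: "sets M = sets borel" by fact
 have space: "space M = UNIV" using sets sets_eq_imp_space_eq by fastforce
 define G where "G w \<longleftrightarrow> (\<exists>L. L-lipschitz_on UNIV w) \<and> bounded {x. w x \<noteq> 0}" for w :: "'a => real"
 have G_meas: "w \<in> borel_measurable borel" if "G w" for w
  using that unfolding G_def by (metis borel_measurable_continuous_onI lipschitz_on_continuous_on)
 have G_bdd: "\<exists>B. \<forall>x. \<bar>w x\<bar> <= B" if "G w" for w
 proof -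
  from that obtain L where "L-lipschitz_on UNIV w" and b: "bounded {x. w x \<noteq> 0}" by (auto simp: G_def)
  then have "uniformly_continuous_on {x. w x \<noteq> 0} w"
   by (meson lipschitz_on_subset lipschitz_on_uniformly_continuous subset_UNIV)
  then have "bounded (w ` {x. w x \<noteq> 0})" using b by (rule bounded_uniformly_continuous_image)
  then obtain B where "\<And>x. w x \<noteq> 0 ==> \<bar>w x\<bar> <= B" by (auto simp: bounded_iff)
  then have "\<bar>w x\<bar> <= max B 0" for x by (cases "w x = 0") (auto intro: max.coboundedI1)
  then show ?thesis by blast
 qed
 have G_sq: "integrable M (\<lambda>x. (w x)\<^sup>2)" if "G w" for w
  using G_bdd[OF that] G_meas[OF that] integrable_square_bounded[of w] by auto
 have G_add: "G (\<lambda>x. u x + w x)" if uw: "G u" "G w" for u w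
 proof -
  have "{x. u x + w x \<noteq> 0} \<subseteq> {x. u x \<noteq> 0} \<union> {x. w x \<noteq> 0}" by auto
  then have "bounded {x. u x + w x \<noteq> 0}"
   using that unfolding G_def by (meson bounded_Un bounded_subset)
  moreover obtain L L' where "L-lipschitz_on UNIV u" "L'-lipschitz_on UNIV w"
   using uw unfolding G_def by blast
  then have "(L + L')-lipschitz_on UNIV (\<lambda>x. u x + w x)"
   by (rule lipschitz_on_add)
  ultimately show ?thesis unfolding G_def by blast
 qed
 define P where "P f \<longleftrightarrow> (f \<in> borel_measurable M \<and> integrable M (\<lambda>x. (f x)\<^sup>2) \<longrightarrow>
  (\<forall>\<epsilon>>0. \<exists>w. G w \<and> (\<integral>x. (f x - w x)\<^sup>2 \<partial>M) < \<epsilon>))" for f :: "'a => real"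
 have comb: "\<exists>w. G w \<and> (\<integral>x. (f x - w x)\<^sup>2 \<partial>M) < \<epsilon>"
  if f: "f \<in> borel_measurable M" "integrable M (\<lambda>x. (f x)\<^sup>2)"
   and g: "g \<in> borel_measurable M" "integrable M (\<lambda>x. (g x)\<^sup>2)"
   and d: "(\<integral>x. (f x - g x)\<^sup>2 \<partial>M) < \<epsilon> / 4" and w: "G w" "(\<integral>x. (g x - w x)\<^sup>2 \<partial>M) < \<epsilon> / 4"
  for f g w \<epsilon>
 proof -
  note [measurable] = f(1) g(1) G_meas[OF w(1)]
  have "(\<integral>x. (f x - w x)\<^sup>2 \<partial>M) <= (\<integral>x. 2 * (f x - g x)\<^sup>2 + 2 * (g x - w x)\<^sup>2 \<partial>M)"
  proof (rule integral_mono)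
   show "integrable M (\<lambda>x. (f x - w x)\<^sup>2)"
    by (intro integrable_square_diff f G_sq w) measurable
   show "integrable M (\<lambda>x. 2 * (f x - g x)\<^sup>2 + 2 * (g x - w x)\<^sup>2)"
    by (intro Bochner_Integration.integrable_add integrable_mult_right integrable_square_diff f g G_sq w)
     measurable
   show "(f x - w x)\<^sup>2 <= 2 * (f x - g x)\<^sup>2 + 2 * (g x - w x)\<^sup>2" for x
    using power2_sum_le[of "f x - g x" "g x - w x"] by simp
  qed
  also have "... = 2 * (\<integral>x. (f x - g x)\<^sup>2 \<partial>M) + 2 * (\<integral>x. (g x - w x)\<^sup>2 \<partial>M)"
   using integrable_square_diff[OF f(1) g(1) f(2) g(2)] integrable_square_diff[OF g(1) _ g(2) G_sq[OF w(1)]]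
   by simp
  also have "... < \<epsilon>" using d w by simp
  finally show ?thesis using w by blast
 qed
 have P_ind: "P (\<lambda>x. indicator A x *\<^sub>R c)" if A: "A \<in> sets M" for A c
 proof -
  show "P (\<lambda>x. indicator A x *\<^sub>R c)"
   unfolding P_def
  proof (intro impI allI)
   fix \<epsilon> :: real assume "\<epsilon> > 0"
   have [measurable]: "A \<in> sets borel" using A sets by simp
   define \<delta> where "\<delta> = \<epsilon> / (8 * (c\<^sup>2 + 1))"
   have "\<delta> > 0" using \<open>\<epsilon> > 0\<close> by (simp add: \<delta>_def add_nonneg_pos)
   have c\<delta>: "c\<^sup>2 * \<delta> < \<epsilon> / 4"
   proof -
    have "c\<^sup>2 * \<delta> <= (c\<^sup>2 + 1) * \<delta>" using \<open>\<delta> > 0\<close> by (simp add: mult_right_mono)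
    also have "... = \<epsilon> / 8"
    proof -
     have "c\<^sup>2 + 1 \<noteq> 0" using zero_le_power2[of c] by linarith
     then show ?thesis unfolding \<delta>_def by (simp add: divide_simps)
    qed
    finally show ?thesis using \<open>\<epsilon> > 0\<close> by simp
   qed
   have SUP: "emeasure M A = (SUP K \<in> {K. K \<subseteq> A \<and> compact K}. emeasure M K)"
    by (rule inner_regular) (use sets A in auto)
   obtain K where K: "K \<subseteq> A" "compact K" "measure M A < measure M K + \<delta>"
   proof (cases "measure M A < \<delta>")
    case True
    then show ?thesis using that[of "{}"] by simp
   next
    case False
    have "ennreal (measure M A - \<delta>) < emeasure M A"
     using False \<open>\<delta> > 0\<close> by (simp add: emeasure_eq_measure ennreal_less_iff)
    then obtain K where "K \<subseteq> A" "compact K" "ennreal (measure M A - \<delta>) < emeasure M K"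
     unfolding SUP by (auto simp: less_SUP_iff)
    then show ?thesis using that[of K] False by (simp add: emeasure_eq_measure ennreal_less_iff)
   qed
   have [measurable]: "K \<in> sets borel" using K(2) by (simp add: compact_imp_closed borel_closed)
   have dK: "(\<integral>x. (indicator A x *\<^sub>R c - c * indicator K x)\<^sup>2 \<partial>M) < \<epsilon> / 4"
   proof -
    have "(indicator A x *\<^sub>R c - c * indicator K x)\<^sup>2 = c\<^sup>2 * indicator (A - K) x" for x
     using K(1) by (auto simp: indicator_def)
    then have "(\<integral>x. (indicator A x *\<^sub>R c - c * indicator K x)\<^sup>2 \<partial>M) = c\<^sup>2 * measure M (A - K)"
     by (simp add: space)
    also have "measure M (A - K) = measure M A - measure M K"
     using K by (intro finite_measure_Diff) (auto simp: sets)
    also have "c\<^sup>2 * ... <= c\<^sup>2 * \<delta>" using K(3) by (intro mult_left_mono) auto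
    finally show ?thesis using c\<delta> by simp
   qed
   have "\<exists>w. G w \<and> (\<integral>x. (c * indicator K x - w x)\<^sup>2 \<partial>M) < \<epsilon> / 4"
   proof (cases "K = {}")
    case True
    then show ?thesis using \<open>\<epsilon> > 0\<close> by (intro exI[of _ "\<lambda>_. 0"]) (auto simp: G_def lipschitz_on_constant intro: exI[of _ 0])
   next
    case False
    define w where "w n x = c * max 0 (1 - real n * infdist x K)" for n x
    have wlim: "(\<lambda>n. w n x) \<longlonglongrightarrow> c * indicator K x" for x
    proof (cases "x \<in> K")
     case True then show ?thesis by (simp add: w_def)
    next
     case False
     then have "infdist x K \<noteq> 0"
      using \<open>K \<noteq> {}\<close> compact_imp_closed[OF K(2)] in_closed_iff_infdist_zero by blast
     then have "infdist x K > 0" using infdist_nonneg[of x K] by linarith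
     then obtain n0 where "real n0 * infdist x K > 1" using reals_Archimedean3 by blast
     have "w n x = 0" if "n \<ge> n0" for n
     proof -
      have "real n0 * infdist x K <= real n * infdist x K" using that by (intro mult_right_mono infdist_nonneg) auto
      then show ?thesis using \<open>real n0 * infdist x K > 1\<close> by (simp add: w_def)
     qed
     then have "(\<lambda>n. w n x) \<longlonglongrightarrow> 0" by (intro tendsto_eventually) (auto simp: eventually_sequentially)
     then show ?thesis using False by simp
    qed
    have w_bd: "\<bar>w n x\<bar> <= \<bar>c\<bar>" for n x
    proof -
     have "0 <= real n * infdist x K" by (intro mult_nonneg_nonneg infdist_nonneg) simp
     then have "\<bar>max 0 (1 - real n * infdist x K)\<bar> <= 1" by (auto simp: max_def)
     then show ?thesis unfolding w_def abs_mult using mult_left_mono[of _ 1 "\<bar>c\<bar>"] by simp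
    qed
    have Gw: "G (w n)" if "n > 0" for n
     unfolding G_def
    proof
     have "\<bar>w n x - w n y\<bar> <= (\<bar>c\<bar> * real n) * \<bar>x' - y'\<bar>"
      if "x' = infdist x K" "y' = infdist y K" for x y x' y'
     proof -
      have "\<bar>max 0 (1 - real n * x') - max 0 (1 - real n * y')\<bar> <= \<bar>real n * x' - real n * y'\<bar>"
       by (auto simp: max_def)
      also have "... = real n * \<bar>x' - y'\<bar>" by (simp add: abs_mult right_diff_distrib[symmetric])
      finally have "\<bar>c\<bar> * \<bar>max 0 (1 - real n * x') - max 0 (1 - real n * y')\<bar> <= \<bar>c\<bar> * (real n * \<bar>x' - y'\<bar>)"
       by (rule mult_left_mono) simp
      moreover have "w n x - w n y = c * (max 0 (1 - real n * x') - max 0 (1 - real n * y'))"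
       using that by (simp add: w_def right_diff_distrib)
      ultimately show ?thesis by (simp add: abs_mult mult.assoc)
     qed
     then have "dist (w n x) (w n y) <= (\<bar>c\<bar> * real n) * dist x y" for x y
      unfolding dist_real_def
      by (rule order_trans[OF _ mult_left_mono[OF infdist_triangle_abs]]) auto
     then have "(\<bar>c\<bar> * real n)-lipschitz_on UNIV (w n)" by (intro lipschitz_onI) auto
     then show "\<exists>L. L-lipschitz_on UNIV (w n)" ..
     have "{x. w n x \<noteq> 0} \<subseteq> (\<Union>x\<in>K. cball x 1)"
     proof
      fix x assume "x \<in> {x. w n x \<noteq> 0}"
      then have "real n * infdist x K < 1" by (auto simp: w_def max_def split: if_splits)
      moreover have "1 * infdist x K <= real n * infdist x K"
       using that by (intro mult_right_mono infdist_nonneg) simp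
      ultimately have "infdist x K < 1" by simp
      moreover obtain y where "y \<in> K" "infdist x K = dist x y"
       using infdist_attains_inf[OF compact_imp_closed[OF K(2)] \<open>K \<noteq> {}\<close>] by metis
      ultimately show "x \<in> (\<Union>x\<in>K. cball x 1)" by (force simp: dist_commute)
     qed
     moreover have "bounded (\<Union>x\<in>K. cball x 1)"
     proof -
      obtain B where B: "\<And>x. x \<in> K ==> norm x <= B"
       using compact_imp_bounded[OF K(2)] by (auto simp: bounded_iff)
      have "norm y <= B + 1" if "y \<in> (\<Union>x\<in>K. cball x 1)" for y
      proof -
       from that obtain x where "x \<in> K" "dist x y <= 1" by auto
       then show ?thesis using B[of x] norm_triangle_ineq2[of y x] by (simp add: dist_norm norm_minus_commute)
      qed
      then show ?thesis unfolding bounded_iff by blast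
     qed
     ultimately show "bounded {x. w n x \<noteq> 0}" by (rule bounded_subset[rotated])
    qed
    have [measurable]: "w n \<in> borel_measurable borel" if "n > 0" for n using Gw[OF that] G_meas by blast
    have "(\<lambda>n. \<integral>x. (c * indicator K x - w (Suc n) x)\<^sup>2 \<partial>M) \<longlonglongrightarrow> (\<integral>x. (c * indicator K x - c * indicator K x)\<^sup>2 \<partial>M)"
    proof (rule integral_dominated_convergence[where w="\<lambda>_. 4 * c\<^sup>2"])
     show "AE x in M. (\<lambda>n. (c * indicator K x - w (Suc n) x)\<^sup>2) \<longlonglongrightarrow> (c * indicator K x - c * indicator K x)\<^sup>2"
      by (intro AE_I2 tendsto_intros LIMSEQ_Suc[OF wlim])
     show "AE x in M. norm ((c * indicator K x - w (Suc n) x)\<^sup>2) <= 4 * c\<^sup>2" for n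
     proof (rule AE_I2)
      fix x
      have "\<bar>c * indicator K x - w (Suc n) x\<bar> <= 2 * \<bar>c\<bar>"
       using w_bd[of "Suc n" x] by (auto simp: indicator_def)
      then have "(c * indicator K x - w (Suc n) x)\<^sup>2 <= (2 * \<bar>c\<bar>)\<^sup>2"
       by (metis abs_ge_zero abs_le_square_iff abs_mult abs_numeral abs_idempotent)
      then show "norm ((c * indicator K x - w (Suc n) x)\<^sup>2) <= 4 * c\<^sup>2" by (simp add: power_mult_distrib)
     qed
    qed auto
    then have "(\<lambda>n. \<integral>x. (c * indicator K x - w (Suc n) x)\<^sup>2 \<partial>M) \<longlonglongrightarrow> 0" by simp
    then have "\<forall>\<^sub>F n in sequentially. (\<integral>x. (c * indicator K x - w (Suc n) x)\<^sup>2 \<partial>M) < \<epsilon> / 4"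
     using \<open>\<epsilon> > 0\<close> by (intro order_tendstoD) auto
    then obtain n where "(\<integral>x. (c * indicator K x - w (Suc n) x)\<^sup>2 \<partial>M) < \<epsilon> / 4"
     by (auto simp: eventually_sequentially)
    then show ?thesis using Gw[of "Suc n"] by blast
   qed
   then obtain w where w: "G w" "(\<integral>x. (c * indicator K x - w x)\<^sup>2 \<partial>M) < \<epsilon> / 4" by blast
   show "\<exists>w. G w \<and> (\<integral>x. (indicator A x *\<^sub>R c - w x)\<^sup>2 \<partial>M) < \<epsilon>"
    by (rule comb[OF _ _ _ _ dK w]) (auto intro!: integrable_square_bounded[where B="\<bar>c\<bar>"] simp: indicator_def)
  qed
 qed
 have P_sum: "P (\<lambda>x. \<Sum>y\<in>F. indicator (A y) x *\<^sub>R c y)"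
  if "finite F" "\<And>y. y \<in> F ==> A y \<in> sets M" for F and A :: "real => 'a set" and c
  using that
 proof (induction F rule: finite_induct)
  case empty
  then show ?case by (auto simp: P_def G_def lipschitz_on_constant intro!: exI[of _ "\<lambda>_. 0"] exI[of _ 0])
 next
  case (insert y F)
  let ?f = "\<lambda>x. indicator (A y) x *\<^sub>R c y" and ?g = "\<lambda>x. \<Sum>y\<in>F. indicator (A y) x *\<^sub>R c y"
  have [measurable]: "A z \<in> sets borel" if "z \<in> insert y F" for z using insert.prems that sets by simp
  have m: "?f \<in> borel_measurable M" "?g \<in> borel_measurable M"
   by (auto intro!: borel_measurable_sum borel_measurable_scaleR borel_measurable_indicator simp: insert.prems)
  have sq: "integrable M (\<lambda>x. (?f x)\<^sup>2)" "integrable M (\<lambda>x. (?g x)\<^sup>2)"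
  proof -
   show "integrable M (\<lambda>x. (?f x)\<^sup>2)"
    using m(1) by (rule integrable_square_bounded[where B="\<bar>c y\<bar>"]) (auto simp: indicator_def)
   have "\<bar>?g x\<bar> <= (\<Sum>y\<in>F. \<bar>c y\<bar>)" for x
    by (rule order_trans[OF sum_abs sum_mono]) (auto simp: indicator_def)
   with m(2) show "integrable M (\<lambda>x. (?g x)\<^sup>2)" by (rule integrable_square_bounded)
  qed
  have Pf: "P ?f" and Pg: "P ?g" using P_ind insert by auto
  have "\<exists>w. G w \<and> (\<integral>x. (?f x + ?g x - w x)\<^sup>2 \<partial>M) < \<epsilon>" if "\<epsilon> > 0" for \<epsilon>
  proof -
   have "\<epsilon> / 4 > 0" using that by simp
   then obtain u w where u: "G u" "(\<integral>x. (?f x - u x)\<^sup>2 \<partial>M) < \<epsilon> / 4"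
    and w: "G w" "(\<integral>x. (?g x - w x)\<^sup>2 \<partial>M) < \<epsilon> / 4"
    using Pf Pg m sq unfolding P_def by blast
   note [measurable] = m G_meas[OF u(1)] G_meas[OF w(1)]
   have i1: "integrable M (\<lambda>x. (?f x - u x)\<^sup>2)" and i2: "integrable M (\<lambda>x. (?g x - w x)\<^sup>2)"
    by (intro integrable_square_diff sq G_sq u w m; measurable)+
   have "(\<integral>x. (?f x + ?g x - (u x + w x))\<^sup>2 \<partial>M) <= (\<integral>x. 2 * (?f x - u x)\<^sup>2 + 2 * (?g x - w x)\<^sup>2 \<partial>M)"
   proof (rule integral_mono')
    show "integrable M (\<lambda>x. 2 * (?f x - u x)\<^sup>2 + 2 * (?g x - w x)\<^sup>2)" using i1 i2 by simp
    show "(?f x + ?g x - (u x + w x))\<^sup>2 <= 2 * (?f x - u x)\<^sup>2 + 2 * (?g x - w x)\<^sup>2" for x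
     using power2_sum_le[of "?f x - u x" "?g x - w x"] by (simp add: algebra_simps)
   qed simp
   also have "... < \<epsilon>" using i1 i2 u w by simp
   finally show ?thesis using G_add[OF u(1) w(1)] by blast
  qed
  then show ?case unfolding P_def sum.insert[OF insert.hyps] by blast
 qed
 have "P f"
 proof -
  obtain s where s: "\<And>i. simple_function M (s i)" "\<And>x. x \<in> space M ==> (\<lambda>i. s i x) \<longlonglongrightarrow> f x"
   "\<And>i x. x \<in> space M ==> norm (s i x) <= 2 * norm (f x)"
   using borel_measurable_implies_sequence_metric[OF meas, of 0] unfolding dist_norm diff_0_right by metis
  note [measurable] = borel_measurable_simple_function[OF s(1)] meas
  have Ps: "P (s i)" for i
  proof -
   have "s i = (\<lambda>x. \<Sum>y\<in>s i ` UNIV. indicator (s i -` {y}) x *\<^sub>R y)"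
   proof
    fix x
    have "(\<Sum>y\<in>s i ` UNIV. indicator (s i -` {y}) x *\<^sub>R y) = (\<Sum>y\<in>{s i x}. indicator (s i -` {y}) x *\<^sub>R y)"
     using simple_functionD(1)[OF s(1)[of i]] space by (intro sum.mono_neutral_right) (auto simp: indicator_def)
    then show "s i x = (\<Sum>y\<in>s i ` UNIV. indicator (s i -` {y}) x *\<^sub>R y)" by simp
   qed
   moreover have "P (\<lambda>x. \<Sum>y\<in>s i ` UNIV. indicator (s i -` {y}) x *\<^sub>R y)"
    using simple_functionD[OF s(1)[of i]] space by (intro P_sum) auto
   ultimately show ?thesis by simp
  qed
  show "P f"
   unfolding P_def
  proof (intro impI allI)
   fix \<epsilon> :: real assume "\<epsilon> > 0"
   note fsq = sq
   have bd: "(s i x)\<^sup>2 <= 4 * (f x)\<^sup>2" for i x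
   proof -
    have "(s i x)\<^sup>2 <= (2 * \<bar>f x\<bar>)\<^sup>2" using s(3)[of x i] space
     by (metis UNIV_I abs_ge_zero power2_abs power_mono real_norm_def)
    then show ?thesis by (simp add: power_mult_distrib)
   qed
   have ssq: "integrable M (\<lambda>x. (s i x)\<^sup>2)" for i
    by (rule Bochner_Integration.integrable_bound[where f="\<lambda>x. 4 * (f x)\<^sup>2"]) (use fsq bd in auto)
   have "(\<lambda>i. \<integral>x. (f x - s i x)\<^sup>2 \<partial>M) \<longlonglongrightarrow> (\<integral>x. (f x - f x)\<^sup>2 \<partial>M)"
   proof (rule integral_dominated_convergence[where w="\<lambda>x. 10 * (f x)\<^sup>2"])
    show "AE x in M. (\<lambda>i. (f x - s i x)\<^sup>2) \<longlonglongrightarrow> (f x - f x)\<^sup>2"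
     by (intro AE_I2 tendsto_intros s(2))
    show "AE x in M. norm ((f x - s i x)\<^sup>2) <= 10 * (f x)\<^sup>2" for i
    proof (rule AE_I2)
     fix x
     have "(f x - s i x)\<^sup>2 <= 2 * (f x)\<^sup>2 + 2 * (s i x)\<^sup>2" using power2_sum_le[of "f x" "- s i x"] by simp
     then show "norm ((f x - s i x)\<^sup>2) <= 10 * (f x)\<^sup>2" using bd[of i x] by simp
    qed
   qed (use fsq in auto)
   then have "\<forall>\<^sub>F i in sequentially. (\<integral>x. (f x - s i x)\<^sup>2 \<partial>M) < \<epsilon> / 4"
    using \<open>\<epsilon> > 0\<close> by (intro order_tendstoD) auto
   then obtain i where i: "(\<integral>x. (f x - s i x)\<^sup>2 \<partial>M) < \<epsilon> / 4" by (auto simp: eventually_sequentially)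
   obtain w where w: "G w" "(\<integral>x. (s i x - w x)\<^sup>2 \<partial>M) < \<epsilon> / 4"
    using Ps[of i] ssq[of i] \<open>\<epsilon> > 0\<close> unfolding P_def by (auto dest: spec[of _ "\<epsilon>/4"])
   show "\<exists>w. G w \<and> (\<integral>x. (f x - w x)\<^sup>2 \<partial>M) < \<epsilon>"
    by (rule comb[OF _ fsq _ ssq i w]) auto
  qed
 qed
 then obtain w where "G w" "(\<integral>x. (f x - w x)\<^sup>2 \<partial>M) < \<epsilon>"
  using meas sq \<open>\<epsilon> > 0\<close> unfolding P_def by blast
 then show ?thesis using integrable_square_diff[OF meas _ sq G_sq[of w]] G_meas[of w] unfolding G_def by auto
qed

section \<open>Primitives of locally integrable functions of time\<close>

definition locint :: "(real => real) => bool" where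
 "locint f \<longleftrightarrow> (\<forall>T. set_integrable lborel {0..T} f)"

text \<open>Differential identities in time are stated through primitives, so that no differentiability is needed.\<close>

definition prim :: "(real => real) => real => real" where
 "prim f t = (LINT \<tau>:{0..t}|lborel. f \<tau>)"

lemma locint_D: "locint f ==> 0 <= a ==> set_integrable lborel {a..b} f"
 unfolding locint_def by (rule set_integrable_subset[of _ "{0..b}"]) auto

lemma prim_0 [simp]: "prim f 0 = 0"
 unfolding prim_def set_lebesgue_integral_def
proof -
 have "(\<integral>x. indicator {0..0} x *\<^sub>R f x \<partial>lborel) = (\<integral>x. indicator {0} x *\<^sub>R f 0 \<partial>(lborel :: real measure))"
  by (rule Bochner_Integration.integral_cong) (auto simp: indicator_def)
 also have "... = 0" by simp
 finally show "(\<integral>x. indicator {0..0} x *\<^sub>R f x \<partial>lborel) = 0" .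
qed

lemma prim_diff:
 assumes "locint f" "0 <= c" "c <= t"
 shows "prim f t - prim f c = (LINT \<tau>:{c..t}|lborel. f \<tau>)"
proof -
 have "{0..t} = {0..c} \<union> {c..t}" using assms by auto
 moreover have "(LINT \<tau>:{0..c} \<union> {c..t}|lborel. f \<tau>) = prim f c + (LINT \<tau>:{c..t}|lborel. f \<tau>)"
  unfolding prim_def
 proof (rule set_integral_Un_AE)
  show "AE x in lborel. \<not> (x \<in> {0..c} \<and> x \<in> {c..t})"
   by (rule AE_I[where N="{c}"]) auto
 qed (use assms locint_D in auto)
 ultimately show ?thesis by (simp add: prim_def)
qed

lemma locint_const [simp]: "locint (\<lambda>_. k)"
 unfolding locint_def by (simp add: set_integrable_def emeasure_lborel_Icc_eq)

lemma locint_add: "locint f ==> locint g ==> locint (\<lambda>t. f t + g t)"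
 and locint_diff: "locint f ==> locint g ==> locint (\<lambda>t. f t - g t)"
 and locint_cmult: "locint f ==> locint (\<lambda>t. k * f t)"
 and locint_abs: "locint f ==> locint (\<lambda>t. \<bar>f t\<bar>)"
 unfolding locint_def by (auto intro: set_integral_add set_integral_diff set_integrable_mult_right set_integrable_abs)

lemma locint_continuous: "continuous_on {0..} f ==> locint f"
 unfolding locint_def by (auto intro!: borel_integrable_atLeastAtMost' elim: continuous_on_subset)

lemma locint_bound:
 assumes "locint g" and [measurable]: "f \<in> borel_measurable borel" and "\<And>t. 0 <= t ==> \<bar>f t\<bar> <= g t"
 shows "locint f"
 unfolding locint_def set_integrable_def
proof
 fix T
 have "integrable lborel (\<lambda>x. indicator {0..T} x *\<^sub>R g x)"
  using assms(1) by (auto simp: locint_def set_integrable_def)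
 then show "integrable lborel (\<lambda>x. indicator {0..T} x *\<^sub>R f x)"
  by (rule Bochner_Integration.integrable_bound) (use assms(3) in \<open>force simp: indicator_def\<close>)+
qed

lemma prim_add: "locint f ==> locint g ==> prim (\<lambda>t. f t + g t) b = prim f b + prim g b"
 and prim_sub: "locint f ==> locint g ==> prim (\<lambda>t. f t - g t) b = prim f b - prim g b"
 and prim_cmult: "prim (\<lambda>t. k * f t) b = k * prim f b"
 unfolding locint_def prim_def by (auto intro: set_integral_add set_integral_diff)

lemma prim_const: "0 <= b ==> prim (\<lambda>_. k) b = k * b"
 unfolding prim_def set_lebesgue_integral_def by simp

lemma prim_mono:
 assumes "locint f" "locint g" "0 <= c" "c <= t" "\<And>\<tau>. c <= \<tau> ==> \<tau> <= t ==> f \<tau> <= g \<tau>"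
 shows "prim f t - prim f c <= prim g t - prim g c"
 unfolding prim_diff[OF assms(1,3,4)] prim_diff[OF assms(2,3,4)]
 by (rule set_integral_mono) (use assms locint_D in auto)

lemma prim_nonneg_mono:
 assumes "locint f" "\<And>\<tau>. 0 <= \<tau> ==> 0 <= f \<tau>" "0 <= c" "c <= t"
 shows "prim f c <= prim f t"
 using prim_mono[of "\<lambda>_. 0" f c t] assms by (simp add: prim_const)

lemma prim_abs_le:
 assumes f: "locint f" and g: "locint g" and "0 <= c" "0 <= t"
  and le: "\<And>\<tau>. min c t <= \<tau> ==> \<tau> <= max c t ==> \<bar>f \<tau>\<bar> <= g \<tau>"
 shows "\<bar>prim f t - prim f c\<bar> <= \<bar>prim g t - prim g c\<bar>"
proof -
 have *: "\<bar>prim f b - prim f a\<bar> <= prim g b - prim g a"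
  if "0 <= a" "a <= b" "\<And>\<tau>. a <= \<tau> ==> \<tau> <= b ==> \<bar>f \<tau>\<bar> <= g \<tau>" for a b
 proof -
  have "prim f b - prim f a <= prim g b - prim g a"
   by (rule prim_mono[OF f g that(1,2)]) (use that(3) in force)
  moreover have "prim (\<lambda>t. (-1) * g t) b - prim (\<lambda>t. (-1) * g t) a <= prim f b - prim f a"
   by (rule prim_mono[OF locint_cmult[OF g] f that(1,2)]) (use that(3) in \<open>force simp: abs_le_iff\<close>)
  ultimately show ?thesis unfolding prim_cmult by (simp add: abs_le_iff)
 qed
 show ?thesis
 proof (cases "c <= t")
  case True then show ?thesis using *[of c t] assms by (simp add: min_def max_def)
 next
  case False then show ?thesis using *[of t c] assms by (simp add: min_def max_def abs_minus_commute)
 qed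
qed

lemma prim_eq_integral: "locint f ==> 0 <= t ==> prim f t = integral {0..t} f"
 unfolding prim_def by (rule set_borel_integral_eq_integral(2)) (simp add: locint_D)

lemma continuous_on_prim:
 assumes "locint f" shows "continuous_on {0..} (prim f)"
 unfolding continuous_on_eq_continuous_within
proof
 fix t :: real assume "t \<in> {0..}"
 then have t: "t \<ge> 0" by simp
 have "continuous_on {0..t+1} (\<lambda>x. integral {0..x} f)"
  by (rule indefinite_integral_continuous_1) (use assms locint_D set_borel_integral_eq_integral(1) in blast)
 then have "continuous_on {0..t+1} (prim f)"
  by (rule continuous_on_eq) (auto simp: prim_eq_integral[OF assms])
 then have "continuous (at t within {0..t+1}) (prim f)" using t by (simp add: continuous_on_eq_continuous_within)
 moreover have "at t within {0..t+1} = at t within {0..}"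
  by (rule at_within_nhd[of _ "{..<t+1}"]) (auto simp: t)
 ultimately show "continuous (at t within {0..}) (prim f)" by (simp add: continuous_within)
qed

lemma DERIV_prim:
 assumes "locint f" "continuous_on {a<..<b} f" "0 <= a" "a < x" "x < b"
 shows "DERIV (prim f) x :> f x"
proof -
 obtain c d where cd: "a < c" "c < x" "x < d" "d < b" using dense assms by meson
 have "continuous_on {c..d} f" by (rule continuous_on_subset[OF assms(2)]) (use cd in auto)
 then have "((\<lambda>u. integral {c..u} f) has_real_derivative f x) (at x within {c..d})"
  by (rule integral_has_real_derivative) (use cd in auto)
 then have 1: "((\<lambda>u. prim f c + integral {c..u} f) has_real_derivative f x) (at x)"
  using cd by (auto simp: at_within_Icc_at intro!: derivative_eq_intros)
 show ?thesis
 proof (rule has_field_derivative_transform_within_open[OF 1, of "{c<..<d}"])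
  fix u assume "u \<in> {c<..<d}"
  then have "prim f u - prim f c = integral {c..u} f"
   using prim_diff[OF assms(1), of c u] cd assms set_borel_integral_eq_integral(2)[OF locint_D[OF assms(1), of c u]]
   by simp
  then show "prim f c + integral {c..u} f = prim f u" by simp
 qed (use cd in auto)
qed

text \<open>Testing in time with \<open>b - t\<close> amounts to integrating twice.\<close>

lemma prim_Fubini:
 assumes B: "locint B" and "0 <= b"
 shows "(LINT t:{0..b}|lborel. (b - t) * B t) = prim (prim B) b"
proof -
 define B' where "B' t = indicator {0..b} t * B t" for t
 have iB: "integrable lborel B'"
  using locint_D[OF B, of 0 b] by (simp add: set_integrable_def B'_def[abs_def])
 then have [measurable]: "B' \<in> borel_measurable borel" by (simp add: borel_measurable_integrable)
 define F where "F = (\<lambda>(t::real, \<tau>::real). indicator {0..b} t * (indicator {..t} \<tau> * B' \<tau>))"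
 have Fm: "F \<in> borel_measurable (lborel \<Otimes>\<^sub>M lborel)"
 proof -
  have "F = (\<lambda>x. indicator {0..b} (fst x) * ((if snd x <= fst x then 1 else 0) * B' (snd x)))"
   by (auto simp: F_def fun_eq_iff indicator_def)
  then show ?thesis by simp
 qed
 have bound: "integrable (lborel \<Otimes>\<^sub>M lborel) F"
 proof (rule lborel_pair.Fubini_integrable)
  show "F \<in> borel_measurable (lborel \<Otimes>\<^sub>M lborel)" by (rule Fm)
  have *: "norm (F (t, \<tau>)) <= indicator {0..b} t * \<bar>B' \<tau>\<bar>" for t \<tau>
   by (auto simp: F_def indicator_def)
  show "AE x in lborel. integrable lborel (\<lambda>y. F (x, y))"
  proof (rule AE_I2)
   fix x :: real
   have "integrable lborel (\<lambda>\<tau>. indicator {..x} \<tau> *\<^sub>R B' \<tau>)"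
    by (rule integrable_mult_indicator) (auto intro: iB)
   then show "integrable lborel (\<lambda>y. F (x, y))" by (simp add: F_def)
  qed
  show "integrable lborel (\<lambda>x. \<integral>y. norm (F (x, y)) \<partial>lborel)"
  proof (rule Bochner_Integration.integrable_bound)
   show "integrable lborel (\<lambda>x. indicator {0..b} x * (\<integral>y. \<bar>B' y\<bar> \<partial>lborel))"
    by (intro integrable_mult_left) (auto simp: emeasure_lborel_Icc_eq)
   show "(\<lambda>x. \<integral>y. norm (F (x, y)) \<partial>lborel) \<in> borel_measurable lborel"
    using Fm by measurable
   show "AE x in lborel. norm (\<integral>y. norm (F (x, y)) \<partial>lborel) <= norm (indicator {0..b} x * (\<integral>y. \<bar>B' y\<bar> \<partial>lborel))"
   proof (rule AE_I2)
    fix x :: real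
    have "(\<integral>y. norm (F (x, y)) \<partial>lborel) <= (\<integral>y. indicator {0..b} x * \<bar>B' y\<bar> \<partial>lborel)"
     by (rule integral_mono') (use iB * in \<open>auto intro!: integrable_mult_right\<close>)
    then show "norm (\<integral>y. norm (F (x, y)) \<partial>lborel) <= norm (indicator {0..b} x * (\<integral>y. \<bar>B' y\<bar> \<partial>lborel))"
     by simp
   qed
  qed
 qed
 have "(LINT t:{0..b}|lborel. (b - t) * B t) = (\<integral>\<tau>. (\<integral>t. F (t, \<tau>) \<partial>lborel) \<partial>lborel)"
  unfolding set_lebesgue_integral_def
 proof (rule Bochner_Integration.integral_cong)
  fix \<tau> :: real
  have "(\<integral>t. F (t, \<tau>) \<partial>lborel) = (\<integral>t. indicator ({0..b} \<inter> {\<tau>..}) t * B' \<tau> \<partial>lborel)"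
   by (rule Bochner_Integration.integral_cong) (auto simp: F_def indicator_def)
  also have "... = measure lborel ({0..b} \<inter> {\<tau>..}) * B' \<tau>" by simp
  also have "... = indicator {0..b} \<tau> *\<^sub>R ((b - \<tau>) * B \<tau>)"
  proof (cases "\<tau> \<in> {0..b}")
   case True
   then have "{0..b} \<inter> {\<tau>..} = {\<tau>..b}" by auto
   then show ?thesis using True by (simp add: B'_def)
  qed (simp add: B'_def)
  finally show "indicator {0..b} \<tau> *\<^sub>R ((b - \<tau>) * B \<tau>) = (\<integral>t. F (t, \<tau>) \<partial>lborel)" by simp
 qed simp
 also have "... = (\<integral>t. (\<integral>\<tau>. F (t, \<tau>) \<partial>lborel) \<partial>lborel)"
  by (rule lborel_pair.Fubini_integral[of "\<lambda>t \<tau>. F (t, \<tau>)"]) (use bound in simp)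
 also have "... = prim (prim B) b"
  unfolding prim_def[of "prim B"] set_lebesgue_integral_def
 proof (rule Bochner_Integration.integral_cong)
  fix t :: real
  show "(\<integral>\<tau>. F (t, \<tau>) \<partial>lborel) = indicator {0..b} t *\<^sub>R prim B t"
  proof (cases "t \<in> {0..b}")
   case True
   then show ?thesis unfolding prim_def set_lebesgue_integral_def F_def B'_def
    by (auto intro!: Bochner_Integration.integral_cong simp: indicator_def)
  qed (simp add: F_def)
 qed simp
 finally show ?thesis .
qed

lemma continuous_eq_of_prim_eq:
 assumes f: "continuous_on {0..} f" and g: "continuous_on {0..} g"
  and eq: "\<And>b. 0 <= b ==> prim f b = prim g b" and "0 <= t"
 shows "f t = g t"
proof -
 have pos: "f t = g t" if "t > 0" for t
 proof -
  have "DERIV (prim f) t :> f t" "DERIV (prim g) t :> g t"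
   using that by (auto intro!: DERIV_prim[of _ 0 "t+1"] locint_continuous f g continuous_on_subset[OF f] continuous_on_subset[OF g])
  moreover have "DERIV (prim g) t :> f t"
   by (rule has_field_derivative_transform_within_open[OF calculation(1), of "{0<..}"]) (use that eq in auto)
  ultimately show ?thesis using DERIV_unique by blast
 qed
 have f0: "(f \<longlongrightarrow> f 0) (at_right 0)" and g0: "(g \<longlongrightarrow> g 0) (at_right 0)"
 proof -
  have "(f \<longlongrightarrow> f 0) (at 0 within {0..})" "(g \<longlongrightarrow> g 0) (at 0 within {0..})"
   using f g unfolding continuous_on_def by force+
  then show "(f \<longlongrightarrow> f 0) (at_right 0)" "(g \<longlongrightarrow> g 0) (at_right 0)"
   by (force elim!: tendsto_within_subset)+
 qed
 have "(f \<longlongrightarrow> g 0) (at_right 0)"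
  by (rule Lim_transform_eventually[OF g0]) (use pos in \<open>auto intro: eventually_mono[OF eventually_at_right_less]\<close>)
 then have "f 0 = g 0" using tendsto_unique[OF _ f0] by simp
 with pos \<open>0 <= t\<close> show ?thesis by (cases "t = 0") auto
qed

text \<open>Linear growth bound: comparison of \<open>d\<close> with the primitive of \<open>d \<tau> / \<tau>\<close>, whose quotient by
 \<open>\<tau>\<close> has nonpositive derivative.\<close>

lemma gronwall_linear:
 assumes "0 < r" "r <= t" and d: "continuous_on {0..} d" and w: "locint w"
  and eq: "\<And>b. r <= b ==> b <= t ==> d b - d r = prim w b - prim w r"
  and le: "\<And>\<tau>. r <= \<tau> ==> \<tau> <= t ==> w \<tau> <= d \<tau> / \<tau>"
 shows "d t / t <= d r / r"
proof -
 define e where "e \<tau> = d \<tau> / max r \<tau>" for \<tau>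
 have e: "continuous_on {0..} e" unfolding e_def using d assms(1)
  by (auto intro!: continuous_intros)
 have le_e: "locint e" using e by (rule locint_continuous)
 define I where "I b = d r + (prim e b - prim e r)" for b
 have dI: "d b <= I b" if "r <= b" "b <= t" for b
 proof -
  have "prim w b - prim w r <= prim e b - prim e r"
   by (rule prim_mono[OF w le_e]) (use that assms in \<open>auto simp: e_def\<close>)
  then show ?thesis using eq[OF that] by (simp add: I_def)
 qed
 have cI: "continuous_on {r..t} I" unfolding I_def
  by (intro continuous_intros continuous_on_subset[OF continuous_on_prim[OF le_e]]) (use assms in auto)
 have "I r / r \<ge> I t / t"
 proof (rule DERIV_nonpos_imp_decreasing_open[OF assms(2)])
  show "continuous_on {r..t} (\<lambda>x. I x / x)" using cI assms(1) by (auto intro!: continuous_intros)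
  fix x assume x: "r < x" "x < t"
  have "DERIV (prim e) x :> e x"
   by (rule DERIV_prim[OF le_e, of 0 "x+1"]) (use x assms in \<open>auto intro: continuous_on_subset[OF e]\<close>)
  then have "DERIV I x :> e x" unfolding I_def by (auto intro!: derivative_eq_intros)
  then have "DERIV (\<lambda>x. I x / x) x :> (e x * x - I x * 1) / (x * x)"
   using x assms by (intro DERIV_divide) (auto intro!: derivative_eq_intros)
  moreover have "(e x * x - I x * 1) / (x * x) <= 0"
   using dI[of x] x assms by (auto simp: e_def divide_nonpos_pos)
  ultimately show "\<exists>y. DERIV (\<lambda>x. I x / x) x :> y \<and> y <= 0" by blast
 qed
 moreover have "d t / t <= I t / t" using dI[of t] assms by (simp add: divide_right_mono)
 ultimately show ?thesis by (simp add: I_def)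
qed

section \<open>Removing second order errors by subdivision\<close>

lemma tendsto_div_nat: "(\<lambda>n. c / real (Suc n)) \<longlonglongrightarrow> 0"
 using tendsto_mult_right_zero[OF LIMSEQ_inverse_real_of_nat, of c] by (simp add: divide_inverse)

text \<open>A one-step bound with an error of second order in the step becomes an exact inequality: over
 a subdivision of mesh \<open>h\<close> the errors add up to at most \<open>C h\<close> times a total
 increment.\<close>

lemma subdivision_ineq:
 fixes \<Phi> q p :: "real => real"
 assumes "a <= b"
  and step: "\<And>c t. a <= c ==> c <= t ==> t <= b ==> t - c <= 1 ==>
   \<Phi> t - \<Phi> c <= (q t - q c) + C * (t - c) * (p t - p c)"
 shows "\<Phi> b - \<Phi> a <= q b - q a"
proof -
 obtain n0 :: nat where n0: "b - a <= real n0" using real_arch_simple by blast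
 have bound: "\<Phi> b - \<Phi> a <= (q b - q a) + ((b - a) / real (Suc n)) * (C * (p b - p a))" if "n \<ge> n0" for n
 proof -
  define h where "h = (b - a) / real (Suc n)"
  define x where "x i = a + real i * h" for i
  have h: "0 <= h" "h <= 1" using assms(1) n0 that by (auto simp: h_def divide_le_eq)
  have xb: "x (Suc n) = b" by (simp add: x_def h_def)
  have x: "a <= x i" "x i <= x (Suc i)" "x (Suc i) - x i = h" for i
   using h by (auto simp: x_def algebra_simps)
  have xle: "x i <= b" if "i <= Suc n" for i
   unfolding xb[symmetric] x_def using that h by (auto intro!: mult_right_mono simp del: of_nat_Suc)
  have "\<Phi> b - \<Phi> a = (\<Sum>i<Suc n. \<Phi> (x (Suc i)) - \<Phi> (x i))"
   by (subst sum_lessThan_telescope) (simp only: xb, simp add: x_def)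
  also have "... <= (\<Sum>i<Suc n. (q (x (Suc i)) - q (x i)) + C * h * (p (x (Suc i)) - p (x i)))"
  proof (rule sum_mono)
   fix i assume "i \<in> {..<Suc n}"
   then show "\<Phi> (x (Suc i)) - \<Phi> (x i) <= (q (x (Suc i)) - q (x i)) + C * h * (p (x (Suc i)) - p (x i))"
    using step[of "x i" "x (Suc i)"] x[of i] xle[of "Suc i"] h by simp
  qed
  also have "... = (q b - q a) + C * h * (p b - p a)"
   proof -
   have "(\<Sum>i<Suc n. f (x (Suc i)) - f (x i)) = f b - f a" for f :: "real => real"
    using sum_lessThan_telescope[of "\<lambda>i. f (x i)" "Suc n"] by (simp only: xb, simp add: x_def)
   then show ?thesis unfolding sum.distrib sum_distrib_left[symmetric] by (simp only:)
  qed
  finally show ?thesis by (simp add: h_def mult_ac)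
 qed
 have "(\<lambda>n. (q b - q a) + ((b - a) / real (Suc n)) * (C * (p b - p a))) \<longlonglongrightarrow> (q b - q a) + 0 * (C * (p b - p a))"
  by (intro tendsto_intros tendsto_div_nat)
 then have "(\<lambda>n. (q b - q a) + ((b - a) / real (Suc n)) * (C * (p b - p a))) \<longlonglongrightarrow> q b - q a"
  by (simp only: mult_zero_left add_0_right)
 then show ?thesis by (rule LIMSEQ_le_const) (intro exI[of _ n0] allI impI bound)
qed

text \<open>The second difference over a long interval is a combination of those of its parts, with
 weights of at most half the number of steps.\<close>

lemma second_difference_telescope:
 fixes x :: "nat => real"
 shows "\<bar>x (2 * m) - 2 * x m + x 0\<bar> <= real m * (\<Sum>j<2 * m - 1. \<bar>x (j + 2) - 2 * x (j + 1) + x j\<bar>)"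
proof -
 define c where "c i = x (Suc i) - x i" for i
 define S where "S = (\<Sum>j<2 * m - 1. \<bar>c (Suc j) - c j\<bar>)"
 have "x (2 * m) - 2 * x m + x 0 = (\<Sum>i<m. c (m + i)) - (\<Sum>i<m. c i)"
 proof -
  have "(\<Sum>i<m. c i) = x m - x 0" unfolding c_def by (rule sum_lessThan_telescope)
  moreover have "(\<Sum>i<m. c (m + i)) = x (m + m) - x m"
  proof -
   have "(\<Sum>i<m. x (m + Suc i) - x (m + i)) = x (m + m) - x (m + 0)"
    by (rule sum_lessThan_telescope)
   then show ?thesis by (simp only: c_def add_Suc_right add_0_right)
  qed
  ultimately show ?thesis unfolding mult_2 by linarith
 qed
 also have "... = (\<Sum>i<m. c (m + i) - c i)" by (simp only: sum_subtractf)
 also have "\<bar>...\<bar> <= (\<Sum>i<m. S)"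
 proof (rule order_trans[OF sum_abs sum_mono])
  fix i assume i: "i \<in> {..<m}"
  have "c (m + i) - c i = (\<Sum>j<m. c (i + Suc j) - c (i + j))"
  proof -
   have "(\<Sum>j<m. c (i + Suc j) - c (i + j)) = c (i + m) - c (i + 0)" by (rule sum_lessThan_telescope)
   then show ?thesis unfolding add_0_right add.commute[of i m] by (rule sym)
  qed
  also have "\<bar>...\<bar> <= (\<Sum>j<m. \<bar>c (i + Suc j) - c (i + j)\<bar>)" by (rule sum_abs)
  also have "... = (\<Sum>j\<in>(+) i ` {..<m}. \<bar>c (Suc j) - c j\<bar>)"
   by (simp add: sum.reindex)
  also have "... <= S"
   unfolding S_def
  proof (rule sum_mono2)
   show "(+) i ` {..<m} \<subseteq> {..<2 * m - 1}"
   proof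
    fix k assume "k \<in> (+) i ` {..<m}"
    then obtain j where "k = i + j" "j < m" by blast
    then show "k \<in> {..<2 * m - 1}" using i unfolding lessThan_iff by linarith
   qed
  qed simp_all
  finally show "\<bar>c (m + i) - c i\<bar> <= S" .
 qed
 also have "... = real m * S" by (simp only: sum_constant card_lessThan)
 also have "S = (\<Sum>j<2 * m - 1. \<bar>x (j + 2) - 2 * x (j + 1) + x j\<bar>)"
 proof -
  have "c (Suc j) - c j = x (j + 2) - 2 * x (j + 1) + x j" for j by (simp add: c_def)
  then show ?thesis unfolding S_def by (simp only:)
 qed
 finally show ?thesis .
qed

text \<open>The loss of the factor \<open>m\<close> when second differences are telescoped is
 compensated by the factor \<open>h\<close> in the assumed bound.\<close>

lemma subdivision_second_difference:
 fixes n q p :: "real => real"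
 assumes "a < b" and "0 <= C"
  and q: "\<And>s t. a <= s ==> s <= t ==> t <= b ==> q s <= q t"
  and p: "\<And>s t. a <= s ==> s <= t ==> t <= b ==> p s <= p t"
  and step: "\<And>c h. a <= c - h ==> c + h <= b ==> 0 < h ==> h <= 1 ==>
   \<bar>n (c + h) - 2 * n c + n (c - h)\<bar> <= h * ((q (c + h) - q (c - h)) + C * h * (p (c + h) - p (c - h)))"
 shows "\<bar>n b - 2 * n ((a + b) / 2) + n a\<bar> <= (b - a) * (q b - q a)"
proof -
 obtain n0 :: nat where n0: "b - a <= real n0" using real_arch_simple by blast
 have bound: "\<bar>n b - 2 * n ((a + b) / 2) + n a\<bar>
   <= (b - a) * ((q b - q a) + ((b - a) / 2 / real (Suc m')) * (C * (p b - p a)))" if "m' \<ge> n0" for m'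
 proof -
  define m where "m = Suc m'"
  define h where "h = (b - a) / 2 / real m"
  define x where "x i = a + real i * h" for i
  have m: "m > 0" by (simp add: m_def)
  have h: "0 < h" "h <= 1" using assms(1) n0 that by (auto simp: h_def m_def divide_le_eq)
  have xb: "x (2 * m) = b" and xm: "x m = (a + b) / 2" and x0: "x 0 = a"
  proof -
   have "2 * real m * h = b - a" "real m * h = (b - a) / 2" using m by (simp_all add: h_def)
   then show "x (2 * m) = b" "x m = (a + b) / 2" "x 0 = a" by (simp_all add: x_def field_simps)
  qed
  have xmono: "x i <= x j" if "i <= j" for i j
   unfolding x_def using that h by (auto intro!: mult_right_mono)
  have xa: "a <= x i" for i using xmono[of 0 i] x0 by simp
  have tel: "(\<Sum>j<2*m-1. f (x (j + 2)) - f (x j)) <= 2 * (f b - f a)"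
   if f: "\<And>s t. a <= s ==> s <= t ==> t <= b ==> f s <= f t" for f :: "real => real"
  proof -
   have "(\<Sum>j<2*m-1. f (x (j + 2)) - f (x j))
     = (\<Sum>j<2*m-1. f (x (Suc (Suc j))) - f (x (Suc j))) + (\<Sum>j<2*m-1. f (x (Suc j)) - f (x j))"
    by (simp add: sum.distrib[symmetric])
   also have "... = (f (x (Suc (2*m-1))) - f (x 1)) + (f (x (2*m-1)) - f (x 0))"
    using sum_lessThan_telescope[of "\<lambda>j. f (x (Suc j))" "2*m-1"] sum_lessThan_telescope[of "\<lambda>j. f (x j)" "2*m-1"]
    by simp
   also have "Suc (2*m-1) = 2*m" using m by simp
   also have "(f (x (2*m)) - f (x 1)) + (f (x (2*m-1)) - f (x 0)) <= 2 * (f b - f a)"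
    using f[of a "x 1"] f[of "x (2*m-1)" b] xa xmono[of "2*m-1" "2*m"] xmono[of 1 "2*m"] m xb x0
    by simp
   finally show ?thesis .
  qed
  have "\<bar>n b - 2 * n ((a + b) / 2) + n a\<bar> = \<bar>n (x (2*m)) - 2 * n (x m) + n (x 0)\<bar>"
   by (simp add: xb xm x0)
  also have "... <= real m * (\<Sum>j<2*m-1. \<bar>n (x (j + 2)) - 2 * n (x (j + 1)) + n (x j)\<bar>)"
   by (rule second_difference_telescope)
  also have "... <= real m * (\<Sum>j<2*m-1. h * ((q (x (j + 2)) - q (x j)) + C * h * (p (x (j + 2)) - p (x j))))"
  proof (intro mult_left_mono sum_mono)
   fix j assume j: "j \<in> {..<2*m-1}"
   have e: "x (j + 2) = x (j + 1) + h" "x j = x (j + 1) - h" by (auto simp: x_def algebra_simps)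
   have "x (j + 2) <= b" using xmono[of "j+2" "2*m"] j xb by simp
   then show "\<bar>n (x (j + 2)) - 2 * n (x (j + 1)) + n (x j)\<bar>
     <= h * ((q (x (j + 2)) - q (x j)) + C * h * (p (x (j + 2)) - p (x j)))"
    using step[of "x (j+1)" h] xa[of j] h unfolding e by simp
  qed simp
  also have "... = (real m * h) * ((\<Sum>j<2*m-1. q (x (j + 2)) - q (x j)) + C * h * (\<Sum>j<2*m-1. p (x (j + 2)) - p (x j)))"
   unfolding sum_distrib_left[symmetric] sum.distrib by (simp only: mult.assoc)
  also have "... <= (real m * h) * (2 * (q b - q a) + C * h * (2 * (p b - p a)))"
   using tel[of q, OF q] tel[of p, OF p] h assms(2)
   by (intro mult_left_mono add_mono) auto
  also have "real m * h = (b - a) / 2" using m by (simp add: h_def)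
  also have "(b - a) / 2 * (2 * (q b - q a) + C * h * (2 * (p b - p a)))
    = (b - a) * ((q b - q a) + h * (C * (p b - p a)))"
  proof -
   have "x / 2 * (2 * y + C * h * (2 * z)) = x * (y + h * (C * z))" for x y z by (simp add: algebra_simps)
   then show ?thesis .
  qed
  finally show ?thesis unfolding h_def m_def .
 qed
 have "(\<lambda>m. (b - a) * ((q b - q a) + ((b - a) / 2 / real (Suc m)) * (C * (p b - p a))))
  \<longlonglongrightarrow> (b - a) * ((q b - q a) + 0 * (C * (p b - p a)))"
  by (intro tendsto_intros tendsto_div_nat)
 then have "(\<lambda>m. (b - a) * ((q b - q a) + ((b - a) / 2 / real (Suc m)) * (C * (p b - p a))))
  \<longlonglongrightarrow> (b - a) * (q b - q a)"
  by (simp only: mult_zero_left add_0_right)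
 then show ?thesis by (rule LIMSEQ_le_const) (intro exI[of _ n0] allI impI bound)
qed

section \<open>Smoothing and cut-off\<close>

lemma steklov_average:
 fixes g :: "real => real"
 assumes g: "continuous_on UNIV g" and "\<epsilon> > 0"
 obtains G where "\<And>y. DERIV G y :> (g (y + \<epsilon>) - g y) / \<epsilon>"
  and "\<And>y. \<exists>\<xi>. y < \<xi> \<and> \<xi> < y + \<epsilon> \<and> G y = g \<xi>"
proof -
 obtain H where H: "\<And>y. DERIV H y :> g y"
 proof -
  have "\<exists>F. \<forall>x::real. -\<infinity> < ereal x \<longrightarrow> ereal x < \<infinity> \<longrightarrow> (F has_vector_derivative g x) (at x)"
   using einterval_antiderivative[of "-\<infinity>" "\<infinity>" g] g by (simp add: continuous_on_eq_continuous_at)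
  then show ?thesis using that by (auto simp: has_real_derivative_iff_has_vector_derivative)
 qed
 show ?thesis
 proof
  fix y
  show "DERIV (\<lambda>y. (H (y + \<epsilon>) - H y) / \<epsilon>) y :> (g (y + \<epsilon>) - g y) / \<epsilon>"
  proof -
   have "DERIV (\<lambda>y. H (y + \<epsilon>)) y :> g (y + \<epsilon>)"
    using H[of "y + \<epsilon>"] by (simp add: DERIV_shift)
   then show ?thesis using H[of y] assms(2) by (auto intro!: derivative_eq_intros)
  qed
  obtain \<xi> where "y < \<xi>" "\<xi> < y + \<epsilon>" "H (y + \<epsilon>) - H y = (y + \<epsilon> - y) * g \<xi>"
   using MVT2[of y "y + \<epsilon>" H g] H assms(2) by auto
  then show "\<exists>\<xi>. y < \<xi> \<and> \<xi> < y + \<epsilon> \<and> (H (y + \<epsilon>) - H y) / \<epsilon> = g \<xi>"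
   using assms(2) by (intro exI[of _ \<xi>]) simp
 qed
qed

text \<open>Bounded functions of class \<open>C\<^sup>1\<close> with derivative \<open>\<phi>'\<close> bounded by \<open>L\<close>. The derivative and its bound are arguments since they occur in the equations.\<close>

definition C1b :: "(real => real) => (real => real) => real => bool" where
 "C1b \<phi> \<phi>' L \<longleftrightarrow> (\<forall>y. DERIV \<phi> y :> \<phi>' y) \<and> continuous_on UNIV \<phi>' \<and> (\<forall>y. \<bar>\<phi>' y\<bar> <= L) \<and>
  (\<exists>B. \<forall>y. \<bar>\<phi> y\<bar> <= B)"

lemma C1b_continuous: "C1b \<phi> \<phi>' L ==> continuous_on UNIV \<phi>"
 by (meson C1b_def DERIV_continuous_on DERIV_subset top_greatest)

lemma C1b_lipschitz:
 assumes "C1b \<phi> \<phi>' L" shows "\<bar>\<phi> x - \<phi> y\<bar> <= L * \<bar>x - y\<bar>"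
proof -
 have "norm (\<phi> x - \<phi> y) <= L * norm (x - y)"
  by (rule field_differentiable_bound[of UNIV \<phi> \<phi>' L]) (use assms in \<open>auto simp: C1b_def\<close>)
 then show ?thesis by simp
qed

text \<open>Averaging over a short interval keeps the Lipschitz constant, the bound and monotonicity.\<close>

lemma lipschitz_smooth_approx:
 fixes g :: "real => real"
 assumes lip: "\<And>x y. \<bar>g x - g y\<bar> <= L * \<bar>x - y\<bar>" and bd: "\<And>y. \<bar>g y\<bar> <= B" and "\<epsilon> > 0"
 obtains G G' where "C1b G G' L" "\<And>y. \<bar>G y - g y\<bar> <= L * \<epsilon>" "\<And>y. \<bar>G y\<bar> <= B"
  "mono g ==> (\<And>y. 0 <= G' y)"
proof -
 have L: "L \<ge> 0" using lip[of 0 1] by simp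
 have "L-lipschitz_on UNIV g" using lip L by (intro lipschitz_onI) (auto simp: dist_real_def)
 then have cont: "continuous_on UNIV g" by (rule lipschitz_on_continuous_on)
 obtain G where G: "\<And>y. DERIV G y :> (g (y + \<epsilon>) - g y) / \<epsilon>"
  "\<And>y. \<exists>\<xi>. y < \<xi> \<and> \<xi> < y + \<epsilon> \<and> G y = g \<xi>"
  using steklov_average[OF cont \<open>\<epsilon> > 0\<close>] by blast
 show ?thesis
 proof (rule that[of G "\<lambda>y. (g (y + \<epsilon>) - g y) / \<epsilon>"])
  show GB: "\<bar>G y\<bar> <= B" for y using G(2)[of y] bd by auto
  show "C1b G (\<lambda>y. (g (y + \<epsilon>) - g y) / \<epsilon>) L" unfolding C1b_def
  proof (intro conjI allI)
   show "DERIV G y :> (g (y + \<epsilon>) - g y) / \<epsilon>" for y by (rule G)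
   show "continuous_on UNIV (\<lambda>y. (g (y + \<epsilon>) - g y) / \<epsilon>)"
    using \<open>\<epsilon> > 0\<close> by (intro continuous_intros continuous_on_compose2[OF cont]) auto
   show "\<bar>(g (y + \<epsilon>) - g y) / \<epsilon>\<bar> <= L" for y
    using lip[of "y + \<epsilon>" y] \<open>\<epsilon> > 0\<close> by (simp add: divide_le_eq)
   show "\<exists>B. \<forall>y. \<bar>G y\<bar> <= B" using GB by blast
  qed
  show "\<bar>G y - g y\<bar> <= L * \<epsilon>" for y
  proof -
   obtain \<xi> where "y < \<xi>" "\<xi> < y + \<epsilon>" "G y = g \<xi>" using G(2) by blast
   moreover from this have "L * \<bar>\<xi> - y\<bar> <= L * \<epsilon>" using L by (intro mult_left_mono) auto
   ultimately show ?thesis using lip[of \<xi> y] by simp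
  qed
  show "0 <= (g (y + \<epsilon>) - g y) / \<epsilon>" if "mono g" for y
   using that \<open>\<epsilon> > 0\<close> by (simp add: mono_def)
 qed
qed

lemma continuous_smooth_approx:
 fixes g :: "real => real"
 assumes cont: "continuous_on UNIV g" and bd: "\<And>y. \<bar>g y\<bar> <= B"
 obtains G G' :: "nat => real => real" and L where "\<And>n. C1b (G n) (G' n) (L n)" "\<And>n y. \<bar>G n y\<bar> <= B"
  "\<And>y. (\<lambda>n. G n y) \<longlonglongrightarrow> g y"
proof -
 define \<epsilon> where "\<epsilon> n = 1 / real (Suc n)" for n
 have pos: "\<epsilon> n > 0" for n by (simp add: \<epsilon>_def)
 have "\<exists>G. (\<forall>y. DERIV G y :> (g (y + \<epsilon> n) - g y) / \<epsilon> n) \<and> (\<forall>y. \<exists>\<xi>. y < \<xi> \<and> \<xi> < y + \<epsilon> n \<and> G y = g \<xi>)" for n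
  using steklov_average[OF cont pos[of n]] by metis
 then obtain G where G: "\<And>n y. DERIV (G n) y :> (g (y + \<epsilon> n) - g y) / \<epsilon> n"
  "\<And>n y. \<exists>\<xi>. y < \<xi> \<and> \<xi> < y + \<epsilon> n \<and> G n y = g \<xi>" by metis
 show ?thesis
 proof (rule that[of G "\<lambda>n y. (g (y + \<epsilon> n) - g y) / \<epsilon> n" "\<lambda>n. 2 * B / \<epsilon> n"])
  show GB: "\<bar>G n y\<bar> <= B" for n y using G(2)[of y n] bd by auto
  show "C1b (G n) (\<lambda>y. (g (y + \<epsilon> n) - g y) / \<epsilon> n) (2 * B / \<epsilon> n)" for n unfolding C1b_def
  proof (intro conjI allI)
   show "DERIV (G n) y :> (g (y + \<epsilon> n) - g y) / \<epsilon> n" for y by (rule G)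
   show "continuous_on UNIV (\<lambda>y. (g (y + \<epsilon> n) - g y) / \<epsilon> n)"
    using pos[of n] by (intro continuous_intros continuous_on_compose2[OF cont]) auto
   show "\<bar>(g (y + \<epsilon> n) - g y) / \<epsilon> n\<bar> <= 2 * B / \<epsilon> n" for y
    using bd[of "y + \<epsilon> n"] bd[of y] pos[of n] by (simp add: divide_right_mono)
   show "\<exists>B. \<forall>y. \<bar>G n y\<bar> <= B" using GB by blast
  qed
  show "(\<lambda>n. G n y) \<longlonglongrightarrow> g y" for y
  proof -
   obtain \<xi> where xi: "\<And>n. y < \<xi> n" "\<And>n. \<xi> n < y + \<epsilon> n" "\<And>n. G n y = g (\<xi> n)" using G(2) by metis
   have "(\<lambda>n. y + \<epsilon> n) \<longlonglongrightarrow> y + 0" unfolding \<epsilon>_def by (intro tendsto_intros tendsto_div_nat)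
   then have "\<xi> \<longlonglongrightarrow> y"
    by (intro tendsto_sandwich[of "\<lambda>_. y" \<xi> _ "\<lambda>n. y + \<epsilon> n"])
     (use xi in \<open>auto intro!: always_eventually less_imp_le\<close>)
   moreover have "isCont g y" using cont by (simp add: continuous_on_eq_continuous_at)
   ultimately have "(\<lambda>n. g (\<xi> n)) \<longlonglongrightarrow> g y" by (simp add: isCont_tendsto_compose)
   then show ?thesis by (simp add: xi)
  qed
 qed
qed

lemma DERIV_pos_part_square: "DERIV (\<lambda>x::real. (max 0 x)\<^sup>2) x :> 2 * max 0 x"
proof (cases "x = 0")
 case True
 have "((\<lambda>h::real. (max 0 h)\<^sup>2 / h) \<longlongrightarrow> 0) (at 0)"
 proof (rule tendsto_sandwich[of "\<lambda>_. 0" _ _ "\<lambda>h. \<bar>h\<bar>"])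
  show "\<forall>\<^sub>F h::real in at 0. 0 <= (max 0 h)\<^sup>2 / h"
   by (rule always_eventually) (simp add: max_def power2_eq_square)
  show "\<forall>\<^sub>F h::real in at 0. (max 0 h)\<^sup>2 / h <= \<bar>h\<bar>"
   by (rule always_eventually) (simp add: max_def power2_eq_square)
  show "((\<lambda>h::real. \<bar>h\<bar>) \<longlongrightarrow> 0) (at 0)" by (intro tendsto_eq_intros) auto
 qed simp
 then show ?thesis using True by (simp add: DERIV_def)
next
 case False
 then consider "x > 0" | "x < 0" by linarith
 then show ?thesis
 proof cases
  case 1
  have "DERIV (\<lambda>x::real. x\<^sup>2) x :> 2 * max 0 x" using 1 by (auto intro!: derivative_eq_intros)
  then show ?thesis
   by (rule has_field_derivative_transform_within_open[of _ _ _ "{0<..}"]) (use 1 in auto)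
 next
  case 2
  have "DERIV (\<lambda>x::real. 0) x :> 2 * max 0 x" using 2 by simp
  then show ?thesis
   by (rule has_field_derivative_transform_within_open[of _ _ _ "{..<0}"]) (use 2 in auto)
 qed
qed

text \<open>A \<open>C\<^sup>1\<close> approximation of the positive part.\<close>

definition soft_pos :: "real => real => real" where
 "soft_pos \<epsilon> x = (max 0 x)\<^sup>2 / (max 0 x + \<epsilon>)"

definition soft_pos' :: "real => real => real" where
 "soft_pos' \<epsilon> x = 1 - (\<epsilon> / (max 0 x + \<epsilon>))\<^sup>2"

lemma DERIV_soft_pos:
 assumes "\<epsilon> > 0" shows "DERIV (soft_pos \<epsilon>) x :> soft_pos' \<epsilon> x"
proof (cases "x = 0")
 case True
 have "((\<lambda>h::real. soft_pos \<epsilon> h / h) \<longlongrightarrow> 0) (at 0)"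
 proof (rule tendsto_sandwich[of "\<lambda>_. 0" _ _ "\<lambda>h. \<bar>h\<bar> / \<epsilon>"])
  show "\<forall>\<^sub>F h in at 0. 0 <= soft_pos \<epsilon> h / h" using assms by (auto intro!: always_eventually simp: max_def soft_pos_def)
  show "\<forall>\<^sub>F h in at 0. soft_pos \<epsilon> h / h <= \<bar>h\<bar> / \<epsilon>"
  proof (rule always_eventually, rule allI)
   fix h :: real
   show "soft_pos \<epsilon> h / h <= \<bar>h\<bar> / \<epsilon>"
   proof (cases "h > 0")
    case True
    have "h / (h + \<epsilon>) <= h / \<epsilon>" using True assms by (intro divide_left_mono) auto
    then show ?thesis using True by (simp add: soft_pos_def max_def power2_eq_square)
   next
    case False
    then have "soft_pos \<epsilon> h = 0" by (simp add: soft_pos_def max_def)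
    then show ?thesis using assms by simp
   qed
  qed
  show "((\<lambda>h::real. \<bar>h\<bar> / \<epsilon>) \<longlongrightarrow> 0) (at 0)" using assms by (intro tendsto_eq_intros) auto
 qed simp
 then show ?thesis using True assms by (simp add: DERIV_def soft_pos_def soft_pos'_def)
next
 case False
 then consider "x > 0" | "x < 0" by linarith
 then show ?thesis
 proof cases
  case 1
  have "DERIV (\<lambda>x::real. x\<^sup>2 / (x + \<epsilon>)) x :> (2 * x * (x + \<epsilon>) - x\<^sup>2 * 1) / ((x + \<epsilon>) * (x + \<epsilon>))"
   using 1 assms by (intro DERIV_divide) (auto intro!: derivative_eq_intros)
  also have "(2 * x * (x + \<epsilon>) - x\<^sup>2 * 1) / ((x + \<epsilon>) * (x + \<epsilon>)) = soft_pos' \<epsilon> x"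
  proof -
   have "(x + \<epsilon>) * (x + \<epsilon>) \<noteq> 0" using 1 assms by simp
   moreover have "2 * x * (x + \<epsilon>) - x\<^sup>2 * 1 = (x + \<epsilon>) * (x + \<epsilon>) - \<epsilon>\<^sup>2"
    by (simp add: algebra_simps power2_eq_square)
   ultimately show ?thesis using 1 by (simp add: soft_pos'_def power_divide power2_eq_square diff_divide_distrib)
  qed
  finally show ?thesis
   by (rule has_field_derivative_transform_within_open[of _ _ _ "{0<..}"]) (use 1 in \<open>auto simp: soft_pos_def\<close>)
 next
  case 2
  have "DERIV (\<lambda>x::real. 0) x :> soft_pos' \<epsilon> x" using 2 assms by (simp add: soft_pos'_def)
  then show ?thesis
   by (rule has_field_derivative_transform_within_open[of _ _ _ "{..<0}"]) (use 2 in \<open>auto simp: soft_pos_def\<close>)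
 qed
qed

lemma soft_pos_bounds:
 assumes "\<epsilon> > 0"
 shows "0 <= soft_pos \<epsilon> x" "soft_pos \<epsilon> x <= max 0 x" "0 <= soft_pos' \<epsilon> x" "soft_pos' \<epsilon> x <= 1"
  "x <= 0 ==> soft_pos \<epsilon> x = 0" "x <= 0 ==> soft_pos' \<epsilon> x = 0"
proof -
 define z where "z = max 0 x"
 have z: "z \<ge> 0" by (simp add: z_def)
 show "0 <= soft_pos \<epsilon> x" using assms z by (simp add: soft_pos_def z_def[symmetric])
 have "z\<^sup>2 <= z * (z + \<epsilon>)" using assms z by (simp add: power2_eq_square algebra_simps)
 then have "z\<^sup>2 / (z + \<epsilon>) <= z" using assms z by (simp add: divide_le_eq)
 then show "soft_pos \<epsilon> x <= max 0 x" by (simp add: soft_pos_def z_def)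
 have "0 <= \<epsilon> / (z + \<epsilon>)" "\<epsilon> / (z + \<epsilon>) <= 1" using assms z by auto
 then have "(\<epsilon> / (z + \<epsilon>))\<^sup>2 <= 1" by (simp add: power_le_one)
 then show "0 <= soft_pos' \<epsilon> x" "soft_pos' \<epsilon> x <= 1" by (auto simp: soft_pos'_def z_def)
 show "x <= 0 ==> soft_pos \<epsilon> x = 0" "x <= 0 ==> soft_pos' \<epsilon> x = 0" using assms by (auto simp: soft_pos_def soft_pos'_def)
qed

lemma continuous_on_soft_pos':
 assumes "\<epsilon> > 0" shows "continuous_on UNIV (soft_pos' \<epsilon>)"
proof -
 have "max 0 x + \<epsilon> \<noteq> 0" for x :: real using assms by (simp add: max_def)
 then show ?thesis unfolding soft_pos'_def by (intro continuous_intros) auto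
qed

lemma soft_pos_tendsto:
 shows "(\<lambda>n. soft_pos (1 / real (Suc n)) x) \<longlonglongrightarrow> max 0 x"
  and "(\<lambda>n. soft_pos' (1 / real (Suc n)) x) \<longlonglongrightarrow> (if x > 0 then 1 else 0)"
proof -
 have e: "(\<lambda>n. 1 / real (Suc n)) \<longlonglongrightarrow> 0" by (rule tendsto_div_nat)
 show "(\<lambda>n. soft_pos (1 / real (Suc n)) x) \<longlonglongrightarrow> max 0 x"
 proof (cases "x > 0")
  case True
  have "(\<lambda>n. x\<^sup>2 / (x + 1 / real (Suc n))) \<longlonglongrightarrow> x\<^sup>2 / (x + 0)"
   using True by (intro tendsto_intros e) auto
  then show ?thesis using True by (simp add: soft_pos_def power2_eq_square)
 qed (simp add: soft_pos_bounds)
 show "(\<lambda>n. soft_pos' (1 / real (Suc n)) x) \<longlonglongrightarrow> (if x > 0 then 1 else 0)"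
 proof (cases "x > 0")
  case True
  have "(\<lambda>n. 1 - ((1 / real (Suc n)) / (x + 1 / real (Suc n)))\<^sup>2) \<longlonglongrightarrow> 1 - (0 / (x + 0))\<^sup>2"
   using True by (intro tendsto_intros e) auto
  then show ?thesis using True by (simp add: soft_pos'_def)
 qed (simp add: soft_pos_bounds)
qed

definition cutoff :: "nat => real => real" where
 "cutoff n y = (max 0 (1 - (y / real (Suc n))\<^sup>2))\<^sup>2"

definition cutoff' :: "nat => real => real" where
 "cutoff' n y = 2 * max 0 (1 - (y / real (Suc n))\<^sup>2) * (- 2 * (y / real (Suc n)) / real (Suc n))"

lemma DERIV_cutoff: "DERIV (cutoff n) y :> cutoff' n y"
proof -
 have "DERIV (\<lambda>y. 1 - (y / real (Suc n))\<^sup>2) y :> (- 2 * (y / real (Suc n)) / real (Suc n))"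
 proof -
  have "DERIV (\<lambda>y. y / real (Suc n)) y :> 1 / real (Suc n)" by (rule DERIV_cdivide[OF DERIV_ident])
  from DERIV_power[OF this, of 2] have "DERIV (\<lambda>y. (y / real (Suc n))\<^sup>2) y :> 2 * (y / real (Suc n)) / real (Suc n)"
   by (simp add: mult_ac)
  from DERIV_diff[OF DERIV_const this] show ?thesis by simp
 qed
 from DERIV_chain2[OF DERIV_pos_part_square this] show ?thesis unfolding cutoff_def cutoff'_def .
qed

lemma cutoff_bounds:
 shows "0 <= cutoff n y" "cutoff n y <= 1" "\<bar>cutoff' n y\<bar> <= 4 / real (Suc n)" "\<bar>cutoff' n y\<bar> <= 4"
  "\<bar>y\<bar> > real (Suc n) ==> cutoff n y = 0"
proof -
 define z where "z = y / real (Suc n)"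
 define m where "m = max 0 (1 - z\<^sup>2)"
 have m: "0 <= m" "m <= 1" by (auto simp: m_def)
 show "0 <= cutoff n y" "cutoff n y <= 1" using m by (auto simp: cutoff_def z_def[symmetric] m_def[symmetric] power_le_one)
 have "m * \<bar>z\<bar> <= 1"
 proof (cases "\<bar>z\<bar> <= 1")
  case True then show ?thesis using m mult_mono[of m 1 "\<bar>z\<bar>" 1] by simp
 next
  case False
  then have "z\<^sup>2 > 1" by (metis abs_one abs_square_le_1 linorder_not_le)
  then show ?thesis by (simp add: m_def)
 qed
 then have *: "4 * (m * \<bar>z\<bar>) / real (Suc n) <= 4 * 1 / real (Suc n)" by (intro divide_right_mono mult_left_mono) auto
 have "\<bar>cutoff' n y\<bar> = 4 * (m * \<bar>z\<bar>) / real (Suc n)"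
  unfolding cutoff'_def z_def[symmetric] m_def[symmetric] using m by (simp add: abs_mult)
 then show 1: "\<bar>cutoff' n y\<bar> <= 4 / real (Suc n)" using * by simp
 have "4 / real (Suc n) <= 4 / 1" by (intro divide_left_mono) auto
 with 1 show "\<bar>cutoff' n y\<bar> <= 4" by simp
 show "cutoff n y = 0" if "\<bar>y\<bar> > real (Suc n)"
 proof -
  have "\<bar>z\<bar> > 1" using that by (simp add: z_def)
  then have "z\<^sup>2 > 1" by (metis abs_one abs_square_le_1 linorder_not_le)
  then show ?thesis unfolding cutoff_def z_def[symmetric] by (simp del: of_nat_Suc)
 qed
qed

lemma continuous_on_cutoff': "continuous_on UNIV (cutoff' n)"
 unfolding cutoff'_def by (intro continuous_intros) auto

lemma cutoff_tendsto: "(\<lambda>n. cutoff n y) \<longlonglongrightarrow> 1" "(\<lambda>n. cutoff' n y) \<longlonglongrightarrow> 0"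
proof -
 have "(\<lambda>n. (max 0 (1 - (y / real (Suc n))\<^sup>2))\<^sup>2) \<longlonglongrightarrow> (max 0 (1 - 0\<^sup>2))\<^sup>2"
  by (intro tendsto_intros tendsto_div_nat)
 then show "(\<lambda>n. cutoff n y) \<longlonglongrightarrow> 1" by (simp add: cutoff_def)
 show "(\<lambda>n. cutoff' n y) \<longlonglongrightarrow> 0"
  by (rule tendsto_rabs_zero_cancel, rule tendsto_sandwich[of "\<lambda>_. 0" _ _ "\<lambda>n. 4 / real (Suc n)"])
   (intro always_eventually allI cutoff_bounds tendsto_div_nat tendsto_const abs_ge_zero)+
qed

section \<open>The uniform measure on the unit interval\<close>

definition unif :: "real measure" where
 "unif = uniform_measure lborel {0<..<1}"

lemma sets_unif [simp, measurable_cong]: "sets unif = sets borel"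
 by (simp add: unif_def)

lemma space_unif [simp]: "space unif = UNIV"
 by (simp add: unif_def)

interpretation unif: prob_space unif
 unfolding unif_def by (rule prob_space_uniform_measure) auto

abbreviation mean :: "(real => real) => real" (binder "\<E> " 10) where
 "\<E> s. f s \<equiv> (\<integral>s. f s \<partial>unif)"

lemma AE_unif: "AE s in unif. 0 < s \<and> s < 1"
 unfolding unif_def by (rule AE_uniform_measureI) auto

lemma AE_unifI: "(\<And>s. 0 < s ==> s < 1 ==> P s) ==> AE s in unif. P s"
 using AE_unif by eventually_elim auto

lemma unif_density: "unif = density lborel (indicator {0<..<1})"
 unfolding unif_def uniform_measure_def by (rule density_cong) (auto simp: divide_ennreal_def)

lemma integral_unif_leb01:
 fixes f :: "real => real"
 assumes "f \<in> borel_measurable borel"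
 shows "(\<E> s. f s) = (\<integral>s. f s \<partial>leb01)" and "integrable unif f \<longleftrightarrow> integrable leb01 f"
proof -
 have [measurable]: "f \<in> borel_measurable lborel" using assms by simp
 have d: "density lborel (indicator {0<..<1::real}) = density lborel (\<lambda>x. ennreal (indicator {0<..<1} x))"
  by (simp add: ennreal_indicator)
 have "(\<E> s. f s) = (\<integral>s. indicator {0<..<1} s *\<^sub>R f s \<partial>lborel)"
  unfolding unif_density d by (subst integral_density) auto
 also have "... = (\<integral>s. indicator {0<..<1} s *\<^sub>R f s \<partial>lebesgue)"
  by (rule integral_completion[symmetric]) simp
 also have "... = (\<integral>s. f s \<partial>leb01)"
  by (rule integral_restrict_space[symmetric]) simp
 finally show "(\<E> s. f s) = (\<integral>s. f s \<partial>leb01)" .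
 have "integrable unif f \<longleftrightarrow> integrable lborel (\<lambda>s. indicator {0<..<1} s *\<^sub>R f s)"
  unfolding unif_density d by (subst integrable_density) auto
 also have "... \<longleftrightarrow> integrable lebesgue (\<lambda>s. indicator {0<..<1} s *\<^sub>R f s)"
  by (rule integrable_completion[symmetric]) simp
 also have "... \<longleftrightarrow> integrable leb01 f"
  by (rule integrable_restrict_space[symmetric]) simp
 finally show "integrable unif f \<longleftrightarrow> integrable leb01 f" .
qed

lemma AE_leb01_iff: "(AE s in leb01. P s) \<longleftrightarrow> (AE s in lebesgue. s \<in> {0<..<1} \<longrightarrow> P s)"
 by (subst AE_restrict_space_iff) auto

section \<open>Comonotone maps and increasing Lipschitz test functions\<close>

text \<open>The positive part of \<open>Y - X\<close> is tested against functions of the values only.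
 With \<open>\<phi>\<close> the primitive of the indicator of the union of the intervals between
 \<open>X s\<close> and \<open>Y s\<close> where \<open>Y\<close> exceeds \<open>X\<close>,
 monotonicity of both maps makes \<open>\<phi> \<circ> Y - \<phi> \<circ> X\<close> equal to that
 positive part; such \<open>\<phi>\<close> are nondecreasing with Lipschitz constant 1.\<close>

lemma comonotone_pos_part_bound:
 fixes X Y :: "real => real"
 assumes [measurable]: "X \<in> borel_measurable borel" "Y \<in> borel_measurable borel"
  and X: "mono_on {0<..<1} X" and Y: "mono_on {0<..<1} Y"
  and bound: "\<And>\<phi> B. mono \<phi> ==> (\<And>x y. \<bar>\<phi> x - \<phi> y\<bar> <= 1 * \<bar>x - y\<bar>) ==> (\<And>y. \<bar>\<phi> y\<bar> <= B) ==>
   (\<E> s. \<phi> (Y s)) - (\<E> s. \<phi> (X s)) <= C"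
 shows "(\<integral>\<^sup>+s. ennreal (Y s - X s) \<partial>unif) <= ennreal C"
proof -
 define a where "a z = measure unif {s. X s < z}" for z
 define b where "b z = measure unif {s. Y s < z}" for z
 have mono_ab: "mono a" "mono b" unfolding a_def b_def
  by (auto intro!: monoI unif.finite_measure_mono)
 then have [measurable]: "a \<in> borel_measurable borel" "b \<in> borel_measurable borel"
  by (auto intro: borel_measurable_mono)
 \<comment> \<open>For each level \<open>z\<close> the sets \<open>{X < z}\<close> and \<open>{Y < z}\<close> are comparable initial segments.\<close>
 have nested: "(\<forall>s. 0 < s \<longrightarrow> s < 1 \<longrightarrow> X s < z \<longrightarrow> Y s < z) \<or> (\<forall>s. 0 < s \<longrightarrow> s < 1 \<longrightarrow> Y s < z \<longrightarrow> X s < z)" for z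
 proof (rule ccontr)
  assume "\<not> ?thesis"
  then obtain s s' where s: "0 < s" "s < 1" "X s < z" "\<not> Y s < z"
   and s': "0 < s'" "s' < 1" "Y s' < z" "\<not> X s' < z" by blast
  show False
  proof (cases "s <= s'")
   case True
   then have "Y s <= Y s'" using mono_onD[OF Y, of s s'] s s' by simp
   then show False using s s' by simp
  next
   case False
   then have "X s' <= X s" using mono_onD[OF X, of s' s] s s' by simp
   then show False using s s' by simp
  qed
 qed
 have le_ba: "a z <= b z" if "\<forall>s. 0 < s \<longrightarrow> s < 1 \<longrightarrow> X s < z \<longrightarrow> Y s < z" for z
  unfolding a_def b_def by (rule unif.finite_measure_mono_AE) (use that in \<open>auto intro!: AE_unifI\<close>)
 have le_ab: "b z <= a z" if "\<forall>s. 0 < s \<longrightarrow> s < 1 \<longrightarrow> Y s < z \<longrightarrow> X s < z" for z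
  unfolding a_def b_def by (rule unif.finite_measure_mono_AE) (use that in \<open>auto intro!: AE_unifI\<close>)
 have trunc: "(\<integral>\<^sup>+s. emeasure lborel ({-R..R} \<inter> {X s<..Y s}) \<partial>unif) <= ennreal C" for R :: real
 proof -
  define E where "E = {z \<in> {-R..R}. b z <= a z}"
  have [measurable]: "E \<in> sets borel" unfolding E_def by measurable
  have finE: "emeasure lborel (E \<inter> A) < \<infinity>" for A
  proof -
   have "emeasure lborel (E \<inter> A) <= emeasure lborel {-R..R}" by (rule emeasure_mono) (auto simp: E_def)
   then show ?thesis by (simp add: emeasure_lborel_Icc_eq less_top[symmetric] top_unique)
    (metis ennreal_neq_top top_unique)
  qed
  define \<phi> where "\<phi> y = measure lborel (E \<inter> {..y})" for y
  have \<phi>_diff: "\<phi> y - \<phi> x = measure lborel (E \<inter> {x<..y})" if "x <= y" for x y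
  proof -
   have "E \<inter> {..y} = (E \<inter> {..x}) \<union> (E \<inter> {x<..y})" using that by auto
   moreover have "measure lborel ((E \<inter> {..x}) \<union> (E \<inter> {x<..y})) = \<phi> x + measure lborel (E \<inter> {x<..y})"
    unfolding \<phi>_def by (rule measure_Union) (use finE in \<open>auto simp: less_top[symmetric]\<close>)
   ultimately show ?thesis by (simp add: \<phi>_def)
  qed
  have \<phi>_mono: "mono \<phi>"
   by (rule monoI) (metis \<phi>_diff diff_ge_0_iff_ge measure_nonneg)
  have \<phi>_lip: "\<bar>\<phi> x - \<phi> y\<bar> <= 1 * \<bar>x - y\<bar>" for x y
  proof -
   have *: "\<bar>\<phi> y - \<phi> x\<bar> <= y - x" if "x <= y" for x y
   proof -
    have "measure lborel (E \<inter> {x<..y}) <= measure lborel {x<..y}"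
     by (rule measure_mono_fmeasurable) (use that in \<open>auto simp: fmeasurable_def\<close>)
    then show ?thesis using \<phi>_diff[OF that] that by simp
   qed
   show ?thesis using *[of x y] *[of y x] by (cases "x <= y") (auto simp: abs_minus_commute)
  qed
  have \<phi>_bd: "\<bar>\<phi> y\<bar> <= measure lborel {-R..R}" for y
   unfolding \<phi>_def abs_of_nonneg[OF measure_nonneg]
   by (rule measure_mono_fmeasurable) (auto simp: E_def fmeasurable_def emeasure_lborel_Icc_eq)
  have [measurable]: "\<phi> \<in> borel_measurable borel" using \<phi>_mono by (rule borel_measurable_mono)
  have int_\<phi>: "integrable unif (\<lambda>s. \<phi> (Z s))" if [measurable]: "Z \<in> borel_measurable borel" for Z
   by (rule unif.integrable_const_bound[of _ "measure lborel {-R..R}"]) (use \<phi>_bd in auto)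
  \<comment> \<open>Where \<open>Y\<close> lies below \<open>X\<close>, the interval between them does not meet \<open>E\<close>, almost surely.\<close>
  have "(\<integral>\<^sup>+s. emeasure lborel (E \<inter> {Y s<..X s}) \<partial>unif) = (\<integral>\<^sup>+s. \<integral>\<^sup>+z. indicator E z * (if Y s < z \<and> z <= X s then 1 else 0) \<partial>lborel \<partial>unif)"
  proof (rule nn_integral_cong)
   fix s
   have "emeasure lborel (E \<inter> {Y s<..X s}) = (\<integral>\<^sup>+z. indicator (E \<inter> {Y s<..X s}) z \<partial>lborel)" by simp
   also have "... = (\<integral>\<^sup>+z. indicator E z * (if Y s < z \<and> z <= X s then 1 else 0) \<partial>lborel)"
    by (rule nn_integral_cong) (auto simp: indicator_def)
   finally show "emeasure lborel (E \<inter> {Y s<..X s}) = ..." .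
  qed
  also have "... = (\<integral>\<^sup>+z. \<integral>\<^sup>+s. indicator E z * (if Y s < z \<and> z <= X s then 1 else 0) \<partial>unif \<partial>lborel)"
  proof (rule pair_sigma_finite.Fubini')
   show "pair_sigma_finite lborel unif"
    by (intro pair_sigma_finite.intro sigma_finite_lborel unif.sigma_finite_measure_axioms)
  qed measurable
  also have "... = (\<integral>\<^sup>+z. 0 \<partial>(lborel :: real measure))"
  proof (rule nn_integral_cong)
   fix z :: real
   show "(\<integral>\<^sup>+s. indicator E z * (if Y s < z \<and> z <= X s then 1 else 0) \<partial>unif) = 0"
   proof (cases "z \<in> E")
    case True
    have "AE s in unif. \<not> (Y s < z \<and> z <= X s)"
    proof (cases "\<forall>s. 0 < s \<longrightarrow> s < 1 \<longrightarrow> Y s < z \<longrightarrow> X s < z")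
     case True then show ?thesis by (auto intro!: AE_unifI simp: not_le)
    next
     case False
     then have sub: "\<forall>s. 0 < s \<longrightarrow> s < 1 \<longrightarrow> X s < z \<longrightarrow> Y s < z" using nested[of z] by blast
     have "a z = b z" using le_ba[OF sub] \<open>z \<in> E\<close> by (simp add: E_def)
     have "measure unif {s. Y s < z} = measure unif ({s. X s < z} \<union> {s. Y s < z \<and> z <= X s})"
     proof (rule unif.finite_measure_eq_AE)
      show "AE s in unif. (s \<in> {s. Y s < z}) = (s \<in> {s. X s < z} \<union> {s. Y s < z \<and> z <= X s})"
       by (rule AE_unifI) (use sub in auto)
     qed auto
     also have "... = measure unif {s. X s < z} + measure unif {s. Y s < z \<and> z <= X s}"
      by (rule unif.finite_measure_Union) auto
     finally have "measure unif {s. Y s < z \<and> z <= X s} = 0"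
      using \<open>a z = b z\<close> by (simp add: a_def b_def)
     then have "{s. Y s < z \<and> z <= X s} \<in> null_sets unif"
      by (auto simp: null_sets_def unif.emeasure_eq_measure)
     then show ?thesis by (rule AE_not_in[THEN AE_mp]) auto
    qed
    then have "(\<integral>\<^sup>+s. indicator E z * (if Y s < z \<and> z <= X s then 1 else 0) \<partial>unif) = (\<integral>\<^sup>+s. 0 \<partial>unif)"
     by (intro nn_integral_cong_AE) auto
    then show ?thesis by simp
   qed simp
  qed
  finally have null: "(\<integral>\<^sup>+s. emeasure lborel (E \<inter> {Y s<..X s}) \<partial>unif) = 0" by simp
  have mes[measurable]: "(\<lambda>s. emeasure lborel (E \<inter> {Z s<..W s})) \<in> borel_measurable borel"
   if [measurable]: "Z \<in> borel_measurable borel" "W \<in> borel_measurable borel" for Z W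
  proof -
   have "emeasure lborel (E \<inter> {Z s<..W s}) = ennreal (\<phi> (max (Z s) (W s)) - \<phi> (Z s))" for s
    using \<phi>_diff[of "Z s" "max (Z s) (W s)"] finE[of "{Z s<..W s}"]
    by (auto simp: max_def emeasure_eq_ennreal_measure less_top[symmetric])
   then show ?thesis by simp
  qed
  have "AE s in unif. emeasure lborel (E \<inter> {Y s<..X s}) = 0"
   using null by (subst (asm) nn_integral_0_iff_AE) auto
  then have ae: "AE s in unif. ennreal (\<phi> (Y s) - \<phi> (X s)) = emeasure lborel ({-R..R} \<inter> {X s<..Y s}) \<and> 0 <= \<phi> (Y s) - \<phi> (X s)"
   using AE_unif
  proof eventually_elim
   fix s assume null: "emeasure lborel (E \<inter> {Y s<..X s}) = 0" and s: "0 < s \<and> s < 1"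
   show "ennreal (\<phi> (Y s) - \<phi> (X s)) = emeasure lborel ({-R..R} \<inter> {X s<..Y s}) \<and> 0 <= \<phi> (Y s) - \<phi> (X s)"
   proof (cases "X s <= Y s")
    case True
    have "{-R..R} \<inter> {X s<..Y s} = E \<inter> {X s<..Y s}"
    proof -
     have "b z <= a z" if z: "X s < z" "z <= Y s" for z
      using nested[of z] le_ab[of z] z s by force
     then show ?thesis by (auto simp: E_def)
    qed
    then show ?thesis using \<phi>_diff[OF True] finE[of "{X s<..Y s}"]
     by (simp add: emeasure_eq_ennreal_measure less_top[symmetric])
   next
    case False
    then have "\<phi> (X s) - \<phi> (Y s) = measure lborel (E \<inter> {Y s<..X s})" by (intro \<phi>_diff) simp
    also have "... = 0" using null by (simp add: measure_def)
    finally show ?thesis using False by simp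
   qed
  qed
  then have "(\<integral>\<^sup>+s. emeasure lborel ({-R..R} \<inter> {X s<..Y s}) \<partial>unif) = (\<integral>\<^sup>+s. ennreal (\<phi> (Y s) - \<phi> (X s)) \<partial>unif)"
   by (intro nn_integral_cong_AE) auto
  also have "... = ennreal (\<E> s. \<phi> (Y s) - \<phi> (X s))"
   using ae by (intro nn_integral_eq_integral Bochner_Integration.integrable_diff int_\<phi>) auto
  also have "... <= ennreal C"
   using bound[OF \<phi>_mono \<phi>_lip \<phi>_bd] int_\<phi> by (intro ennreal_leI) simp
  finally show ?thesis .
 qed
 define f where "f n s = ennreal (min (Y s) (real n) - max (X s) (- real n))" for n s
 have f_le: "f n s <= emeasure lborel ({-real n..real n} \<inter> {X s<..Y s})" for n s
 proof (cases "min (Y s) (real n) \<ge> max (X s) (- real n)")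
  case True
  have "f n s = emeasure lborel {max (X s) (- real n)<..min (Y s) (real n)}" using True by (simp add: f_def)
  also have "... <= emeasure lborel ({-real n..real n} \<inter> {X s<..Y s})" by (rule emeasure_mono) auto
  finally show ?thesis .
 next
  case False
  then have "f n s = 0" unfolding f_def by (intro ennreal_neg) (use False in linarith)
  then show ?thesis by simp
 qed
 have "(\<integral>\<^sup>+s. ennreal (Y s - X s) \<partial>unif) = (\<integral>\<^sup>+s. (SUP n. f n s) \<partial>unif)"
 proof (rule nn_integral_cong)
  fix s
  have "incseq (\<lambda>n. f n s)" unfolding f_def by (intro incseq_SucI ennreal_leI) auto
  then have "(\<lambda>n. f n s) \<longlonglongrightarrow> (SUP n. f n s)" by (rule LIMSEQ_SUP)
  moreover have "\<forall>\<^sub>F n in sequentially. f n s = ennreal (Y s - X s)"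
  proof -
   obtain n0 where "max \<bar>X s\<bar> \<bar>Y s\<bar> <= real n0" using real_arch_simple by blast
   then have "f n s = ennreal (Y s - X s)" if "n \<ge> n0" for n
   proof -
    have "\<bar>X s\<bar> <= real n" "\<bar>Y s\<bar> <= real n" using that \<open>max \<bar>X s\<bar> \<bar>Y s\<bar> <= real n0\<close> by linarith+
    then have "min (Y s) (real n) = Y s" "max (X s) (- real n) = X s" by (auto simp: min_def max_def)
    then show ?thesis by (simp add: f_def)
   qed
   then show ?thesis by (auto simp: eventually_sequentially)
  qed
  then have "(\<lambda>n. f n s) \<longlonglongrightarrow> ennreal (Y s - X s)" by (rule tendsto_eventually)
  ultimately show "ennreal (Y s - X s) = (SUP n. f n s)" by (rule LIMSEQ_unique[symmetric])
 qed
 also have "... = (SUP n. \<integral>\<^sup>+s. f n s \<partial>unif)"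
  by (rule nn_integral_monotone_convergence_SUP)
   (auto simp: f_def intro!: incseq_SucI le_funI ennreal_leI)
 also have "... <= ennreal C"
  by (rule SUP_least) (rule order_trans[OF nn_integral_mono[OF f_le] trunc])
 finally show ?thesis .
qed

text \<open>Integrating the excess over a moving level against the level recovers a square; this turns
 bounds on excesses into a bound of second moments.\<close>

lemma nn_integral_layers:
 fixes x h :: real
 assumes "h > 0"
 shows "(\<integral>\<^sup>+l. ennreal (x - l * h) * indicator {0..} l \<partial>lborel) = ennreal ((max 0 x)\<^sup>2 / (2 * h))"
proof (cases "x > 0")
 case True
 have "(\<integral>\<^sup>+l. ennreal (x - l * h) * indicator {0..} l \<partial>lborel)
   = (\<integral>\<^sup>+l. ennreal (x - l * h) * indicator {0..x / h} l \<partial>lborel)"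
 proof (rule nn_integral_cong)
  fix l :: real
  have "ennreal (x - l * h) = 0" if "l > x / h"
   using that assms by (intro ennreal_neg) (simp add: field_simps)
  then show "ennreal (x - l * h) * indicator {0..} l = ennreal (x - l * h) * indicator {0..x / h} l"
   by (auto simp: indicator_def not_le)
 qed
 also have "... = ennreal ((x * (x / h) - (x / h)\<^sup>2 * h / 2) - (x * 0 - 0\<^sup>2 * h / 2))"
 proof (rule nn_integral_FTC_Icc)
  show "DERIV (\<lambda>l. x * l - l\<^sup>2 * h / 2) l :> x - l * h" if "l \<in> {0..x / h}" for l
   by (auto intro!: derivative_eq_intros)
  show "0 <= x - l * h" if "l \<in> {0..x / h}" for l using that assms by (simp add: field_simps)
 qed (use True assms in auto)
 also have "(x * (x / h) - (x / h)\<^sup>2 * h / 2) - (x * 0 - 0\<^sup>2 * h / 2) = (max 0 x)\<^sup>2 / (2 * h)"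
  using True assms by (simp add: field_simps power2_eq_square)
 finally show ?thesis .
next
 case False
 have "(\<integral>\<^sup>+l. ennreal (x - l * h) * indicator {0..} l \<partial>lborel) = (\<integral>\<^sup>+l. 0 \<partial>(lborel :: real measure))"
 proof (rule nn_integral_cong)
  fix l :: real
  have "x - l * h <= 0" if "l \<ge> 0" using that False assms by (smt (verit) mult_nonneg_nonneg)
  then show "ennreal (x - l * h) * indicator {0..} l = 0" by (auto simp: indicator_def ennreal_neg)
 qed
 then show ?thesis using False by (simp add: max_def)
qed

lemma shift_bound:
 fixes a b a' b' P e \<sigma> :: real
 assumes "\<sigma> = 1 \<or> \<sigma> = -1" "\<sigma> * (a - b) <= P" "\<bar>a - a'\<bar> <= e / 2" "\<bar>b - b'\<bar> <= e / 2"
 shows "\<sigma> * (a' - b') <= P + e"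
 using assms by (smt (verit) field_sum_of_halves mult_cancel_right1 mult_minus_left)

section \<open>The Lagrangian formulation\<close>

text \<open>Particles are labelled by \<open>s\<close> in \<open>(0,1)\<close>. The two conservation laws are integrated twice in time,
 which is the form reached by test functions \<open>(b - t) \<phi>\<close>. The mass equation is needed in all frames
 moving with constant speed \<open>l\<close>.\<close>

locale sticky_flow =
 fixes X vv :: "real => real => real" and v0 :: "real => real"
 assumes X_joint: "(\<lambda>(t, s). X t s) \<in> borel_measurable (borel \<Otimes>\<^sub>M borel)"
  and vv_joint: "(\<lambda>(t, y). vv t y) \<in> borel_measurable (borel \<Otimes>\<^sub>M borel)"
  and X_mono: "0 <= t ==> mono_on {0<..<1} (X t)"
  and X_right_cont: "0 <= t ==> 0 < s ==> s < 1 ==> continuous (at_right s) (X t)"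
  and X0_sq: "integrable unif (\<lambda>s. (X 0 s)\<^sup>2)"
  and V_sq: "integrable unif (\<lambda>s. (vv t (X t s))\<^sup>2)"
  and energy: "locint (\<lambda>t. \<E> s. (vv t (X t s))\<^sup>2)"
  and v0_cont: "continuous_on UNIV v0" and v0_bdd: "\<exists>B. \<forall>y. \<bar>v0 y\<bar> <= B"
  and narrow: "continuous_on UNIV \<phi> ==> (\<And>y. \<bar>\<phi> y\<bar> <= B) ==>
    continuous_on {0..} (\<lambda>t. \<E> s. \<phi> (X t s))"
  and mass: "C1b \<phi> \<phi>' L ==> 0 <= b ==>
    prim (\<lambda>t. \<E> s. \<phi> (X t s - l * t)) b
     = (\<E> s. \<phi> (X 0 s)) * b
      + prim (prim (\<lambda>t. \<E> s. (vv t (X t s) - l) * \<phi>' (X t s - l * t))) b"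
  and momentum: "C1b \<phi> \<phi>' L ==> 0 <= b ==>
    prim (\<lambda>t. \<E> s. vv t (X t s) * \<phi> (X t s)) b
     = (\<E> s. v0 (X 0 s) * \<phi> (X 0 s)) * b
      + prim (prim (\<lambda>t. \<E> s. (vv t (X t s))\<^sup>2 * \<phi>' (X t s))) b"
  and oleinik: "0 < t ==> y1 <= y2 ==> vv t y2 - vv t y1 <= (y2 - y1) / t"
  and energy_init: "((\<lambda>t. \<E> s. (vv t (X t s))\<^sup>2) \<longlongrightarrow> (\<E> s. (v0 (X 0 s))\<^sup>2)) (at_right 0)"
begin

definition V :: "real => real => real" where
 "V t s = vv t (X t s)"

definition En :: "real => real" where
 "En t = prim (\<lambda>t. \<E> s. (V t s)\<^sup>2) t"

lemma X_meas [measurable (raw)]: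
 assumes "f \<in> borel_measurable M" "g \<in> borel_measurable M"
 shows "(\<lambda>x. X (f x) (g x)) \<in> borel_measurable M"
 using measurable_compose[OF measurable_Pair[OF assms] X_joint] by simp

lemma vv_meas [measurable (raw)]:
 assumes "f \<in> borel_measurable M" "g \<in> borel_measurable M"
 shows "(\<lambda>x. vv (f x) (g x)) \<in> borel_measurable M"
 using measurable_compose[OF measurable_Pair[OF assms] vv_joint] by simp

lemma V_meas [measurable (raw)]:
 assumes [measurable]: "f \<in> borel_measurable M" "g \<in> borel_measurable M"
 shows "(\<lambda>x. V (f x) (g x)) \<in> borel_measurable M"
 unfolding V_def by measurable

lemma V_square_integrable: "integrable unif (\<lambda>s. (V t s)\<^sup>2)"
 using V_sq by (simp add: V_def)

lemma V_integrable: "integrable unif (V t)"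
 by (rule unif.integrable_of_square) (auto intro: V_square_integrable)

lemma locint_energy: "locint (\<lambda>t. \<E> s. (V t s)\<^sup>2)"
 using energy by (simp add: V_def)

lemma En_mono: "0 <= c ==> c <= t ==> En c <= En t"
 unfolding En_def by (rule prim_nonneg_mono[OF locint_energy]) auto

lemma integrable_V_bounded:
 assumes [measurable]: "k \<in> borel_measurable borel" and "\<And>s. \<bar>k s\<bar> <= B"
 shows "integrable unif (\<lambda>s. V t s * k s)" "integrable unif (\<lambda>s. (V t s)\<^sup>2 * k s)"
proof -
 have "integrable unif (\<lambda>s. (k s)\<^sup>2)" by (rule unif.integrable_square_bounded) (use assms in auto)
 then show "integrable unif (\<lambda>s. V t s * k s)" by (intro integrable_mult_of_squares V_square_integrable) auto
 have B: "0 <= B" using assms(2)[of 0] by linarith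
 show "integrable unif (\<lambda>s. (V t s)\<^sup>2 * k s)"
  by (rule Bochner_Integration.integrable_bound[OF integrable_mult_right[OF V_square_integrable, of B t]])
   (use assms(2) B in \<open>auto intro!: AE_I2 mult_right_mono simp: abs_mult mult.commute[of _ "k _"]\<close>)
qed

lemma abs_integral_V_bounded:
 assumes [measurable]: "k \<in> borel_measurable borel" and "\<And>s. \<bar>k s\<bar> <= B"
 shows "\<bar>\<E> s. V t s * k s\<bar> <= B * (1/2 + 1/2 * (\<E> s. (V t s)\<^sup>2))"
proof -
 have B: "0 <= B" using assms(2)[of 0] by linarith
 have "\<bar>\<E> s. V t s * k s\<bar> <= (\<E> s. \<bar>V t s * k s\<bar>)" by (rule integral_abs_bound)
 also have "... <= (\<E> s. B * (1/2 + 1/2 * (V t s)\<^sup>2))"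
 proof (rule integral_mono)
  show "integrable unif (\<lambda>s. \<bar>V t s * k s\<bar>)" using integrable_V_bounded[OF assms] by auto
  show "integrable unif (\<lambda>s. B * (1/2 + 1/2 * (V t s)\<^sup>2))" using V_square_integrable by auto
  fix s
  have "\<bar>V t s * k s\<bar> <= B * \<bar>V t s\<bar>" using assms(2)[of s] by (simp add: abs_mult mult.commute mult_right_mono)
  also have "\<bar>V t s\<bar> <= 1/2 + 1/2 * (V t s)\<^sup>2" using young_ineq[of 1 "V t s" 1] by simp
  finally show "\<bar>V t s * k s\<bar> <= B * (1/2 + 1/2 * (V t s)\<^sup>2)" using B by (simp add: mult_left_mono)
 qed
 also have "... = B * (1/2 + 1/2 * (\<E> s. (V t s)\<^sup>2))" using V_square_integrable by (simp add: unif.prob_space[simplified])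
 finally show ?thesis .
qed

lemma locint_V_bounded:
 assumes [measurable]: "(\<lambda>(t, s). k t s) \<in> borel_measurable (borel \<Otimes>\<^sub>M borel)" and "\<And>t s. \<bar>k t s\<bar> <= B"
 shows "locint (\<lambda>t. \<E> s. V t s * k t s)" "locint (\<lambda>t. \<E> s. (V t s)\<^sup>2 * k t s)"
  "locint (\<lambda>t. \<E> s. k t s)"
proof -
 have km [measurable (raw)]: "(\<lambda>x. k (f x) (g x)) \<in> borel_measurable M"
  if "f \<in> borel_measurable M" "g \<in> borel_measurable M" for f g and M :: "'z measure"
  using measurable_compose[OF measurable_Pair assms(1), of f M g] that by simp
 have [measurable]: "k t \<in> borel_measurable borel" for t by simp
 have B: "0 <= B" using assms(2)[of 0 0] by linarith
 show "locint (\<lambda>t. \<E> s. V t s * k t s)"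
 proof (rule locint_bound)
  show "locint (\<lambda>t. B * (1/2 + 1/2 * (\<E> s. (V t s)\<^sup>2)))"
   by (intro locint_cmult locint_add locint_const locint_energy)
  show "\<bar>\<E> s. V t s * k t s\<bar> <= B * (1/2 + 1/2 * (\<E> s. (V t s)\<^sup>2))" for t
   by (rule abs_integral_V_bounded) (use assms(2) in auto)
 qed measurable
 show "locint (\<lambda>t. \<E> s. (V t s)\<^sup>2 * k t s)"
 proof (rule locint_bound)
  show "locint (\<lambda>t. B * (\<E> s. (V t s)\<^sup>2))" by (intro locint_cmult locint_energy)
  fix t :: real
  have "\<bar>\<E> s. (V t s)\<^sup>2 * k t s\<bar> <= (\<E> s. \<bar>(V t s)\<^sup>2 * k t s\<bar>)" by (rule integral_abs_bound)
  also have "... <= (\<E> s. B * (V t s)\<^sup>2)"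
  proof (rule integral_mono)
   show "integrable unif (\<lambda>s. \<bar>(V t s)\<^sup>2 * k t s\<bar>)"
    by (intro integrable_abs integrable_V_bounded(2)[where B=B]) (use assms(2) in auto)
   show "\<bar>(V t s)\<^sup>2 * k t s\<bar> <= B * (V t s)\<^sup>2" for s
    using mult_right_mono[OF assms(2)[of t s], of "(V t s)\<^sup>2"] by (simp add: abs_mult mult.commute)
  qed (use V_square_integrable in auto)
  finally show "\<bar>\<E> s. (V t s)\<^sup>2 * k t s\<bar> <= B * (\<E> s. (V t s)\<^sup>2)" using V_square_integrable by simp
 qed measurable
 show "locint (\<lambda>t. \<E> s. k t s)"
 proof (rule locint_bound)
  show "locint (\<lambda>t. B)" by simp
  fix t :: real
  have "\<bar>\<E> s. k t s\<bar> <= (\<E> s. B)"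
   by (rule order_trans[OF integral_abs_bound integral_mono])
    (use assms(2) in \<open>auto intro!: unif.integrable_const_bound[of _ B]\<close>)
  then show "\<bar>\<E> s. k t s\<bar> <= B" by (simp add: unif.prob_space[simplified])
 qed measurable
qed

lemma C1b_meas:
 assumes "C1b \<phi> \<phi>' L"
 shows "\<phi> \<in> borel_measurable borel" "\<phi>' \<in> borel_measurable borel"
 using C1b_continuous[OF assms] assms by (auto simp: C1b_def intro: borel_measurable_continuous_onI)

subsection \<open>Conservation of mass between two times\<close>

text \<open>Both sides are continuous in \<open>b\<close>, so the identity between primitives holds for
 the functions themselves.\<close>

lemma mass_balance:
 assumes \<phi>: "C1b \<phi> \<phi>' L" and "0 <= a" "0 <= b"
  and B_def: "B = (\<lambda>t. \<E> s. (V t s - l) * \<phi>' (X t s - l * t))"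
 shows "(\<E> s. \<phi> (X b s - l * b)) - (\<E> s. \<phi> (X a s - l * a)) = prim B b - prim B a"
  and "locint B"
proof -
 note [measurable] = C1b_meas[OF \<phi>]
 have L: "\<bar>\<phi>' y\<bar> <= L" for y using \<phi> by (simp add: C1b_def)
 have L0: "0 <= L" using L[of 0] by linarith
 obtain M where M: "\<And>y. \<bar>\<phi> y\<bar> <= M" using \<phi> by (auto simp: C1b_def)
 have Beq: "B t = (\<E> s. V t s * \<phi>' (X t s - l * t)) - l * (\<E> s. \<phi>' (X t s - l * t))" for t
 proof -
  have "integrable unif (\<lambda>s. \<phi>' (X t s - l * t))" by (rule unif.integrable_const_bound[of _ L]) (use L in auto)
  moreover have "integrable unif (\<lambda>s. V t s * \<phi>' (X t s - l * t))"
   by (rule integrable_V_bounded(1)) (use L in auto)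
  ultimately show ?thesis unfolding B_def left_diff_distrib
   by (simp only: Bochner_Integration.integral_diff integrable_mult_right integral_mult_right_zero)
 qed
 show B: "locint B"
 proof -
  have "B = (\<lambda>t. (\<E> s. V t s * \<phi>' (X t s - l * t)) - l * (\<E> s. \<phi>' (X t s - l * t)))"
   by (rule ext) (rule Beq)
  moreover have "locint (\<lambda>t. (\<E> s. V t s * \<phi>' (X t s - l * t)) - l * (\<E> s. \<phi>' (X t s - l * t)))"
  proof (rule locint_diff[OF _ locint_cmult])
   have m: "(\<lambda>(t, s). \<phi>' (X t s - l * t)) \<in> borel_measurable (borel \<Otimes>\<^sub>M borel)" by measurable
   show "locint (\<lambda>t. \<E> s. V t s * \<phi>' (X t s - l * t))" by (rule locint_V_bounded(1)[OF m L])
   show "locint (\<lambda>t. \<E> s. \<phi>' (X t s - l * t))" by (rule locint_V_bounded(3)[OF m L])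
  qed
  ultimately show ?thesis by (simp only:)
 qed
 have main: "(\<E> s. \<phi> (X t s - l * t)) = (\<E> s. \<phi> (X 0 s)) + prim B t" if "0 <= t" for t
 proof (rule continuous_eq_of_prim_eq[OF _ _ _ that])
  show "continuous_on {0..} (\<lambda>t. (\<E> s. \<phi> (X 0 s)) + prim B t)"
   by (intro continuous_intros continuous_on_prim B)
  show cont: "continuous_on {0..} (\<lambda>t. \<E> s. \<phi> (X t s - l * t))"
   unfolding continuous_on_def
  proof
   fix t0 :: real assume t0: "t0 \<in> {0..}"
   have "continuous_on {0..} (\<lambda>t. \<E> s. \<phi> (X t s - l * t0))"
   proof (rule narrow)
    show "continuous_on UNIV (\<lambda>y. \<phi> (y - l * t0))"
     by (rule continuous_on_compose2[OF C1b_continuous[OF \<phi>]]) (intro continuous_intros, simp)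
    show "\<bar>\<phi> (y - l * t0)\<bar> <= M" for y by (rule M)
   qed
   then have 1: "((\<lambda>t. \<E> s. \<phi> (X t s - l * t0)) \<longlongrightarrow> (\<E> s. \<phi> (X t0 s - l * t0))) (at t0 within {0..})"
    using t0 by (simp add: continuous_on_def)
   have int: "integrable unif (\<lambda>s. \<phi> (X t s - r))" for t r by (rule unif.integrable_const_bound[of _ M]) (use M in auto)
   have bd: "\<bar>(\<E> s. \<phi> (X t s - l * t)) - (\<E> s. \<phi> (X t s - l * t0))\<bar> <= L * (\<bar>l\<bar> * \<bar>t - t0\<bar>)" for t
   proof -
    have "\<bar>\<E> s. \<phi> (X t s - l * t) - \<phi> (X t s - l * t0)\<bar> <= (\<E> s. L * (\<bar>l\<bar> * \<bar>t - t0\<bar>))"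
    proof (rule order_trans[OF integral_abs_bound integral_mono])
     fix s
     have eq: "\<bar>(X t s - l * t) - (X t s - l * t0)\<bar> = \<bar>l\<bar> * \<bar>t - t0\<bar>"
     proof -
      have "(X t s - l * t) - (X t s - l * t0) = l * (t0 - t)" by (simp add: algebra_simps)
      then have "\<bar>(X t s - l * t) - (X t s - l * t0)\<bar> = \<bar>l\<bar> * \<bar>t0 - t\<bar>" by (simp only: abs_mult)
      then show ?thesis unfolding abs_minus_commute[of t0 t] .
     qed
     show "\<bar>\<phi> (X t s - l * t) - \<phi> (X t s - l * t0)\<bar> <= L * (\<bar>l\<bar> * \<bar>t - t0\<bar>)"
      using C1b_lipschitz[OF \<phi>, of "X t s - l * t" "X t s - l * t0"] unfolding eq .
    qed (auto intro!: int)
    also have "(\<E> s. L * (\<bar>l\<bar> * \<bar>t - t0\<bar>)) = L * (\<bar>l\<bar> * \<bar>t - t0\<bar>)"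
     by (simp add: unif.prob_space[simplified])
    finally show ?thesis using int by (simp only: Bochner_Integration.integral_diff)
   qed
   have "((\<lambda>t. L * (\<bar>l\<bar> * \<bar>t - t0\<bar>)) \<longlongrightarrow> L * (\<bar>l\<bar> * \<bar>t0 - t0\<bar>)) (at t0 within {0..})"
    by (intro tendsto_intros)
   then have lim: "((\<lambda>t. L * (\<bar>l\<bar> * \<bar>t - t0\<bar>)) \<longlongrightarrow> 0) (at t0 within {0..})"
    by (simp only: diff_self abs_zero mult_zero_right)
   have "((\<lambda>t. (\<E> s. \<phi> (X t s - l * t)) - (\<E> s. \<phi> (X t s - l * t0))) \<longlongrightarrow> 0) (at t0 within {0..})"
   proof (rule Lim_null_comparison[OF _ lim])
    show "\<forall>\<^sub>F t in at t0 within {0..}. norm ((\<E> s. \<phi> (X t s - l * t)) - (\<E> s. \<phi> (X t s - l * t0))) <= L * (\<bar>l\<bar> * \<bar>t - t0\<bar>)"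
     unfolding real_norm_def by (rule always_eventually) (rule allI, rule bd)
   qed
   from tendsto_add[OF this 1]
   show "((\<lambda>t. \<E> s. \<phi> (X t s - l * t)) \<longlongrightarrow> (\<E> s. \<phi> (X t0 s - l * t0))) (at t0 within {0..})"
    by (simp only: diff_add_cancel add_0_left)
  qed
  fix b :: real assume b: "0 <= b"
  show "prim (\<lambda>t. \<E> s. \<phi> (X t s - l * t)) b = prim (\<lambda>t. (\<E> s. \<phi> (X 0 s)) + prim B t) b"
  proof -
   have "prim (\<lambda>t. (\<E> s. \<phi> (X 0 s)) + prim B t) b = prim (\<lambda>_. \<E> s. \<phi> (X 0 s)) b + prim (prim B) b"
    by (rule prim_add[OF locint_const locint_continuous[OF continuous_on_prim[OF B]]])
   then show ?thesis using mass[OF \<phi> b, of l] b unfolding B_def V_def by (simp only: prim_const)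
  qed
 qed
 then show "(\<E> s. \<phi> (X b s - l * b)) - (\<E> s. \<phi> (X a s - l * a)) = prim B b - prim B a"
  using main[OF assms(2)] main[OF assms(3)] by linarith
qed

subsection \<open>Displacement bounded by kinetic energy\<close>

text \<open>In the frame moving with speed \<open>l\<close> only particles faster than \<open>l\<close>
 contribute to an increasing test function, and monotone rearrangements turn this bound on laws into
 one on the maps.\<close>

lemma displacement_tail:
 assumes "0 <= c" "c <= t" and \<sigma>: "\<sigma> = 1 \<or> \<sigma> = -1"
 shows "(\<integral>\<^sup>+s. ennreal (\<sigma> * (X t s - X c s) - l * (t - c)) \<partial>unif)
  <= (\<integral>\<^sup>+\<tau>. (\<integral>\<^sup>+s. ennreal (\<sigma> * V \<tau> s - l) \<partial>unif) * indicator {c..t} \<tau> \<partial>lborel)"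
proof -
 define k where "k \<tau> s = max 0 (\<sigma> * V \<tau> s - l)" for \<tau> s
 define K where "K \<tau> = (\<E> s. k \<tau> s)" for \<tau>
 have int_k: "integrable unif (k \<tau>)" for \<tau>
  unfolding k_def using V_integrable[of \<tau>] by (intro integrable_max integrable_const Bochner_Integration.integrable_diff) auto
 have K_meas[measurable]: "K \<in> borel_measurable borel" unfolding K_def k_def by measurable
 have locK: "locint K"
 proof (rule locint_bound)
  show "locint (\<lambda>t. (1/2 + \<bar>l\<bar>) + 1/2 * (\<E> s. (V t s)\<^sup>2))"
   by (intro locint_cmult locint_add locint_const locint_energy)
  fix \<tau> :: real
  have "\<bar>K \<tau>\<bar> <= (\<E> s. (1/2 + \<bar>l\<bar>) + 1/2 * (V \<tau> s)\<^sup>2)"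
   unfolding K_def
  proof (rule order_trans[OF integral_abs_bound integral_mono])
   show "integrable unif (\<lambda>s. (1/2 + \<bar>l\<bar>) + 1/2 * (V \<tau> s)\<^sup>2)" using V_square_integrable by auto
   fix s
   have "\<bar>V \<tau> s\<bar> <= 1/2 + 1/2 * (V \<tau> s)\<^sup>2" using young_ineq[of 1 "V \<tau> s" 1] by simp
   then show "\<bar>k \<tau> s\<bar> <= (1/2 + \<bar>l\<bar>) + 1/2 * (V \<tau> s)\<^sup>2" using \<sigma> by (auto simp: k_def)
  qed (use int_k in auto)
  then show "\<bar>K \<tau>\<bar> <= (1/2 + \<bar>l\<bar>) + 1/2 * (\<E> s. (V \<tau> s)\<^sup>2)"
   using V_square_integrable by (simp add: unif.prob_space[simplified])
 qed measurable
 have rhs: "(\<integral>\<^sup>+\<tau>. (\<integral>\<^sup>+s. ennreal (\<sigma> * V \<tau> s - l) \<partial>unif) * indicator {c..t} \<tau> \<partial>lborel) = ennreal (prim K t - prim K c)"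
 proof -
  have "(\<integral>\<^sup>+s. ennreal (\<sigma> * V \<tau> s - l) \<partial>unif) = ennreal (K \<tau>)" for \<tau>
  proof -
   have "(\<integral>\<^sup>+s. ennreal (\<sigma> * V \<tau> s - l) \<partial>unif) = (\<integral>\<^sup>+s. ennreal (k \<tau> s) \<partial>unif)"
    by (rule nn_integral_cong) (auto simp: k_def max_def ennreal_neg)
   also have "... = ennreal (K \<tau>)" unfolding K_def
    by (rule nn_integral_eq_integral[OF int_k]) (auto simp: k_def)
   finally show ?thesis .
  qed
  moreover have "K \<tau> \<ge> 0" for \<tau> unfolding K_def k_def by simp
  moreover have "(\<integral>\<^sup>+\<tau>. ennreal (K \<tau>) * indicator {c..t} \<tau> \<partial>lborel) = ennreal (prim K t - prim K c)"
   if "\<And>\<tau>. K \<tau> \<ge> 0"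
  proof -
   have "(\<integral>\<^sup>+\<tau>. ennreal (K \<tau>) * indicator {c..t} \<tau> \<partial>lborel) = (\<integral>\<^sup>+\<tau>. ennreal (indicator {c..t} \<tau> *\<^sub>R K \<tau>) \<partial>lborel)"
    by (rule nn_integral_cong) (auto simp: indicator_def)
   also have "... = ennreal (\<integral>\<tau>. indicator {c..t} \<tau> *\<^sub>R K \<tau> \<partial>lborel)"
    by (rule nn_integral_eq_integral) (use locint_D[OF locK assms(1), of t] that in \<open>auto simp: set_integrable_def\<close>)
   finally show ?thesis unfolding prim_diff[OF locK assms(1,2)] set_lebesgue_integral_def .
  qed
  ultimately show ?thesis by simp
 qed
 define m where "m = \<sigma> * l"
 define A where "A r s = X r s - m * r" for r s
 have \<sigma>m: "\<sigma> * m = l" using \<sigma> by (auto simp: m_def)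
 have A_mono: "mono_on {0<..<1} (A r)" if "0 <= r" for r
  using X_mono[OF that] by (auto simp: A_def mono_on_def)
 have A_meas[measurable]: "A r \<in> borel_measurable borel" for r unfolding A_def by measurable
 have key: "\<sigma> * ((\<E> s. \<phi> (A t s)) - (\<E> s. \<phi> (A c s))) <= prim K t - prim K c"
  if \<phi>: "mono \<phi>" "\<And>x y. \<bar>\<phi> x - \<phi> y\<bar> <= 1 * \<bar>x - y\<bar>" "\<And>y. \<bar>\<phi> y\<bar> <= B" for \<phi> B
 proof (rule field_le_epsilon)
  fix e :: real assume "e > 0"
  then obtain G G' where G: "C1b G G' 1" "\<And>y. \<bar>G y - \<phi> y\<bar> <= 1 * (e / 2)" and G0: "\<And>y. 0 <= G' y"
   using lipschitz_smooth_approx[OF \<phi>(2,3), of "e / 2"] \<phi>(1) by (metis half_gt_zero)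
  have [measurable]: "\<phi> \<in> borel_measurable borel" using \<phi>(1) by (rule borel_measurable_mono)
  note [measurable] = C1b_meas[OF G(1)]
  obtain BG where BG: "\<And>y. \<bar>G y\<bar> <= BG" using G(1) by (auto simp: C1b_def)
  have close: "\<bar>(\<E> s. G (A r s)) - (\<E> s. \<phi> (A r s))\<bar> <= e / 2" for r
  proof -
   have i: "integrable unif (\<lambda>s. G (A r s))" "integrable unif (\<lambda>s. \<phi> (A r s))"
    by (rule unif.integrable_const_bound[of _ BG], simp_all add: BG)
     (rule unif.integrable_const_bound[of _ B], simp_all add: \<phi>(3))
   have "\<bar>\<E> s. G (A r s) - \<phi> (A r s)\<bar> <= (\<E> s. e / 2)"
    by (rule order_trans[OF integral_abs_bound integral_mono]) (use G(2) i in auto)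
   then show ?thesis using i by (simp add: unif.prob_space[simplified])
  qed
  define BB where "BB = (\<lambda>\<tau>. \<E> s. (V \<tau> s - m) * G' (X \<tau> s - m * \<tau>))"
  have eq: "(\<E> s. G (A t s)) - (\<E> s. G (A c s)) = prim BB t - prim BB c"
   and BB: "locint BB"
   using mass_balance[OF G(1) assms(1) order_trans[OF assms(1,2)] BB_def] by (auto simp: A_def)
  have "prim (\<lambda>\<tau>. \<sigma> * BB \<tau>) t - prim (\<lambda>\<tau>. \<sigma> * BB \<tau>) c <= prim K t - prim K c"
  proof (rule prim_mono[OF locint_cmult[OF BB] locK assms(1,2)])
   fix \<tau>
   have "\<sigma> * BB \<tau> = (\<E> s. (\<sigma> * V \<tau> s - l) * G' (X \<tau> s - m * \<tau>))"
   proof -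
    have "\<sigma> * BB \<tau> = (\<E> s. \<sigma> * ((V \<tau> s - m) * G' (X \<tau> s - m * \<tau>)))"
     unfolding BB_def by (rule integral_mult_right_zero[symmetric])
    also have "(\<lambda>s. \<sigma> * ((V \<tau> s - m) * G' (X \<tau> s - m * \<tau>))) = (\<lambda>s. (\<sigma> * V \<tau> s - l) * G' (X \<tau> s - m * \<tau>))"
     unfolding \<sigma>m[symmetric] mult.assoc[symmetric] right_diff_distrib by (rule refl)
    finally show ?thesis .
   qed
   also have "... <= K \<tau>" unfolding K_def
   proof (rule integral_mono'[OF int_k])
    fix s
    have g: "0 <= G' (X \<tau> s - m * \<tau>)" "G' (X \<tau> s - m * \<tau>) <= 1" using G0 G(1) by (auto simp: C1b_def abs_le_iff)
    have "(\<sigma> * V \<tau> s - l) * G' (X \<tau> s - m * \<tau>) <= k \<tau> s * G' (X \<tau> s - m * \<tau>)"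
     using g by (intro mult_right_mono) (auto simp: k_def)
    also have "... <= k \<tau> s * 1" using g by (intro mult_left_mono) (auto simp: k_def)
    finally show "(\<sigma> * V \<tau> s - l) * G' (X \<tau> s - m * \<tau>) <= k \<tau> s" by simp
   qed (simp add: k_def)
   finally show "\<sigma> * BB \<tau> <= K \<tau>" .
  qed
  then have "\<sigma> * ((\<E> s. G (A t s)) - (\<E> s. G (A c s))) <= prim K t - prim K c"
   unfolding eq prim_cmult right_diff_distrib .
  from shift_bound[OF \<sigma> this close close]
  show "\<sigma> * ((\<E> s. \<phi> (A t s)) - (\<E> s. \<phi> (A c s))) <= prim K t - prim K c + e" .
 qed
 have t: "0 <= t" using assms by simp
 show ?thesis unfolding rhs using \<sigma>
 proof
  assume \<sigma>1: "\<sigma> = 1"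
  have "(\<integral>\<^sup>+s. ennreal (A t s - A c s) \<partial>unif) <= ennreal (prim K t - prim K c)"
  proof (rule comonotone_pos_part_bound[OF A_meas A_meas A_mono A_mono])
   fix \<phi> :: "real => real" and B
   assume "mono \<phi>" "\<And>x y. \<bar>\<phi> x - \<phi> y\<bar> <= 1 * \<bar>x - y\<bar>" "\<And>y. \<bar>\<phi> y\<bar> <= B"
   from key[OF this] show "(\<E> s. \<phi> (A t s)) - (\<E> s. \<phi> (A c s)) <= prim K t - prim K c"
    using \<sigma>1 by simp
  qed (use assms t in auto)
  moreover have "A t s - A c s = \<sigma> * (X t s - X c s) - l * (t - c)" for s
   using \<sigma>1 by (simp add: A_def m_def algebra_simps)
  ultimately show "(\<integral>\<^sup>+s. ennreal (\<sigma> * (X t s - X c s) - l * (t - c)) \<partial>unif) <= ennreal (prim K t - prim K c)" by simp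
 next
  assume \<sigma>1: "\<sigma> = -1"
  have "(\<integral>\<^sup>+s. ennreal (A c s - A t s) \<partial>unif) <= ennreal (prim K t - prim K c)"
  proof (rule comonotone_pos_part_bound[OF A_meas A_meas A_mono A_mono])
   fix \<phi> :: "real => real" and B
   assume "mono \<phi>" "\<And>x y. \<bar>\<phi> x - \<phi> y\<bar> <= 1 * \<bar>x - y\<bar>" "\<And>y. \<bar>\<phi> y\<bar> <= B"
   from key[OF this] show "(\<E> s. \<phi> (A c s)) - (\<E> s. \<phi> (A t s)) <= prim K t - prim K c"
    using \<sigma>1 by simp
  qed (use assms t in auto)
  moreover have "A c s - A t s = \<sigma> * (X t s - X c s) - l * (t - c)" for s
   using \<sigma>1 by (simp add: A_def m_def algebra_simps)
  ultimately show "(\<integral>\<^sup>+s. ennreal (\<sigma> * (X t s - X c s) - l * (t - c)) \<partial>unif) <= ennreal (prim K t - prim K c)" by simp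
 qed
qed

end

context sticky_flow
begin

text \<open>The excesses over all speeds \<open>l\<close> are summed: displacements give the square of
 the displacement divided by the time, velocities give the energy.\<close>

lemma displacement_nn:
 assumes "0 <= c" "c <= t"
 shows "(\<integral>\<^sup>+s. ennreal ((X t s - X c s)\<^sup>2) \<partial>unif) <= ennreal ((t - c) * (En t - En c))"
proof (cases "c = t")
 case True then show ?thesis by simp
next
 case False
 define h where "h = t - c"
 have h: "h > 0" using False assms by (simp add: h_def)
 have pair: "pair_sigma_finite lborel unif" "pair_sigma_finite lborel (lborel :: real measure)"
  by (intro pair_sigma_finite.intro sigma_finite_lborel unif.sigma_finite_measure_axioms)+
 have half: "(\<integral>\<^sup>+s. ennreal ((max 0 (\<sigma> * (X t s - X c s)))\<^sup>2 / (2 * h)) \<partial>unif)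
   <= (\<integral>\<^sup>+\<tau>. (\<integral>\<^sup>+s. ennreal ((max 0 (\<sigma> * V \<tau> s))\<^sup>2 / 2) \<partial>unif) * indicator {c..t} \<tau> \<partial>lborel)"
  if \<sigma>: "\<sigma> = 1 \<or> \<sigma> = -1" for \<sigma> :: real
 proof -
  have "(\<integral>\<^sup>+s. ennreal ((max 0 (\<sigma> * (X t s - X c s)))\<^sup>2 / (2 * h)) \<partial>unif)
    = (\<integral>\<^sup>+s. \<integral>\<^sup>+l. ennreal (\<sigma> * (X t s - X c s) - l * h) * indicator {0..} l \<partial>lborel \<partial>unif)"
   by (simp only: nn_integral_layers[OF h])
  also have "... = (\<integral>\<^sup>+l. \<integral>\<^sup>+s. ennreal (\<sigma> * (X t s - X c s) - l * h) * indicator {0..} l \<partial>unif \<partial>lborel)"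
   by (rule pair_sigma_finite.Fubini'[OF pair(1)]) measurable
  also have "... = (\<integral>\<^sup>+l. (\<integral>\<^sup>+s. ennreal (\<sigma> * (X t s - X c s) - l * h) \<partial>unif) * indicator {0..} l \<partial>lborel)"
   by (intro nn_integral_cong nn_integral_multc) measurable
  also have "... <= (\<integral>\<^sup>+l. (\<integral>\<^sup>+\<tau>. (\<integral>\<^sup>+s. ennreal (\<sigma> * V \<tau> s - l) \<partial>unif) * indicator {c..t} \<tau> \<partial>lborel) * indicator {0..} l \<partial>lborel)"
   using displacement_tail[OF assms \<sigma>] unfolding h_def by (intro nn_integral_mono mult_right_mono) auto
  also have "... = (\<integral>\<^sup>+l. \<integral>\<^sup>+\<tau>. (\<integral>\<^sup>+s. ennreal (\<sigma> * V \<tau> s - l) \<partial>unif) * indicator {c..t} \<tau> * indicator {0..} l \<partial>lborel \<partial>lborel)"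
   by (intro nn_integral_cong nn_integral_multc[symmetric]) measurable
  also have "... = (\<integral>\<^sup>+\<tau>. \<integral>\<^sup>+l. (\<integral>\<^sup>+s. ennreal (\<sigma> * V \<tau> s - l) \<partial>unif) * indicator {c..t} \<tau> * indicator {0..} l \<partial>lborel \<partial>lborel)"
   by (rule pair_sigma_finite.Fubini'[OF pair(2), symmetric]) measurable
  also have "... = (\<integral>\<^sup>+\<tau>. (\<integral>\<^sup>+s. ennreal ((max 0 (\<sigma> * V \<tau> s))\<^sup>2 / 2) \<partial>unif) * indicator {c..t} \<tau> \<partial>lborel)"
  proof (rule nn_integral_cong)
   fix \<tau> :: real
   have "(\<integral>\<^sup>+l. (\<integral>\<^sup>+s. ennreal (\<sigma> * V \<tau> s - l) \<partial>unif) * indicator {c..t} \<tau> * indicator {0..} l \<partial>lborel)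
     = (\<integral>\<^sup>+l. (\<integral>\<^sup>+s. ennreal (\<sigma> * V \<tau> s - l) * indicator {0..} l \<partial>unif) * indicator {c..t} \<tau> \<partial>lborel)"
    by (rule nn_integral_cong, subst nn_integral_multc) (auto simp: mult_ac)
   also have "... = (\<integral>\<^sup>+l. (\<integral>\<^sup>+s. ennreal (\<sigma> * V \<tau> s - l) * indicator {0..} l \<partial>unif) \<partial>lborel) * indicator {c..t} \<tau>"
    by (rule nn_integral_multc) measurable
   also have "(\<integral>\<^sup>+l. (\<integral>\<^sup>+s. ennreal (\<sigma> * V \<tau> s - l) * indicator {0..} l \<partial>unif) \<partial>lborel)
     = (\<integral>\<^sup>+s. (\<integral>\<^sup>+l. ennreal (\<sigma> * V \<tau> s - l * 1) * indicator {0..} l \<partial>lborel) \<partial>unif)"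
    unfolding mult_1_right by (rule pair_sigma_finite.Fubini'[OF pair(1), symmetric]) measurable
   also have "... = (\<integral>\<^sup>+s. ennreal ((max 0 (\<sigma> * V \<tau> s))\<^sup>2 / 2) \<partial>unif)"
    unfolding nn_integral_layers[OF zero_less_one] by (simp only: mult_1_right)
   finally show "(\<integral>\<^sup>+l. (\<integral>\<^sup>+s. ennreal (\<sigma> * V \<tau> s - l) \<partial>unif) * indicator {c..t} \<tau> * indicator {0..} l \<partial>lborel)
     = (\<integral>\<^sup>+s. ennreal ((max 0 (\<sigma> * V \<tau> s))\<^sup>2 / 2) \<partial>unif) * indicator {c..t} \<tau>" .
  qed
  finally show ?thesis .
 qed
 have split: "ennreal (x\<^sup>2 / r) = ennreal ((max 0 (1 * x))\<^sup>2 / r) + ennreal ((max 0 (-1 * x))\<^sup>2 / r)" if "r > 0" for x r :: real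
  using that by (subst ennreal_plus[symmetric]) (auto simp: max_def)
 have "(\<integral>\<^sup>+s. ennreal ((X t s - X c s)\<^sup>2 / (2 * h)) \<partial>unif)
   = (\<integral>\<^sup>+s. ennreal ((max 0 (1 * (X t s - X c s)))\<^sup>2 / (2 * h)) \<partial>unif) + (\<integral>\<^sup>+s. ennreal ((max 0 (-1 * (X t s - X c s)))\<^sup>2 / (2 * h)) \<partial>unif)"
 proof -
  have "(\<integral>\<^sup>+s. ennreal ((X t s - X c s)\<^sup>2 / (2 * h)) \<partial>unif)
   = (\<integral>\<^sup>+s. ennreal ((max 0 (1 * (X t s - X c s)))\<^sup>2 / (2 * h)) + ennreal ((max 0 (-1 * (X t s - X c s)))\<^sup>2 / (2 * h)) \<partial>unif)"
   using h by (intro nn_integral_cong split) simp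
  also have "... = (\<integral>\<^sup>+s. ennreal ((max 0 (1 * (X t s - X c s)))\<^sup>2 / (2 * h)) \<partial>unif) + (\<integral>\<^sup>+s. ennreal ((max 0 (-1 * (X t s - X c s)))\<^sup>2 / (2 * h)) \<partial>unif)"
   by (rule nn_integral_add) measurable
  finally show ?thesis .
 qed
 also have "... <= (\<integral>\<^sup>+\<tau>. (\<integral>\<^sup>+s. ennreal ((max 0 (1 * V \<tau> s))\<^sup>2 / 2) \<partial>unif) * indicator {c..t} \<tau> \<partial>lborel)
   + (\<integral>\<^sup>+\<tau>. (\<integral>\<^sup>+s. ennreal ((max 0 (-1 * V \<tau> s))\<^sup>2 / 2) \<partial>unif) * indicator {c..t} \<tau> \<partial>lborel)"
  by (intro add_mono half) auto
 also have "... = (\<integral>\<^sup>+\<tau>. (\<integral>\<^sup>+s. ennreal ((max 0 (1 * V \<tau> s))\<^sup>2 / 2) \<partial>unif) * indicator {c..t} \<tau>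
   + (\<integral>\<^sup>+s. ennreal ((max 0 (-1 * V \<tau> s))\<^sup>2 / 2) \<partial>unif) * indicator {c..t} \<tau> \<partial>lborel)"
  by (rule nn_integral_add[symmetric]) measurable
 also have "... = (\<integral>\<^sup>+\<tau>. ennreal (indicator {c..t} \<tau> *\<^sub>R (1/2 * (\<E> s. (V \<tau> s)\<^sup>2))) \<partial>lborel)"
 proof (rule nn_integral_cong)
  fix \<tau> :: real
  have "(\<integral>\<^sup>+s. ennreal ((max 0 (1 * V \<tau> s))\<^sup>2 / 2) \<partial>unif) + (\<integral>\<^sup>+s. ennreal ((max 0 (-1 * V \<tau> s))\<^sup>2 / 2) \<partial>unif)
    = (\<integral>\<^sup>+s. ennreal ((V \<tau> s)\<^sup>2 / 2) \<partial>unif)"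
  proof -
   have "(\<integral>\<^sup>+s. ennreal ((V \<tau> s)\<^sup>2 / 2) \<partial>unif)
    = (\<integral>\<^sup>+s. ennreal ((max 0 (1 * V \<tau> s))\<^sup>2 / 2) + ennreal ((max 0 (-1 * V \<tau> s))\<^sup>2 / 2) \<partial>unif)"
    by (intro nn_integral_cong split) simp
   also have "... = (\<integral>\<^sup>+s. ennreal ((max 0 (1 * V \<tau> s))\<^sup>2 / 2) \<partial>unif) + (\<integral>\<^sup>+s. ennreal ((max 0 (-1 * V \<tau> s))\<^sup>2 / 2) \<partial>unif)"
    by (rule nn_integral_add) measurable
   finally show ?thesis by (rule sym)
  qed
  also have "... = ennreal (1/2 * (\<E> s. (V \<tau> s)\<^sup>2))"
   using V_square_integrable[of \<tau>] by (subst nn_integral_eq_integral) auto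
  finally show "(\<integral>\<^sup>+s. ennreal ((max 0 (1 * V \<tau> s))\<^sup>2 / 2) \<partial>unif) * indicator {c..t} \<tau>
   + (\<integral>\<^sup>+s. ennreal ((max 0 (-1 * V \<tau> s))\<^sup>2 / 2) \<partial>unif) * indicator {c..t} \<tau> = ennreal (indicator {c..t} \<tau> *\<^sub>R (1/2 * (\<E> s. (V \<tau> s)\<^sup>2)))"
   by (auto simp: indicator_def distrib_right[symmetric])
 qed
 also have "... = ennreal (\<integral>\<tau>. indicator {c..t} \<tau> *\<^sub>R (1/2 * (\<E> s. (V \<tau> s)\<^sup>2)) \<partial>lborel)"
  using locint_D[OF locint_cmult[OF locint_energy, of "1/2"] assms(1), of t]
  by (intro nn_integral_eq_integral) (auto simp: set_integrable_def)
 also have "(\<integral>\<tau>. indicator {c..t} \<tau> *\<^sub>R (1/2 * (\<E> s. (V \<tau> s)\<^sup>2)) \<partial>lborel) = 1/2 * (En t - En c)"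
  using prim_diff[OF locint_cmult[OF locint_energy, of "1/2"] assms]
  unfolding prim_cmult En_def set_lebesgue_integral_def by (simp only: right_diff_distrib)
 finally have *: "(\<integral>\<^sup>+s. ennreal ((X t s - X c s)\<^sup>2 / (2 * h)) \<partial>unif) <= ennreal (1/2 * (En t - En c))" .
 have "(\<integral>\<^sup>+s. ennreal ((X t s - X c s)\<^sup>2) \<partial>unif) = (\<integral>\<^sup>+s. ennreal (2 * h) * ennreal ((X t s - X c s)\<^sup>2 / (2 * h)) \<partial>unif)"
  using h by (intro nn_integral_cong) (auto simp: ennreal_mult[symmetric])
 also have "... = ennreal (2 * h) * (\<integral>\<^sup>+s. ennreal ((X t s - X c s)\<^sup>2 / (2 * h)) \<partial>unif)"
  by (rule nn_integral_cmult) measurable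
 also have "... <= ennreal (2 * h) * ennreal (1/2 * (En t - En c))" using * by (rule mult_left_mono) simp
 also have "... = ennreal ((t - c) * (En t - En c))"
  using h En_mono[OF assms] by (subst ennreal_mult[symmetric]) (auto simp: h_def)
 finally show ?thesis .
qed

lemma displacement_square:
 assumes "0 <= c" "0 <= t"
 shows "integrable unif (\<lambda>s. (X t s - X c s)\<^sup>2)"
  and "(\<E> s. (X t s - X c s)\<^sup>2) <= \<bar>t - c\<bar> * \<bar>En t - En c\<bar>"
proof -
 have *: "(\<integral>\<^sup>+s. ennreal ((X t s - X c s)\<^sup>2) \<partial>unif) <= ennreal (\<bar>t - c\<bar> * \<bar>En t - En c\<bar>)"
 proof (cases "c <= t")
  case True
  then show ?thesis using displacement_nn[OF assms(1) True] En_mono[OF assms(1) True] by simp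
 next
  case False
  then show ?thesis using displacement_nn[OF assms(2), of c] En_mono[OF assms(2), of c]
   by (simp add: power2_commute[of "X t _"] abs_minus_commute)
 qed
 then have "(\<integral>\<^sup>+s. ennreal ((X t s - X c s)\<^sup>2) \<partial>unif) < \<infinity>"
  by (rule le_less_trans) simp
 then show i: "integrable unif (\<lambda>s. (X t s - X c s)\<^sup>2)" by (intro integrableI_nonneg) auto
 have "ennreal (\<E> s. (X t s - X c s)\<^sup>2) <= ennreal (\<bar>t - c\<bar> * \<bar>En t - En c\<bar>)"
  using * by (subst (asm) nn_integral_eq_integral[OF i]) auto
 then show "(\<E> s. (X t s - X c s)\<^sup>2) <= \<bar>t - c\<bar> * \<bar>En t - En c\<bar>"
  by (subst (asm) ennreal_le_iff) auto
qed

lemma X_square_integrable: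
 assumes "0 <= t" shows "integrable unif (\<lambda>s. (X t s)\<^sup>2)"
 using integrable_square_add[OF _ _ X0_sq displacement_square(1)[of 0 t]] assms by simp

lemma X_integrable: "0 <= t ==> integrable unif (X t)"
 by (rule unif.integrable_of_square) (auto intro: X_square_integrable)

end

section \<open>Oriented and unoriented time integrals\<close>

definition tint :: "(real => real) => real => real => real" where
 "tint f c t = prim f (max c t) - prim f (min c t)"

lemma tint_mono:
 assumes "locint f" "locint g" "0 <= c" "0 <= t" "\<And>\<tau>. min c t <= \<tau> ==> \<tau> <= max c t ==> f \<tau> <= g \<tau>"
 shows "tint f c t <= tint g c t"
 unfolding tint_def by (rule prim_mono) (use assms in auto)

lemma tint_add: "locint f ==> locint g ==> tint (\<lambda>t. f t + g t) a b = tint f a b + tint g a b"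
 by (simp add: tint_def prim_add)

lemma tint_diff: "locint f ==> locint g ==> tint (\<lambda>t. f t - g t) a b = tint f a b - tint g a b"
 by (simp add: tint_def prim_sub)

lemma tint_cmult: "tint (\<lambda>t. k * f t) a b = k * tint f a b"
 by (simp add: tint_def prim_cmult right_diff_distrib)

lemma tint_const: "0 <= a ==> 0 <= b ==> tint (\<lambda>_. k) a b = k * \<bar>b - a\<bar>"
 by (auto simp: tint_def prim_const right_diff_distrib min_def max_def abs_if)

lemma abs_prim_le_tint:
 assumes "locint f" "locint g" "0 <= c" "0 <= t" "\<And>\<tau>. min c t <= \<tau> ==> \<tau> <= max c t ==> \<bar>f \<tau>\<bar> <= g \<tau>"
 shows "\<bar>prim f t - prim f c\<bar> <= tint g c t"
proof -
 have "\<bar>prim f t - prim f c\<bar> <= \<bar>prim g t - prim g c\<bar>" by (rule prim_abs_le) (use assms in auto)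
 also have "... = \<bar>tint g c t\<bar>" by (auto simp: tint_def max_def min_def)
 also have "tint g c t \<ge> tint (\<lambda>_. 0) c t"
  by (rule tint_mono) (use assms(1-4) in \<open>auto intro: order_trans[OF abs_ge_zero assms(5)]\<close>)
 then have "\<bar>tint g c t\<bar> = tint g c t" using assms by (simp add: tint_const)
 finally show ?thesis .
qed

lemma mult_prim_tint: "(t - c) * (prim f t - prim f c) = \<bar>t - c\<bar> * tint f c t"
 by (auto simp: tint_def max_def min_def abs_if algebra_simps)

lemma antiderivative:
 fixes f :: "real => real"
 assumes "continuous_on UNIV f"
 obtains F where "\<And>y. DERIV F y :> f y"
proof -
 have "\<exists>F. \<forall>x::real. -\<infinity> < ereal x \<longrightarrow> ereal x < \<infinity> \<longrightarrow> (F has_vector_derivative f x) (at x)"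
  using einterval_antiderivative[of "-\<infinity>" "\<infinity>" f] assms by (simp add: continuous_on_eq_continuous_at)
 then show ?thesis using that by (auto simp: has_real_derivative_iff_has_vector_derivative)
qed

context sticky_flow
begin

lemma expectation_const [simp]: "(\<E> s. k) = (k::real)"
 by (simp add: unif.prob_space[simplified])

lemma prob_UNIV [simp]: "measure unif UNIV = 1"
 using unif.prob_space by simp

lemma En_tint:
 "0 <= c ==> 0 <= t ==> \<bar>En t - En c\<bar> = tint (\<lambda>\<tau>. \<E> s. (V \<tau> s)\<^sup>2) c t"
 using En_mono[of c t] En_mono[of t c] by (auto simp: tint_def En_def[symmetric] max_def min_def)

section \<open>Lipschitz approximation of the velocity field\<close>

text \<open>The velocity is a function of time and position, square integrable for the joint law of both
 up to time \<open>T\<close>, so density of Lipschitz functions applies.\<close>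

lemma velocity_approx:
 assumes "0 <= T" "\<epsilon> > 0"
 obtains w :: "real => real => real" and L M R where "0 <= L"
  and "\<And>t y t' y'. \<bar>w t y - w t' y'\<bar> <= L * (\<bar>t - t'\<bar> + \<bar>y - y'\<bar>)"
  and "\<And>t y. \<bar>w t y\<bar> <= M" and "\<And>t y. R <= \<bar>y\<bar> ==> w t y = 0"
  and "prim (\<lambda>\<tau>. \<E> s. (V \<tau> s - w \<tau> (X \<tau> s))\<^sup>2) T <= \<epsilon>"
proof -
 define Lt where "Lt = density lborel (indicator {0..T})"
 have sets_Lt [measurable_cong]: "sets Lt = sets borel" by (simp add: Lt_def)
 have "finite_measure Lt"
  by (rule finite_measureI) (simp add: Lt_def emeasure_density emeasure_lborel_Icc_eq)
 then interpret Lt: finite_measure Lt .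
 interpret P: pair_sigma_finite Lt unif by unfold_locales
 interpret P2: finite_measure "Lt \<Otimes>\<^sub>M unif"
  by (intro finite_measure_pair_measure unif.finite_measure_axioms Lt.finite_measure_axioms)
 define \<mu> where "\<mu> = distr (Lt \<Otimes>\<^sub>M unif) (borel :: (real \<times> real) measure) (\<lambda>(t, s). (t, X t s))"
 have map_meas [measurable]: "(\<lambda>(t, s). (t, X t s)) \<in> (Lt \<Otimes>\<^sub>M unif) \<rightarrow>\<^sub>M (borel :: (real \<times> real) measure)"
  unfolding borel_prod[symmetric] by measurable
 have fin: "finite_measure \<mu>" unfolding \<mu>_def by (rule P2.finite_measure_distr[OF map_meas])
 have nn: "(\<integral>\<^sup>+x. f x \<partial>\<mu>) = (\<integral>\<^sup>+t. (\<integral>\<^sup>+s. f (t, X t s) \<partial>unif) * indicator {0..T} t \<partial>lborel)"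
  if [measurable]: "f \<in> borel_measurable (borel :: (real \<times> real) measure)" for f :: "real \<times> real => ennreal"
 proof -
  have [measurable]: "(\<lambda>(t, s). f (t, X t s)) \<in> borel_measurable (Lt \<Otimes>\<^sub>M unif)"
   using measurable_compose[OF map_meas that] by (simp add: case_prod_beta)
  have m2: "(\<lambda>t. \<integral>\<^sup>+s. f (t, X t s) \<partial>unif) \<in> borel_measurable Lt" by measurable
  have "(\<integral>\<^sup>+x. f x \<partial>\<mu>) = (\<integral>\<^sup>+x. f (fst x, X (fst x) (snd x)) \<partial>(Lt \<Otimes>\<^sub>M unif))"
   unfolding \<mu>_def by (subst nn_integral_distr) (auto simp: case_prod_beta)
  also have "... = (\<integral>\<^sup>+t. \<integral>\<^sup>+s. f (t, X t s) \<partial>unif \<partial>Lt)"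
   by (subst unif.nn_integral_fst[symmetric]) (auto simp: case_prod_beta)
  also have "... = (\<integral>\<^sup>+t. indicator {0..T} t * (\<integral>\<^sup>+s. f (t, X t s) \<partial>unif) \<partial>lborel)"
   unfolding Lt_def by (subst nn_integral_density) (use m2 in \<open>auto simp: Lt_def\<close>)
  finally show ?thesis by (simp add: mult.commute)
 qed
 have nn_prim: "(\<integral>\<^sup>+x. ennreal (f x) \<partial>\<mu>) = ennreal (prim (\<lambda>t. \<E> s. f (t, X t s)) T)"
  if [measurable]: "f \<in> borel_measurable (borel :: (real \<times> real) measure)" and pos: "\<And>x. 0 <= f x"
   and i: "\<And>t. integrable unif (\<lambda>s. f (t, X t s))" and l: "locint (\<lambda>t. \<E> s. f (t, X t s))"
  for f :: "real \<times> real => real"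
 proof -
  have "(\<integral>\<^sup>+x. ennreal (f x) \<partial>\<mu>) = (\<integral>\<^sup>+t. ennreal (indicator {0..T} t *\<^sub>R (\<E> s. f (t, X t s))) \<partial>lborel)"
   by (subst nn, simp, rule nn_integral_cong, subst nn_integral_eq_integral[OF i])
    (auto simp: pos indicator_def)
  also have "... = ennreal (prim (\<lambda>t. \<E> s. f (t, X t s)) T)"
   unfolding prim_def set_lebesgue_integral_def
   by (rule nn_integral_eq_integral) (use l pos in \<open>auto simp: locint_def set_integrable_def\<close>)
  finally show ?thesis .
 qed
 define f where "f = (\<lambda>(t, y). vv t y)"
 have [measurable]: "f \<in> borel_measurable borel" unfolding f_def borel_prod[symmetric] by measurable
 have "(\<integral>\<^sup>+x. ennreal ((f x)\<^sup>2) \<partial>\<mu>) = ennreal (prim (\<lambda>t. \<E> s. (f (t, X t s))\<^sup>2) T)"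
 proof (rule nn_prim)
  show "(\<lambda>x. (f x)\<^sup>2) \<in> borel_measurable borel" by measurable
 qed (use V_square_integrable locint_energy in \<open>auto simp: f_def V_def\<close>)
 then have fsq: "integrable \<mu> (\<lambda>x. (f x)\<^sup>2)"
  by (intro integrableI_nonneg) (auto simp: \<mu>_def)
 obtain w L where w: "L-lipschitz_on UNIV w" "bounded {x. w x \<noteq> 0}"
  "integrable \<mu> (\<lambda>x. (f x - w x)\<^sup>2)" "(\<integral>x. (f x - w x)\<^sup>2 \<partial>\<mu>) < \<epsilon>"
  using lipschitz_dense_L2[OF _ fin _ fsq \<open>\<epsilon> > 0\<close>] by (auto simp: \<mu>_def)
 have cont: "continuous_on UNIV w" using w(1) by (rule lipschitz_on_continuous_on)
 then have [measurable]: "w \<in> borel_measurable borel" by (rule borel_measurable_continuous_onI)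
 obtain R where R: "\<And>x. w x \<noteq> 0 ==> norm x <= R" using w(2) by (auto simp: bounded_iff)
 have "bounded (w ` {x. w x \<noteq> 0})"
  using lipschitz_on_uniformly_continuous[OF lipschitz_on_subset[OF w(1), of "{x. w x \<noteq> 0}"]] w(2)
  by (intro bounded_uniformly_continuous_image) auto
 then obtain M where M: "\<And>x. w x \<noteq> 0 ==> \<bar>w x\<bar> <= M" by (auto simp: bounded_iff)
 have L: "0 <= L" using w(1) by (rule lipschitz_on_nonneg)
 have M': "\<bar>w x\<bar> <= max M 0" for x by (cases "w x = 0") (auto intro: max.coboundedI1 M)
 have meas2: "(\<lambda>(t, s). w (t, X t s)) \<in> borel_measurable (borel \<Otimes>\<^sub>M borel)"
 proof -
  have "(\<lambda>x. (fst x, X (fst x) (snd x))) \<in> borel \<Otimes>\<^sub>M borel \<rightarrow>\<^sub>M borel \<Otimes>\<^sub>M borel" by measurable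
  then have "(\<lambda>x. w (fst x, X (fst x) (snd x))) \<in> borel_measurable (borel \<Otimes>\<^sub>M borel)"
   by (rule measurable_compose) (simp add: borel_prod)
  then show ?thesis by (simp add: case_prod_beta)
 qed
 have wm [measurable]: "(\<lambda>s. w (t, X t s)) \<in> borel_measurable borel" for t
  by (rule borel_measurable_continuous_on[OF cont]) (simp add: borel_prod[symmetric])
 have expand: "(\<E> s. (V t s - w (t, X t s))\<^sup>2)
   = (\<E> s. (V t s)\<^sup>2) - 2 * (\<E> s. V t s * w (t, X t s)) + (\<E> s. (w (t, X t s))\<^sup>2)"
  and iw: "integrable unif (\<lambda>s. (V t s - w (t, X t s))\<^sup>2)" for t
 proof -
  have i: "integrable unif (\<lambda>s. (w (t, X t s))\<^sup>2)" by (rule unif.integrable_square_bounded[OF _ M']) simp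
  have i2: "integrable unif (\<lambda>s. V t s * w (t, X t s))" by (rule integrable_V_bounded(1)[OF _ M']) simp
  show "integrable unif (\<lambda>s. (V t s - w (t, X t s))\<^sup>2)"
   by (rule integrable_square_diff) (auto intro: i V_square_integrable)
  show "(\<E> s. (V t s - w (t, X t s))\<^sup>2)
   = (\<E> s. (V t s)\<^sup>2) - 2 * (\<E> s. V t s * w (t, X t s)) + (\<E> s. (w (t, X t s))\<^sup>2)"
   unfolding power2_diff mult.assoc using i i2 V_square_integrable[of t] by simp
 qed
 have "locint (\<lambda>t. (\<E> s. (V t s)\<^sup>2) - 2 * (\<E> s. V t s * w (t, X t s)) + (\<E> s. (w (t, X t s))\<^sup>2))"
 proof (intro locint_add locint_diff locint_cmult locint_energy)
  show "locint (\<lambda>t. \<E> s. V t s * w (t, X t s))" by (rule locint_V_bounded(1)[OF meas2 M'])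
  have "(\<lambda>(t, s). (w (t, X t s))\<^sup>2) \<in> borel_measurable (borel \<Otimes>\<^sub>M borel)"
   using borel_measurable_power[OF meas2, of 2] by (simp add: case_prod_beta)
  moreover have "\<bar>(w (t, X t s))\<^sup>2\<bar> <= (max M 0)\<^sup>2" for t s
   using power_mono[OF M'[of "(t, X t s)"], of 2] by simp
  ultimately show "locint (\<lambda>t. \<E> s. (w (t, X t s))\<^sup>2)" by (rule locint_V_bounded(3))
 qed
 then have lw: "locint (\<lambda>t. \<E> s. (V t s - w (t, X t s))\<^sup>2)" by (simp only: expand)
 have "ennreal (\<integral>x. (f x - w x)\<^sup>2 \<partial>\<mu>) = ennreal (prim (\<lambda>t. \<E> s. (V t s - w (t, X t s))\<^sup>2) T)"
 proof -
  have "ennreal (\<integral>x. (f x - w x)\<^sup>2 \<partial>\<mu>) = (\<integral>\<^sup>+x. ennreal ((f x - w x)\<^sup>2) \<partial>\<mu>)"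
   by (rule nn_integral_eq_integral[symmetric, OF w(3)]) simp
  also have "... = ennreal (prim (\<lambda>t. \<E> s. (f (t, X t s) - w (t, X t s))\<^sup>2) T)"
  proof (rule nn_prim)
   show "(\<lambda>x. (f x - w x)\<^sup>2) \<in> borel_measurable borel" by measurable
  qed (use iw lw in \<open>auto simp: f_def V_def\<close>)
  finally show ?thesis by (simp add: f_def V_def)
 qed
 moreover have "0 <= prim (\<lambda>t. \<E> s. (V t s - w (t, X t s))\<^sup>2) T"
  using prim_nonneg_mono[OF lw _ _ \<open>0 <= T\<close>] by simp
 ultimately have small: "prim (\<lambda>t. \<E> s. (V t s - w (t, X t s))\<^sup>2) T <= \<epsilon>"
  using w(4) by (simp add: ennreal_inj)
 show ?thesis
 proof (rule that[of L "\<lambda>t y. w (t, y)" "max M 0" "R + 1"])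
  show "0 <= L" by (rule L)
  show "\<bar>w (t, y) - w (t', y')\<bar> <= L * (\<bar>t - t'\<bar> + \<bar>y - y'\<bar>)" for t y t' y'
  proof -
   have "\<bar>w (t, y) - w (t', y')\<bar> <= L * dist (t, y) (t', y')"
    using lipschitz_onD[OF w(1), of "(t, y)" "(t', y')"] by (simp add: dist_real_def)
   also have "dist (t, y) (t', y') <= \<bar>t - t'\<bar> + \<bar>y - y'\<bar>"
    unfolding dist_Pair_Pair dist_real_def by (rule sqrt_sum_squares_le_sum_abs[THEN order_trans]) simp
   then have "L * dist (t, y) (t', y') <= L * (\<bar>t - t'\<bar> + \<bar>y - y'\<bar>)" using L by (rule mult_left_mono)
   finally show ?thesis .
  qed
  show "\<bar>w (t, y)\<bar> <= max M 0" for t y by (rule M')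
  show "w (t, y) = 0" if "R + 1 <= \<bar>y\<bar>" for t y
  proof (rule ccontr)
   assume "w (t, y) \<noteq> 0"
   then have "norm (t, y) <= R" by (rule R)
   moreover have "\<bar>y\<bar> <= norm (t, y)" using norm_snd_le[of y t] by simp
   ultimately show False using that by linarith
  qed
 qed (rule small)
qed

definition Mu :: "real => real" where "Mu t = t + En t"

lemma Mu_mono: "0 <= c ==> c <= t ==> Mu c <= Mu t"
 using En_mono[of c t] by (simp add: Mu_def)

definition dMu :: "real => real => real" where "dMu c t = \<bar>Mu t - Mu c\<bar>"

lemma dMu_eq: "0 <= c ==> 0 <= t ==> dMu c t = \<bar>t - c\<bar> + \<bar>En t - En c\<bar>"
 using En_mono[of c t] En_mono[of t c] by (auto simp: dMu_def Mu_def abs_if)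

lemma sq_displacement_dMu:
 assumes "0 <= c" "0 <= t"
 shows "(\<E> s. (X t s - X c s)\<^sup>2) <= \<bar>t - c\<bar> * dMu c t"
proof -
 have "\<bar>t - c\<bar> * \<bar>En t - En c\<bar> <= \<bar>t - c\<bar> * dMu c t"
  by (rule mult_left_mono) (use dMu_eq[OF assms] in auto)
 then show ?thesis using displacement_square(2)[OF assms] by linarith
qed

lemma tint_mono_interval:
 assumes "locint f" "\<And>\<tau>. 0 <= f \<tau>" "0 <= c" "0 <= t" "min c t <= \<tau>" "\<tau> <= max c t"
 shows "tint f c \<tau> <= tint f c t"
proof -
 have *: "prim f a <= prim f b" if "0 <= a" "a <= b" for a b by (rule prim_nonneg_mono[OF assms(1,2) that])
 show ?thesis using assms(3-) *[of c t] *[of t c] *[of \<tau> t] *[of t \<tau>] *[of c \<tau>] *[of \<tau> c]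
  by (auto simp: tint_def min_def max_def split: if_splits)
qed

lemma dMu_interval:
 assumes "0 <= c" "0 <= t" "min c t <= \<tau>" "\<tau> <= max c t"
 shows "dMu c \<tau> <= dMu c t" "\<bar>\<tau> - c\<bar> <= \<bar>t - c\<bar>" "0 <= \<tau>"
 using assms Mu_mono[of c t] Mu_mono[of t c] Mu_mono[of \<tau> t] Mu_mono[of t \<tau>] Mu_mono[of c \<tau>] Mu_mono[of \<tau> c]
 by (auto simp: dMu_def min_def max_def abs_if split: if_splits)

end

text \<open>A flow together with a Lipschitz field \<open>w\<close> meant to be close to its velocity in mean square.\<close>

locale approx_flow = sticky_flow +
 fixes w :: "real => real => real" and L M R :: real
 assumes L: "0 <= L" and w_lip: "\<bar>w t y - w t' y'\<bar> <= L * (\<bar>t - t'\<bar> + \<bar>y - y'\<bar>)"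
  and w_bdd: "\<bar>w t y\<bar> <= M" and w_supp: "R <= \<bar>y\<bar> ==> w t y = 0"
begin

definition err :: "real => real" where
 "err \<tau> = (\<E> s. (V \<tau> s - w \<tau> (X \<tau> s))\<^sup>2)"

lemma w_lip_y: "\<bar>w t y - w t y'\<bar> <= L * \<bar>y - y'\<bar>"
 using w_lip[of t y t y'] by simp

lemma M_nonneg: "0 <= M" using w_bdd[of 0 0] by linarith

lemma w_cont: "continuous_on UNIV (w t)"
proof (rule lipschitz_on_continuous_on)
 show "L-lipschitz_on UNIV (w t)" using w_lip_y L by (intro lipschitz_onI) (auto simp: dist_real_def)
qed

lemma w_joint: "continuous_on UNIV (\<lambda>x. w (fst x) (snd x))"
proof (rule lipschitz_on_continuous_on)
 show "(2 * L)-lipschitz_on UNIV (\<lambda>x. w (fst x) (snd x))"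
 proof (rule lipschitz_onI)
  fix x y :: "real \<times> real"
  have "\<bar>fst x - fst y\<bar> <= dist x y" "\<bar>snd x - snd y\<bar> <= dist x y"
   using dist_fst_le[of x y] dist_snd_le[of x y] by (auto simp: dist_real_def)
  then have "L * (\<bar>fst x - fst y\<bar> + \<bar>snd x - snd y\<bar>) <= L * (2 * dist x y)"
   using L by (intro mult_left_mono) auto
  then show "dist (w (fst x) (snd x)) (w (fst y) (snd y)) <= 2 * L * dist x y"
   using w_lip[of "fst x" "snd x" "fst y" "snd y"] by (simp add: dist_real_def)
 qed (use L in auto)
qed

lemma w_meas [measurable (raw)]:
 assumes [measurable]: "f \<in> borel_measurable N" "g \<in> borel_measurable N"
 shows "(\<lambda>x. w (f x) (g x)) \<in> borel_measurable N"
proof -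
 have "(\<lambda>x. w (fst (f x, g x)) (snd (f x, g x))) \<in> borel_measurable N"
  by (rule borel_measurable_continuous_on[OF w_joint]) (simp add: borel_prod[symmetric])
 then show ?thesis by simp
qed

lemma w_sq_int [simp]: "integrable unif (\<lambda>s. (w a (X b s))\<^sup>2)"
 by (rule unif.integrable_square_bounded[OF _ w_bdd]) simp

lemma V_sub_w_sq_int: "integrable unif (\<lambda>s. (V \<tau> s - w a (X b s))\<^sup>2)"
 by (intro integrable_square_diff V_square_integrable) auto

lemma locint_sq_diff:
 assumes "(\<lambda>(t, s). k t s) \<in> borel_measurable (borel \<Otimes>\<^sub>M borel)" "\<And>t s. \<bar>k t s\<bar> <= M"
 shows "locint (\<lambda>t. \<E> s. (V t s - k t s)\<^sup>2)"
proof -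
 have km [measurable]: "k t \<in> borel_measurable borel" for t
  using measurable_compose[OF _ assms(1), of "\<lambda>s. (t, s)" borel] by simp
 have i: "integrable unif (\<lambda>s. (k t s)\<^sup>2)" for t by (rule unif.integrable_square_bounded[OF _ assms(2)]) simp
 have i2: "integrable unif (\<lambda>s. V t s * k t s)" for t by (rule integrable_V_bounded(1)[OF _ assms(2)]) simp
 have "(\<E> s. (V t s - k t s)\<^sup>2)
   = (\<E> s. (V t s)\<^sup>2) - 2 * (\<E> s. V t s * k t s) + (\<E> s. (k t s)\<^sup>2)" for t
  unfolding power2_diff mult.assoc using i i2 V_square_integrable[of t] by simp
 moreover have "locint (\<lambda>t. (\<E> s. (V t s)\<^sup>2) - 2 * (\<E> s. V t s * k t s) + (\<E> s. (k t s)\<^sup>2))"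
 proof (intro locint_add locint_diff locint_cmult locint_energy)
  show "locint (\<lambda>t. \<E> s. V t s * k t s)" by (rule locint_V_bounded(1)[OF assms])
  have "(\<lambda>(t, s). (k t s)\<^sup>2) \<in> borel_measurable (borel \<Otimes>\<^sub>M borel)"
   using borel_measurable_power[OF assms(1), of 2] by (simp add: case_prod_beta)
  moreover have "\<bar>(k t s)\<^sup>2\<bar> <= M\<^sup>2" for t s using power_mono[OF assms(2)[of t s], of 2] by simp
  ultimately show "locint (\<lambda>t. \<E> s. (k t s)\<^sup>2)" by (rule locint_V_bounded(3))
 qed
 ultimately show ?thesis by (simp only:)
qed

lemma locint_err: "locint err"
 unfolding err_def by (rule locint_sq_diff) (auto intro: w_bdd)

lemma locint_frozen: "locint (\<lambda>\<tau>. \<E> s. (V \<tau> s - w c (X c s))\<^sup>2)"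
 "locint (\<lambda>\<tau>. \<E> s. (V \<tau> s - w c (X \<tau> s))\<^sup>2)"
 by (rule locint_sq_diff; auto intro: w_bdd)+

text \<open>The mass equation for a primitive of \<open>w c \<cdot> g'\<close> is compared with the
 first order Taylor expansion; the remainder is quadratic in the displacement.\<close>

lemma linearize:
 assumes g: "\<And>y. DERIV g y :> g' y" "continuous_on UNIV g'" "\<And>y. \<bar>g' y\<bar> <= \<Lambda>" and "0 <= c" "0 <= t"
  and B_def: "B = (\<lambda>\<tau>. \<E> s. V \<tau> s * (w c (X \<tau> s) * g' (X \<tau> s)))"
 shows "\<bar>(\<E> s. w c (X c s) * (g (X t s) - g (X c s))) - (prim B t - prim B c)\<bar>
   <= L * \<Lambda> * (\<E> s. (X t s - X c s)\<^sup>2)"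
  and "integrable unif (\<lambda>s. w c (X c s) * (g (X t s) - g (X c s)))" and "locint B"
proof -
 have \<Lambda>: "0 <= \<Lambda>" using g(3)[of 0] by linarith
 define f where "f y = w c y * g' y" for y
 have fc: "continuous_on UNIV f" unfolding f_def by (intro continuous_intros w_cont g)
 have fb: "\<bar>f y\<bar> <= M * \<Lambda>" for y unfolding f_def abs_mult using w_bdd g(3) \<Lambda> M_nonneg by (intro mult_mono) auto
 obtain H where H: "\<And>y. DERIV H y :> f y" using antiderivative[OF fc] by blast
 define r where "r = max R 1"
 have r: "r > 0" "R <= r" by (auto simp: r_def)
 have f0: "f y = 0" if "r <= \<bar>y\<bar>" for y using w_supp[of y c] that r by (simp add: f_def)
 have Hlip: "\<bar>H x - H y\<bar> <= M * \<Lambda> * \<bar>x - y\<bar>" for x y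
 proof -
  have "norm (H x - H y) <= M * \<Lambda> * norm (x - y)"
   by (rule field_differentiable_bound[of UNIV H f]) (use H fb in auto)
  then show ?thesis by simp
 qed
 have H_right: "H y = H r" if "r < y" for y
 proof -
  obtain z where "r < z" "z < y" "H y - H r = (y - r) * f z" using MVT2[OF \<open>r < y\<close>, of H f] H by auto
  then show ?thesis using f0[of z] r by simp
 qed
 have H_left: "H y = H (- r)" if "y < - r" for y
 proof -
  obtain z where "y < z" "z < - r" "H (- r) - H y = (- r - y) * f z" using MVT2[OF \<open>y < - r\<close>, of H f] H by auto
  then show ?thesis using f0[of z] r by simp
 qed
 have Hb: "\<bar>H y\<bar> <= \<bar>H 0\<bar> + M * \<Lambda> * r" for y
 proof -
  have *: "\<bar>H y\<bar> <= \<bar>H 0\<bar> + M * \<Lambda> * r" if "\<bar>y\<bar> <= r" for y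
  proof -
   have "M * \<Lambda> * \<bar>y - 0\<bar> <= M * \<Lambda> * r" using that M_nonneg \<Lambda> by (intro mult_left_mono) auto
   then show ?thesis using Hlip[of y 0] by linarith
  qed
  show ?thesis using *[of y] *[of r] *[of "- r"] H_right[of y] H_left[of y] r by (cases "\<bar>y\<bar> <= r") (auto simp: abs_le_iff not_le)
 qed
 have C1: "C1b H f (M * \<Lambda>)" unfolding C1b_def using H fc fb Hb by blast
 have Beq: "B = (\<lambda>t. \<E> s. (V t s - 0) * f (X t s - 0 * t))" by (simp add: B_def f_def)
 have main: "(\<E> s. H (X t s)) - (\<E> s. H (X c s)) = prim B t - prim B c" and "locint B"
  using mass_balance[OF C1 \<open>0 <= c\<close> \<open>0 <= t\<close> Beq] by auto
 show "locint B" by fact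
 have glip: "\<bar>g x - g y\<bar> <= \<Lambda> * \<bar>x - y\<bar>" for x y
 proof -
  have "norm (g x - g y) <= \<Lambda> * norm (x - y)"
   by (rule field_differentiable_bound[of UNIV g g']) (use g in auto)
  then show ?thesis by simp
 qed
 have gc: "continuous_on UNIV g" using g(1) by (meson DERIV_continuous_on DERIV_subset top_greatest)
 have Hc: "continuous_on UNIV H" using H by (meson DERIV_continuous_on DERIV_subset top_greatest)
 have [measurable]: "g \<in> borel_measurable borel" "H \<in> borel_measurable borel"
  using gc Hc by (auto intro: borel_measurable_continuous_onI)
 show int1: "integrable unif (\<lambda>s. w c (X c s) * (g (X t s) - g (X c s)))"
 proof (rule integrable_mult_of_squares)
  show "integrable unif (\<lambda>s. (g (X t s) - g (X c s))\<^sup>2)"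
  proof (rule Bochner_Integration.integrable_bound)
   show "integrable unif (\<lambda>s. \<Lambda>\<^sup>2 * (X t s - X c s)\<^sup>2)" using displacement_square(1)[OF \<open>0 <= c\<close> \<open>0 <= t\<close>] by simp
   show "AE s in unif. norm ((g (X t s) - g (X c s))\<^sup>2) <= norm (\<Lambda>\<^sup>2 * (X t s - X c s)\<^sup>2)"
   proof (rule AE_I2)
    fix s
    have "(g (X t s) - g (X c s))\<^sup>2 <= (\<Lambda> * \<bar>X t s - X c s\<bar>)\<^sup>2"
     using power_mono[OF glip[of "X t s" "X c s"], of 2] by simp
    then show "norm ((g (X t s) - g (X c s))\<^sup>2) <= norm (\<Lambda>\<^sup>2 * (X t s - X c s)\<^sup>2)" by (simp add: power_mult_distrib)
   qed
  qed measurable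
 qed auto
 have pt: "\<bar>w c x * (g y - g x) - (H y - H x)\<bar> <= L * \<Lambda> * (y - x)\<^sup>2" for x y
 proof -
  have "norm ((\<lambda>z. H z - w c x * g z) y - (\<lambda>z. H z - w c x * g z) x) <= (L * \<Lambda> * \<bar>y - x\<bar>) * norm (y - x)"
  proof (rule field_differentiable_bound[of "{min x y..max x y}" _ "\<lambda>z. f z - w c x * g' z"])
   fix z assume z: "z \<in> {min x y..max x y}"
   show "((\<lambda>z. H z - w c x * g z) has_field_derivative f z - w c x * g' z) (at z within {min x y..max x y})"
    by (intro derivative_intros DERIV_subset[OF H] DERIV_subset[OF DERIV_cmult[OF g(1)]]) auto
   have "f z - w c x * g' z = (w c z - w c x) * g' z" by (simp add: f_def left_diff_distrib)
   then have "norm (f z - w c x * g' z) = \<bar>w c z - w c x\<bar> * \<bar>g' z\<bar>" by (simp add: abs_mult)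
   also have "... <= (L * \<bar>z - x\<bar>) * \<Lambda>" using L g(3) w_lip_y by (intro mult_mono) auto
   also have "... <= (L * \<bar>y - x\<bar>) * \<Lambda>"
    using z L \<Lambda> by (intro mult_right_mono mult_left_mono) (auto simp: min_def max_def split: if_splits)
   finally show "norm (f z - w c x * g' z) <= L * \<Lambda> * \<bar>y - x\<bar>" by (simp only: mult_ac)
  qed auto
  moreover have "(H y - w c x * g y) - (H x - w c x * g x) = - (w c x * (g y - g x) - (H y - H x))"
   by (simp add: algebra_simps)
  ultimately show ?thesis by (simp add: power2_eq_square abs_mult[symmetric] mult.assoc del: minus_diff_eq)
 qed
 have iH: "integrable unif (\<lambda>s. H (X r s))" for r
  by (rule unif.integrable_const_bound[of _ "\<bar>H 0\<bar> + M * \<Lambda> * max R 1"]) (use Hb in \<open>auto simp: r_def\<close>)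
 have "(\<E> s. w c (X c s) * (g (X t s) - g (X c s))) - (prim B t - prim B c)
   = (\<E> s. w c (X c s) * (g (X t s) - g (X c s)) - (H (X t s) - H (X c s)))"
  unfolding main[symmetric] using int1 iH by simp
 also have "\<bar>...\<bar> <= (\<E> s. L * \<Lambda> * (X t s - X c s)\<^sup>2)"
 proof (rule order_trans[OF integral_abs_bound integral_mono])
  show "integrable unif (\<lambda>s. L * \<Lambda> * (X t s - X c s)\<^sup>2)" using displacement_square(1)[OF \<open>0 <= c\<close> \<open>0 <= t\<close>] by simp
  show "integrable unif (\<lambda>s. \<bar>w c (X c s) * (g (X t s) - g (X c s)) - (H (X t s) - H (X c s))\<bar>)"
   by (intro integrable_abs Bochner_Integration.integrable_diff int1 iH)
 qed (rule pt)
 finally show "\<bar>(\<E> s. w c (X c s) * (g (X t s) - g (X c s))) - (prim B t - prim B c)\<bar>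
   <= L * \<Lambda> * (\<E> s. (X t s - X c s)\<^sup>2)" by simp
qed

text \<open>Freezing the field at time \<open>c\<close> costs a Lipschitz constant times a displacement,
 which is itself of first order in the length of the window.\<close>

lemma frozen_error:
 assumes "0 <= c" "0 <= t" "\<bar>t - c\<bar> <= 1"
 shows "tint (\<lambda>\<tau>. \<E> s. (V \<tau> s - w c (X c s))\<^sup>2) c t <= 2 * tint err c t + 8 * L\<^sup>2 * \<bar>t - c\<bar> * dMu c t"
  and "tint (\<lambda>\<tau>. \<E> s. (V \<tau> s - w c (X \<tau> s))\<^sup>2) c t <= 2 * tint err c t + 8 * L\<^sup>2 * \<bar>t - c\<bar> * dMu c t"
proof -
 define h where "h = \<bar>t - c\<bar>"
 have h: "0 <= h" "h <= 1" using assms by (auto simp: h_def)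
 have d: "h <= dMu c t" "0 <= dMu c t" using dMu_eq[OF assms(1,2)] by (auto simp: h_def)
 have hh: "h * h <= h * dMu c t" using d h by (intro mult_left_mono) auto
 define k where "k = 8 * L\<^sup>2 * (h * dMu c t)"
 have k: "0 <= k" using d h by (simp add: k_def)
 have est: "(\<E> s. (V \<tau> s - w c (Y s))\<^sup>2) <= 2 * err \<tau> + k"
  if \<tau>: "min c t <= \<tau>" "\<tau> <= max c t" and Y: "Y = X c \<or> Y = X \<tau>" for \<tau> Y
 proof -
  note \<tau>' = dMu_interval[OF assms(1,2) \<tau>]
  have iY: "integrable unif (\<lambda>s. (X \<tau> s - X c s)\<^sup>2)" by (rule displacement_square(1)[OF assms(1) \<tau>'(3)])
  have "(\<E> s. (V \<tau> s - w c (Y s))\<^sup>2)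
   <= (\<E> s. 2 * (V \<tau> s - w \<tau> (X \<tau> s))\<^sup>2 + 4 * L\<^sup>2 * h\<^sup>2 + 4 * L\<^sup>2 * (X \<tau> s - X c s)\<^sup>2)"
  proof (rule integral_mono)
   show "integrable unif (\<lambda>s. (V \<tau> s - w c (Y s))\<^sup>2)" using Y V_sub_w_sq_int by auto
   show "integrable unif (\<lambda>s. 2 * (V \<tau> s - w \<tau> (X \<tau> s))\<^sup>2 + 4 * L\<^sup>2 * h\<^sup>2 + 4 * L\<^sup>2 * (X \<tau> s - X c s)\<^sup>2)"
    using iY V_sub_w_sq_int by auto
   fix s
   have "\<bar>w \<tau> (X \<tau> s) - w c (Y s)\<bar> <= L * (\<bar>\<tau> - c\<bar> + \<bar>X \<tau> s - Y s\<bar>)" by (rule w_lip)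
   also have "... <= L * (h + \<bar>X \<tau> s - X c s\<bar>)"
    using L \<tau>'(2) Y by (intro mult_left_mono add_mono) (auto simp: h_def)
   finally have "(w \<tau> (X \<tau> s) - w c (Y s))\<^sup>2 <= (L * (h + \<bar>X \<tau> s - X c s\<bar>))\<^sup>2"
    using power_mono[of "\<bar>w \<tau> (X \<tau> s) - w c (Y s)\<bar>" _ 2] by simp
   also have "... = L\<^sup>2 * (h + \<bar>X \<tau> s - X c s\<bar>)\<^sup>2" by (rule power_mult_distrib)
   also have "... <= L\<^sup>2 * (2 * h\<^sup>2 + 2 * \<bar>X \<tau> s - X c s\<bar>\<^sup>2)" by (intro mult_left_mono power2_sum_le) simp
   also have "... = 2 * L\<^sup>2 * h\<^sup>2 + 2 * L\<^sup>2 * (X \<tau> s - X c s)\<^sup>2" by (simp add: distrib_left)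
   finally have "(w \<tau> (X \<tau> s) - w c (Y s))\<^sup>2 <= 2 * L\<^sup>2 * h\<^sup>2 + 2 * L\<^sup>2 * (X \<tau> s - X c s)\<^sup>2" .
   then show "(V \<tau> s - w c (Y s))\<^sup>2 <= 2 * (V \<tau> s - w \<tau> (X \<tau> s))\<^sup>2 + 4 * L\<^sup>2 * h\<^sup>2 + 4 * L\<^sup>2 * (X \<tau> s - X c s)\<^sup>2"
    using power2_sum_le[of "V \<tau> s - w \<tau> (X \<tau> s)" "w \<tau> (X \<tau> s) - w c (Y s)"] by simp
  qed
  also have "... = 2 * err \<tau> + 4 * L\<^sup>2 * h\<^sup>2 + 4 * L\<^sup>2 * (\<E> s. (X \<tau> s - X c s)\<^sup>2)"
   using iY V_sub_w_sq_int[of \<tau> \<tau> \<tau>] by (simp add: err_def)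
  also have "... <= 2 * err \<tau> + 4 * L\<^sup>2 * (h * dMu c t) + 4 * L\<^sup>2 * (h * dMu c t)"
  proof (intro add_mono mult_left_mono order_refl)
   show "h\<^sup>2 <= h * dMu c t" using hh by (simp add: power2_eq_square)
   have "\<bar>\<tau> - c\<bar> * dMu c \<tau> <= h * dMu c t" using \<tau>' h by (intro mult_mono) (auto simp: h_def dMu_def)
   then show "(\<E> s. (X \<tau> s - X c s)\<^sup>2) <= h * dMu c t"
    using sq_displacement_dMu[OF assms(1) \<tau>'(3)] by linarith
  qed auto
  also have "... = 2 * err \<tau> + k" unfolding k_def by (simp only: add.assoc)
  finally show ?thesis .
 qed
 have fin: "tint (\<lambda>\<tau>. 2 * err \<tau> + k) c t <= 2 * tint err c t + 8 * L\<^sup>2 * \<bar>t - c\<bar> * dMu c t"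
 proof -
  have "tint (\<lambda>\<tau>. 2 * err \<tau> + k) c t = 2 * tint err c t + k * h"
   using assms by (simp add: tint_add[OF locint_cmult[OF locint_err] locint_const] tint_cmult tint_const h_def)
  also have "k * h <= k * 1" using k h by (intro mult_left_mono) auto
  finally show ?thesis by (simp add: k_def h_def mult.assoc)
 qed
 have "tint (\<lambda>\<tau>. \<E> s. (V \<tau> s - w c (X c s))\<^sup>2) c t <= tint (\<lambda>\<tau>. 2 * err \<tau> + k) c t"
  by (rule tint_mono[OF _ locint_add[OF locint_cmult[OF locint_err] locint_const]])
   (use est assms in \<open>auto intro: locint_frozen\<close>)
 then show "tint (\<lambda>\<tau>. \<E> s. (V \<tau> s - w c (X c s))\<^sup>2) c t <= 2 * tint err c t + 8 * L\<^sup>2 * \<bar>t - c\<bar> * dMu c t"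
  using fin by linarith
 have "tint (\<lambda>\<tau>. \<E> s. (V \<tau> s - w c (X \<tau> s))\<^sup>2) c t <= tint (\<lambda>\<tau>. 2 * err \<tau> + k) c t"
  by (rule tint_mono[OF _ locint_add[OF locint_cmult[OF locint_err] locint_const]])
   (use est assms in \<open>auto intro: locint_frozen\<close>)
 then show "tint (\<lambda>\<tau>. \<E> s. (V \<tau> s - w c (X \<tau> s))\<^sup>2) c t <= 2 * tint err c t + 8 * L\<^sup>2 * \<bar>t - c\<bar> * dMu c t"
  using fin by linarith
qed

end

lemma (in sticky_flow) abs_le_square:
 fixes f :: "real => real"
 assumes [measurable]: "f \<in> borel_measurable borel" and "integrable unif (\<lambda>s. (f s)\<^sup>2)" "\<kappa> > 0"
 shows "(\<E> s. \<bar>f s\<bar>) <= \<kappa> / 2 + (\<E> s. (f s)\<^sup>2) / (2 * \<kappa>)"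
 using integral_abs_mult_le[of "\<lambda>_. 1" unif f \<kappa>] assms by simp

context approx_flow
begin

definition C0 :: real where "C0 = 8 * L\<^sup>2 + 2 * M * L + 2 * L"

text \<open>Expanding the square, the cross term is an integral of the velocity against the frozen field
 by \<open>linearize\<close>; together with the energy bound of the displacement this completes the
 square to \<open>(V - w)\<^sup>2\<close>.\<close>

lemma window_displacement_square:
 assumes "0 <= c" "0 <= t" "\<bar>t - c\<bar> <= 1"
 shows "integrable unif (\<lambda>s. (X t s - X c s - (t - c) * w c (X c s))\<^sup>2)"
  and "(\<E> s. (X t s - X c s - (t - c) * w c (X c s))\<^sup>2)
   <= \<bar>t - c\<bar> * (2 * tint err c t + C0 * \<bar>t - c\<bar> * dMu c t)"
proof -
 define h where "h = \<bar>t - c\<bar>"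
 define d where "d = dMu c t"
 have h: "0 <= h" by (simp add: h_def)
 have d: "h <= d" "0 <= d" using dMu_eq[OF assms(1,2)] by (auto simp: h_def d_def)
 have iD: "integrable unif (\<lambda>s. (X t s - X c s)\<^sup>2)" by (rule displacement_square(1)[OF assms(1,2)])
 have iDw: "integrable unif (\<lambda>s. (X t s - X c s) * w c (X c s))"
  by (rule integrable_mult_of_squares[OF _ _ iD]) auto
 show "integrable unif (\<lambda>s. (X t s - X c s - (t - c) * w c (X c s))\<^sup>2)"
  by (intro integrable_square_diff iD integrable_square_cmult(1)) auto
 define B where "B = (\<lambda>\<tau>. \<E> s. V \<tau> s * (w c (X \<tau> s) * 1))"
 have lin: "\<bar>(\<E> s. w c (X c s) * (X t s - X c s)) - (prim B t - prim B c)\<bar> <= L * 1 * (\<E> s. (X t s - X c s)\<^sup>2)"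
  and B: "locint B"
  using linearize[of "\<lambda>y. y" "\<lambda>_. 1" 1 c t B] assms B_def by auto
 define ww where "ww = (\<E> s. (w c (X c s))\<^sup>2)"
 have lw: "locint (\<lambda>\<tau>. \<E> s. (w c (X \<tau> s))\<^sup>2)"
 proof (rule locint_V_bounded(3))
  show "(\<lambda>(t, s). (w c (X t s))\<^sup>2) \<in> borel_measurable (borel \<Otimes>\<^sub>M borel)" by measurable
  show "\<bar>(w c (X t s))\<^sup>2\<bar> <= M\<^sup>2" for t s using power_mono[OF w_bdd[of c "X t s"], of 2] by simp
 qed
 have e1: "(\<E> s. (X t s - X c s - (t - c) * w c (X c s))\<^sup>2)
  = (\<E> s. (X t s - X c s)\<^sup>2) - 2 * ((t - c) * (\<E> s. w c (X c s) * (X t s - X c s))) + h\<^sup>2 * ww"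
 proof -
  have sq: "(D - k * z)\<^sup>2 = D\<^sup>2 - 2 * (k * (z * D)) + k\<^sup>2 * z\<^sup>2" for D k z :: real
   by (simp add: power2_eq_square algebra_simps)
  have i1: "integrable unif (\<lambda>s. 2 * ((t - c) * (w c (X c s) * (X t s - X c s))))"
   using iDw by (intro integrable_mult_right) (simp only: mult.commute)
  have i2: "integrable unif (\<lambda>s. (t - c)\<^sup>2 * (w c (X c s))\<^sup>2)" by (intro integrable_mult_right w_sq_int)
  have "h\<^sup>2 = (t - c)\<^sup>2" by (simp add: h_def)
  then show ?thesis
   unfolding sq ww_def
   by (simp only: Bochner_Integration.integral_add[OF Bochner_Integration.integrable_diff[OF iD i1] i2]
     Bochner_Integration.integral_diff[OF iD i1] integral_mult_right_zero)
 qed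
 have e2: "(t - c) * (\<E> s. w c (X c s) * (X t s - X c s)) \<ge> h * tint B c t - h * (L * (h * d))"
 proof -
  define Z where "Z = (\<E> s. w c (X c s) * (X t s - X c s)) - (prim B t - prim B c)"
  have "L * (\<E> s. (X t s - X c s)\<^sup>2) <= L * (h * d)"
   using sq_displacement_dMu[OF assms(1,2)] L by (intro mult_left_mono) (auto simp: h_def d_def)
  then have "\<bar>Z\<bar> <= L * (h * d)" using lin unfolding Z_def by simp
  then have "\<bar>(t - c) * Z\<bar> <= h * (L * (h * d))" unfolding abs_mult h_def by (rule mult_left_mono) simp
  moreover have "(t - c) * (\<E> s. w c (X c s) * (X t s - X c s)) = (t - c) * (prim B t - prim B c) + (t - c) * Z"
   by (simp add: Z_def algebra_simps)
  ultimately show ?thesis unfolding mult_prim_tint h_def by linarith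
 qed
 have e3: "(\<E> s. (X t s - X c s)\<^sup>2) <= h * tint (\<lambda>\<tau>. \<E> s. (V \<tau> s)\<^sup>2) c t"
  using displacement_square(2)[OF assms(1,2)] unfolding En_tint[OF assms(1,2)] h_def .
 have e4: "h\<^sup>2 * ww = h * tint (\<lambda>_. ww) c t"
  using assms by (simp add: tint_const h_def power2_eq_square)
 have e5: "tint (\<lambda>\<tau>. \<E> s. (V \<tau> s)\<^sup>2) c t - 2 * tint B c t + tint (\<lambda>_. ww) c t
  = tint (\<lambda>\<tau>. (\<E> s. (V \<tau> s - w c (X \<tau> s))\<^sup>2) + (ww - (\<E> s. (w c (X \<tau> s))\<^sup>2))) c t"
 proof -
  have "(\<E> s. (V \<tau> s - w c (X \<tau> s))\<^sup>2) + (ww - (\<E> s. (w c (X \<tau> s))\<^sup>2))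
    = (\<E> s. (V \<tau> s)\<^sup>2) - 2 * B \<tau> + ww" for \<tau>
  proof -
   have "integrable unif (\<lambda>s. V \<tau> s * w c (X \<tau> s))" by (rule integrable_V_bounded(1)[OF _ w_bdd]) simp
   then show ?thesis unfolding power2_diff mult.assoc B_def using V_square_integrable[of \<tau>] by simp
  qed
  then show ?thesis
   by (simp only: tint_add[OF locint_diff[OF locint_energy locint_cmult[OF B]] locint_const]
    tint_diff[OF locint_energy locint_cmult[OF B]] tint_cmult)
 qed
 have e6: "tint (\<lambda>\<tau>. (\<E> s. (V \<tau> s - w c (X \<tau> s))\<^sup>2) + (ww - (\<E> s. (w c (X \<tau> s))\<^sup>2))) c t
   <= tint (\<lambda>\<tau>. (\<E> s. (V \<tau> s - w c (X \<tau> s))\<^sup>2) + 2 * M * L * d) c t"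
 proof (rule tint_mono[OF _ _ assms(1,2)])
  show "locint (\<lambda>\<tau>. (\<E> s. (V \<tau> s - w c (X \<tau> s))\<^sup>2) + (ww - (\<E> s. (w c (X \<tau> s))\<^sup>2)))"
   by (intro locint_add locint_frozen locint_diff locint_const lw)
  show "locint (\<lambda>\<tau>. (\<E> s. (V \<tau> s - w c (X \<tau> s))\<^sup>2) + 2 * M * L * d)"
   by (intro locint_add locint_frozen locint_const)
  fix \<tau> assume \<tau>: "min c t <= \<tau>" "\<tau> <= max c t"
  note \<tau>' = dMu_interval[OF assms(1,2) \<tau>]
  have iX: "integrable unif (\<lambda>s. (X \<tau> s - X c s)\<^sup>2)" by (rule displacement_square(1)[OF assms(1) \<tau>'(3)])
  have iabs: "integrable unif (\<lambda>s. \<bar>X \<tau> s - X c s\<bar>)"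
   by (rule integrable_abs[OF unif.integrable_of_square[OF _ iX]]) measurable
  have "(\<E> s. \<bar>X \<tau> s - X c s\<bar>) <= d"
  proof (cases "h = 0")
   case True
   then have "\<tau> = c" using \<tau>'(2) by (simp add: h_def)
   then show ?thesis using d by simp
  next
   case False
   with h have hp: "h > 0" by simp
   have "\<bar>\<tau> - c\<bar> * dMu c \<tau> <= h * d" using \<tau>' h by (intro mult_mono) (auto simp: h_def d_def dMu_def)
   then have "(\<E> s. (X \<tau> s - X c s)\<^sup>2) <= h * d"
    using sq_displacement_dMu[OF assms(1) \<tau>'(3)] by linarith
   then have "(\<E> s. (X \<tau> s - X c s)\<^sup>2) / (2 * h) <= (h * d) / (2 * h)" using hp by (intro divide_right_mono) auto
   also have "... = d / 2" using hp by simp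
   finally have "(\<E> s. (X \<tau> s - X c s)\<^sup>2) / (2 * h) <= d / 2" .
   moreover have "(\<E> s. \<bar>X \<tau> s - X c s\<bar>) <= h / 2 + (\<E> s. (X \<tau> s - X c s)\<^sup>2) / (2 * h)"
    by (rule abs_le_square[OF _ iX hp]) measurable
   ultimately show ?thesis using d by linarith
  qed
  then have bd: "2 * M * L * (\<E> s. \<bar>X \<tau> s - X c s\<bar>) <= 2 * M * L * d"
   using M_nonneg L by (intro mult_left_mono) auto
  have "ww - (\<E> s. (w c (X \<tau> s))\<^sup>2) = (\<E> s. (w c (X c s))\<^sup>2 - (w c (X \<tau> s))\<^sup>2)" by (simp add: ww_def)
  also have "... <= (\<E> s. 2 * M * L * \<bar>X \<tau> s - X c s\<bar>)"
  proof (rule integral_mono)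
   fix s
   have "(w c (X c s))\<^sup>2 - (w c (X \<tau> s))\<^sup>2 = (w c (X c s) + w c (X \<tau> s)) * (w c (X c s) - w c (X \<tau> s))"
    by (simp add: power2_eq_square algebra_simps)
   also have "... <= \<bar>w c (X c s) + w c (X \<tau> s)\<bar> * \<bar>w c (X c s) - w c (X \<tau> s)\<bar>"
    by (rule order_trans[OF abs_ge_self eq_refl[OF abs_mult]])
   also have "... <= (2 * M) * (L * \<bar>X c s - X \<tau> s\<bar>)"
    using w_bdd[of c "X c s"] w_bdd[of c "X \<tau> s"] M_nonneg by (intro mult_mono w_lip_y) auto
   finally show "(w c (X c s))\<^sup>2 - (w c (X \<tau> s))\<^sup>2 <= 2 * M * L * \<bar>X \<tau> s - X c s\<bar>"
    unfolding abs_minus_commute[of "X c s"] mult.assoc .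
  qed (use iabs in auto)
  also have "... = 2 * M * L * (\<E> s. \<bar>X \<tau> s - X c s\<bar>)" by (rule integral_mult_right_zero)
  also note bd
  finally show "(\<E> s. (V \<tau> s - w c (X \<tau> s))\<^sup>2) + (ww - (\<E> s. (w c (X \<tau> s))\<^sup>2))
    <= (\<E> s. (V \<tau> s - w c (X \<tau> s))\<^sup>2) + 2 * M * L * d" by linarith
 qed
 also have "tint (\<lambda>\<tau>. (\<E> s. (V \<tau> s - w c (X \<tau> s))\<^sup>2) + 2 * M * L * d) c t
   = tint (\<lambda>\<tau>. \<E> s. (V \<tau> s - w c (X \<tau> s))\<^sup>2) c t + 2 * M * L * d * h"
  unfolding tint_add[OF locint_frozen(2) locint_const] tint_const[OF assms(1,2)] h_def ..
 also have "... <= (2 * tint err c t + 8 * L\<^sup>2 * h * d) + 2 * M * L * d * h"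
  using frozen_error(2)[OF assms] by (simp add: h_def d_def)
 finally have e7: "tint (\<lambda>\<tau>. \<E> s. (V \<tau> s)\<^sup>2) c t - 2 * tint B c t + tint (\<lambda>_. ww) c t
   <= (2 * tint err c t + 8 * L\<^sup>2 * h * d) + 2 * M * L * d * h" unfolding e5 .
 have "(\<E> s. (X t s - X c s - (t - c) * w c (X c s))\<^sup>2)
   <= h * (tint (\<lambda>\<tau>. \<E> s. (V \<tau> s)\<^sup>2) c t - 2 * tint B c t + tint (\<lambda>_. ww) c t) + 2 * (h * (L * (h * d)))"
  proof -
  have "a - 2 * x + y <= h * (p - 2 * q + r) + 2 * z" if "y = h * r" "x \<ge> h * q - z" "a <= h * p"
   for a x y p q r z :: real
  proof -
   have "h * (p - 2 * q + r) = h * p - 2 * (h * q) + h * r" by (simp add: algebra_simps)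
   then show ?thesis using that by linarith
  qed
  from this[OF e4 e2 e3] show ?thesis unfolding e1 .
 qed
 also have "... <= h * ((2 * tint err c t + 8 * L\<^sup>2 * h * d) + 2 * M * L * d * h) + 2 * (h * (L * (h * d)))"
  by (intro add_right_mono mult_left_mono e7 h)
 also have "... = h * (2 * tint err c t + C0 * h * d)" by (simp add: C0_def algebra_simps)
 finally show "(\<E> s. (X t s - X c s - (t - c) * w c (X c s))\<^sup>2)
   <= \<bar>t - c\<bar> * (2 * tint err c t + C0 * \<bar>t - c\<bar> * dMu c t)" unfolding h_def d_def .
qed

text \<open>The error budget: its total increment over a bounded time interval can be made arbitrarily small, see \<open>approximation\<close>.\<close>

definition tol :: "real => real => real" where
 "tol \<theta> t = 2 * \<theta> * Mu t + 3 / \<theta> * prim err t"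

definition C1 :: "real => real" where "C1 \<theta> = C0 / \<theta> + 8 * L\<^sup>2 / \<theta> + L"

lemma prim_err_mono: "0 <= c ==> c <= t ==> prim err c <= prim err t"
 by (rule prim_nonneg_mono[OF locint_err]) (auto simp: err_def)

lemma err_tint: "0 <= c ==> 0 <= t ==> tint err c t = \<bar>prim err t - prim err c\<bar>"
 using prim_err_mono[of c t] prim_err_mono[of t c] by (auto simp: tint_def max_def min_def)

lemma tol_mono: "\<theta> > 0 ==> 0 <= c ==> c <= t ==> tol \<theta> c <= tol \<theta> t"
 unfolding tol_def using Mu_mono[of c t] prim_err_mono[of c t]
 by (intro add_mono mult_left_mono) auto

lemma tol_diff:
 assumes "\<theta> > 0" "0 <= c" "0 <= t"
 shows "\<bar>tol \<theta> t - tol \<theta> c\<bar> = 2 * \<theta> * dMu c t + 3 / \<theta> * tint err c t"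
proof -
 have *: "\<bar>tol \<theta> b - tol \<theta> a\<bar> = 2 * \<theta> * \<bar>Mu b - Mu a\<bar> + 3 / \<theta> * \<bar>prim err b - prim err a\<bar>"
  if "0 <= a" "a <= b" for a b
 proof -
  have "tol \<theta> b - tol \<theta> a = 2 * \<theta> * (Mu b - Mu a) + 3 / \<theta> * (prim err b - prim err a)"
   unfolding tol_def right_diff_distrib by linarith
  then show ?thesis
   using tol_mono[OF assms(1) that] Mu_mono[OF that] prim_err_mono[OF that] by (simp only: abs_of_nonneg diff_ge_0_iff_ge)
 qed
 show ?thesis
 proof (cases "c <= t")
  case True
  then show ?thesis using *[of c t] assms unfolding err_tint[OF assms(2,3)] dMu_def by simp
 next
  case False
  then show ?thesis using *[of t c] assms unfolding err_tint[OF assms(2,3)] dMu_def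
   by (simp only: abs_minus_commute[of "tol \<theta> t"] abs_minus_commute[of "Mu t"] abs_minus_commute[of "prim err t"])
 qed
qed

lemma C0_nonneg: "0 <= C0" using L M_nonneg by (simp add: C0_def)

lemma C1_nonneg: "\<theta> > 0 ==> 0 <= C1 \<theta>" using L C0_nonneg by (simp add: C1_def)

lemma tint_err_nonneg: "0 <= c ==> 0 <= t ==> 0 <= tint err c t" by (simp add: err_tint)

text \<open>Young's inequality with weight \<open>\<theta>\<close> turns the quadratic bound into
 increments of \<open>tol \<theta>\<close>, which are additive over windows, plus an error of second
 order.\<close>

lemma window_bounds:
 assumes "\<theta> > 0" "0 <= c" "0 <= t" "\<bar>t - c\<bar> <= 1"
 shows "(\<E> s. \<bar>X t s - X c s - (t - c) * w c (X c s)\<bar>) <= \<bar>tol \<theta> t - tol \<theta> c\<bar> + C1 \<theta> * \<bar>t - c\<bar> * dMu c t"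
  and "tint (\<lambda>\<tau>. \<E> s. \<bar>V \<tau> s - w c (X c s)\<bar>) c t <= \<bar>tol \<theta> t - tol \<theta> c\<bar> + C1 \<theta> * \<bar>t - c\<bar> * dMu c t"
  and "locint (\<lambda>\<tau>. \<E> s. \<bar>V \<tau> s - w c (X c s)\<bar>)"
proof -
 define h where "h = \<bar>t - c\<bar>"
 define d where "d = dMu c t"
 define e where "e = tint err c t"
 have h: "0 <= h" by (simp add: h_def)
 have d: "h <= d" "0 <= d" using dMu_eq[OF assms(2,3)] by (auto simp: h_def d_def)
 have e: "0 <= e" unfolding e_def by (rule tint_err_nonneg[OF assms(2,3)])
 have hd: "0 <= h * d" using h d by simp
 have fin: "\<theta> / 2 * h + e / \<theta> + k / (2 * \<theta>) * (h * d) <= \<bar>tol \<theta> t - tol \<theta> c\<bar> + C1 \<theta> * \<bar>t - c\<bar> * dMu c t"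
  if "k <= 2 * C0 + 16 * L\<^sup>2" for k
 proof -
  have "\<theta> / 2 * h <= 2 * \<theta> * d" using d h assms(1) by (intro mult_mono) auto
  moreover have "e / \<theta> <= 3 / \<theta> * e" using e assms(1) by (simp add: divide_right_mono)
  moreover have "k / (2 * \<theta>) * (h * d) <= C1 \<theta> * (h * d)"
  proof (rule mult_right_mono[OF _ hd])
   have "k / (2 * \<theta>) <= (2 * C0 + 16 * L\<^sup>2) / (2 * \<theta>)" using that assms(1) by (intro divide_right_mono) auto
   also have "... = C0 / \<theta> + 8 * L\<^sup>2 / \<theta>" by (simp add: add_divide_distrib)
   finally show "k / (2 * \<theta>) <= C1 \<theta>" using L by (simp add: C1_def)
  qed
  ultimately show ?thesis unfolding tol_diff[OF assms(1-3)] h_def d_def e_def by (simp only: mult.assoc)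
 qed
 show "(\<E> s. \<bar>X t s - X c s - (t - c) * w c (X c s)\<bar>) <= \<bar>tol \<theta> t - tol \<theta> c\<bar> + C1 \<theta> * \<bar>t - c\<bar> * dMu c t"
 proof (cases "h = 0")
  case True
  then have "t = c" by (simp add: h_def)
  then show ?thesis by simp
 next
  case False
  with h have hp: "h > 0" by simp
  let ?S = "(\<E> s. (X t s - X c s - (t - c) * w c (X c s))\<^sup>2)"
  have "?S / (2 * (\<theta> * h)) <= (h * (2 * e + C0 * h * d)) / (2 * (\<theta> * h))"
   using window_displacement_square(2)[OF assms(2-4)] hp assms(1) unfolding h_def d_def e_def
   by (intro divide_right_mono) auto
  also have "... = (2 * e + C0 * (h * d)) / (2 * \<theta>)"
   using hp by (simp only: mult.left_commute[of 2 h] mult.commute[of \<theta> h] mult.assoc mult.left_commute[of 2 h \<theta>]) simp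
  also have "... = e / \<theta> + C0 / (2 * \<theta>) * (h * d)" by (simp add: add_divide_distrib)
  finally have 1: "?S / (2 * (\<theta> * h)) <= e / \<theta> + C0 / (2 * \<theta>) * (h * d)" .
  have "(\<E> s. \<bar>X t s - X c s - (t - c) * w c (X c s)\<bar>) <= (\<theta> * h) / 2 + ?S / (2 * (\<theta> * h))"
   by (rule abs_le_square[OF _ window_displacement_square(1)[OF assms(2-4)]]) (use hp assms(1) in auto)
  with 1 have "(\<E> s. \<bar>X t s - X c s - (t - c) * w c (X c s)\<bar>) <= \<theta> / 2 * h + e / \<theta> + C0 / (2 * \<theta>) * (h * d)"
   by simp
  moreover have "C0 <= 2 * C0 + 16 * L\<^sup>2" using C0_nonneg zero_le_power2[of L] by linarith
  ultimately show ?thesis using fin by (meson order_trans)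
 qed
 have pt: "(\<E> s. \<bar>V \<tau> s - w c (X c s)\<bar>) <= \<theta> / 2 + 1 / (2 * \<theta>) * (\<E> s. (V \<tau> s - w c (X c s))\<^sup>2)" for \<tau>
  using abs_le_square[OF _ V_sub_w_sq_int assms(1), of \<tau> c c] by simp
 have loc2: "locint (\<lambda>\<tau>. \<theta> / 2 + 1 / (2 * \<theta>) * (\<E> s. (V \<tau> s - w c (X c s))\<^sup>2))"
  by (intro locint_add locint_const locint_cmult locint_frozen)
 show loc: "locint (\<lambda>\<tau>. \<E> s. \<bar>V \<tau> s - w c (X c s)\<bar>)"
  by (rule locint_bound[OF loc2]) (use pt in \<open>auto simp: abs_of_nonneg\<close>)
 have "tint (\<lambda>\<tau>. \<E> s. \<bar>V \<tau> s - w c (X c s)\<bar>) c t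
   <= tint (\<lambda>\<tau>. \<theta> / 2 + 1 / (2 * \<theta>) * (\<E> s. (V \<tau> s - w c (X c s))\<^sup>2)) c t"
  by (rule tint_mono[OF loc loc2 assms(2,3) pt])
 also have "... = \<theta> / 2 * h + 1 / (2 * \<theta>) * tint (\<lambda>\<tau>. \<E> s. (V \<tau> s - w c (X c s))\<^sup>2) c t"
  unfolding tint_add[OF locint_const locint_cmult[OF locint_frozen(1)]] tint_cmult tint_const[OF assms(2,3)] h_def ..
 also have "... <= \<theta> / 2 * h + 1 / (2 * \<theta>) * (2 * e + 8 * L\<^sup>2 * h * d)"
  using frozen_error(1)[OF assms(2-4)] assms(1) unfolding h_def e_def d_def
  by (intro add_left_mono mult_left_mono) auto
 also have "... = \<theta> / 2 * h + e / \<theta> + 8 * L\<^sup>2 / (2 * \<theta>) * (h * d)"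
 proof -
  have "1 / (2 * \<theta>) * (2 * e + 8 * L\<^sup>2 * h * d) = e / \<theta> + 8 * L\<^sup>2 / (2 * \<theta>) * (h * d)"
   by (simp add: distrib_left add_divide_distrib)
  then show ?thesis by (simp only: add.assoc)
 qed
 finally have *: "tint (\<lambda>\<tau>. \<E> s. \<bar>V \<tau> s - w c (X c s)\<bar>) c t <= \<theta> / 2 * h + e / \<theta> + 8 * L\<^sup>2 / (2 * \<theta>) * (h * d)" .
 show "tint (\<lambda>\<tau>. \<E> s. \<bar>V \<tau> s - w c (X c s)\<bar>) c t <= \<bar>tol \<theta> t - tol \<theta> c\<bar> + C1 \<theta> * \<bar>t - c\<bar> * dMu c t"
 proof -
  have "8 * L\<^sup>2 <= 2 * C0 + 16 * L\<^sup>2" using C0_nonneg zero_le_power2[of L] by linarith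
  from order_trans[OF * fin[OF this]] show ?thesis .
 qed
qed

end

section \<open>The velocity as a time derivative\<close>

context sticky_flow
begin

text \<open>First \<open>\<theta>\<close> is chosen small against the total energy, then the error of
 the field small against \<open>\<theta>\<close>.\<close>

lemma approximation:
 assumes "0 <= b" "\<eta> > 0"
 obtains w L M R \<theta> where "approx_flow X vv v0 w L M R" "\<theta> > 0"
  "approx_flow.tol X vv w \<theta> b - approx_flow.tol X vv w \<theta> 0 <= \<eta>"
proof -
 have Mu: "0 <= Mu b" using Mu_mono[of 0 b] assms(1) by (simp add: Mu_def En_def)
 define \<theta> where "\<theta> = \<eta> / (4 * (1 + Mu b))"
 have \<theta>: "\<theta> > 0" using Mu assms(2) by (simp add: \<theta>_def)
 define \<epsilon> where "\<epsilon> = \<theta> * \<eta> / 6"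
 have \<epsilon>: "\<epsilon> > 0" using \<theta> assms(2) by (simp add: \<epsilon>_def)
 obtain L :: real and w :: "real => real => real" and M R where w: "0 <= L"
  "\<And>t y t' y'. \<bar>w t y - w t' y'\<bar> <= L * (\<bar>t - t'\<bar> + \<bar>y - y'\<bar>)"
  "\<And>t y. \<bar>w t y\<bar> <= M" "\<And>t y. R <= \<bar>y\<bar> ==> w t y = 0"
  and small: "prim (\<lambda>\<tau>. \<E> s. (V \<tau> s - w \<tau> (X \<tau> s))\<^sup>2) b <= \<epsilon>"
  by (rule velocity_approx[OF assms(1) \<epsilon>]) (rule that)
 interpret approx_flow X vv v0 w L M R
  by unfold_locales (fact w)+
 have "3 / \<theta> * prim err b <= 3 / \<theta> * \<epsilon>"
  using small \<theta> unfolding err_def by (intro mult_left_mono) auto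
 also have "... = \<eta> / 2" using \<theta> unfolding \<epsilon>_def by simp
 finally have 1: "3 / \<theta> * prim err b <= \<eta> / 2" .
 have "2 * \<theta> * Mu b <= 2 * \<theta> * (1 + Mu b)" using \<theta> by (intro mult_left_mono) auto
 also have "... = \<eta> / 2"
 proof -
  have "1 + Mu b \<noteq> 0" using Mu by linarith
  moreover have "2 * (\<eta> / (4 * x)) * x = \<eta> / 2" if "x \<noteq> 0" for x using that by simp
  ultimately show ?thesis unfolding \<theta>_def by blast
 qed
 finally have 2: "2 * \<theta> * Mu b <= \<eta> / 2" .
 have "tol \<theta> b - tol \<theta> 0 <= \<eta>"
 proof -
  have "tol \<theta> 0 = 0" by (simp add: tol_def Mu_def En_def)
  then show ?thesis using 1 2 unfolding tol_def by linarith
 qed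
 then show ?thesis using that[OF approx_flow_axioms \<theta>] by blast
qed

lemma integrable_X_bounded:
 assumes [measurable]: "k \<in> borel_measurable borel" and "\<And>s. \<bar>k s\<bar> <= B" and "0 <= t"
 shows "integrable unif (\<lambda>s. X t s * k s)"
proof (rule integrable_mult_of_squares)
 show "integrable unif (\<lambda>s. (k s)\<^sup>2)" by (rule unif.integrable_square_bounded[OF _ assms(2)]) simp
qed (simp_all add: X_square_integrable[OF assms(3)])

text \<open>On each window \<open>X\<close> moves with the frozen field up to \<open>tol\<close>, and so
 does the integral of \<open>V\<close>. Summation over a subdivision leaves only the total increment of
 \<open>tol\<close>, which is arbitrarily small.\<close>

lemma velocity_balance_1:
 assumes [measurable]: "k \<in> borel_measurable borel" and k: "\<And>s. \<bar>k s\<bar> <= 1" and "0 <= a" "a <= b"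
 shows "(\<E> s. X b s * k s) - (\<E> s. X a s * k s)
  = prim (\<lambda>\<tau>. \<E> s. V \<tau> s * k s) b - prim (\<lambda>\<tau>. \<E> s. V \<tau> s * k s) a"
proof -
 define fk where "fk \<tau> = (\<E> s. V \<tau> s * k s)" for \<tau>
 have mk: "(\<lambda>(t::real, s). k s) \<in> borel_measurable (borel \<Otimes>\<^sub>M borel)" by measurable
 have lfk: "locint fk" unfolding fk_def by (rule locint_V_bounded(1)[OF mk k])
 define \<Phi> where "\<Phi> t = (\<E> s. X t s * k s) - prim fk t" for t
 have "\<bar>\<Phi> b - \<Phi> a\<bar> <= 0"
 proof (rule field_le_epsilon)
  fix e :: real assume "e > 0"
  then have e2: "e / 2 > 0" and b0: "0 <= b" using assms by auto
  obtain w L M R \<theta> where A: "approx_flow X vv v0 w L M R" and \<theta>: "\<theta> > 0"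
   and small: "approx_flow.tol X vv w \<theta> b - approx_flow.tol X vv w \<theta> 0 <= e / 2"
   by (rule approximation[OF b0 e2])
  interpret approx_flow X vv v0 w L M R by (rule A)
  have step: "\<bar>\<Phi> t - \<Phi> c\<bar> <= (2 * tol \<theta> t - 2 * tol \<theta> c) + 2 * C1 \<theta> * (t - c) * (Mu t - Mu c)"
   if c: "a <= c" "c <= t" "t - c <= 1" for c t
  proof -
   have c0: "0 <= c" and t0: "0 <= t" and ct: "\<bar>t - c\<bar> <= 1" using c assms by auto
   note wb = window_bounds[OF \<theta> c0 t0 ct]
   have iw: "integrable unif (\<lambda>s. w c (X c s) * k s)"
    by (rule integrable_mult_of_squares) (auto intro!: unif.integrable_square_bounded[OF _ k])
   have iV: "integrable unif (\<lambda>s. V \<tau> s * k s)" for \<tau> by (rule integrable_V_bounded(1)[OF _ k]) simp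
   have i1: "integrable unif (\<lambda>s. (X t s - X c s - (t - c) * w c (X c s)) * k s)"
    by (rule integrable_mult_of_squares[OF _ _ window_displacement_square(1)[OF c0 t0 ct]])
     (auto intro!: unif.integrable_square_bounded[OF _ k])
   define Ew where "Ew = (\<E> s. w c (X c s) * k s)"
   have eq: "\<Phi> t - \<Phi> c = (\<E> s. (X t s - X c s - (t - c) * w c (X c s)) * k s) - (prim (\<lambda>\<tau>. fk \<tau> - Ew) t - prim (\<lambda>\<tau>. fk \<tau> - Ew) c)"
   proof -
    have "(\<E> s. (X t s - X c s - (t - c) * w c (X c s)) * k s)
     = (\<E> s. X t s * k s) - (\<E> s. X c s * k s) - (t - c) * Ew"
    proof -
     have alg: "(x - y - z * o') * r = x * r - y * r - z * (o' * r)" for x y z o' r :: real by (simp add: algebra_simps)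
     have it: "integrable unif (\<lambda>s. X t s * k s)" "integrable unif (\<lambda>s. X c s * k s)"
      by (rule integrable_X_bounded[OF _ k t0], simp, rule integrable_X_bounded[OF _ k c0], simp)
     show ?thesis
      unfolding alg Ew_def
      by (simp only: Bochner_Integration.integral_diff[OF Bochner_Integration.integrable_diff[OF it] integrable_mult_right[OF iw]]
        Bochner_Integration.integral_diff[OF it] integral_mult_right_zero)
    qed
    moreover have "prim (\<lambda>\<tau>. fk \<tau> - Ew) t - prim (\<lambda>\<tau>. fk \<tau> - Ew) c = (prim fk t - prim fk c) - (t - c) * Ew"
     unfolding prim_sub[OF lfk locint_const] prim_const[OF c0] prim_const[OF t0] left_diff_distrib mult.commute[of Ew] by linarith
    ultimately show ?thesis unfolding \<Phi>_def by linarith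
   qed
   have hP: "\<bar>\<E> s. (X t s - X c s - (t - c) * w c (X c s)) * k s\<bar> <= (\<E> s. \<bar>X t s - X c s - (t - c) * w c (X c s)\<bar>)"
   proof (rule order_trans[OF integral_abs_bound integral_mono])
    show "integrable unif (\<lambda>s. \<bar>(X t s - X c s - (t - c) * w c (X c s)) * k s\<bar>)" by (rule integrable_abs[OF i1])
    show "integrable unif (\<lambda>s. \<bar>X t s - X c s - (t - c) * w c (X c s)\<bar>)"
     by (rule integrable_abs[OF unif.integrable_of_square[OF _ window_displacement_square(1)[OF c0 t0 ct]]]) measurable
    show "\<bar>(X t s - X c s - (t - c) * w c (X c s)) * k s\<bar> <= \<bar>X t s - X c s - (t - c) * w c (X c s)\<bar>" for s
     unfolding abs_mult by (rule mult_left_le[OF k abs_ge_zero])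
   qed
   have hQ: "\<bar>prim (\<lambda>\<tau>. fk \<tau> - Ew) t - prim (\<lambda>\<tau>. fk \<tau> - Ew) c\<bar> <= tint (\<lambda>\<tau>. \<E> s. \<bar>V \<tau> s - w c (X c s)\<bar>) c t"
   proof (rule abs_prim_le_tint[OF locint_diff[OF lfk locint_const] wb(3) c0 t0])
    fix \<tau>
    have eq2: "fk \<tau> - Ew = (\<E> s. (V \<tau> s - w c (X c s)) * k s)"
     unfolding fk_def Ew_def left_diff_distrib using iV iw by simp
    show "\<bar>fk \<tau> - Ew\<bar> <= (\<E> s. \<bar>V \<tau> s - w c (X c s)\<bar>)"
     unfolding eq2
    proof (rule order_trans[OF integral_abs_bound integral_mono])
     show "integrable unif (\<lambda>s. \<bar>V \<tau> s - w c (X c s)\<bar>)"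
      by (rule integrable_abs[OF unif.integrable_of_square[OF _ V_sub_w_sq_int]]) measurable
     show "integrable unif (\<lambda>s. \<bar>(V \<tau> s - w c (X c s)) * k s\<bar>)"
      unfolding left_diff_distrib by (intro integrable_abs Bochner_Integration.integrable_diff iV iw)
     show "\<bar>(V \<tau> s - w c (X c s)) * k s\<bar> <= \<bar>V \<tau> s - w c (X c s)\<bar>" for s
      unfolding abs_mult by (rule mult_left_le[OF k abs_ge_zero])
    qed
   qed
   have "\<bar>\<Phi> t - \<Phi> c\<bar> <= (\<bar>tol \<theta> t - tol \<theta> c\<bar> + C1 \<theta> * \<bar>t - c\<bar> * dMu c t) + (\<bar>tol \<theta> t - tol \<theta> c\<bar> + C1 \<theta> * \<bar>t - c\<bar> * dMu c t)"
    unfolding eq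
    by (rule order_trans[OF abs_triangle_ineq4]) (intro add_mono order_trans[OF hP wb(1)] order_trans[OF hQ wb(2)])
   moreover have "\<bar>tol \<theta> t - tol \<theta> c\<bar> = tol \<theta> t - tol \<theta> c" using tol_mono[OF \<theta> c0 c(2)] by simp
   moreover have "\<bar>t - c\<bar> = t - c" "dMu c t = Mu t - Mu c" using Mu_mono[OF c0 c(2)] c by (simp_all add: dMu_def)
   moreover have "(x - y + z * u * v) + (x - y + z * u * v) = (2 * x - 2 * y) + 2 * z * u * v" for x y z u v :: real
    by simp
   ultimately show ?thesis by (simp only:)
  qed
  have "\<Phi> b - \<Phi> a <= 2 * tol \<theta> b - 2 * tol \<theta> a"
   by (rule subdivision_ineq[OF assms(4)]) (rule order_trans[OF abs_ge_self step])
  moreover have "(- \<Phi> b) - (- \<Phi> a) <= 2 * tol \<theta> b - 2 * tol \<theta> a"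
  proof (rule subdivision_ineq[OF assms(4)])
   fix c t assume "a <= c" "c <= t" "t <= b" "t - c <= 1"
   with step[of c t] show "- \<Phi> t - - \<Phi> c <= 2 * tol \<theta> t - 2 * tol \<theta> c + 2 * C1 \<theta> * (t - c) * (Mu t - Mu c)"
    by linarith
  qed
  moreover have "tol \<theta> 0 <= tol \<theta> a" using tol_mono[OF \<theta> _ assms(3)] by simp
  ultimately show "\<bar>\<Phi> b - \<Phi> a\<bar> <= 0 + e" using small by linarith
 qed
 then have "\<Phi> b = \<Phi> a" by simp
 then show ?thesis unfolding \<Phi>_def fk_def by linarith
qed

lemma velocity_balance:
 assumes [measurable]: "k \<in> borel_measurable borel" and k: "\<And>s. \<bar>k s\<bar> <= B" and "0 <= a" "0 <= b"
 shows "(\<E> s. X b s * k s) - (\<E> s. X a s * k s)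
  = prim (\<lambda>\<tau>. \<E> s. V \<tau> s * k s) b - prim (\<lambda>\<tau>. \<E> s. V \<tau> s * k s) a"
proof -
 define D where "D = \<bar>B\<bar> + 1"
 have D: "D > 0" by (simp add: D_def)
 have kD: "\<bar>k s / D\<bar> <= 1" for s using k[of s] D by (simp add: D_def)
 have *: "(\<E> s. X b s * k s) - (\<E> s. X a s * k s)
  = prim (\<lambda>\<tau>. \<E> s. V \<tau> s * k s) b - prim (\<lambda>\<tau>. \<E> s. V \<tau> s * k s) a" if "0 <= a" "a <= b" for a b
 proof -
  have "(\<E> s. Y s * k s) = D * (\<E> s. Y s * (k s / D))" for Y
   unfolding integral_mult_right_zero[symmetric] using D by (intro Bochner_Integration.integral_cong) auto
  note scale = this
  have m: "(\<lambda>s. k s / D) \<in> borel_measurable borel" by measurable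
  show ?thesis
   unfolding scale prim_cmult right_diff_distrib[symmetric] velocity_balance_1[OF m kD that] ..
 qed
 show ?thesis
 proof (cases "a <= b")
  case True then show ?thesis using *[of a b] assms by simp
 next
  case False then show ?thesis using *[of b a] assms by linarith
 qed
qed

end

section \<open>Second differences along the flow\<close>

context approx_flow
begin

text \<open>To first order, moving the test function from \<open>X c\<close> to \<open>X \<tau>\<close>
 changes the momentum by velocity times displacement times \<open>g'\<close>. With the frozen field in
 place of the velocity and of the displacement this is the integral of \<open>V\<^sup>2 g'\<close> from
 \<open>c\<close> to \<open>\<tau>\<close>.\<close>

lemma momentum_defect:
 assumes g: "C1b g g' \<Lambda>" "\<Lambda> > 0" and \<theta>: "\<theta> > 0" and c: "0 <= c" and t: "0 <= t" and ct: "\<bar>t - c\<bar> <= 1"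
  and B1_def: "B1 = (\<lambda>\<tau>. \<E> s. (V \<tau> s)\<^sup>2 * g' (X \<tau> s))"
  and F_def: "F = (\<lambda>\<tau>. (\<E> s. V \<tau> s * g (X \<tau> s)) - (\<E> s. V \<tau> s * g (X c s)) - (prim B1 \<tau> - prim B1 c))"
 shows "\<bar>prim F t - prim F c\<bar> <= \<Lambda> * (\<bar>t - c\<bar> * (\<bar>tol \<theta> t - tol \<theta> c\<bar> + C1 \<theta> * \<bar>t - c\<bar> * dMu c t))"
  and "locint F" and "locint B1"
proof -
 define h where "h = \<bar>t - c\<bar>"
 define d where "d = dMu c t"
 define e where "e = tint err c t"
 have h: "0 <= h" by (simp add: h_def)
 have d: "h <= d" "0 <= d" using dMu_eq[OF c t] by (auto simp: h_def d_def)
 have e: "0 <= e" unfolding e_def by (rule tint_err_nonneg[OF c t])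
 note [measurable] = C1b_meas[OF g(1)]
 have g': "\<And>y. DERIV g y :> g' y" "continuous_on UNIV g'" "\<And>y. \<bar>g' y\<bar> <= \<Lambda>" using g(1) by (auto simp: C1b_def)
 obtain Bg where Bg: "\<And>y. \<bar>g y\<bar> <= Bg" using g(1) by (auto simp: C1b_def)
 have m1: "(\<lambda>(t, s). g' (X t s)) \<in> borel_measurable (borel \<Otimes>\<^sub>M borel)" by measurable
 have m2: "(\<lambda>(t, s). g (X t s)) \<in> borel_measurable (borel \<Otimes>\<^sub>M borel)" by measurable
 have m3: "(\<lambda>(t::real, s). g (X c s)) \<in> borel_measurable (borel \<Otimes>\<^sub>M borel)" by measurable
 show lB1: "locint B1" unfolding B1_def by (rule locint_V_bounded(2)[OF m1 g'(3)])
 show lF: "locint F" unfolding F_def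
  by (rule locint_diff[OF locint_diff[OF locint_V_bounded(1)[OF m2 Bg] locint_V_bounded(1)[OF m3 Bg]]
     locint_diff[OF locint_continuous[OF continuous_on_prim[OF lB1]] locint_const]])
 define B2 where "B2 = (\<lambda>\<tau>. \<E> s. V \<tau> s * (w c (X \<tau> s) * g' (X \<tau> s)))"
 have lB2: "locint B2" by (rule linearize(3)[OF g' c t B2_def])
 define fr where "fr \<tau> = (\<E> s. (V \<tau> s - w c (X c s))\<^sup>2)" for \<tau>
 define Gf where "Gf \<tau> = \<Lambda> * (\<theta> / 2 * (\<E> s. (V \<tau> s)\<^sup>2) + 1 / (2 * \<theta>) * (\<E> s. (V \<tau> s - w c (X \<tau> s))\<^sup>2))" for \<tau>
 have lG: "locint Gf" unfolding Gf_def by (intro locint_cmult locint_add locint_energy locint_frozen)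
 have Gf0: "0 <= Gf \<tau>" for \<tau> using g(2) \<theta> by (simp add: Gf_def)
 have Gt: "tint Gf c t <= \<Lambda> * (\<theta> / 2 * d + (e / \<theta> + 4 * L\<^sup>2 / \<theta> * (h * d)))"
 proof -
  have "tint Gf c t = \<Lambda> * (\<theta> / 2 * \<bar>En t - En c\<bar> + 1 / (2 * \<theta>) * tint (\<lambda>\<tau>. \<E> s. (V \<tau> s - w c (X \<tau> s))\<^sup>2) c t)"
   unfolding Gf_def tint_cmult tint_add[OF locint_cmult[OF locint_energy] locint_cmult[OF locint_frozen(2)]] En_tint[OF c t] ..
  also have "... <= \<Lambda> * (\<theta> / 2 * d + 1 / (2 * \<theta>) * (2 * e + 8 * L\<^sup>2 * h * d))"
   using frozen_error(2)[OF c t ct] dMu_eq[OF c t] g(2) \<theta> unfolding h_def d_def e_def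
   by (intro mult_left_mono add_mono) auto
  also have "1 / (2 * \<theta>) * (2 * e + 8 * L\<^sup>2 * h * d) = e / \<theta> + 4 * L\<^sup>2 / \<theta> * (h * d)"
   by (simp add: distrib_left add_divide_distrib)
  finally show ?thesis .
 qed
 have pt: "\<bar>F \<tau>\<bar> <= \<Lambda> * ((\<theta> * d + e / \<theta> + (4 * L\<^sup>2 / \<theta> + L) * (h * d)) + h / (2 * \<theta>) * fr \<tau>)"
  if \<tau>: "min c t <= \<tau>" "\<tau> <= max c t" for \<tau>
 proof -
  note \<tau>' = dMu_interval[OF c t \<tau>]
  have iX: "integrable unif (\<lambda>s. (X \<tau> s - X c s)\<^sup>2)" by (rule displacement_square(1)[OF c \<tau>'(3)])
  have dX: "(\<E> s. (X \<tau> s - X c s)\<^sup>2) <= h * d"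
  proof -
   have "\<bar>\<tau> - c\<bar> * dMu c \<tau> <= h * d" using \<tau>' h by (intro mult_mono) (auto simp: h_def d_def dMu_def)
   then show ?thesis using sq_displacement_dMu[OF c \<tau>'(3)] by linarith
  qed
  define Dg where "Dg s = g (X \<tau> s) - g (X c s)" for s
  have [measurable]: "Dg \<in> borel_measurable borel" unfolding Dg_def by measurable
  have Dgb: "\<bar>Dg s\<bar> <= 2 * Bg" for s using Bg[of "X \<tau> s"] Bg[of "X c s"] by (simp add: Dg_def)
  have iDg2: "integrable unif (\<lambda>s. (Dg s)\<^sup>2)" by (rule unif.integrable_square_bounded[OF _ Dgb]) simp
  have Dg2: "(\<E> s. (Dg s)\<^sup>2) <= \<Lambda>\<^sup>2 * (h * d)"
  proof -
   have "(\<E> s. (Dg s)\<^sup>2) <= (\<E> s. \<Lambda>\<^sup>2 * (X \<tau> s - X c s)\<^sup>2)"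
   proof (rule integral_mono[OF iDg2])
    fix s
    show "(Dg s)\<^sup>2 <= \<Lambda>\<^sup>2 * (X \<tau> s - X c s)\<^sup>2"
     using power_mono[OF C1b_lipschitz[OF g(1), of "X \<tau> s" "X c s"], of 2] by (simp add: Dg_def power_mult_distrib)
   qed (use iX in simp)
   also have "... = \<Lambda>\<^sup>2 * (\<E> s. (X \<tau> s - X c s)\<^sup>2)" by (rule integral_mult_right_zero)
   also have "... <= \<Lambda>\<^sup>2 * (h * d)" by (rule mult_left_mono[OF dX]) simp
   finally show ?thesis .
  qed
  have iVD: "integrable unif (\<lambda>s. V \<tau> s * Dg s)" by (rule integrable_V_bounded(1)[OF _ Dgb]) simp
  have iwD: "integrable unif (\<lambda>s. w c (X c s) * Dg s)" by (rule integrable_mult_of_squares[OF _ _ _ iDg2]) auto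
  define E1 where "E1 = (\<E> s. (V \<tau> s - w c (X c s)) * Dg s)"
  define E2 where "E2 = (\<E> s. w c (X c s) * Dg s)"
  have F_split: "F \<tau> = E1 + (E2 - (prim B2 \<tau> - prim B2 c)) - ((prim B1 \<tau> - prim B1 c) - (prim B2 \<tau> - prim B2 c))"
  proof -
   have "(\<E> s. V \<tau> s * g (X \<tau> s)) - (\<E> s. V \<tau> s * g (X c s)) = (\<E> s. V \<tau> s * Dg s)"
    unfolding Dg_def right_diff_distrib
    using integrable_V_bounded(1)[of "\<lambda>s. g (X \<tau> s)" Bg] integrable_V_bounded(1)[of "\<lambda>s. g (X c s)" Bg] Bg by simp
   also have "... = E1 + E2" unfolding E1_def E2_def left_diff_distrib using iVD iwD by simp
   finally show ?thesis by (simp add: F_def)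
  qed
  have b1: "\<bar>E1\<bar> <= \<Lambda> * (\<theta> / 2 * d + h / (2 * \<theta>) * fr \<tau>)"
  proof (cases "h = 0")
   case True
   then have "\<tau> = c" using \<tau>'(2) by (simp add: h_def)
   then have "E1 = 0" by (simp add: E1_def Dg_def)
   then show ?thesis using True g(2) \<theta> d by simp
  next
   case False
   with h have hp: "h > 0" by simp
   define \<kappa> where "\<kappa> = \<theta> / (\<Lambda> * h)"
   have \<kappa>: "\<kappa> > 0" using \<theta> g(2) hp by (simp add: \<kappa>_def)
   have "\<bar>E1\<bar> <= (\<E> s. \<bar>Dg s * (V \<tau> s - w c (X c s))\<bar>)"
    unfolding E1_def mult.commute[of _ "Dg _"] by (rule integral_abs_bound)
   also have "... <= \<kappa> / 2 * (\<E> s. (Dg s)\<^sup>2) + fr \<tau> / (2 * \<kappa>)"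
    unfolding fr_def by (rule integral_abs_mult_le[OF _ _ iDg2 V_sub_w_sq_int \<kappa>]) measurable
   also have "... <= \<kappa> / 2 * (\<Lambda>\<^sup>2 * (h * d)) + fr \<tau> / (2 * \<kappa>)"
    using Dg2 \<kappa> by (intro add_right_mono mult_left_mono) auto
   also have "\<kappa> / 2 * (\<Lambda>\<^sup>2 * (h * d)) = \<Lambda> * (\<theta> / 2 * d)"
    using g(2) hp unfolding \<kappa>_def by (simp add: power2_eq_square)
   also have "fr \<tau> / (2 * \<kappa>) = \<Lambda> * (h / (2 * \<theta>) * fr \<tau>)"
    using g(2) hp \<theta> unfolding \<kappa>_def by simp
   finally show ?thesis by (simp only: distrib_left)
  qed
  have b2: "\<bar>E2 - (prim B2 \<tau> - prim B2 c)\<bar> <= \<Lambda> * (L * (h * d))"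
  proof -
   have "\<bar>E2 - (prim B2 \<tau> - prim B2 c)\<bar> <= L * \<Lambda> * (\<E> s. (X \<tau> s - X c s)\<^sup>2)"
    unfolding E2_def Dg_def by (rule linearize(1)[OF g' c \<tau>'(3) B2_def])
   also have "... <= L * \<Lambda> * (h * d)" using L g(2) by (intro mult_left_mono[OF dX]) auto
   finally show ?thesis by (simp only: mult_ac)
  qed
  have b3: "\<bar>(prim B1 \<tau> - prim B1 c) - (prim B2 \<tau> - prim B2 c)\<bar> <= \<Lambda> * (\<theta> / 2 * d + (e / \<theta> + 4 * L\<^sup>2 / \<theta> * (h * d)))"
  proof -
   have eq3: "(prim B1 \<tau> - prim B1 c) - (prim B2 \<tau> - prim B2 c) = prim (\<lambda>\<sigma>. B1 \<sigma> - B2 \<sigma>) \<tau> - prim (\<lambda>\<sigma>. B1 \<sigma> - B2 \<sigma>) c"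
    by (simp add: prim_sub[OF lB1 lB2])
   have "\<bar>prim (\<lambda>\<sigma>. B1 \<sigma> - B2 \<sigma>) \<tau> - prim (\<lambda>\<sigma>. B1 \<sigma> - B2 \<sigma>) c\<bar> <= tint Gf c \<tau>"
   proof (rule abs_prim_le_tint[OF locint_diff[OF lB1 lB2] lG c \<tau>'(3)])
    fix \<sigma>
    have i1: "integrable unif (\<lambda>s. (V \<sigma> s)\<^sup>2 * g' (X \<sigma> s))" by (rule integrable_V_bounded(2)[OF _ g'(3)]) simp
    have b: "\<bar>w c (X \<sigma> s) * g' (X \<sigma> s)\<bar> <= M * \<Lambda>" for s
     unfolding abs_mult using w_bdd g'(3) M_nonneg by (intro mult_mono) auto
    have i2: "integrable unif (\<lambda>s. V \<sigma> s * (w c (X \<sigma> s) * g' (X \<sigma> s)))" by (rule integrable_V_bounded(1)[OF _ b]) simp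
    have i3: "integrable unif (\<lambda>s. V \<sigma> s * (V \<sigma> s - w c (X \<sigma> s)))"
     by (rule integrable_mult_of_squares[OF _ _ V_square_integrable V_sub_w_sq_int]) auto
    have eq: "(V \<sigma> s)\<^sup>2 * g' (X \<sigma> s) - V \<sigma> s * (w c (X \<sigma> s) * g' (X \<sigma> s)) = (V \<sigma> s * (V \<sigma> s - w c (X \<sigma> s))) * g' (X \<sigma> s)" for s
     by (simp add: power2_eq_square algebra_simps)
    have eq4: "B1 \<sigma> - B2 \<sigma> = (\<E> s. (V \<sigma> s * (V \<sigma> s - w c (X \<sigma> s))) * g' (X \<sigma> s))"
     unfolding B1_def B2_def eq[symmetric] using i1 i2 by simp
    have "\<bar>\<E> s. (V \<sigma> s * (V \<sigma> s - w c (X \<sigma> s))) * g' (X \<sigma> s)\<bar> <= (\<E> s. \<Lambda> * \<bar>V \<sigma> s * (V \<sigma> s - w c (X \<sigma> s))\<bar>)"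
    proof (rule order_trans[OF integral_abs_bound integral_mono])
     show "integrable unif (\<lambda>s. \<bar>V \<sigma> s * (V \<sigma> s - w c (X \<sigma> s)) * g' (X \<sigma> s)\<bar>)"
      unfolding eq[symmetric] by (intro integrable_abs Bochner_Integration.integrable_diff i1 i2)
     show "integrable unif (\<lambda>s. \<Lambda> * \<bar>V \<sigma> s * (V \<sigma> s - w c (X \<sigma> s))\<bar>)" by (intro integrable_mult_right integrable_abs i3)
     fix s
     have "\<bar>V \<sigma> s * (V \<sigma> s - w c (X \<sigma> s)) * g' (X \<sigma> s)\<bar> = \<bar>g' (X \<sigma> s)\<bar> * \<bar>V \<sigma> s * (V \<sigma> s - w c (X \<sigma> s))\<bar>"
      by (simp only: abs_mult mult_ac)
     also have "... <= \<Lambda> * \<bar>V \<sigma> s * (V \<sigma> s - w c (X \<sigma> s))\<bar>" by (rule mult_right_mono[OF g'(3) abs_ge_zero])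
     finally show "\<bar>V \<sigma> s * (V \<sigma> s - w c (X \<sigma> s)) * g' (X \<sigma> s)\<bar> <= \<Lambda> * \<bar>V \<sigma> s * (V \<sigma> s - w c (X \<sigma> s))\<bar>" .
    qed
    also have "... = \<Lambda> * (\<E> s. \<bar>V \<sigma> s * (V \<sigma> s - w c (X \<sigma> s))\<bar>)" by (rule integral_mult_right_zero)
    also have "... <= Gf \<sigma>" unfolding Gf_def
    proof (rule mult_left_mono)
     show "(\<E> s. \<bar>V \<sigma> s * (V \<sigma> s - w c (X \<sigma> s))\<bar>)
      <= \<theta> / 2 * (\<E> s. (V \<sigma> s)\<^sup>2) + 1 / (2 * \<theta>) * (\<E> s. (V \<sigma> s - w c (X \<sigma> s))\<^sup>2)"
      using integral_abs_mult_le[OF _ _ V_square_integrable V_sub_w_sq_int \<theta>, of \<sigma> \<sigma> c \<sigma>] by simp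
    qed (use g(2) in simp)
    finally show "\<bar>B1 \<sigma> - B2 \<sigma>\<bar> <= Gf \<sigma>" unfolding eq4 .
   qed
   also have "... <= tint Gf c t" by (rule tint_mono_interval[OF lG Gf0 c t \<tau>])
   also note Gt
   finally show ?thesis unfolding eq3 .
  qed
  have "\<bar>F \<tau>\<bar> <= \<Lambda> * (\<theta> / 2 * d + h / (2 * \<theta>) * fr \<tau>) + \<Lambda> * (L * (h * d)) + \<Lambda> * (\<theta> / 2 * d + (e / \<theta> + 4 * L\<^sup>2 / \<theta> * (h * d)))"
   using b1 b2 b3 unfolding F_split by linarith
  also have "... = \<Lambda> * ((\<theta> / 2 * d + h / (2 * \<theta>) * fr \<tau>) + L * (h * d) + (\<theta> / 2 * d + (e / \<theta> + 4 * L\<^sup>2 / \<theta> * (h * d))))"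
   by (simp only: distrib_left)
  also have "(\<theta> / 2 * d + h / (2 * \<theta>) * fr \<tau>) + L * (h * d) + (\<theta> / 2 * d + (e / \<theta> + 4 * L\<^sup>2 / \<theta> * (h * d)))
   = (\<theta> * d + e / \<theta> + (4 * L\<^sup>2 / \<theta> + L) * (h * d)) + h / (2 * \<theta>) * fr \<tau>"
   unfolding distrib_right[of _ L] by linarith
  finally show ?thesis .
 qed
 define A where "A = \<theta> * d + e / \<theta> + (4 * L\<^sup>2 / \<theta> + L) * (h * d)"
 have lfr: "locint fr" unfolding fr_def by (rule locint_frozen)
 have "\<bar>prim F t - prim F c\<bar> <= tint (\<lambda>\<tau>. \<Lambda> * (A + h / (2 * \<theta>) * fr \<tau>)) c t"
  by (rule abs_prim_le_tint[OF lF locint_cmult[OF locint_add[OF locint_const locint_cmult[OF lfr]]] c t])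
   (use pt in \<open>simp only: A_def\<close>)
 also have "... = \<Lambda> * (A * h + h / (2 * \<theta>) * tint fr c t)"
  unfolding tint_cmult tint_add[OF locint_const locint_cmult[OF lfr]] tint_const[OF c t] h_def ..
 also have "... <= \<Lambda> * (A * h + h / (2 * \<theta>) * (2 * e + 8 * L\<^sup>2 * h * d))"
  using frozen_error(1)[OF c t ct] g(2) \<theta> h unfolding fr_def[symmetric] h_def[symmetric] d_def e_def
  by (intro mult_left_mono add_left_mono) auto
 also have "A * h + h / (2 * \<theta>) * (2 * e + 8 * L\<^sup>2 * h * d) = h * (A + 1 / (2 * \<theta>) * (2 * e + 8 * L\<^sup>2 * h * d))"
  by (simp add: distrib_left)
 also have "1 / (2 * \<theta>) * (2 * e + 8 * L\<^sup>2 * h * d) = e / \<theta> + 4 * L\<^sup>2 / \<theta> * (h * d)"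
  by (simp add: distrib_left add_divide_distrib)
 also have "\<Lambda> * (h * (A + (e / \<theta> + 4 * L\<^sup>2 / \<theta> * (h * d)))) <= \<Lambda> * (h * (\<bar>tol \<theta> t - tol \<theta> c\<bar> + C1 \<theta> * h * d))"
 proof (intro mult_left_mono)
  have 1: "\<theta> * d <= 2 * \<theta> * d" using \<theta> d by simp
  have 2: "e / \<theta> + e / \<theta> <= 3 / \<theta> * e" using e \<theta> by (simp add: divide_right_mono)
  have 3: "(4 * L\<^sup>2 / \<theta> + L) * (h * d) + 4 * L\<^sup>2 / \<theta> * (h * d) <= C1 \<theta> * (h * d)"
  proof -
   have "(4 * L\<^sup>2 / \<theta> + L) + 4 * L\<^sup>2 / \<theta> <= C1 \<theta>" using C0_nonneg \<theta> by (simp add: C1_def)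
   then show ?thesis unfolding distrib_right[symmetric] using h d by (intro mult_right_mono) auto
  qed
  show "A + (e / \<theta> + 4 * L\<^sup>2 / \<theta> * (h * d)) <= \<bar>tol \<theta> t - tol \<theta> c\<bar> + C1 \<theta> * h * d"
   unfolding tol_diff[OF \<theta> c t] A_def d_def[symmetric] e_def[symmetric] mult.assoc[of "C1 \<theta>"] using 1 2 3 by linarith
 qed (use h g(2) in auto)
 finally show "\<bar>prim F t - prim F c\<bar> <= \<Lambda> * (\<bar>t - c\<bar> * (\<bar>tol \<theta> t - tol \<theta> c\<bar> + C1 \<theta> * \<bar>t - c\<bar> * dMu c t))"
  unfolding h_def d_def .
qed

end

lemma prim_average_tendsto:
 assumes f: "locint f" and lim: "(f \<longlongrightarrow> l) (at_right 0)"
 shows "((\<lambda>t. prim f t / t) \<longlongrightarrow> l) (at_right 0)"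
proof (rule tendstoI)
 fix e :: real assume "e > 0"
 then have "\<forall>\<^sub>F t in at_right 0. dist (f t) l < e / 2" using lim by (intro tendstoD) auto
 then obtain d where d: "d > 0" "\<And>t. 0 < t ==> t < d ==> \<bar>f t - l\<bar> < e / 2"
  unfolding eventually_at_right_field by (auto simp: dist_real_def)
 show "\<forall>\<^sub>F t in at_right 0. dist (prim f t / t) l < e"
  unfolding eventually_at_right_field
 proof (intro exI[of _ d] conjI allI impI d(1))
  fix t :: real assume t: "0 < t" "t < d"
  have "\<bar>prim (\<lambda>\<tau>. f \<tau> - l) t\<bar> <= e / 2 * t"
  proof -
   define g where "g \<tau> = (if \<tau> = 0 then l else f \<tau>)" for \<tau>
   have eq: "prim (\<lambda>\<tau>. f \<tau> - l) t = prim (\<lambda>\<tau>. g \<tau> - l) t" and lg: "locint g"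
   proof -
    have ae: "AE x in lborel. x \<noteq> (0::real)" by (rule AE_I[where N="{0}"]) auto
    have meas: "set_borel_measurable lborel {0..T} f" for T
     using f borel_measurable_integrable unfolding locint_def set_integrable_def set_borel_measurable_def by blast
    have m0: "(\<lambda>x. indicator {0..T} x *\<^sub>R g x) \<in> borel_measurable lborel" for T
    proof -
     have "(\<lambda>x. indicator {0..T} x *\<^sub>R g x) = (\<lambda>x. if x = 0 then indicator {0..T} 0 *\<^sub>R l else indicator {0..T} x *\<^sub>R f x)"
      by (auto simp: g_def fun_eq_iff)
     moreover have "... \<in> borel_measurable lborel"
      using meas[of T] by (intro measurable_If) (auto simp: set_borel_measurable_def)
     ultimately show ?thesis by simp
    qed
    have ig: "integrable lborel (\<lambda>x. indicator {0..T} x *\<^sub>R g x)" for T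
    proof (rule integrable_cong_AE_imp)
     show "integrable lborel (\<lambda>x. indicator {0..T} x *\<^sub>R f x)"
      using f unfolding locint_def set_integrable_def by blast
     show "AE x in lborel. indicator {0..T} x *\<^sub>R f x = indicator {0..T} x *\<^sub>R g x"
      using ae by eventually_elim (simp add: g_def)
    qed (rule m0)
    then show "locint g" by (simp add: locint_def set_integrable_def)
    have "prim g t = prim f t" unfolding prim_def set_lebesgue_integral_def
    proof (rule integral_cong_AE)
     show "(\<lambda>x. indicator {0..t} x *\<^sub>R f x) \<in> borel_measurable lborel"
      using meas[of t] unfolding set_borel_measurable_def .
     show "AE x in lborel. indicator {0..t} x *\<^sub>R g x = indicator {0..t} x *\<^sub>R f x"
      using ae by eventually_elim (simp add: g_def)
    qed (rule m0)
    then show "prim (\<lambda>\<tau>. f \<tau> - l) t = prim (\<lambda>\<tau>. g \<tau> - l) t"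
     by (simp only: prim_sub[OF f locint_const] prim_sub[OF \<open>locint g\<close> locint_const])
   qed
   have "\<bar>prim (\<lambda>\<tau>. g \<tau> - l) t - prim (\<lambda>\<tau>. g \<tau> - l) 0\<bar> <= \<bar>prim (\<lambda>_. e / 2) t - prim (\<lambda>_. e / 2) 0\<bar>"
   proof (rule prim_abs_le[OF locint_diff[OF lg locint_const] locint_const])
    fix \<tau> assume "min 0 t <= \<tau>" "\<tau> <= max 0 t"
    then have "0 <= \<tau>" "\<tau> < d" using t by auto
    then show "\<bar>g \<tau> - l\<bar> <= e / 2" using d(2)[of \<tau>] \<open>e > 0\<close> by (cases "\<tau> = 0") (auto simp: g_def)
   qed (use t in auto)
   then show ?thesis using t \<open>e > 0\<close> by (simp add: eq prim_const)
  qed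
  moreover have "prim f t / t - l = prim (\<lambda>\<tau>. f \<tau> - l) t / t"
   using t by (simp add: prim_sub[OF f locint_const] prim_const diff_divide_distrib)
  ultimately have "\<bar>prim f t / t - l\<bar> <= e / 2" using t by (simp add: divide_le_eq)
  then show "dist (prim f t / t) l < e" using \<open>e > 0\<close> by (simp add: dist_real_def)
 qed
qed

text \<open>McShane extension, followed by truncation.\<close>

lemma lipschitz_factorization:
 fixes x K :: "'a => real"
 assumes "S \<noteq> {}" and lip: "\<And>s s'. s \<in> S ==> s' \<in> S ==> \<bar>K s - K s'\<bar> <= \<Lambda> * \<bar>x s - x s'\<bar>"
  and bd: "\<And>s. s \<in> S ==> \<bar>K s\<bar> <= B" and \<Lambda>: "0 <= \<Lambda>"
 obtains g where "\<And>y z. \<bar>g y - g z\<bar> <= \<Lambda> * \<bar>y - z\<bar>" "\<And>y. \<bar>g y\<bar> <= B" "\<And>s. s \<in> S ==> g (x s) = K s"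
proof -
 define f where "f y = (INF s\<in>S. K s + \<Lambda> * \<bar>y - x s\<bar>)" for y
 define g where "g y = max (- B) (min B (f y))" for y
 obtain s0 where "s0 \<in> S" using assms(1) by blast
 then have B: "0 <= B" using bd[of s0] by linarith
 have bb: "bdd_below ((\<lambda>s. K s + \<Lambda> * \<bar>y - x s\<bar>) ` S)" for y
 proof (rule bdd_belowI2)
  fix s assume "s \<in> S"
  then have "- B <= K s" using bd[of s] by linarith
  moreover have "0 <= \<Lambda> * \<bar>y - x s\<bar>" using \<Lambda> by simp
  ultimately show "- B <= K s + \<Lambda> * \<bar>y - x s\<bar>" by linarith
 qed
 have f_le: "f y <= f z + \<Lambda> * \<bar>y - z\<bar>" for y z
 proof -
  have "f y - \<Lambda> * \<bar>y - z\<bar> <= f z"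
   unfolding f_def[of z]
  proof (rule cINF_greatest[OF assms(1)])
   fix s assume s: "s \<in> S"
   have "f y <= K s + \<Lambda> * \<bar>y - x s\<bar>" unfolding f_def by (rule cINF_lower[OF bb s])
   also have "\<Lambda> * \<bar>y - x s\<bar> <= \<Lambda> * (\<bar>y - z\<bar> + \<bar>z - x s\<bar>)" using \<Lambda> by (intro mult_left_mono) auto
   finally show "f y - \<Lambda> * \<bar>y - z\<bar> <= K s + \<Lambda> * \<bar>z - x s\<bar>" unfolding distrib_left by linarith
  qed
  then show ?thesis by linarith
 qed
 show ?thesis
 proof
  fix y z
  have "\<bar>f y - f z\<bar> <= \<Lambda> * \<bar>y - z\<bar>" using f_le[of y z] f_le[of z y] unfolding abs_minus_commute[of z y] by linarith
  moreover have "\<bar>g y - g z\<bar> <= \<bar>f y - f z\<bar>" unfolding g_def by (auto simp: max_def min_def)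
  ultimately show "\<bar>g y - g z\<bar> <= \<Lambda> * \<bar>y - z\<bar>" by linarith
 next
  show "\<bar>g y\<bar> <= B" for y using B by (auto simp: g_def max_def min_def)
 next
  fix s assume s: "s \<in> S"
  have "f (x s) <= K s + \<Lambda> * \<bar>x s - x s\<bar>" unfolding f_def by (rule cINF_lower[OF bb s])
  moreover have "K s <= f (x s)" unfolding f_def
  proof (rule cINF_greatest[OF assms(1)])
   fix s' assume "s' \<in> S"
   from lip[OF s this] show "K s <= K s' + \<Lambda> * \<bar>x s - x s'\<bar>" by linarith
  qed
  ultimately have "f (x s) = K s" by simp
  then show "g (x s) = K s" using bd[OF s] by (auto simp: g_def max_def min_def)
 qed
qed

context approx_flow
begin

text \<open>The momentum tested with the frozen function \<open>g \<circ> X c\<close> is constant near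
 time \<open>c\<close> up to the defect: the change by \<open>V\<^sup>2 g'\<close> in the momentum
 equation is the one caused by the motion of the test function.\<close>

lemma second_difference_smooth:
 assumes g: "C1b g g' \<Lambda>" "\<Lambda> > 0" and \<theta>: "\<theta> > 0" and h: "0 < h" "h <= 1" and ch: "0 <= c - h"
 shows "\<bar>\<E> s. (X (c + h) s - 2 * X c s + X (c - h) s) * g (X c s)\<bar>
  <= \<Lambda> * (h * ((tol \<theta> (c + h) - tol \<theta> (c - h)) + C1 \<theta> * h * (Mu (c + h) - Mu (c - h))))"
proof -
 note [measurable] = C1b_meas[OF g(1)]
 have c: "0 <= c" "0 <= c + h" using h ch by auto
 obtain Bg where Bg: "\<And>y. \<bar>g y\<bar> <= Bg" using g(1) by (auto simp: C1b_def)
 define B1 where "B1 = (\<lambda>\<tau>. \<E> s. (V \<tau> s)\<^sup>2 * g' (X \<tau> s))"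
 define f1 where "f1 = (\<lambda>\<tau>. \<E> s. V \<tau> s * g (X \<tau> s))"
 define f0 where "f0 = (\<lambda>\<tau>. \<E> s. V \<tau> s * g (X c s))"
 define F where "F = (\<lambda>\<tau>. (\<E> s. V \<tau> s * g (X \<tau> s)) - (\<E> s. V \<tau> s * g (X c s)) - (prim B1 \<tau> - prim B1 c))"
 have F_eq: "F = (\<lambda>\<tau>. f1 \<tau> - f0 \<tau> - (prim B1 \<tau> - prim B1 c))" by (simp only: F_def f1_def f0_def)
 have dp: "\<bar>prim F (c + h) - prim F c\<bar> <= \<Lambda> * (h * ((tol \<theta> (c + h) - tol \<theta> c) + C1 \<theta> * h * (Mu (c + h) - Mu c)))"
  using momentum_defect(1)[OF g \<theta> c(1) c(2) _ B1_def F_def] h tol_mono[OF \<theta> c(1), of "c + h"] Mu_mono[OF c(1), of "c + h"]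
  by (simp add: dMu_def)
 have dm: "\<bar>prim F (c - h) - prim F c\<bar> <= \<Lambda> * (h * ((tol \<theta> c - tol \<theta> (c - h)) + C1 \<theta> * h * (Mu c - Mu (c - h))))"
  using momentum_defect(1)[OF g \<theta> c(1) ch _ B1_def F_def] h tol_mono[OF \<theta> ch, of c] Mu_mono[OF ch, of c]
  by (simp add: dMu_def)
 have lB1: "locint B1" by (rule momentum_defect(3)[OF g \<theta> c(1) c(1) _ B1_def F_def]) simp
 have m2: "(\<lambda>(t, s). g (X t s)) \<in> borel_measurable (borel \<Otimes>\<^sub>M borel)" by measurable
 have m3: "(\<lambda>(t::real, s). g (X c s)) \<in> borel_measurable (borel \<Otimes>\<^sub>M borel)" by measurable
 have lf1: "locint f1" unfolding f1_def by (rule locint_V_bounded(1)[OF m2 Bg])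
 have lf0: "locint f0" unfolding f0_def by (rule locint_V_bounded(1)[OF m3 Bg])
 define Q where "Q = (\<E> s. v0 (X 0 s) * g (X 0 s))"
 have pf0: "prim f0 t = Q * t + prim B1 c * t - prim F t" if "0 <= t" for t
 proof -
  have "prim f1 t = Q * t + prim (prim B1) t"
   using momentum[OF g(1) that] by (simp only: f1_def B1_def V_def Q_def)
  moreover have "prim F t = prim f1 t - prim f0 t - (prim (prim B1) t - prim B1 c * t)"
   unfolding F_eq
   by (simp only: prim_sub[OF locint_diff[OF lf1 lf0] locint_diff[OF locint_continuous[OF continuous_on_prim[OF lB1]] locint_const]]
    prim_sub[OF lf1 lf0] prim_sub[OF locint_continuous[OF continuous_on_prim[OF lB1]] locint_const] prim_const[OF that])
  ultimately show ?thesis by linarith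
 qed
 have mg: "(\<lambda>s. g (X c s)) \<in> borel_measurable borel" by measurable
 have vb: "(\<E> s. X b s * g (X c s)) - (\<E> s. X c s * g (X c s)) = prim f0 b - prim f0 c" if "0 <= b" for b
  unfolding f0_def by (rule velocity_balance[OF mg Bg c(1) that])
 have iX: "integrable unif (\<lambda>s. X b s * g (X c s))" if "0 <= b" for b by (rule integrable_X_bounded[OF mg Bg that])
 have "(\<E> s. (X (c + h) s - 2 * X c s + X (c - h) s) * g (X c s))
  = (\<E> s. X (c + h) s * g (X c s)) - 2 * (\<E> s. X c s * g (X c s)) + (\<E> s. X (c - h) s * g (X c s))"
  unfolding distrib_right left_diff_distrib mult.assoc using iX[OF c(2)] iX[OF c(1)] iX[OF ch] by simp
 also have "... = - (prim F (c + h) - prim F c) - (prim F (c - h) - prim F c)"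
  using vb[OF c(2)] vb[OF ch] pf0[OF c(2)] pf0[OF c(1)] pf0[OF ch] by (simp add: algebra_simps)
 finally have eq: "(\<E> s. (X (c + h) s - 2 * X c s + X (c - h) s) * g (X c s)) = - (prim F (c + h) - prim F c) - (prim F (c - h) - prim F c)" .
 have "\<Lambda> * (h * ((tol \<theta> (c + h) - tol \<theta> c) + C1 \<theta> * h * (Mu (c + h) - Mu c))) + \<Lambda> * (h * ((tol \<theta> c - tol \<theta> (c - h)) + C1 \<theta> * h * (Mu c - Mu (c - h))))
  = \<Lambda> * (h * ((tol \<theta> (c + h) - tol \<theta> (c - h)) + C1 \<theta> * h * (Mu (c + h) - Mu (c - h))))"
  by (simp add: algebra_simps)
 then show ?thesis unfolding eq using dp dm by linarith
qed

lemma second_difference_lipschitz: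
 assumes g: "\<And>y z. \<bar>g y - g z\<bar> <= \<Lambda> * \<bar>y - z\<bar>" "\<And>y. \<bar>g y\<bar> <= B" "\<Lambda> > 0" and \<theta>: "\<theta> > 0"
  and h: "0 < h" "h <= 1" and ch: "0 <= c - h"
 shows "\<bar>\<E> s. (X (c + h) s - 2 * X c s + X (c - h) s) * g (X c s)\<bar>
  <= \<Lambda> * (h * ((tol \<theta> (c + h) - tol \<theta> (c - h)) + C1 \<theta> * h * (Mu (c + h) - Mu (c - h))))"
proof (rule field_le_epsilon)
 fix e :: real assume e: "e > 0"
 define Y where "Y s = X (c + h) s - 2 * X c s + X (c - h) s" for s
 have c: "0 <= c" "0 <= c + h" using h ch by auto
 have iY: "integrable unif Y" unfolding Y_def
  by (intro Bochner_Integration.integrable_add Bochner_Integration.integrable_diff integrable_mult_right X_integrable c ch)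
 have mY[measurable]: "Y \<in> borel_measurable borel" unfolding Y_def by measurable
 define A where "A = (\<E> s. \<bar>Y s\<bar>)"
 have A: "0 <= A" by (simp add: A_def)
 define \<epsilon> where "\<epsilon> = e / (\<Lambda> * (A + 1))"
 have \<epsilon>: "\<epsilon> > 0" using e g(3) A by (simp add: \<epsilon>_def)
 obtain G G' where G: "C1b G G' \<Lambda>" "\<And>y. \<bar>G y - g y\<bar> <= \<Lambda> * \<epsilon>" "\<And>y. \<bar>G y\<bar> <= B"
  using lipschitz_smooth_approx[OF g(1,2) \<epsilon>] by metis
 have mg: "g \<in> borel_measurable borel"
 proof -
  have "\<Lambda>-lipschitz_on UNIV g" using g by (intro lipschitz_onI) (auto simp: dist_real_def)
  then show ?thesis by (intro borel_measurable_continuous_onI lipschitz_on_continuous_on)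
 qed
 note [measurable] = C1b_meas[OF G(1)] mg
 have iYg: "integrable unif (\<lambda>s. Y s * k (X c s))" if [measurable]: "k \<in> borel_measurable borel" and "\<And>y. \<bar>k y\<bar> <= B" for k
 proof (rule Bochner_Integration.integrable_bound)
  show "integrable unif (\<lambda>s. B * Y s)" by (rule integrable_mult_right[OF iY])
  show "AE s in unif. norm (Y s * k (X c s)) <= norm (B * Y s)"
  proof (rule AE_I2)
   fix s
   have "\<bar>k (X c s)\<bar> <= \<bar>B\<bar>" using that(2)[of "X c s"] by linarith
   then show "norm (Y s * k (X c s)) <= norm (B * Y s)" unfolding real_norm_def abs_mult mult.commute[of "\<bar>B\<bar>"]
    by (rule mult_left_mono) simp
  qed
 qed measurable
 have "\<bar>(\<E> s. Y s * g (X c s)) - (\<E> s. Y s * G (X c s))\<bar> <= e"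
 proof -
  have "(\<E> s. Y s * g (X c s)) - (\<E> s. Y s * G (X c s)) = (\<E> s. Y s * g (X c s) - Y s * G (X c s))"
   using iYg[OF mg g(2)] iYg[OF C1b_meas(1)[OF G(1)] G(3)] by simp
  moreover have "\<bar>\<E> s. Y s * g (X c s) - Y s * G (X c s)\<bar> <= (\<E> s. (\<Lambda> * \<epsilon>) * \<bar>Y s\<bar>)"
  proof (rule order_trans[OF integral_abs_bound integral_mono])
   show "integrable unif (\<lambda>s. \<bar>Y s * g (X c s) - Y s * G (X c s)\<bar>)"
    using iYg[OF mg g(2)] iYg[OF C1b_meas(1)[OF G(1)] G(3)] by simp
   show "integrable unif (\<lambda>s. (\<Lambda> * \<epsilon>) * \<bar>Y s\<bar>)" by (rule integrable_mult_right[OF integrable_abs[OF iY]])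
   fix s
   have "\<bar>g (X c s) - G (X c s)\<bar> <= \<Lambda> * \<epsilon>" using G(2)[of "X c s"] by (simp only: abs_minus_commute)
   then show "\<bar>Y s * g (X c s) - Y s * G (X c s)\<bar> <= (\<Lambda> * \<epsilon>) * \<bar>Y s\<bar>"
    unfolding right_diff_distrib[symmetric] abs_mult mult.commute[of "\<bar>Y s\<bar>"] by (rule mult_right_mono) simp
  qed
  moreover have "(\<E> s. (\<Lambda> * \<epsilon>) * \<bar>Y s\<bar>) = (\<Lambda> * \<epsilon>) * A" unfolding A_def by (rule integral_mult_right_zero)
  moreover have "(\<Lambda> * \<epsilon>) * A <= (\<Lambda> * \<epsilon>) * (A + 1)" using g(3) \<epsilon> by (intro mult_left_mono) auto
  moreover have "(\<Lambda> * \<epsilon>) * (A + 1) = e" using g(3) A unfolding \<epsilon>_def by simp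
  ultimately show ?thesis by linarith
 qed
 then show "\<bar>\<E> s. (X (c + h) s - 2 * X c s + X (c - h) s) * g (X c s)\<bar>
  <= \<Lambda> * (h * ((tol \<theta> (c + h) - tol \<theta> (c - h)) + C1 \<theta> * h * (Mu (c + h) - Mu (c - h)))) + e"
  using second_difference_smooth[OF G(1) g(3) \<theta> h ch] unfolding Y_def by linarith
qed

end

context sticky_flow
begin

text \<open>The second difference over small steps is of higher order; telescoping over a subdivision
 leaves an arbitrarily small error.\<close>

lemma midpoint_affine:
 assumes K [measurable]: "K \<in> borel_measurable borel" and KB: "\<And>s. \<bar>K s\<bar> <= B" and "0 < a" "a < b" and \<Lambda>: "\<Lambda> > 0"
  and factor: "\<And>c. a <= c ==> c <= b ==> \<exists>g. (\<forall>y z. \<bar>g y - g z\<bar> <= \<Lambda> * \<bar>y - z\<bar>) \<and> (\<forall>y. \<bar>g y\<bar> <= B) \<and>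
    (\<forall>s. 0 < s \<longrightarrow> s < 1 \<longrightarrow> g (X c s) = K s)"
 shows "(\<E> s. X b s * K s) - 2 * (\<E> s. X ((a + b) / 2) s * K s) + (\<E> s. X a s * K s) = 0"
proof -
 define n where "n t = (\<E> s. X t s * K s)" for t
 have b0: "0 <= b" using assms by simp
 have "\<bar>n b - 2 * n ((a + b) / 2) + n a\<bar> <= 0"
 proof (rule field_le_epsilon)
  fix e :: real assume e: "e > 0"
  define \<eta> where "\<eta> = e / ((b - a) * \<Lambda>)"
  have \<eta>: "\<eta> > 0" using e assms by (simp add: \<eta>_def)
  obtain w L M R \<theta> where A: "approx_flow X vv v0 w L M R" and \<theta>: "\<theta> > 0"
   and small: "approx_flow.tol X vv w \<theta> b - approx_flow.tol X vv w \<theta> 0 <= \<eta>"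
   by (rule approximation[OF b0 \<eta>])
  interpret approx_flow X vv v0 w L M R by (rule A)
  have "\<bar>n b - 2 * n ((a + b) / 2) + n a\<bar> <= (b - a) * (\<Lambda> * tol \<theta> b - \<Lambda> * tol \<theta> a)"
  proof (rule subdivision_second_difference[OF \<open>a < b\<close>, of "\<Lambda> * C1 \<theta>" _ Mu])
   show "0 <= \<Lambda> * C1 \<theta>" using \<Lambda> C1_nonneg[OF \<theta>] by simp
   show "\<Lambda> * tol \<theta> s <= \<Lambda> * tol \<theta> t" if "a <= s" "s <= t" "t <= b" for s t
    using that \<Lambda> assms(3) by (intro mult_left_mono tol_mono \<theta>) auto
   show "Mu s <= Mu t" if "a <= s" "s <= t" "t <= b" for s t using that assms(3) by (intro Mu_mono) auto
   fix c h assume ch: "a <= c - h" "c + h <= b" "0 < h" "h <= 1"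
   then have "a <= c" "c <= b" by auto
   then obtain g where g: "\<And>y z. \<bar>g y - g z\<bar> <= \<Lambda> * \<bar>y - z\<bar>" "\<And>y. \<bar>g y\<bar> <= B"
    "\<And>s. 0 < s ==> s < 1 ==> g (X c s) = K s" using factor by metis
   have c0: "0 <= c - h" "0 <= c" "0 <= c + h" using ch assms(3) by auto
   have "\<Lambda>-lipschitz_on UNIV g" using g(1) \<Lambda> by (intro lipschitz_onI) (auto simp: dist_real_def)
   then have [measurable]: "g \<in> borel_measurable borel" by (intro borel_measurable_continuous_onI lipschitz_on_continuous_on)
   have iK: "integrable unif (\<lambda>s. X t s * K s)" if "0 <= t" for t by (rule integrable_X_bounded[OF K KB that])
   have "n (c + h) - 2 * n c + n (c - h) = (\<E> s. (X (c + h) s - 2 * X c s + X (c - h) s) * K s)"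
    unfolding n_def distrib_right left_diff_distrib mult.assoc using iK[OF c0(1)] iK[OF c0(2)] iK[OF c0(3)] by simp
   also have "... = (\<E> s. (X (c + h) s - 2 * X c s + X (c - h) s) * g (X c s))"
    by (rule integral_cong_AE) (auto intro!: AE_unifI simp: g(3))
   finally have eq: "n (c + h) - 2 * n c + n (c - h) = (\<E> s. (X (c + h) s - 2 * X c s + X (c - h) s) * g (X c s))" .
   have alg: "\<Lambda> * (h * ((x - y) + z * h * u)) = h * ((\<Lambda> * x - \<Lambda> * y) + \<Lambda> * z * h * u)" for x y z u
    by (simp add: algebra_simps)
   show "\<bar>n (c + h) - 2 * n c + n (c - h)\<bar>
     <= h * ((\<Lambda> * tol \<theta> (c + h) - \<Lambda> * tol \<theta> (c - h)) + \<Lambda> * C1 \<theta> * h * (Mu (c + h) - Mu (c - h)))"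
    unfolding eq alg[symmetric] by (rule second_difference_lipschitz[OF g(1,2) \<Lambda> \<theta> ch(3,4) c0(1)])
  qed
  also have "... = ((b - a) * \<Lambda>) * (tol \<theta> b - tol \<theta> a)" by (simp add: algebra_simps)
  also have "... <= ((b - a) * \<Lambda>) * \<eta>"
  proof (rule mult_left_mono)
   show "tol \<theta> b - tol \<theta> a <= \<eta>" using small tol_mono[OF \<theta>, of 0 a] assms(3) by linarith
  qed (use assms in simp)
  also have "... = e" using assms by (simp add: \<eta>_def)
  finally show "\<bar>n b - 2 * n ((a + b) / 2) + n a\<bar> <= 0 + e" by simp
 qed
 then show ?thesis by (simp add: n_def)
qed

section \<open>Stickiness\<close>

text \<open>For the average gap \<open>d\<close> between two short intervals, the one-sided Lipschitz
 bound gives \<open>d' <= d / \<tau>\<close> by \<open>velocity_balance\<close>; shrinking the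
 intervals uses right continuity.\<close>

lemma sticky:
 assumes r: "0 < r" "r <= t" and s: "0 < s1" "s1 < s2" "s2 < 1"
 shows "X t s2 - X t s1 <= t / r * (X r s2 - X r s1)"
proof -
 \<comment> \<open>First for averages over short intervals to the right of the two points.\<close>
 have avg: "X t s2 - X t (s1 + \<epsilon>) <= t / r * (X r (s2 + \<epsilon>) - X r s1)"
  if \<epsilon>: "0 < \<epsilon>" "s1 + \<epsilon> <= s2" "s2 + \<epsilon> < 1" for \<epsilon>
 proof -
  define \<beta> where "\<beta> x = (indicator {s2<..s2 + \<epsilon>} x - indicator {s1<..s1 + \<epsilon>} x) / \<epsilon>" for x :: real
  have \<beta>m [measurable]: "\<beta> \<in> borel_measurable borel" unfolding \<beta>_def by measurable
  have \<beta>b: "\<bar>\<beta> x\<bar> <= 1 / \<epsilon>" for x using \<epsilon> by (auto simp: \<beta>_def indicator_def abs_mult divide_right_mono)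
  have half: "(\<E> x. (k :: real) * indicator {p<..p + \<epsilon>} x) = k * \<epsilon>" if "0 < p" "p + \<epsilon> < 1" for p k
  proof -
   have "measure unif {p<..p + \<epsilon>} = \<epsilon>"
   proof -
    have "{0<..<1} \<inter> {p<..p + \<epsilon>} = {p<..p + \<epsilon>}" using that by auto
    then show ?thesis using \<epsilon> unfolding unif_def by (subst measure_uniform_measure) auto
   qed
   then show ?thesis by simp
  qed
  have ind: "integrable unif (indicator {p<..q} :: real => real)" for p q
   by (rule unif.integrable_const_bound[of _ 1]) (auto simp: indicator_def)
  have comp: "(\<E> x. Z x * \<beta> x) <= Zhi - Zlo"
   if iZ: "integrable unif Z" and Z2: "\<And>x. s2 < x ==> x <= s2 + \<epsilon> ==> Z x <= Zhi"
    and Z1: "\<And>x. s1 < x ==> x <= s1 + \<epsilon> ==> Zlo <= Z x" for Z Zhi Zlo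
  proof -
   have "(\<E> x. Z x * \<beta> x) <= (\<E> x. (Zhi * indicator {s2<..s2 + \<epsilon>} x - Zlo * indicator {s1<..s1 + \<epsilon>} x) / \<epsilon>)"
   proof (rule integral_mono)
    show "integrable unif (\<lambda>x. Z x * \<beta> x)"
    proof (rule Bochner_Integration.integrable_bound[OF integrable_mult_right[OF iZ, of "1 / \<epsilon>"]])
     show "(\<lambda>x. Z x * \<beta> x) \<in> borel_measurable unif" using borel_measurable_integrable[OF iZ] by measurable
     show "AE x in unif. norm (Z x * \<beta> x) <= norm (1 / \<epsilon> * Z x)"
     proof (rule AE_I2)
      fix x
      have "\<bar>Z x\<bar> * \<bar>\<beta> x\<bar> <= \<bar>Z x\<bar> * (1 / \<epsilon>)" by (rule mult_left_mono[OF \<beta>b]) simp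
      then show "norm (Z x * \<beta> x) <= norm (1 / \<epsilon> * Z x)" using \<epsilon> by (simp add: abs_mult)
     qed
    qed
    show "integrable unif (\<lambda>x. (Zhi * indicator {s2<..s2 + \<epsilon>} x - Zlo * indicator {s1<..s1 + \<epsilon>} x) / \<epsilon>)"
     by (intro integrable_divide Bochner_Integration.integrable_diff integrable_mult_right ind)
    fix x
    show "Z x * \<beta> x <= (Zhi * indicator {s2<..s2 + \<epsilon>} x - Zlo * indicator {s1<..s1 + \<epsilon>} x) / \<epsilon>"
    proof -
     have "Z x * (indicator {s2<..s2 + \<epsilon>} x - indicator {s1<..s1 + \<epsilon>} x)
       <= Zhi * indicator {s2<..s2 + \<epsilon>} x - Zlo * indicator {s1<..s1 + \<epsilon>} x"
      using Z1[of x] Z2[of x] \<epsilon> by (auto simp: indicator_def)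
     then show ?thesis using \<epsilon> unfolding \<beta>_def times_divide_eq_right by (intro divide_right_mono) auto
    qed
   qed
   also have "... = ((\<E> x. Zhi * indicator {s2<..s2 + \<epsilon>} x) - (\<E> x. Zlo * indicator {s1<..s1 + \<epsilon>} x)) / \<epsilon>"
    by (simp only: integral_divide_zero Bochner_Integration.integral_diff[OF integrable_mult_right[OF ind] integrable_mult_right[OF ind]])
   also have "... = Zhi - Zlo" 
   proof -
    have "0 < s2" "s1 + \<epsilon> < 1" using s \<epsilon> by auto
    then have "(\<E> x. Zhi * indicator {s2<..s2 + \<epsilon>} x) = Zhi * \<epsilon>" "(\<E> x. Zlo * indicator {s1<..s1 + \<epsilon>} x) = Zlo * \<epsilon>"
     using half[of s2 Zhi] half[of s1 Zlo] s \<epsilon> by simp_all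
    then show ?thesis using \<epsilon>(1) by (simp only: left_diff_distrib[symmetric]) simp
   qed
   finally show ?thesis .
  qed
  define d where "d \<tau> = (\<E> x. X \<tau> x * \<beta> x)" for \<tau>
  define om where "om \<tau> = (\<E> x. V \<tau> x * \<beta> x)" for \<tau>
  have m: "(\<lambda>(t::real, s). \<beta> s) \<in> borel_measurable (borel \<Otimes>\<^sub>M borel)" by measurable
  have lom: "locint om" unfolding om_def by (rule locint_V_bounded(1)[OF m \<beta>b])
  have bal: "d b - d a = prim om b - prim om a" if "0 <= a" "0 <= b" for a b
   unfolding d_def om_def by (rule velocity_balance[OF \<beta>m \<beta>b that])
  have cd: "continuous_on {0..} d"
  proof (rule continuous_on_eq)
   show "continuous_on {0..} (\<lambda>x. d 0 + prim om x)" by (intro continuous_intros continuous_on_prim[OF lom])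
   show "d 0 + prim om x = d x" if "x \<in> {0..}" for x using bal[of 0 x] that by simp
  qed
  have "d t / t <= d r / r"
  proof (rule gronwall_linear[OF r cd lom])
   show "d b - d r = prim om b - prim om r" if "r <= b" "b <= t" for b using bal[of r b] r that by simp
   fix \<tau> assume \<tau>: "r <= \<tau>" "\<tau> <= t"
   then have \<tau>0: "0 < \<tau>" using r by simp
   define Z where "Z x = V \<tau> x - X \<tau> x / \<tau>" for x
   have Zmono: "Z y <= Z x" if "0 < x" "x <= y" "y < 1" for x y
   proof -
    have "X \<tau> x <= X \<tau> y" using mono_onD[OF X_mono, of \<tau> x y] \<tau>0 that by simp
    from oleinik[OF \<tau>0 this] show ?thesis by (simp add: Z_def V_def diff_divide_distrib)
   qed
   have iZ: "integrable unif Z" unfolding Z_def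
    using V_integrable[of \<tau>] X_integrable[of \<tau>] \<tau>0 by simp
   have "(\<E> x. Z x * \<beta> x) <= Z s2 - Z (s1 + \<epsilon>)"
    by (rule comp[OF iZ]) (use s \<epsilon> in \<open>auto intro!: Zmono\<close>)
   moreover have "Z s2 <= Z (s1 + \<epsilon>)" using s \<epsilon> by (intro Zmono) auto
   moreover have "(\<E> x. Z x * \<beta> x) = om \<tau> - d \<tau> / \<tau>"
   proof -
    have i1: "integrable unif (\<lambda>x. V \<tau> x * \<beta> x)" by (rule integrable_V_bounded(1)[OF \<beta>m \<beta>b])
    have i2: "integrable unif (\<lambda>x. X \<tau> x * \<beta> x)" by (rule integrable_X_bounded[OF \<beta>m \<beta>b]) (use \<tau>0 in simp)
    have "Z x * \<beta> x = V \<tau> x * \<beta> x - X \<tau> x * \<beta> x / \<tau>" for x by (simp add: Z_def left_diff_distrib)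
    then show ?thesis unfolding om_def d_def
     by (simp only: Bochner_Integration.integral_diff[OF i1 integrable_divide[OF i2]] integral_divide_zero)
   qed
   ultimately show "om \<tau> <= d \<tau> / \<tau>" by linarith
  qed
  moreover have "X t s2 - X t (s1 + \<epsilon>) <= d t"
  proof -
   have tt: "0 <= t" using r by simp
   have "(\<E> x. (- X t x) * \<beta> x) <= - X t s2 - (- X t (s1 + \<epsilon>))"
   proof (rule comp)
    show "integrable unif (\<lambda>x. - X t x)" using X_integrable[OF tt] by simp
    show "- X t x <= - X t s2" if "s2 < x" "x <= s2 + \<epsilon>" for x
     using mono_onD[OF X_mono[OF tt], of s2 x] that s \<epsilon> by simp
    show "- X t (s1 + \<epsilon>) <= - X t x" if "s1 < x" "x <= s1 + \<epsilon>" for x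
     using mono_onD[OF X_mono[OF tt], of x "s1 + \<epsilon>"] that s \<epsilon> by simp
   qed
   then show ?thesis by (simp add: d_def)
  qed
  moreover have "d r <= X r (s2 + \<epsilon>) - X r s1"
   unfolding d_def
  proof (rule comp)
   have rr: "0 <= r" using r by simp
   show "integrable unif (X r)" by (rule X_integrable[OF rr])
   show "X r x <= X r (s2 + \<epsilon>)" if "s2 < x" "x <= s2 + \<epsilon>" for x
    using mono_onD[OF X_mono[OF rr], of x "s2 + \<epsilon>"] that s \<epsilon> by simp
   show "X r s1 <= X r x" if "s1 < x" "x <= s1 + \<epsilon>" for x
    using mono_onD[OF X_mono[OF rr], of s1 x] that s \<epsilon> by simp
  qed
  moreover have "t / r * d r <= t / r * (X r (s2 + \<epsilon>) - X r s1)" if "d r <= X r (s2 + \<epsilon>) - X r s1"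
   using that r by (intro mult_left_mono) auto
  moreover have "d t <= t / r * d r" if "d t / t <= d r / r"
   using that r by (simp add: field_simps)
  ultimately show ?thesis by linarith
 qed
 have ev: "\<forall>\<^sub>F \<epsilon> in at_right 0. X t s2 - X t (s1 + \<epsilon>) <= t / r * (X r (s2 + \<epsilon>) - X r s1)"
  unfolding eventually_at_right_field
 proof (intro exI[of _ "min (s2 - s1) (1 - s2)"] conjI allI impI)
  fix \<epsilon> assume "0 < \<epsilon>" "\<epsilon> < min (s2 - s1) (1 - s2)"
  then show "X t s2 - X t (s1 + \<epsilon>) <= t / r * (X r (s2 + \<epsilon>) - X r s1)" by (intro avg) auto
 qed (use s in auto)
 have lim: "((\<lambda>\<epsilon>. X \<tau> (p + \<epsilon>)) \<longlongrightarrow> X \<tau> p) (at_right 0)" if "0 <= \<tau>" "0 < p" "p < 1" for \<tau> p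
 proof -
  have "(X \<tau> \<longlongrightarrow> X \<tau> p) (at_right p)" using X_right_cont[OF that] by (simp add: continuous_within)
  then show ?thesis by (subst (asm) filterlim_at_right_to_0) (simp add: add.commute)
 qed
 show ?thesis
 proof (rule tendsto_le[OF _ _ _ ev])
  show "((\<lambda>\<epsilon>. t / r * (X r (s2 + \<epsilon>) - X r s1)) \<longlongrightarrow> t / r * (X r s2 - X r s1)) (at_right 0)"
   by (intro tendsto_intros lim) (use r s in auto)
  show "((\<lambda>\<epsilon>. X t s2 - X t (s1 + \<epsilon>)) \<longlongrightarrow> X t s2 - X t s1) (at_right 0)"
   by (intro tendsto_intros lim) (use r s in auto)
 qed simp
qed

end

lemma tendsto_at_right_0:
 fixes n :: "real => real"
 assumes "continuous_on {0..} n" shows "(n \<longlongrightarrow> n 0) (at_right 0)"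
proof -
 have "\<forall>x\<in>{0..}. (n \<longlongrightarrow> n x) (at x within {0..})" using assms unfolding continuous_on_def .
 then have "(n \<longlongrightarrow> n 0) (at 0 within {0..})" by (rule bspec) simp
 then show ?thesis by (rule tendsto_within_subset) auto
qed

lemma prim_tendsto_0: "locint f ==> (prim f \<longlongrightarrow> 0) (at_right 0)"
 using tendsto_at_right_0[OF continuous_on_prim, of f] by (simp only: prim_0)

context sticky_flow
begin

section \<open>The initial velocity\<close>

abbreviation V0 :: "real => real" where "V0 s \<equiv> v0 (X 0 s)"

lemma v0_meas [measurable]: "v0 \<in> borel_measurable borel"
 using v0_cont by (rule borel_measurable_continuous_onI)

lemma V0_sq: "integrable unif (\<lambda>s. (V0 s)\<^sup>2)"
 using v0_bdd unif.integrable_square_bounded[of "\<lambda>s. V0 s"] by auto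

text \<open>Expanding the square, the energy converges by the initial condition and the mixed term by
 the momentum equation. This is where convergence of the energy at time 0 enters.\<close>

lemma initial_average_smooth:
 assumes \<phi>: "C1b \<phi> \<phi>' L"
 shows "((\<lambda>t. prim (\<lambda>\<tau>. \<E> s. (V \<tau> s - \<phi> (X 0 s))\<^sup>2) t / t) \<longlongrightarrow> (\<E> s. (V0 s - \<phi> (X 0 s))\<^sup>2)) (at_right 0)"
  and "locint (\<lambda>\<tau>. \<E> s. (V \<tau> s - \<phi> (X 0 s))\<^sup>2)"
proof -
 note [measurable] = C1b_meas[OF \<phi>]
 obtain B where B: "\<And>y. \<bar>\<phi> y\<bar> <= B" using \<phi> by (auto simp: C1b_def)
 have L: "\<And>y. \<bar>\<phi>' y\<bar> <= L" using \<phi> by (simp add: C1b_def)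
 have L0: "0 <= L" using L[of 0] by linarith
 define f1 where "f1 = (\<lambda>\<tau>. \<E> s. V \<tau> s * \<phi> (X \<tau> s))"
 define f0 where "f0 = (\<lambda>\<tau>. \<E> s. V \<tau> s * \<phi> (X 0 s))"
 define B1 where "B1 = (\<lambda>\<tau>. \<E> s. (V \<tau> s)\<^sup>2 * \<phi>' (X \<tau> s))"
 define e where "e = (\<lambda>\<tau>. \<E> s. (V \<tau> s)\<^sup>2)"
 define Q where "Q = (\<E> s. V0 s * \<phi> (X 0 s))"
 define P where "P = (\<E> s. (\<phi> (X 0 s))\<^sup>2)"
 have m1: "(\<lambda>(t, s). \<phi>' (X t s)) \<in> borel_measurable (borel \<Otimes>\<^sub>M borel)" by measurable
 have m2: "(\<lambda>(t, s). \<phi> (X t s)) \<in> borel_measurable (borel \<Otimes>\<^sub>M borel)" by measurable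
 have m3: "(\<lambda>(t::real, s). \<phi> (X 0 s)) \<in> borel_measurable (borel \<Otimes>\<^sub>M borel)" by measurable
 have lB1: "locint B1" unfolding B1_def by (rule locint_V_bounded(2)[OF m1 L])
 have lf1: "locint f1" unfolding f1_def by (rule locint_V_bounded(1)[OF m2 B])
 have lf0: "locint f0" unfolding f0_def by (rule locint_V_bounded(1)[OF m3 B])
 have le: "locint e" unfolding e_def by (rule locint_energy)
 have iP: "integrable unif (\<lambda>s. (\<phi> (X 0 s))\<^sup>2)" by (rule unif.integrable_square_bounded[OF _ B]) simp
 have iV: "integrable unif (\<lambda>s. V \<tau> s * \<phi> (X r s))" for \<tau> r by (rule integrable_V_bounded(1)[OF _ B]) simp
 have iQ: "integrable unif (\<lambda>s. V0 s * \<phi> (X 0 s))" by (rule integrable_mult_of_squares[OF _ _ V0_sq iP]) auto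
 have expand: "(\<lambda>\<tau>. \<E> s. (V \<tau> s - \<phi> (X 0 s))\<^sup>2) = (\<lambda>\<tau>. e \<tau> - 2 * f0 \<tau> + P)"
  unfolding power2_diff mult.assoc e_def f0_def P_def using V_square_integrable iP iV by (intro ext) simp
 show "locint (\<lambda>\<tau>. \<E> s. (V \<tau> s - \<phi> (X 0 s))\<^sup>2)"
  unfolding expand by (intro locint_add locint_diff locint_cmult le lf0 locint_const)
 have fin: "(\<E> s. (V0 s - \<phi> (X 0 s))\<^sup>2) = (\<E> s. (V0 s)\<^sup>2) - 2 * Q + P"
  unfolding power2_diff mult.assoc Q_def P_def using V0_sq iP iQ by simp
 have e_lim: "(e \<longlongrightarrow> (\<E> s. (V0 s)\<^sup>2)) (at_right 0)" using energy_init by (simp add: e_def V_def)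
 have f1_lim: "((\<lambda>t. prim f1 t / t) \<longlongrightarrow> Q) (at_right 0)"
 proof -
  have p0: "(prim B1 \<longlongrightarrow> 0) (at_right 0)" by (rule prim_tendsto_0[OF lB1])
  have "((\<lambda>t. Q + prim (prim B1) t / t) \<longlongrightarrow> Q + 0) (at_right 0)"
   by (intro tendsto_intros prim_average_tendsto p0 locint_continuous continuous_on_prim lB1)
  then have 1: "((\<lambda>t. Q + prim (prim B1) t / t) \<longlongrightarrow> Q) (at_right 0)" by simp
  have "\<forall>\<^sub>F t in at_right 0. Q + prim (prim B1) t / t = prim f1 t / t"
  proof (rule eventually_mono[OF eventually_at_right_less])
   fix t :: real assume t: "0 < t"
   have "prim f1 t = Q * t + prim (prim B1) t"
    using momentum[OF \<phi>, of t] t by (simp only: f1_def B1_def V_def Q_def less_imp_le)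
   then show "Q + prim (prim B1) t / t = prim f1 t / t" using t by (simp add: add_divide_distrib)
  qed
  from Lim_transform_eventually[OF 1 this] show ?thesis .
 qed
 have df_lim: "((\<lambda>\<tau>. f0 \<tau> - f1 \<tau>) \<longlongrightarrow> 0) (at_right 0)"
 proof (rule Lim_null_comparison)
  have En0: "(En \<longlongrightarrow> 0) (at_right 0)" unfolding En_def[abs_def] by (rule prim_tendsto_0[OF locint_energy])
  have sq: "((\<lambda>t. sqrt t) \<longlongrightarrow> 0) (at_right 0)"
   using tendsto_real_sqrt[OF tendsto_ident_at, of 0 "{0<..}"] by simp
  have "((\<lambda>t. L * (sqrt t / 2 * (e t + En t))) \<longlongrightarrow> L * (0 / 2 * ((\<E> s. (V0 s)\<^sup>2) + 0))) (at_right 0)"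
   by (intro tendsto_intros sq e_lim En0) simp
  then show "((\<lambda>t. L * (sqrt t / 2 * (e t + En t))) \<longlongrightarrow> 0) (at_right 0)" by simp
  show "\<forall>\<^sub>F t in at_right 0. norm (f0 t - f1 t) <= L * (sqrt t / 2 * (e t + En t))"
  proof (rule eventually_mono[OF eventually_at_right_less])
   fix t :: real assume t: "0 < t"
   then have t0: "0 <= t" by simp
   have iX: "integrable unif (\<lambda>s. (X t s - X 0 s)\<^sup>2)" by (rule displacement_square(1)[OF order_refl t0])
   have iVX: "integrable unif (\<lambda>s. V t s * (X t s - X 0 s))"
    by (rule integrable_mult_of_squares[OF _ _ V_square_integrable iX]) auto
   have eq: "f0 t - f1 t = (\<E> s. V t s * \<phi> (X 0 s) - V t s * \<phi> (X t s))"
    unfolding f0_def f1_def using iV by simp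
   have "norm (\<E> s. V t s * \<phi> (X 0 s) - V t s * \<phi> (X t s)) <= (\<E> s. L * \<bar>V t s * (X t s - X 0 s)\<bar>)"
   proof (rule order_trans[OF integral_norm_bound integral_mono])
    show "integrable unif (\<lambda>s. norm (V t s * \<phi> (X 0 s) - V t s * \<phi> (X t s)))" using iV by simp
    show "integrable unif (\<lambda>s. L * \<bar>V t s * (X t s - X 0 s)\<bar>)" using iVX by (intro integrable_mult_right integrable_abs)
    fix s
    have "\<bar>V t s\<bar> * \<bar>\<phi> (X 0 s) - \<phi> (X t s)\<bar> <= \<bar>V t s\<bar> * (L * \<bar>X 0 s - X t s\<bar>)"
     by (rule mult_left_mono[OF C1b_lipschitz[OF \<phi>]]) simp
    then show "norm (V t s * \<phi> (X 0 s) - V t s * \<phi> (X t s)) <= L * \<bar>V t s * (X t s - X 0 s)\<bar>"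
     unfolding right_diff_distrib[symmetric] real_norm_def abs_mult abs_minus_commute[of "X 0 s"] by (simp only: mult.left_commute)
   qed
   also have "... = L * (\<E> s. \<bar>V t s * (X t s - X 0 s)\<bar>)" by (rule integral_mult_right_zero)
   also have "... <= L * (sqrt t / 2 * (e t + En t))"
   proof (rule mult_left_mono[OF _ L0])
    have "(\<E> s. \<bar>V t s * (X t s - X 0 s)\<bar>) <= sqrt t / 2 * e t + (\<E> s. (X t s - X 0 s)\<^sup>2) / (2 * sqrt t)"
     unfolding e_def by (rule integral_abs_mult_le[OF _ _ V_square_integrable iX]) (use t in auto)
    also have "(\<E> s. (X t s - X 0 s)\<^sup>2) / (2 * sqrt t) <= (t * En t) / (2 * sqrt t)"
     using displacement_square(2)[OF order_refl t0] t En_mono[OF order_refl t0] by (intro divide_right_mono) (auto simp: En_def)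
    also have "(t * En t) / (2 * sqrt t) = sqrt t / 2 * En t"
    proof -
     have "x * x * En t / (2 * x) = x / 2 * En t" if "x \<noteq> 0" for x using that by simp
     from this[of "sqrt t"] show ?thesis using t by simp
    qed
    finally show "(\<E> s. \<bar>V t s * (X t s - X 0 s)\<bar>) <= sqrt t / 2 * (e t + En t)" by (simp add: distrib_left)
   qed
   finally show "norm (f0 t - f1 t) <= L * (sqrt t / 2 * (e t + En t))" unfolding eq .
  qed
 qed
 have "((\<lambda>t. prim e t / t - 2 * (prim f1 t / t + prim (\<lambda>\<tau>. f0 \<tau> - f1 \<tau>) t / t) + P) \<longlongrightarrow> (\<E> s. (V0 s)\<^sup>2) - 2 * (Q + 0) + P) (at_right 0)"
  by (intro tendsto_intros prim_average_tendsto[OF le e_lim] f1_lim prim_average_tendsto[OF locint_diff[OF lf0 lf1] df_lim])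
 then have 2: "((\<lambda>t. prim e t / t - 2 * (prim f1 t / t + prim (\<lambda>\<tau>. f0 \<tau> - f1 \<tau>) t / t) + P) \<longlongrightarrow> (\<E> s. (V0 s - \<phi> (X 0 s))\<^sup>2)) (at_right 0)"
  unfolding fin by (simp only: add_0_right)
 have "\<forall>\<^sub>F t in at_right 0. prim e t / t - 2 * (prim f1 t / t + prim (\<lambda>\<tau>. f0 \<tau> - f1 \<tau>) t / t) + P = prim (\<lambda>\<tau>. \<E> s. (V \<tau> s - \<phi> (X 0 s))\<^sup>2) t / t"
 proof (rule eventually_mono[OF eventually_at_right_less])
  fix t :: real assume t: "0 < t"
  have "prim (\<lambda>\<tau>. e \<tau> - 2 * f0 \<tau> + P) t = prim e t - 2 * prim f0 t + P * t"
   using t by (simp only: prim_add[OF locint_diff[OF le locint_cmult[OF lf0]] locint_const] prim_sub[OF le locint_cmult[OF lf0]] prim_cmult prim_const less_imp_le)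
  moreover have "prim (\<lambda>\<tau>. f0 \<tau> - f1 \<tau>) t = prim f0 t - prim f1 t" by (rule prim_sub[OF lf0 lf1])
  ultimately show "prim e t / t - 2 * (prim f1 t / t + prim (\<lambda>\<tau>. f0 \<tau> - f1 \<tau>) t / t) + P = prim (\<lambda>\<tau>. \<E> s. (V \<tau> s - \<phi> (X 0 s))\<^sup>2) t / t"
   unfolding expand using t by (simp add: field_simps)
 qed
 from Lim_transform_eventually[OF 2 this]
 show "((\<lambda>t. prim (\<lambda>\<tau>. \<E> s. (V \<tau> s - \<phi> (X 0 s))\<^sup>2) t / t) \<longlongrightarrow> (\<E> s. (V0 s - \<phi> (X 0 s))\<^sup>2)) (at_right 0)" .
qed

text \<open>The time averages of \<open>V\<close> converge strongly to \<open>V0\<close>, as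
 \<open>V0\<close> is approximated by smooth functions of the initial position.\<close>

lemma initial_velocity:
 assumes K [measurable]: "K \<in> borel_measurable borel" and KB: "\<And>s. \<bar>K s\<bar> <= B"
 shows "((\<lambda>t. ((\<E> s. X t s * K s) - (\<E> s. X 0 s * K s)) / t) \<longlongrightarrow> (\<E> s. V0 s * K s)) (at_right 0)"
proof (rule tendstoI)
 fix \<epsilon> :: real assume \<epsilon>: "\<epsilon> > 0"
 define e where "e = \<epsilon> / (3 * (\<bar>B\<bar> + 1))"
 have e: "e > 0" using \<epsilon> by (simp add: e_def)
 obtain Bv where Bv: "\<And>y. \<bar>v0 y\<bar> <= Bv" using v0_bdd by blast
 obtain G :: "nat => real => real" and G' :: "nat => real => real" and LL where G: "\<And>n. C1b (G n) (G' n) (LL n)" "\<And>n y. \<bar>G n y\<bar> <= Bv"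
  "\<And>y. (\<lambda>n. G n y) \<longlonglongrightarrow> v0 y" by (rule continuous_smooth_approx[OF v0_cont Bv]) (rule that)
 have Gm [measurable]: "G n \<in> borel_measurable borel" for n by (rule C1b_meas(1)[OF G(1)])
 have "(\<lambda>n. \<E> s. (V0 s - G n (X 0 s))\<^sup>2) \<longlonglongrightarrow> (\<E> s. (V0 s - V0 s)\<^sup>2)"
 proof (rule integral_dominated_convergence[where w="\<lambda>_. (2 * Bv)\<^sup>2"])
  show "AE s in unif. (\<lambda>n. (V0 s - G n (X 0 s))\<^sup>2) \<longlonglongrightarrow> (V0 s - V0 s)\<^sup>2" by (intro AE_I2 tendsto_intros G(3))
  show "AE s in unif. norm ((V0 s - G n (X 0 s))\<^sup>2) <= (2 * Bv)\<^sup>2" for n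
  proof (rule AE_I2)
   fix s
   have "\<bar>V0 s - G n (X 0 s)\<bar> <= 2 * Bv" using Bv[of "X 0 s"] G(2)[of n "X 0 s"] by linarith
   then show "norm ((V0 s - G n (X 0 s))\<^sup>2) <= (2 * Bv)\<^sup>2"
    using power_mono[of "\<bar>V0 s - G n (X 0 s)\<bar>" "2 * Bv" 2] by simp
  qed
 qed auto
 then have "(\<lambda>n. \<E> s. (V0 s - G n (X 0 s))\<^sup>2) \<longlonglongrightarrow> 0" by simp
 then have "\<forall>\<^sub>F n in sequentially. (\<E> s. (V0 s - G n (X 0 s))\<^sup>2) < e\<^sup>2" using e by (intro order_tendstoD) auto
 then obtain n where n: "(\<E> s. (V0 s - G n (X 0 s))\<^sup>2) < e\<^sup>2" by (auto simp: eventually_sequentially)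
 define \<phi> where "\<phi> = G n"
 have \<phi>: "C1b \<phi> (G' n) (LL n)" and [measurable]: "\<phi> \<in> borel_measurable borel" and \<phi>B: "\<And>y. \<bar>\<phi> y\<bar> <= Bv"
  and close: "(\<E> s. (V0 s - \<phi> (X 0 s))\<^sup>2) < e\<^sup>2"
  using G n by (auto simp: \<phi>_def)
 define sq where "sq = (\<lambda>\<tau>. \<E> s. (V \<tau> s - \<phi> (X 0 s))\<^sup>2)"
 have lsq: "locint sq" unfolding sq_def by (rule initial_average_smooth(2)[OF \<phi>])
 have ev: "\<forall>\<^sub>F t in at_right 0. prim sq t / t < e\<^sup>2"
  by (rule order_tendstoD(2)[OF initial_average_smooth(1)[OF \<phi>, folded sq_def] close])
 have iphi: "integrable unif (\<lambda>s. (\<phi> (X 0 s))\<^sup>2)" by (rule unif.integrable_square_bounded[OF _ \<phi>B]) simp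
 have iK: "integrable unif (\<lambda>s. (K s)\<^sup>2)" by (rule unif.integrable_square_bounded[OF _ KB]) simp
 have i1: "integrable unif (\<lambda>s. \<phi> (X 0 s) * K s)" by (rule integrable_mult_of_squares[OF _ _ iphi iK]) auto
 have i2: "integrable unif (\<lambda>s. V0 s * K s)" by (rule integrable_mult_of_squares[OF _ _ V0_sq iK]) auto
 have i3: "integrable unif (\<lambda>s. V \<tau> s * K s)" for \<tau> by (rule integrable_V_bounded(1)[OF K KB])
 have isq: "integrable unif (\<lambda>s. (V \<tau> s - \<phi> (X 0 s))\<^sup>2)" for \<tau>
  by (rule integrable_square_diff[OF _ _ V_square_integrable iphi]) auto
 have isq0: "integrable unif (\<lambda>s. (V0 s - \<phi> (X 0 s))\<^sup>2)"
  by (rule integrable_square_diff[OF _ _ V0_sq iphi]) auto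
 have B0: "0 <= B" using KB[of 0] by linarith
 have bnd: "\<bar>\<E> s. f s * K s\<bar> <= B * (e / 2 + (\<E> s. (f s)\<^sup>2) / (2 * e))"
  if f[measurable]: "f \<in> borel_measurable borel" and i: "integrable unif (\<lambda>s. (f s)\<^sup>2)" for f
 proof -
  have "\<bar>\<E> s. f s * K s\<bar> <= (\<E> s. B * \<bar>f s\<bar>)"
  proof (rule order_trans[OF integral_abs_bound integral_mono])
   show "integrable unif (\<lambda>s. \<bar>f s * K s\<bar>)" by (rule integrable_abs[OF integrable_mult_of_squares[OF _ _ i iK]]) auto
   show "integrable unif (\<lambda>s. B * \<bar>f s\<bar>)" by (rule integrable_mult_right[OF integrable_abs[OF unif.integrable_of_square[OF _ i]]]) simp
   show "\<bar>f s * K s\<bar> <= B * \<bar>f s\<bar>" for s unfolding abs_mult mult.commute[of "\<bar>f s\<bar>"] by (rule mult_right_mono[OF KB]) simp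
  qed
  also have "... = B * (\<E> s. \<bar>f s\<bar>)" by (rule integral_mult_right_zero)
  also have "... <= B * (e / 2 + (\<E> s. (f s)\<^sup>2) / (2 * e))"
   by (rule mult_left_mono[OF abs_le_square[OF f i e] B0])
  finally show ?thesis .
 qed
 define fK where "fK = (\<lambda>\<tau>. \<E> s. V \<tau> s * K s)"
 have mK: "(\<lambda>(t::real, s). K s) \<in> borel_measurable (borel \<Otimes>\<^sub>M borel)" by measurable
 have lfK: "locint fK" unfolding fK_def by (rule locint_V_bounded(1)[OF mK KB])
 define q where "q = (\<E> s. \<phi> (X 0 s) * K s)"
 have q0: "\<bar>(\<E> s. V0 s * K s) - q\<bar> <= B * e"
 proof -
  have "(\<E> s. V0 s * K s) - q = (\<E> s. (V0 s - \<phi> (X 0 s)) * K s)"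
   unfolding q_def left_diff_distrib using i1 i2 by simp
  moreover have "\<bar>\<E> s. (V0 s - \<phi> (X 0 s)) * K s\<bar> <= B * (e / 2 + (\<E> s. (V0 s - \<phi> (X 0 s))\<^sup>2) / (2 * e))"
   by (rule bnd[OF _ isq0]) simp
  moreover have "B * (e / 2 + (\<E> s. (V0 s - \<phi> (X 0 s))\<^sup>2) / (2 * e)) <= B * (e / 2 + e\<^sup>2 / (2 * e))"
   using close e B0 by (intro mult_left_mono add_left_mono divide_right_mono) auto
  moreover have "e / 2 + e\<^sup>2 / (2 * e) = e" using e by (simp add: power2_eq_square)
  ultimately show ?thesis by simp
 qed
 show "\<forall>\<^sub>F t in at_right 0. dist (((\<E> s. X t s * K s) - (\<E> s. X 0 s * K s)) / t) (\<E> s. V0 s * K s) < \<epsilon>"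
  using ev eventually_at_right_less
 proof eventually_elim
  fix t :: real assume small: "prim sq t / t < e\<^sup>2" and t: "0 < t"
  have t0: "0 <= t" using t by simp
  have "(\<E> s. X t s * K s) - (\<E> s. X 0 s * K s) = prim fK t"
   unfolding fK_def using velocity_balance[OF K KB order_refl t0] by simp
  moreover have "\<bar>prim (\<lambda>\<tau>. fK \<tau> - q) t - prim (\<lambda>\<tau>. fK \<tau> - q) 0\<bar> <= tint (\<lambda>\<tau>. B * (e / 2 + 1 / (2 * e) * sq \<tau>)) 0 t"
  proof (rule abs_prim_le_tint[OF locint_diff[OF lfK locint_const] locint_cmult[OF locint_add[OF locint_const locint_cmult[OF lsq]]] order_refl t0])
   fix \<tau>
   have eq: "fK \<tau> - q = (\<E> s. (V \<tau> s - \<phi> (X 0 s)) * K s)"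
    unfolding fK_def q_def left_diff_distrib using i1 i3 by simp
   show "\<bar>fK \<tau> - q\<bar> <= B * (e / 2 + 1 / (2 * e) * sq \<tau>)"
    unfolding eq sq_def using bnd[OF _ isq, of \<tau>] by simp
  qed
  moreover have "tint (\<lambda>\<tau>. B * (e / 2 + 1 / (2 * e) * sq \<tau>)) 0 t = B * (e / 2 * t + 1 / (2 * e) * prim sq t)"
   unfolding tint_cmult tint_add[OF locint_const locint_cmult[OF lsq]] tint_const[OF order_refl t0]
   using t by (simp add: tint_def)
  moreover have "prim (\<lambda>\<tau>. fK \<tau> - q) t = prim fK t - q * t"
   by (simp only: prim_sub[OF lfK locint_const] prim_const[OF t0])
  moreover have "B * (e / 2 * t + 1 / (2 * e) * prim sq t) <= B * (e / 2 * t + 1 / (2 * e) * (e\<^sup>2 * t))"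
   using small t e B0 by (intro mult_left_mono add_left_mono) (auto simp: divide_less_eq)
  moreover have "e / 2 * t + 1 / (2 * e) * (e\<^sup>2 * t) = e * t" using e by (simp add: power2_eq_square)
  ultimately have A: "\<bar>prim fK t - q * t\<bar> <= B * (e * t)"
   and A2: "((\<E> s. X t s * K s) - (\<E> s. X 0 s * K s)) / t = prim fK t / t"
   by simp_all
  have "\<bar>prim fK t / t - q\<bar> = \<bar>(prim fK t - q * t) / t\<bar>" using t by (simp add: diff_divide_distrib)
  also have "... = \<bar>prim fK t - q * t\<bar> / t" using t by (simp only: abs_divide abs_of_pos)
  also have "... <= B * (e * t) / t" using A t by (intro divide_right_mono) auto
  also have "... = B * e" using t by simp
  finally have "dist (((\<E> s. X t s * K s) - (\<E> s. X 0 s * K s)) / t) (\<E> s. V0 s * K s) <= 2 * (B * e)"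
   using q0 unfolding dist_real_def A2 by linarith
  also have "2 * (B * e) < 3 * ((\<bar>B\<bar> + 1) * e)"
  proof -
   have "2 * z < 3 * (z + e)" if "0 <= z" for z using that e by simp
   from this[of "B * e"] have "2 * (B * e) < 3 * (B * e + e)" using e B0 by simp
   then show ?thesis by (simp only: abs_of_nonneg[OF B0] distrib_right mult_1_left)
  qed
  also have "3 * ((\<bar>B\<bar> + 1) * e) = \<epsilon>"
  proof -
   have "3 * (c * (\<epsilon> / (3 * c))) = \<epsilon>" if "c \<noteq> 0" for c using that by simp
   from this[of "\<bar>B\<bar> + 1"] show ?thesis unfolding e_def by linarith
  qed
  finally show "dist (((\<E> s. X t s * K s) - (\<E> s. X 0 s * K s)) / t) (\<E> s. V0 s * K s) < \<epsilon>" .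
 qed
qed

section \<open>Displacements seen by functions of the terminal position\<close>

text \<open>By \<open>sticky\<close> the test function is a Lipschitz function of \<open>X c\<close> for
 every \<open>c <= t\<close>, with a constant that blows up only as \<open>c \<rightarrow>
 0\<close>. Hence the mean is affine on the positive times, by continuity also up to 0, and its slope
 is the initial one.\<close>

lemma terminal_lipschitz:
 assumes \<psi>: "\<And>y z. \<bar>\<psi> y - \<psi> z\<bar> <= Lp * \<bar>y - z\<bar>" "\<And>y. \<bar>\<psi> y\<bar> <= B" and r: "0 <= r" "r <= t"
 shows "(\<E> s. X r s * \<psi> (X t s)) - (\<E> s. X 0 s * \<psi> (X t s)) = r * (\<E> s. V0 s * \<psi> (X t s))"
proof (cases "r = 0")
 case False
 then have rp: "r > 0" and tp: "t > 0" using r by auto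
 have Lp: "0 <= Lp" using \<psi>(1)[of 0 1] by simp
 have "Lp-lipschitz_on UNIV \<psi>" using \<psi>(1) Lp by (intro lipschitz_onI) (auto simp: dist_real_def)
 then have [measurable]: "\<psi> \<in> borel_measurable borel" by (intro borel_measurable_continuous_onI lipschitz_on_continuous_on)
 define K where "K s = \<psi> (X t s)" for s
 have K[measurable]: "K \<in> borel_measurable borel" unfolding K_def by measurable
 have KB: "\<bar>K s\<bar> <= B" for s by (simp add: K_def \<psi>(2))
 define n where "n a = (\<E> s. X a s * K s)" for a
 define fK where "fK = (\<lambda>\<tau>. \<E> s. V \<tau> s * K s)"
 have mK: "(\<lambda>(t::real, s). K s) \<in> borel_measurable (borel \<Otimes>\<^sub>M borel)" by measurable
 have lfK: "locint fK" unfolding fK_def by (rule locint_V_bounded(1)[OF mK KB])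
 have cn: "continuous_on {0..} n"
 proof (rule continuous_on_eq)
  show "continuous_on {0..} (\<lambda>x. n 0 + prim fK x)" by (intro continuous_intros continuous_on_prim[OF lfK])
  show "n 0 + prim fK x = n x" if "x \<in> {0..}" for x
   using velocity_balance[OF K KB order_refl, of x] that unfolding n_def fK_def by simp
 qed
 have mid: "n b - 2 * n ((a + b) / 2) + n a = 0" if ab: "0 < a" "a < b" "b <= t" for a b
  unfolding n_def
 proof (rule midpoint_affine[OF K KB ab(1,2)])
  show "(Lp + 1) * (t / a) > 0" using Lp tp ab by simp
  fix c assume c: "a <= c" "c <= b"
  have c0: "0 < c" "c <= t" using c ab by auto
  have st: "\<bar>X t s - X t s'\<bar> <= t / c * \<bar>X c s - X c s'\<bar>" if "0 < s" "s < 1" "0 < s'" "s' < 1" for s s'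
  proof -
   have *: "\<bar>X t s - X t s'\<bar> <= t / c * \<bar>X c s - X c s'\<bar>" if "0 < s'" "s' < s" "s < 1" for s s'
   proof -
    have "X t s' <= X t s" "X c s' <= X c s"
     using mono_onD[OF X_mono[of t], of s' s] mono_onD[OF X_mono[of c], of s' s] that tp c0 by auto
    then show ?thesis using sticky[OF c0 that] by simp
   qed
   show ?thesis using *[of s' s] *[of s s'] that unfolding abs_minus_commute[of "X t s'"] abs_minus_commute[of "X c s'"]
    by (cases s s' rule: linorder_cases) auto
  qed
  have lipK: "\<bar>K s - K s'\<bar> <= (Lp + 1) * (t / a) * \<bar>X c s - X c s'\<bar>" if "s \<in> {0<..<1}" "s' \<in> {0<..<1}" for s s'
  proof -
   have "\<bar>K s - K s'\<bar> <= Lp * \<bar>X t s - X t s'\<bar>" unfolding K_def by (rule \<psi>(1))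
   also have "... <= (Lp + 1) * (t / c * \<bar>X c s - X c s'\<bar>)" using st that Lp by (intro mult_mono) auto
   also have "... <= (Lp + 1) * (t / a * \<bar>X c s - X c s'\<bar>)"
    using c c0 ab tp Lp by (intro mult_left_mono mult_right_mono divide_left_mono) auto
   finally show ?thesis by (simp only: mult.assoc)
  qed
  have ne: "{0<..<1::real} \<noteq> {}" by simp
  have pos: "0 <= (Lp + 1) * (t / a)" using Lp tp ab by simp
  show "\<exists>g. (\<forall>y z. \<bar>g y - g z\<bar> <= (Lp + 1) * (t / a) * \<bar>y - z\<bar>) \<and> (\<forall>y. \<bar>g y\<bar> <= B) \<and>
    (\<forall>s. 0 < s \<longrightarrow> s < 1 \<longrightarrow> g (X c s) = K s)"
  proof (rule lipschitz_factorization[OF ne lipK KB pos])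
   fix g assume g: "\<And>y z. \<bar>g y - g z\<bar> <= (Lp + 1) * (t / a) * \<bar>y - z\<bar>" "\<And>y. \<bar>g y\<bar> <= B"
    "\<And>s. s \<in> {0<..<1} ==> g (X c s) = K s"
   show "\<exists>g. (\<forall>y z. \<bar>g y - g z\<bar> <= (Lp + 1) * (t / a) * \<bar>y - z\<bar>) \<and> (\<forall>y. \<bar>g y\<bar> <= B) \<and>
    (\<forall>s. 0 < s \<longrightarrow> s < 1 \<longrightarrow> g (X c s) = K s)"
    by (intro exI[of _ g] conjI allI impI g) simp
  qed
 qed
 have half: "n b - n 0 = 2 * (n (b / 2) - n 0)" if b: "0 < b" "b <= t" for b
 proof -
  have "((\<lambda>a. n b - 2 * n ((a + b) / 2) + n a) \<longlongrightarrow> n b - 2 * n ((0 + b) / 2) + n 0) (at_right 0)"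
  proof (intro tendsto_intros)
   show "(n \<longlongrightarrow> n 0) (at_right 0)" by (rule tendsto_at_right_0[OF cn])
   have "continuous_on {0..} (\<lambda>a. n ((a + b) / 2))"
    by (rule continuous_on_compose2[OF cn]) (use b in \<open>auto intro!: continuous_intros\<close>)
   then show "((\<lambda>a. n ((a + b) / 2)) \<longlongrightarrow> n ((0 + b) / 2)) (at_right 0)" by (rule tendsto_at_right_0)
  qed
  then have "n b - 2 * n ((0 + b) / 2) + n 0 = 0"
  proof (rule tendsto_unique[OF trivial_limit_at_right_real])
   show "((\<lambda>a. n b - 2 * n ((a + b) / 2) + n a) \<longlongrightarrow> 0) (at_right 0)"
  proof (rule tendsto_eventually)
   show "\<forall>\<^sub>F a in at_right 0. n b - 2 * n ((a + b) / 2) + n a = 0"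
    unfolding eventually_at_right_field by (intro exI[of _ b]) (use mid b in auto)
  qed
  qed
  then show ?thesis by simp
 qed
 define u where "u b = (n b - n 0) / b" for b
 have uk: "u (r / 2 ^ k) = u r" for k
 proof (induction k)
  case (Suc k)
  have p: "0 < r / 2 ^ k" "r / 2 ^ k <= t"
  proof -
   show "0 < r / 2 ^ k" using rp by simp
   have "r / 2 ^ k <= r / 1" using rp by (intro divide_left_mono) auto
   then show "r / 2 ^ k <= t" using r by simp
  qed
  have "u (r / 2 ^ k) = u (r / 2 ^ k / 2)" unfolding u_def using half[OF p] p(1) by simp
  then show ?case using Suc by (simp add: mult.commute)
 qed simp
 have "(u \<longlongrightarrow> (\<E> s. V0 s * K s)) (at_right 0)"
  unfolding u_def[abs_def] n_def by (rule initial_velocity[OF K KB])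
 moreover have "filterlim (\<lambda>k. r / 2 ^ k) (at_right 0) sequentially"
 proof (rule tendsto_imp_filterlim_at_right)
  have "(\<lambda>k. r * (1 / 2) ^ k) \<longlonglongrightarrow> r * 0" by (intro tendsto_mult tendsto_const LIMSEQ_power_zero) simp
  then show "(\<lambda>k. r / 2 ^ k) \<longlonglongrightarrow> 0" by (simp only: power_one_over mult_zero_right times_divide_eq_right mult_1_right)
  show "\<forall>\<^sub>F k in sequentially. 0 < r / 2 ^ k" using rp by simp
 qed
 ultimately have "(\<lambda>k. u (r / 2 ^ k)) \<longlonglongrightarrow> (\<E> s. V0 s * K s)" by (rule filterlim_compose)
 then have "u r = (\<E> s. V0 s * K s)" unfolding uk by (simp only: LIMSEQ_const_iff)
 then have "n r - n 0 = r * (\<E> s. V0 s * K s)" unfolding u_def using rp by (simp add: divide_eq_eq mult.commute)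
 then show ?thesis by (simp only: n_def K_def)
next
 case True
 show ?thesis unfolding True by (simp only: mult_zero_left diff_self)
qed

end

lemma (in sticky_flow) terminal_limit:
 assumes lip: "\<And>n y z. \<bar>\<psi> n y - \<psi> n z\<bar> <= \<Lambda> n * \<bar>y - z\<bar>" and bd: "\<And>n y. \<bar>\<psi> n y\<bar> <= B"
  and lim: "\<And>y. (\<lambda>n. \<psi> n y) \<longlonglongrightarrow> \<psi>' y" and r: "0 <= r" "r <= t"
 shows "(\<E> s. (r * V0 s + X 0 s - X r s) * \<psi>' (X t s)) = 0"
proof -
 have \<Lambda>: "0 <= \<Lambda> n" for n using lip[of n 0 1] by simp
 have "(\<Lambda> n)-lipschitz_on UNIV (\<psi> n)" for n using lip[of n] \<Lambda>[of n] by (intro lipschitz_onI) (auto simp: dist_real_def)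
 then have pm [measurable]: "\<psi> n \<in> borel_measurable borel" for n
  by (intro borel_measurable_continuous_onI lipschitz_on_continuous_on)
 have [measurable]: "\<psi>' \<in> borel_measurable borel" by (rule borel_measurable_LIMSEQ_real[OF lim pm])
 have r0: "integrable unif (X r)" "integrable unif (X 0)" "integrable unif V0"
  using X_integrable r unif.integrable_of_square[OF _ V0_sq] by auto
 define R where "R s = r * V0 s + X 0 s - X r s" for s
 have Rm [measurable]: "R \<in> borel_measurable borel" unfolding R_def by measurable
 have iR: "integrable unif R" unfolding R_def by (intro Bochner_Integration.integrable_diff Bochner_Integration.integrable_add integrable_mult_right r0)
 have pK [measurable]: "(\<lambda>s. \<psi> n (X t s)) \<in> borel_measurable borel" for n by measurable
 have z: "(\<E> s. R s * \<psi> n (X t s)) = 0" for n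
 proof -
  have i1: "integrable unif (\<lambda>s. X r s * \<psi> n (X t s))" by (rule integrable_X_bounded[OF pK bd r(1)])
  have i2: "integrable unif (\<lambda>s. X 0 s * \<psi> n (X t s))" by (rule integrable_X_bounded[OF pK bd order_refl])
  have i3: "integrable unif (\<lambda>s. V0 s * \<psi> n (X t s))"
   by (rule integrable_mult_of_squares[OF _ _ V0_sq unif.integrable_square_bounded[OF _ bd]]) simp_all
  have "(\<E> s. R s * \<psi> n (X t s))
    = (\<E> s. r * (V0 s * \<psi> n (X t s)) + X 0 s * \<psi> n (X t s) - X r s * \<psi> n (X t s))"
   unfolding R_def by (intro Bochner_Integration.integral_cong refl) (simp add: algebra_simps)
  also have "... = r * (\<E> s. V0 s * \<psi> n (X t s)) + (\<E> s. X 0 s * \<psi> n (X t s)) - (\<E> s. X r s * \<psi> n (X t s))"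
   using i1 i2 i3 by simp
  finally show ?thesis using terminal_lipschitz[OF lip bd r, of n] by simp
 qed
 have "(\<lambda>n. \<E> s. R s * \<psi> n (X t s)) \<longlonglongrightarrow> (\<E> s. R s * \<psi>' (X t s))"
 proof (rule integral_dominated_convergence[where w="\<lambda>s. B * \<bar>R s\<bar>"])
  show "integrable unif (\<lambda>s. B * \<bar>R s\<bar>)" using iR by simp
  show "AE s in unif. (\<lambda>n. R s * \<psi> n (X t s)) \<longlonglongrightarrow> R s * \<psi>' (X t s)" by (intro AE_I2 tendsto_intros lim)
  show "AE s in unif. norm (R s * \<psi> n (X t s)) <= B * \<bar>R s\<bar>" for n
   using bd by (intro AE_I2) (auto simp: abs_mult mult.commute[of "\<bar>R _\<bar>"] intro!: mult_right_mono)
 qed simp_all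
 then show ?thesis unfolding z by (simp add: R_def LIMSEQ_const_iff)
qed

lemma lipschitz_clamp:
 fixes x y :: real
 shows "\<bar>min 1 (max 0 x) - min 1 (max 0 y)\<bar> <= \<bar>x - y\<bar>"
 by (simp add: min_def max_def abs_if)

lemma eventually_Suc_mult_gt_1: "0 < (x :: real) ==> \<forall>\<^sub>F n in sequentially. 1 < real (Suc n) * x"
proof -
 assume x: "0 < x"
 obtain N where N: "1 < real N * x" using reals_Archimedean3[OF x] by blast
 show ?thesis
 proof (rule eventually_sequentiallyI)
  fix n assume "N <= n"
  then have "real N * x <= real (Suc n) * x" using x by (intro mult_right_mono) auto
  then show "1 < real (Suc n) * x" using N by simp
 qed
qed

lemma (in sticky_flow) terminal_above:
 assumes "0 <= r" "r <= t"
 shows "(\<E> s. (r * V0 s + X 0 s - X r s) * indicator {c<..} (X t s)) = 0"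
  and "(\<E> s. (r * V0 s + X 0 s - X r s) * indicator {c..} (X t s)) = 0"
  and "(\<E> s. r * V0 s + X 0 s - X r s) = 0"
proof -
 have lip: "\<bar>min 1 (max 0 (k + real (Suc n) * (y - c))) - min 1 (max 0 (k + real (Suc n) * (z - c)))\<bar> <= real (Suc n) * \<bar>y - z\<bar>"
  for n y z k
 proof -
  have "(k + real (Suc n) * (y - c)) - (k + real (Suc n) * (z - c)) = real (Suc n) * (y - z)" by (simp add: algebra_simps)
  then show ?thesis using lipschitz_clamp[of "k + real (Suc n) * (y - c)" "k + real (Suc n) * (z - c)"]
   by (simp only: abs_mult abs_of_nat)
 qed
 have bd: "\<bar>min 1 (max 0 (k + real (Suc n) * (y - c)))\<bar> <= 1" for n y k by (simp add: min_def max_def)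
 have above: "(\<lambda>n. min 1 (max 0 (k + real (Suc n) * (y - c)))) \<longlonglongrightarrow> 1" if "0 <= k" "c < y" for k y
 proof (rule tendsto_eventually)
  show "\<forall>\<^sub>F n in sequentially. min 1 (max 0 (k + real (Suc n) * (y - c))) = 1"
   by (rule eventually_mono[OF eventually_Suc_mult_gt_1[of "y - c"]]) (use that in \<open>auto simp: min_def max_def\<close>)
 qed
 have below: "(\<lambda>n. min 1 (max 0 (k + real (Suc n) * (y - c)))) \<longlonglongrightarrow> 0" if "k <= 1" "y < c" for k y
 proof (rule tendsto_eventually)
  show "\<forall>\<^sub>F n in sequentially. min 1 (max 0 (k + real (Suc n) * (y - c))) = 0"
  proof (rule eventually_mono[OF eventually_Suc_mult_gt_1[of "c - y"]])
   fix n assume "1 < real (Suc n) * (c - y)"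
   then have "k + real (Suc n) * (y - c) <= 0" using that by (simp add: algebra_simps)
   then show "min 1 (max 0 (k + real (Suc n) * (y - c))) = 0" by (simp add: max_def)
  qed (use that in simp)
 qed
 show "(\<E> s. (r * V0 s + X 0 s - X r s) * indicator {c<..} (X t s)) = 0"
 proof (rule terminal_limit[OF lip bd _ assms])
  fix y show "(\<lambda>n. min 1 (max 0 (0 + real (Suc n) * (y - c)))) \<longlonglongrightarrow> indicator {c<..} y"
   using above[of 0 y] below[of 0 y] by (cases y c rule: linorder_cases) (simp_all add: indicator_def)
 qed
 show "(\<E> s. (r * V0 s + X 0 s - X r s) * indicator {c..} (X t s)) = 0"
 proof (rule terminal_limit[OF lip bd _ assms])
  fix y show "(\<lambda>n. min 1 (max 0 (1 + real (Suc n) * (y - c)))) \<longlonglongrightarrow> indicator {c..} y"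
   using above[of 1 y] below[of 1 y] by (cases y c rule: linorder_cases) (simp_all add: indicator_def)
 qed
 have "(\<E> s. (r * V0 s + X 0 s - X r s) * (\<lambda>_. 1) (X t s)) = 0"
  by (rule terminal_limit[of "\<lambda>_ _. 1" "\<lambda>_. 0" 1 "\<lambda>_. 1", OF _ _ _ assms]) auto
 then show "(\<E> s. r * V0 s + X 0 s - X r s) = 0" by simp
qed

lemma clip_tendsto:
 fixes x :: real
 shows "(\<lambda>n. max (- real n) (min (real n) x)) \<longlonglongrightarrow> x"
proof (rule tendsto_eventually)
 obtain N :: nat where N: "\<bar>x\<bar> <= real N" using real_arch_simple by blast
 show "\<forall>\<^sub>F n in sequentially. max (- real n) (min (real n) x) = x"
 proof (rule eventually_sequentiallyI)
  fix n assume "N <= n"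
  then have "\<bar>x\<bar> <= real n" using N by linarith
  then show "max (- real n) (min (real n) x) = x" by (simp add: min_def max_def abs_le_iff)
 qed
qed

lemma (in sticky_flow) defect_square:
 assumes "0 <= t" shows "integrable unif (\<lambda>s. (t * V0 s + X 0 s - X t s)\<^sup>2)"
 by (intro integrable_square_diff integrable_square_add integrable_square_cmult V0_sq X_square_integrable order_refl assms) measurable

lemma (in sticky_flow) orthogonal_to_position:
 assumes t: "0 <= t"
 shows "(\<E> s. (t * V0 s + X 0 s - X t s) * X t s) = 0"
proof -
 define R where "R s = t * V0 s + X 0 s - X t s" for s
 have Rm [measurable]: "R \<in> borel_measurable borel" unfolding R_def by measurable
 have iRX: "integrable unif (\<lambda>s. R s * X t s)"
  by (rule integrable_mult_of_squares[OF _ _ defect_square[OF t, folded R_def] X_square_integrable[OF t]]) auto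
 have z: "(\<E> s. R s * max (- real n) (min (real n) (X t s))) = 0" for n
  unfolding R_def
  by (rule terminal_limit[of "\<lambda>_ x. max (- real n) (min (real n) x)" "\<lambda>_. 1" "real n", OF _ _ tendsto_const t order_refl])
   (auto simp: min_def max_def)
 have "(\<lambda>n. \<E> s. R s * max (- real n) (min (real n) (X t s))) \<longlonglongrightarrow> (\<E> s. R s * X t s)"
 proof (rule integral_dominated_convergence[where w="\<lambda>s. \<bar>R s * X t s\<bar>"])
  show "integrable unif (\<lambda>s. \<bar>R s * X t s\<bar>)" by (rule integrable_abs[OF iRX])
  show "AE s in unif. (\<lambda>n. R s * max (- real n) (min (real n) (X t s))) \<longlonglongrightarrow> R s * X t s"
   by (intro AE_I2 tendsto_mult tendsto_const clip_tendsto)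
  show "AE s in unif. norm (R s * max (- real n) (min (real n) (X t s))) <= \<bar>R s * X t s\<bar>" for n
   unfolding real_norm_def abs_mult by (intro AE_I2 mult_left_mono) (auto simp: min_def max_def)
 qed measurable
 then show ?thesis unfolding z by (simp add: R_def LIMSEQ_const_iff)
qed

section \<open>The defect has nonpositive mass on right-hand intervals\<close>

text \<open>The indicator of \<open>(m,1)\<close> splits into a function \<open>th\<close> of the
 terminal position and a part \<open>\<delta>\<close> that lives on the block of particles sitting at
 \<open>X t m\<close> and has mean zero there. For \<open>th\<close> the motion is free by
 \<open>terminal_above\<close>. For \<open>\<delta>\<close>, which is negative to the left and positive
 to the right of \<open>m\<close>, the mean of \<open>X\<close> is nonnegative at time 0, vanishes at
 time \<open>t\<close>, and is of higher order shortly before.\<close>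

lemma (in sticky_flow) mean_displacement_step:
 assumes A: "approx_flow X vv v0 w L M R" and \<theta>: "\<theta> > 0" and m: "0 < m" "m < 1"
  and a: "0 < a" "a <= r" "r <= t" "t - r <= 1"
 shows "(\<E> s. (X r s - X 0 s) * indicator {m<..} s) / r - (\<E> s. (X t s - X 0 s) * indicator {m<..} s) / t
  <= (approx_flow.tol X vv w \<theta> t - approx_flow.tol X vv w \<theta> r) / a + approx_flow.C1 L M \<theta> / a * (t - r) * (Mu t - Mu r)"
proof -
 interpret A: approx_flow X vv v0 w L M R by (rule A)
 have r0: "0 < r" "0 <= r" "0 <= t" "0 < t" using a by auto
 define y where "y = X t m"
 define atom where "atom s = (indicator {y} (X t s) :: real)" for s
 have [measurable]: "atom \<in> borel_measurable borel" unfolding atom_def by measurable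
 define k where "k s = (indicator {m<..} s :: real)" for s
 have km [measurable]: "k \<in> borel_measurable borel" unfolding k_def by measurable
 have ib: "integrable unif f" if "f \<in> borel_measurable borel" "\<And>s. \<bar>f s\<bar> <= 1" for f :: "real => real"
  by (rule unif.integrable_const_bound[of _ 1]) (use that in auto)
 define pA where "pA = (\<E> s. atom s)"
 define pB where "pB = (\<E> s. k s * atom s)"
 have ia: "integrable unif atom" by (rule ib) (auto simp: atom_def indicator_def)
 have ika: "integrable unif (\<lambda>s. k s * atom s)" by (rule ib) (auto simp: atom_def k_def indicator_def)
 have pAB: "0 <= pB" "pB <= pA"
  unfolding pA_def pB_def using ia ika by (auto intro!: integral_mono Bochner_Integration.integral_nonneg simp: k_def atom_def indicator_def)
 \<comment> \<open>The fraction of the particles at \<open>y\<close> that have labels above \<open>m\<close>.\<close>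
 define \<alpha> where "\<alpha> = (if pA = 0 then 0 else pB / pA)"
 have \<alpha>: "0 <= \<alpha>" "\<alpha> <= 1" "\<alpha> * pA = pB" using pAB by (auto simp: \<alpha>_def divide_le_eq_1)
 define th where "th s = (1 - \<alpha>) * indicator {y<..} (X t s) + \<alpha> * indicator {y..} (X t s)" for s
 have [measurable]: "th \<in> borel_measurable borel" unfolding th_def by measurable
 define \<delta> where "\<delta> s = (k s - \<alpha>) * atom s" for s
 have dm [measurable]: "\<delta> \<in> borel_measurable borel" unfolding \<delta>_def by measurable
 have \<delta>1: "\<bar>\<delta> s\<bar> <= 1" for s using \<alpha> by (auto simp: \<delta>_def k_def atom_def indicator_def)
 have kd: "AE s in unif. k s = th s + \<delta> s"
 proof (rule AE_unifI)
  fix s :: real assume s: "0 < s" "s < 1"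
  have "X t s <= y" if "s <= m" unfolding y_def using mono_onD[OF X_mono[OF r0(3)], of s m] s m that by auto
  moreover have "y <= X t s" if "m <= s" unfolding y_def using mono_onD[OF X_mono[OF r0(3)], of m s] s m that by auto
  ultimately show "k s = th s + \<delta> s" unfolding k_def th_def \<delta>_def atom_def indicator_def by (cases "m < s") auto
 qed
 have id: "integrable unif \<delta>" by (rule ib[OF dm \<delta>1])
 have E\<delta>: "(\<E> s. \<delta> s) = 0"
 proof -
  have "(\<E> s. \<delta> s) = (\<E> s. k s * atom s - \<alpha> * atom s)" by (simp add: \<delta>_def left_diff_distrib)
  also have "... = pB - \<alpha> * pA" unfolding pA_def pB_def using ia ika by simp
  finally show ?thesis using \<alpha> by simp
 qed
 have E\<delta>f: "(\<E> s. f (X t s) * \<delta> s) = 0" for f :: "real => real"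
 proof -
  have "(\<lambda>s. f (X t s) * \<delta> s) = (\<lambda>s. f y * \<delta> s)" by (rule ext) (simp add: \<delta>_def atom_def indicator_def)
  then show ?thesis using E\<delta> by simp
 qed
 have iXd: "integrable unif (\<lambda>s. X q s * \<delta> s)" if "0 <= q" for q by (rule integrable_X_bounded[OF dm \<delta>1 that])
 have E0: "0 <= (\<E> s. X 0 s * \<delta> s)"
 proof -
  have "0 <= (\<E> s. (X 0 s - X 0 m) * \<delta> s)"
  proof (rule integral_nonneg_AE, rule AE_unifI)
   fix s :: real assume s: "0 < s" "s < 1"
   show "0 <= (X 0 s - X 0 m) * \<delta> s"
   proof (cases "m < s")
    case True
    then have "X 0 m <= X 0 s" using mono_onD[OF X_mono[OF order_refl], of m s] s m by auto
    then show ?thesis using True \<alpha> by (intro mult_nonneg_nonneg) (auto simp: \<delta>_def k_def atom_def indicator_def)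
   next
    case False
    then have "X 0 s <= X 0 m" using mono_onD[OF X_mono[OF order_refl], of s m] s m by auto
    then show ?thesis using False \<alpha> by (intro mult_nonpos_nonpos) (auto simp: \<delta>_def k_def atom_def indicator_def)
   qed
  qed
  also have "... = (\<E> s. X 0 s * \<delta> s) - X 0 m * (\<E> s. \<delta> s)"
   using iXd[of 0] id by (simp add: left_diff_distrib)
  finally show ?thesis using E\<delta> by simp
 qed
 have th1: "\<bar>th s\<bar> <= 1" for s using \<alpha> by (auto simp: th_def indicator_def)
 have iXth: "integrable unif (\<lambda>s. X q s * th s)" if "0 <= q" for q by (rule integrable_X_bounded[OF _ th1 that]) simp
 have iVth: "integrable unif (\<lambda>s. V0 s * th s)"
  by (rule integrable_mult_of_squares[OF _ _ V0_sq unif.integrable_square_bounded[OF _ th1]]) simp_all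
 define v where "v = (\<E> s. V0 s * th s)"
 have Eth: "(\<E> s. X q s * th s) - (\<E> s. X 0 s * th s) = q * v" if q: "0 <= q" "q <= t" for q
 proof -
  define R' where "R' s = q * V0 s + X 0 s - X q s" for s
  have R'm [measurable]: "R' \<in> borel_measurable borel" unfolding R'_def by measurable
  have R'sq: "integrable unif (\<lambda>s. (R' s)\<^sup>2)" using defect_square[OF q(1)] by (simp add: R'_def)
  have i: "integrable unif (\<lambda>s. R' s * indicator S (X t s))" if [measurable]: "S \<in> sets borel" for S
   by (rule integrable_mult_of_squares[OF _ _ R'sq unif.integrable_square_bounded[of _ 1]]) (auto simp: indicator_def)
  have "(\<E> s. R' s * th s) = (\<E> s. (1 - \<alpha>) * (R' s * indicator {y<..} (X t s)) + \<alpha> * (R' s * indicator {y..} (X t s)))"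
   unfolding th_def by (intro Bochner_Integration.integral_cong refl) (simp add: algebra_simps)
  also have "... = (1 - \<alpha>) * (\<E> s. R' s * indicator {y<..} (X t s)) + \<alpha> * (\<E> s. R' s * indicator {y..} (X t s))"
   using i[of "{y<..}"] i[of "{y..}"] by simp
  also have "... = 0" unfolding R'_def terminal_above(1,2)[OF q] by simp
  finally have 1: "(\<E> s. R' s * th s) = 0" .
  have "(\<E> s. R' s * th s) = (\<E> s. q * (V0 s * th s) + X 0 s * th s - X q s * th s)"
   unfolding R'_def by (intro Bochner_Integration.integral_cong refl) (simp add: algebra_simps)
  also have "... = q * v + (\<E> s. X 0 s * th s) - (\<E> s. X q s * th s)"
   unfolding v_def using iXth[of 0] iXth[OF q(1)] iVth by simp
  finally show ?thesis using 1 by simp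
 qed
 define p where "p = (\<E> s. X 0 s * \<delta> s)"
 define x where "x q = (\<E> s. X q s * \<delta> s)" for q
 have u: "(\<E> s. (X q s - X 0 s) * indicator {m<..} s) = x q - p + q * v" if q: "0 <= q" "q <= t" for q
 proof -
  have "(\<E> s. (X q s - X 0 s) * indicator {m<..} s)
    = (\<E> s. (X q s * \<delta> s - X 0 s * \<delta> s) + (X q s * th s - X 0 s * th s))"
  proof (rule integral_cong_AE)
   show "AE s in unif. (X q s - X 0 s) * indicator {m<..} s = X q s * \<delta> s - X 0 s * \<delta> s + (X q s * th s - X 0 s * th s)"
    using kd by eventually_elim (simp add: k_def algebra_simps)
  qed measurable
  also have "... = x q - p + ((\<E> s. X q s * th s) - (\<E> s. X 0 s * th s))"
   unfolding x_def p_def using iXd[of 0] iXd[OF q(1)] iXth[of 0] iXth[OF q(1)] by simp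
  finally show ?thesis unfolding Eth[OF q] .
 qed
 have xt: "x t = 0" unfolding x_def by (rule E\<delta>f)
 define W where "W = (\<E> s. \<bar>X r s - X t s - (r - t) * w t (X t s)\<bar>)"
 have iw: "integrable unif (\<lambda>s. w t (X t s) * \<delta> s)"
  by (rule integrable_mult_of_squares[OF _ _ A.w_sq_int unif.integrable_square_bounded[OF _ \<delta>1]]) simp_all
 have iww: "integrable unif (\<lambda>s. w t (X t s))" by (rule unif.integrable_of_square[OF _ A.w_sq_int]) simp
 have xr: "x r <= W"
 proof -
  have "x r = x r - x t - (r - t) * (\<E> s. w t (X t s) * \<delta> s)" using xt E\<delta>f[of "w t"] by simp
  also have "... = (\<E> s. X r s * \<delta> s - X t s * \<delta> s - (r - t) * (w t (X t s) * \<delta> s))"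
   unfolding x_def using iXd[OF r0(2)] iXd[OF r0(3)] iw by simp
  also have "... <= W"
   unfolding W_def
  proof (rule integral_mono)
   show "integrable unif (\<lambda>s. X r s * \<delta> s - X t s * \<delta> s - (r - t) * (w t (X t s) * \<delta> s))"
    by (intro Bochner_Integration.integrable_diff integrable_mult_right iw iXd r0)
   show "integrable unif (\<lambda>s. \<bar>X r s - X t s - (r - t) * w t (X t s)\<bar>)"
    by (intro integrable_abs Bochner_Integration.integrable_diff integrable_mult_right iww X_integrable r0)
   fix s
   define z where "z = X r s - X t s - (r - t) * w t (X t s)"
   have "z * \<delta> s <= \<bar>z\<bar> * \<bar>\<delta> s\<bar>" by (metis abs_ge_self abs_mult)
   also have "... <= \<bar>z\<bar> * 1" by (rule mult_left_mono[OF \<delta>1]) simp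
   finally have "z * \<delta> s <= \<bar>z\<bar>" by simp
   then show "X r s * \<delta> s - X t s * \<delta> s - (r - t) * (w t (X t s) * \<delta> s) <= \<bar>X r s - X t s - (r - t) * w t (X t s)\<bar>"
    unfolding z_def by (simp add: algebra_simps)
  qed
  finally show ?thesis .
 qed
 have Wb: "W <= (A.tol \<theta> t - A.tol \<theta> r) + A.C1 \<theta> * (t - r) * (Mu t - Mu r)"
 proof -
  have ab: "\<bar>r - t\<bar> = t - r" "\<bar>r - t\<bar> <= 1" using a by auto
  have "\<bar>A.tol \<theta> r - A.tol \<theta> t\<bar> = A.tol \<theta> t - A.tol \<theta> r" using A.tol_mono[OF \<theta> r0(2) a(3)] by simp
  moreover have "dMu t r = Mu t - Mu r" using Mu_mono[OF r0(2) a(3)] by (simp add: dMu_def)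
  ultimately show ?thesis using A.window_bounds(1)[OF \<theta> r0(3) r0(2) ab(2)] unfolding W_def ab(1) by simp
 qed
 have p0: "0 <= p" unfolding p_def by (rule E0)
 have "(x r - p + r * v) / r - (0 - p + t * v) / t = x r / r - (p / r - p / t)"
  using r0 by (simp add: add_divide_distrib diff_divide_distrib)
 also have "... <= x r / r" using p0 a r0 by (simp add: divide_left_mono)
 also have "... <= W / r" using xr r0 by (intro divide_right_mono) auto
 also have "... <= W / a" using a r0 by (intro divide_left_mono) (auto simp: W_def intro!: Bochner_Integration.integral_nonneg)
 also have "... <= ((A.tol \<theta> t - A.tol \<theta> r) + A.C1 \<theta> * (t - r) * (Mu t - Mu r)) / a"
  using Wb a by (intro divide_right_mono) auto
 also have "... = (A.tol \<theta> t - A.tol \<theta> r) / a + A.C1 \<theta> / a * (t - r) * (Mu t - Mu r)"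
  by (simp add: add_divide_distrib)
 finally show ?thesis unfolding u[OF r0(2) a(3)] u[OF r0(3) order_refl] xt .
qed

text \<open>The step errors are removed by subdivision.\<close>

lemma (in sticky_flow) mean_displacement_mono:
 assumes m: "0 < m" "m < 1" and a: "0 < a" "a <= b"
 shows "(\<E> s. (X a s - X 0 s) * indicator {m<..} s) / a <= (\<E> s. (X b s - X 0 s) * indicator {m<..} s) / b"
proof (rule field_le_epsilon)
 fix e :: real assume e: "0 < e"
 have b0: "0 <= b" and a0: "0 <= a" using a by auto
 define u where "u t = (\<E> s. (X t s - X 0 s) * indicator {m<..} s) / t" for t
 obtain w L M R \<theta> where A: "approx_flow X vv v0 w L M R" and \<theta>: "\<theta> > 0"
  and small: "approx_flow.tol X vv w \<theta> b - approx_flow.tol X vv w \<theta> 0 <= e * a"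
  using approximation[OF b0 mult_pos_pos[OF e a(1)]] by blast
 interpret A: approx_flow X vv v0 w L M R by (rule A)
 have "- u b - (- u a) <= A.tol \<theta> b / a - A.tol \<theta> a / a"
 proof (rule subdivision_ineq[OF a(2), where C="A.C1 \<theta> / a" and p=Mu])
  fix c t assume c: "a <= c" "c <= t" "t <= b" "t - c <= 1"
  have "u c - u t <= (A.tol \<theta> t - A.tol \<theta> c) / a + A.C1 \<theta> / a * (t - c) * (Mu t - Mu c)"
   unfolding u_def by (rule mean_displacement_step[OF A \<theta> m a(1) c(1) c(2) c(4)])
  then show "- u t - (- u c) <= A.tol \<theta> t / a - A.tol \<theta> c / a + A.C1 \<theta> / a * (t - c) * (Mu t - Mu c)"
   by (simp add: diff_divide_distrib)
 qed
 also have "... <= (A.tol \<theta> b - A.tol \<theta> 0) / a"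
  unfolding diff_divide_distrib[symmetric] using A.tol_mono[OF \<theta> order_refl a0] a by (intro divide_right_mono) auto
 also have "... <= e * a / a" using small a by (intro divide_right_mono) auto
 finally show "u a <= u b + e" using a by simp
qed

lemma (in sticky_flow) defect_right_interval:
 assumes m: "0 < m" "m < 1" and t: "0 < t"
 shows "(\<E> s. (t * V0 s + X 0 s - X t s) * indicator {m<..} s) <= 0"
proof -
 define k where "k s = (indicator {m<..} s :: real)" for s
 have km [measurable]: "k \<in> borel_measurable borel" unfolding k_def by measurable
 have k1: "\<bar>k s\<bar> <= 1" for s by (simp add: k_def indicator_def)
 have iX: "integrable unif (\<lambda>s. X q s * k s)" if "0 <= q" for q by (rule integrable_X_bounded[OF km k1 that])
 have iV: "integrable unif (\<lambda>s. V0 s * k s)"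
  by (rule integrable_mult_of_squares[OF _ _ V0_sq unif.integrable_square_bounded[OF _ k1]]) simp_all
 have d: "(\<E> s. (X q s - X 0 s) * k s) = (\<E> s. X q s * k s) - (\<E> s. X 0 s * k s)" if "0 <= q" for q
  unfolding left_diff_distrib using iX[OF that] iX[of 0] by simp
 have "(\<E> s. V0 s * k s) <= (\<E> s. (X t s - X 0 s) * k s) / t"
 proof (rule tendsto_upperbound[OF initial_velocity[OF km k1]])
  show "\<forall>\<^sub>F a in at_right 0. ((\<E> s. X a s * k s) - (\<E> s. X 0 s * k s)) / a <= (\<E> s. (X t s - X 0 s) * k s) / t"
   unfolding eventually_at_right_field
   using mean_displacement_mono[OF m, of _ t, folded k_def] d t by (intro exI[of _ t]) auto
 qed simp
 then have "t * (\<E> s. V0 s * k s) <= (\<E> s. (X t s - X 0 s) * k s)"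
  using t by (simp add: le_divide_eq mult.commute)
 moreover have "(\<E> s. (t * V0 s + X 0 s - X t s) * k s) = t * (\<E> s. V0 s * k s) - (\<E> s. (X t s - X 0 s) * k s)"
 proof -
  have "(\<E> s. (t * V0 s + X 0 s - X t s) * k s) = (\<E> s. t * (V0 s * k s) - (X t s * k s - X 0 s * k s))"
   by (intro Bochner_Integration.integral_cong refl) (simp add: algebra_simps)
  then show ?thesis using iX[of t] iX[of 0] iV d[of t] t by simp
 qed
 ultimately show ?thesis by (simp add: k_def)
qed

section \<open>The defect lies in the polar of the monotone cone\<close>

text \<open>The identity truncated at \<open>\<plusminus> Suc i\<close> and rounded up to the grid of width \<open>1 / Suc i\<close>, written through indicators of half lines.\<close>

definition stair :: "nat => real => real" where
 "stair i x = (\<Sum>j<2 * (Suc i)\<^sup>2. indicator {real j / real (Suc i) - real (Suc i)<..} x) / real (Suc i) - real (Suc i)"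

lemma stair_closed:
 "stair i x = real (min (2 * (Suc i)\<^sup>2) (nat \<lceil>(x + real (Suc i)) * real (Suc i)\<rceil>)) / real (Suc i) - real (Suc i)"
proof -
 define n where "n = real (Suc i)"
 have n: "0 < n" by (simp add: n_def)
 have "(\<Sum>j<2 * (Suc i)\<^sup>2. indicator {real j / n - n<..} x) = (\<Sum>j<2 * (Suc i)\<^sup>2. if j < nat \<lceil>(x + n) * n\<rceil> then 1 else (0 :: real))"
 proof (rule sum.cong[OF refl])
  fix j
  have "real j / n - n < x \<longleftrightarrow> real j < (x + n) * n" using n by (simp add: less_diff_eq diff_less_eq pos_divide_less_eq)
  also have "... \<longleftrightarrow> j < nat \<lceil>(x + n) * n\<rceil>" by (simp add: zless_nat_eq_int_zless less_ceiling_iff)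
  finally show "indicator {real j / n - n<..} x = (if j < nat \<lceil>(x + n) * n\<rceil> then 1 else (0 :: real))" by (simp add: indicator_def)
 qed
 also have "... = real (card {j. j < 2 * (Suc i)\<^sup>2 \<and> j < nat \<lceil>(x + n) * n\<rceil>})"
  by (subst sum.inter_filter[symmetric]) (auto intro!: arg_cong[where f=card])
 also have "{j. j < 2 * (Suc i)\<^sup>2 \<and> j < nat \<lceil>(x + n) * n\<rceil>} = {..<min (2 * (Suc i)\<^sup>2) (nat \<lceil>(x + n) * n\<rceil>)}" by auto
 finally show ?thesis unfolding stair_def n_def[symmetric] by simp
qed

lemma stair_error:
 assumes "\<bar>x\<bar> <= real (Suc i)"
 shows "\<bar>stair i x - x\<bar> <= 1 / real (Suc i)"
proof -
 define n where "n = real (Suc i)"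
 have n: "0 < n" "n * n = real ((Suc i)\<^sup>2)" by (simp_all only: n_def power2_eq_square of_nat_mult of_nat_0_less_iff zero_less_Suc)
 have x: "0 <= x + n" "x + n <= 2 * n" using assms unfolding n_def[symmetric] by auto
 define y where "y = (x + n) * n"
 have "0 <= y" unfolding y_def using x n by (intro mult_nonneg_nonneg) auto
 have "y <= (2 * n) * n" unfolding y_def using x n by (intro mult_right_mono) auto
 also have "... = real (2 * (Suc i)\<^sup>2)" by (simp only: mult.assoc n(2) of_nat_mult of_nat_numeral)
 finally have "\<lceil>y\<rceil> <= int (2 * (Suc i)\<^sup>2)" by (simp only: ceiling_le_iff of_int_of_nat_eq)
 then have "nat \<lceil>y\<rceil> <= 2 * (Suc i)\<^sup>2" by (simp only: nat_le_iff)
 then have st: "stair i x = real (nat \<lceil>y\<rceil>) / n - n"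
  unfolding stair_closed n_def[symmetric] y_def[symmetric] by (simp only: min.absorb2)
 have "y <= real (nat \<lceil>y\<rceil>)" "real (nat \<lceil>y\<rceil>) <= y + 1" using \<open>0 <= y\<close> by linarith+
 then have "y / n <= real (nat \<lceil>y\<rceil>) / n" "real (nat \<lceil>y\<rceil>) / n <= (y + 1) / n" using n by (auto intro!: divide_right_mono)
 moreover have "y / n = x + n" "(y + 1) / n = x + n + 1 / n" using n by (auto simp: y_def add_divide_distrib)
 ultimately show ?thesis unfolding st n_def[symmetric] by linarith
qed

lemma stair_bound: "\<bar>stair i x\<bar> <= \<bar>x\<bar> + 1"
proof -
 define n where "n = real (Suc i)"
 have n: "1 <= n" by (simp add: n_def)
 have nn: "n * n = real ((Suc i)\<^sup>2)" by (simp only: n_def power2_eq_square of_nat_mult)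
 consider "\<bar>x\<bar> <= n" | "n < x" | "x < - n" by linarith
 then show ?thesis
 proof cases
  case 1
  have "1 / n <= 1" using n by simp
  then show ?thesis using stair_error[of x i] 1 unfolding n_def by linarith
 next
  case 2
  have K: "real (2 * (Suc i)\<^sup>2) = (2 * n) * n" by (simp only: mult.assoc nn of_nat_mult of_nat_numeral)
  have "real (2 * (Suc i)\<^sup>2) = (2 * n) * n" by (rule K)
  also have "... <= (x + n) * n" using 2 n by (intro mult_right_mono) auto
  finally have "2 * (Suc i)\<^sup>2 <= nat \<lceil>(x + n) * n\<rceil>" by linarith
  then have "stair i x = real (2 * (Suc i)\<^sup>2) / n - n"
   unfolding stair_closed n_def[symmetric] by (simp only: min.absorb1)
  also have "... = n" unfolding K using n by simp
  finally show ?thesis using 2 n by linarith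
 next
  case 3
  have "(x + n) * n <= 0" using 3 n by (intro mult_nonpos_nonneg) auto
  then have "nat \<lceil>(x + n) * n\<rceil> = 0" by simp
  then have "stair i x = - n" unfolding stair_closed n_def[symmetric] by simp
  then show ?thesis using 3 n by linarith
 qed
qed

lemma stair_tendsto: "(\<lambda>i. stair i x) \<longlonglongrightarrow> x"
proof -
 have "(\<lambda>i. stair i x - x) \<longlonglongrightarrow> 0"
 proof (rule Lim_null_comparison[OF _ tendsto_div_nat[of 1]])
  obtain N :: nat where N: "\<bar>x\<bar> <= real N" using real_arch_simple by blast
  show "\<forall>\<^sub>F i in sequentially. norm (stair i x - x) <= 1 / real (Suc i)"
  proof (rule eventually_sequentiallyI)
   fix i assume "N <= i"
   then have "\<bar>x\<bar> <= real (Suc i)" using N by simp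
   then show "norm (stair i x - x) <= 1 / real (Suc i)" unfolding real_norm_def by (rule stair_error)
  qed
 qed
 then show ?thesis by (simp only: LIM_zero_iff)
qed

lemma AE_unif_neq: "AE s in unif. s \<noteq> (m :: real)"
 unfolding unif_density by (subst AE_density) (auto intro: AE_mp[OF AE_lborel_singleton[of m]])

text \<open>The set where \<open>k\<close> exceeds a level is, up to one point, a right-hand interval,
 empty, or everything.\<close>

lemma (in sticky_flow) defect_upper_level:
 fixes k :: "real => real"
 assumes km [measurable]: "k \<in> borel_measurable borel" and k: "mono_on {0<..<1} k" and t: "0 < t"
 shows "(\<E> s. (t * V0 s + X 0 s - X t s) * indicator {l<..} (k s)) <= 0"
proof -
 define D where "D = {s. 0 < s \<and> s < 1 \<and> l < k s}"
 have up: "s' \<in> D" if "s \<in> D" "s <= s'" "s' < 1" for s s'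
 proof -
  have a: "0 < s" "l < k s" "0 < s'" using that by (auto simp: D_def)
  have "k s <= k s'" by (rule mono_onD[OF k]) (use that a in auto)
  then show ?thesis using a that by (simp add: D_def)
 qed
 have [measurable]: "(\<lambda>s. indicator {l<..} (k s) :: real) \<in> borel_measurable borel"
  by (rule measurable_compose[OF km]) simp
 consider "D = {}" | "D \<noteq> {}" "Inf D <= 0" | "D \<noteq> {}" "0 < Inf D" by linarith
 then show ?thesis
 proof cases
  case 1
  have "(\<E> s. (t * V0 s + X 0 s - X t s) * indicator {l<..} (k s)) = (\<E> s. 0)"
  proof (rule integral_cong_AE)
   show "AE s in unif. (t * V0 s + X 0 s - X t s) * indicator {l<..} (k s) = 0"
    using 1 by (intro AE_unifI) (auto simp: D_def indicator_def)
  qed simp_all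
  then show ?thesis by simp
 next
  case 2
  have all: "s \<in> D" if "0 < s" "s < 1" for s
  proof -
   have lt: "Inf D < s" using 2(2) that by linarith
   obtain s' where "s' \<in> D" "s' < s" using cInf_lessD[OF 2(1) lt] by (elim bexE) (rule that)
   then show ?thesis using up[of s' s] that by auto
  qed
  have "(\<E> s. (t * V0 s + X 0 s - X t s) * indicator {l<..} (k s)) = (\<E> s. t * V0 s + X 0 s - X t s)"
  proof (rule integral_cong_AE)
   show "AE s in unif. (t * V0 s + X 0 s - X t s) * indicator {l<..} (k s) = t * V0 s + X 0 s - X t s"
    using all by (intro AE_unifI) (auto simp: D_def indicator_def)
  qed simp_all
  then show ?thesis using terminal_above(3)[of t t] t by simp
 next
  case 3
  define m where "m = Inf D"
  have bb: "bdd_below D" by (auto simp: D_def intro!: bdd_belowI[of _ 0])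
  obtain d where d: "d \<in> D" using 3 by auto
  have m: "0 < m" "m < 1"
  proof -
   show "0 < m" using 3 by (simp add: m_def)
   have "m <= d" unfolding m_def by (rule cInf_lower[OF d bb])
   then show "m < 1" using d by (auto simp: D_def)
  qed
  have "(\<E> s. (t * V0 s + X 0 s - X t s) * indicator {l<..} (k s)) = (\<E> s. (t * V0 s + X 0 s - X t s) * indicator {m<..} s)"
  proof (rule integral_cong_AE)
   show "AE s in unif. (t * V0 s + X 0 s - X t s) * indicator {l<..} (k s) = (t * V0 s + X 0 s - X t s) * indicator {m<..} s"
    using AE_unif_neq[of m] AE_unif
   proof eventually_elim
    case (elim s)
    have "s \<in> D \<longleftrightarrow> m < s"
    proof
     assume "s \<in> D"
     then have "m <= s" unfolding m_def by (rule cInf_lower[OF _ bb])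
     then show "m < s" using elim by simp
    next
     assume "m < s"
     then obtain s' where "s' \<in> D" "s' < s" using cInf_lessD[OF 3(1), of s] unfolding m_def by auto
     then show "s \<in> D" using up[of s' s] elim by auto
    qed
    then have "l < k s \<longleftrightarrow> m < s" using elim by (auto simp: D_def)
    then show ?case by (simp add: indicator_def)
   qed
  qed simp_all
  then show ?thesis using defect_right_interval[OF m t] by simp
 qed
qed

text \<open>Staircase approximations are sums of indicators of upper level sets.\<close>

lemma (in sticky_flow) defect_polar:
 fixes k :: "real => real"
 assumes km [measurable]: "k \<in> borel_measurable borel" and k: "mono_on {0<..<1} k"
  and k2: "integrable unif (\<lambda>s. (k s)\<^sup>2)" and t: "0 < t"
 shows "(\<E> s. (t * V0 s + X 0 s - X t s) * k s) <= 0"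
proof -
 define R where "R s = t * V0 s + X 0 s - X t s" for s
 have Rm [measurable]: "R \<in> borel_measurable borel" unfolding R_def by measurable
 have R2: "integrable unif (\<lambda>s. (R s)\<^sup>2)" unfolding R_def by (rule defect_square) (use t in simp)
 have iR: "integrable unif R" by (rule unif.integrable_of_square[OF _ R2]) simp
 have iRk: "integrable unif (\<lambda>s. R s * k s)" by (rule integrable_mult_of_squares[OF _ _ R2 k2]) simp_all
 have sm [measurable]: "stair i \<in> borel_measurable borel" for i unfolding stair_def[abs_def] by measurable
 have step: "(\<E> s. R s * stair i (k s)) <= 0" for i
 proof -
  define n where "n = real (Suc i)"
  have i1: "integrable unif (\<lambda>s. R s * indicator {l<..} (k s))" for l
   by (rule integrable_mult_of_squares[OF _ _ R2 unif.integrable_square_bounded[of _ 1]]) (auto simp: indicator_def)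
  have "(\<E> s. R s * stair i (k s))
    = (\<E> s. (\<Sum>j<2 * (Suc i)\<^sup>2. R s * indicator {real j / n - n<..} (k s)) / n - n * R s)"
   unfolding stair_def n_def[symmetric]
   by (intro Bochner_Integration.integral_cong refl) (simp add: right_diff_distrib sum_distrib_left)
  also have "... = (\<Sum>j<2 * (Suc i)\<^sup>2. \<E> s. R s * indicator {real j / n - n<..} (k s)) / n - n * (\<E> s. R s)"
  proof -
   have "integrable unif (\<lambda>s. (\<Sum>j<2 * (Suc i)\<^sup>2. R s * indicator {real j / n - n<..} (k s)) / n)"
    by (intro integrable_divide Bochner_Integration.integrable_sum i1)
   then show ?thesis
    by (simp only: Bochner_Integration.integral_diff[OF _ integrable_mult_right[OF iR]] integral_divide_zero
      integral_mult_right_zero Bochner_Integration.integral_sum[OF i1])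
  qed
  also have "(\<E> s. R s) = 0" unfolding R_def using terminal_above(3)[of t t] t by simp
  also have "(\<Sum>j<2 * (Suc i)\<^sup>2. \<E> s. R s * indicator {real j / n - n<..} (k s)) / n - n * 0 <= 0"
  proof -
   have "(\<Sum>j<2 * (Suc i)\<^sup>2. \<E> s. R s * indicator {real j / n - n<..} (k s)) <= 0"
    unfolding R_def by (intro sum_nonpos defect_upper_level[OF km k t])
   then show ?thesis by (simp add: divide_nonpos_nonneg n_def)
  qed
  finally show ?thesis .
 qed
 have "(\<lambda>i. \<E> s. R s * stair i (k s)) \<longlonglongrightarrow> (\<E> s. R s * k s)"
 proof (rule integral_dominated_convergence[where w="\<lambda>s. \<bar>R s * k s\<bar> + \<bar>R s\<bar>"])
  show "integrable unif (\<lambda>s. \<bar>R s * k s\<bar> + \<bar>R s\<bar>)" by (intro Bochner_Integration.integrable_add integrable_abs iRk iR)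
  show "AE s in unif. (\<lambda>i. R s * stair i (k s)) \<longlonglongrightarrow> R s * k s" by (intro AE_I2 tendsto_mult tendsto_const stair_tendsto)
  show "AE s in unif. norm (R s * stair i (k s)) <= \<bar>R s * k s\<bar> + \<bar>R s\<bar>" for i
  proof (rule AE_I2)
   fix s
   have "\<bar>R s\<bar> * \<bar>stair i (k s)\<bar> <= \<bar>R s\<bar> * (\<bar>k s\<bar> + 1)" by (rule mult_left_mono[OF stair_bound]) simp
   then show "norm (R s * stair i (k s)) <= \<bar>R s * k s\<bar> + \<bar>R s\<bar>" by (simp add: abs_mult distrib_left)
  qed
 qed simp_all
 then have "(\<E> s. R s * k s) <= 0" by (rule LIMSEQ_le_const2) (use step in auto)
 then show ?thesis by (simp add: R_def)
qed

section \<open>The limit of the rescaled flow is the projection of the initial velocity\<close>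

context sticky_flow
begin

abbreviation nrm :: "real => real => real" where "nrm t s \<equiv> X t s / t"

lemma nrm_square: "0 < t ==> integrable unif (\<lambda>s. (nrm t s)\<^sup>2)"
 by (rule integrable_square_cmult(3)[OF X_square_integrable]) simp

lemma variational:
 fixes k :: "real => real"
 assumes [measurable]: "k \<in> borel_measurable borel" and "mono_on {0<..<1} k" "integrable unif (\<lambda>s. (k s)\<^sup>2)" and t: "0 < t"
 shows "(\<E> s. (X 0 s / t + V0 s - nrm t s) * (k s - nrm t s)) <= 0"
proof -
 have t0: "0 <= t" using t by simp
 define R where "R s = t * V0 s + X 0 s - X t s" for s
 have Rm [measurable]: "R \<in> borel_measurable borel" unfolding R_def by measurable
 have R2: "integrable unif (\<lambda>s. (R s)\<^sup>2)" unfolding R_def by (rule defect_square[OF t0])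
 have i1: "integrable unif (\<lambda>s. R s * k s)" by (rule integrable_mult_of_squares[OF _ _ R2 assms(3)]) simp_all
 have i2: "integrable unif (\<lambda>s. R s * X t s)" by (rule integrable_mult_of_squares[OF _ _ R2 X_square_integrable[OF t0]]) simp_all
 have "(\<E> s. (X 0 s / t + V0 s - nrm t s) * (k s - nrm t s)) = (\<E> s. (1 / t) * (R s * k s) - (1 / (t * t)) * (R s * X t s))"
  unfolding R_def using t by (intro Bochner_Integration.integral_cong refl) (simp add: field_simps)
 also have "... = (1 / t) * (\<E> s. R s * k s) - (1 / (t * t)) * (\<E> s. R s * X t s)"
  using i1 i2 by (simp only: Bochner_Integration.integral_diff[OF integrable_mult_right[OF i1] integrable_mult_right[OF i2]] integral_mult_right_zero)
 also have "(\<E> s. R s * X t s) = 0" unfolding R_def by (rule orthogonal_to_position[OF t0])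
 also have "(1 / t) * (\<E> s. R s * k s) - (1 / (t * t)) * 0 <= 0"
  using defect_polar[OF assms] t unfolding R_def[symmetric] by (simp add: divide_nonpos_pos)
 finally show ?thesis .
qed

lemma nrm_mono: "0 < t ==> mono_on {0<..<1} (nrm t)"
 using X_mono[of t] by (auto simp: mono_on_def divide_right_mono)

text \<open>The variational inequality at each of the two times is tested with the position at the other
 one.\<close>

lemma nrm_distance:
 assumes t: "0 < t" and r: "0 < r"
 shows "(\<E> s. (nrm r s - nrm t s)\<^sup>2) <= (1 / t - 1 / r)\<^sup>2 * (\<E> s. (X 0 s)\<^sup>2)"
proof -
 define c where "c = 1 / t - 1 / r"
 have nm [measurable]: "nrm q \<in> borel_measurable borel" for q by measurable
 define d where "d s = nrm r s - nrm t s" for s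
 have dm [measurable]: "d \<in> borel_measurable borel" unfolding d_def by measurable
 have d2: "integrable unif (\<lambda>s. (d s)\<^sup>2)" unfolding d_def
  by (rule integrable_square_diff[OF _ _ nrm_square[OF r] nrm_square[OF t]]) simp_all
 define g where "g q s = X 0 s / q + V0 s - nrm q s" for q s
 have gm [measurable]: "g q \<in> borel_measurable borel" for q unfolding g_def by measurable
 have g2: "integrable unif (\<lambda>s. (g q s)\<^sup>2)" if "0 < q" for q unfolding g_def
  by (intro integrable_square_diff integrable_square_add integrable_square_cmult X0_sq V0_sq nrm_square that) measurable
 have i: "integrable unif (\<lambda>s. g q s * d s)" if "0 < q" for q
  by (rule integrable_mult_of_squares[OF _ _ g2[OF that] d2]) simp_all
 have 1: "(\<E> s. g t s * d s) <= 0"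
  unfolding g_def d_def by (rule variational[OF nm nrm_mono[OF r] nrm_square[OF r] t])
 have "(\<E> s. g r s * (nrm t s - nrm r s)) <= 0"
  unfolding g_def by (rule variational[OF nm nrm_mono[OF t] nrm_square[OF t] r])
 moreover have "g r s * (nrm t s - nrm r s) = - (g r s * d s)" for s by (simp add: d_def algebra_simps)
 ultimately have 2: "0 <= (\<E> s. g r s * d s)" by simp
 have "(\<E> s. (d s)\<^sup>2 / 2 - c\<^sup>2 * (X 0 s)\<^sup>2 / 2) <= (\<E> s. g t s * d s - g r s * d s)"
 proof (rule integral_mono)
  show "integrable unif (\<lambda>s. (d s)\<^sup>2 / 2 - c\<^sup>2 * (X 0 s)\<^sup>2 / 2)"
   by (intro Bochner_Integration.integrable_diff integrable_divide integrable_mult_right d2 X0_sq)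
  show "integrable unif (\<lambda>s. g t s * d s - g r s * d s)" by (intro Bochner_Integration.integrable_diff i t r)
  fix s
  have "g t s * d s - g r s * d s = c * X 0 s * d s + (d s)\<^sup>2"
   unfolding g_def c_def d_def by (simp add: power2_eq_square algebra_simps diff_divide_distrib)
  moreover have "0 <= (c * X 0 s + d s)\<^sup>2" by simp
  ultimately show "(d s)\<^sup>2 / 2 - c\<^sup>2 * (X 0 s)\<^sup>2 / 2 <= g t s * d s - g r s * d s"
   by (simp add: power2_sum power_mult_distrib)
 qed
 moreover have "(\<E> s. g t s * d s - g r s * d s) = (\<E> s. g t s * d s) - (\<E> s. g r s * d s)"
  by (rule Bochner_Integration.integral_diff[OF i[OF t] i[OF r]])
 moreover have "(\<E> s. (d s)\<^sup>2 / 2 - c\<^sup>2 * (X 0 s)\<^sup>2 / 2) = (\<E> s. (d s)\<^sup>2) / 2 - c\<^sup>2 * (\<E> s. (X 0 s)\<^sup>2) / 2"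
  using d2 X0_sq by simp
 ultimately show ?thesis using 1 2 unfolding d_def c_def by linarith
qed

lemma increments_decrease:
 assumes "0 < r" "r <= t" "0 < s1" "s1 < s2" "s2 < 1"
 shows "nrm t s2 - nrm t s1 <= nrm r s2 - nrm r s1"
proof -
 have "(X t s2 - X t s1) / t <= t / r * (X r s2 - X r s1) / t" using sticky[OF assms] assms by (intro divide_right_mono) auto
 then show ?thesis using assms by (simp add: diff_divide_distrib)
qed

text \<open>Stickiness makes all increments of \<open>nrm t\<close> monotone in \<open>t\<close>, hence
 pointwise convergent, and dominated by those at time 1. The value at \<open>1/2\<close> converges
 since the mean momentum is conserved.\<close>

lemma rescaled_limit:
 obtains P D where "P \<in> borel_measurable borel" "D \<in> borel_measurable borel" "integrable unif (\<lambda>s. (D s)\<^sup>2)"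
  "\<And>i s. 0 < s ==> s < 1 ==> \<bar>nrm (real (Suc i)) s\<bar> <= D s"
  "\<And>s. 0 < s ==> s < 1 ==> (\<lambda>i. nrm (real (Suc i)) s) \<longlonglongrightarrow> P s"
proof -
 define n where "n i s = nrm (real (Suc i)) s" for i s
 have nm [measurable]: "n i \<in> borel_measurable borel" for i unfolding n_def by measurable
 \<comment> \<open>Differences to a fixed label are monotone in \<open>i\<close>, which \<open>n i s\<close> itself need not be.\<close>
 define d where "d i s = n i s - n i (1/2)" for i s
 have dm [measurable]: "d i \<in> borel_measurable borel" for i unfolding d_def by measurable
 have nmono: "n i s <= n i s'" if "0 < s" "s <= s'" "s' < 1" for i s s'
  unfolding n_def using mono_onD[OF nrm_mono[of "real (Suc i)"], of s s'] that by auto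
 have dec: "n j s2 - n j s1 <= n i s2 - n i s1" if "i <= j" "0 < s1" "s1 <= s2" "s2 < 1" for i j s1 s2
 proof (cases "s1 = s2")
  case False
  then show ?thesis unfolding n_def using that by (intro increments_decrease) auto
 qed simp
 have bound: "\<bar>d i s\<bar> <= \<bar>d 0 s\<bar>" if s: "0 < s" "s < 1" for i s
  using nmono[of s "1/2" i] nmono[of "1/2" s i] nmono[of s "1/2" 0] nmono[of "1/2" s 0] dec[of 0 i s "1/2"] dec[of 0 i "1/2" s] s
  unfolding d_def by (cases "s <= 1/2") auto
 have conv: "convergent (\<lambda>i. d i s)" if s: "0 < s" "s < 1" for s
 proof (rule Bseq_monoseq_convergent)
  show "Bseq (\<lambda>i. d i s)" by (rule BseqI'[of _ "\<bar>d 0 s\<bar>"]) (use bound s in simp)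
  show "monoseq (\<lambda>i. d i s)"
  proof (cases "s <= 1/2")
   case True
   have "d i s <= d j s" if "i <= j" for i j using dec[OF that, of s "1/2"] True s unfolding d_def by auto
   then show ?thesis by (auto simp: monoseq_def)
  next
   case False
   have "d j s <= d i s" if "i <= j" for i j using dec[OF that, of "1/2" s] False s unfolding d_def by auto
   then show ?thesis by (auto simp: monoseq_def)
  qed
 qed
 have n2: "integrable unif (\<lambda>s. (n i s)\<^sup>2)" for i unfolding n_def by (rule nrm_square) simp
 have c2: "integrable unif (\<lambda>s. c\<^sup>2)" for c :: real by simp
 have d2: "integrable unif (\<lambda>s. (d i s)\<^sup>2)" for i
  unfolding d_def by (rule integrable_square_diff[OF _ _ n2 c2]) simp_all
 have di: "integrable unif (d i)" for i by (rule unif.integrable_of_square[OF _ d2]) simp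
 define dl where "dl s = lim (\<lambda>i. d i s)" for s
 have dlm [measurable]: "dl \<in> borel_measurable borel" unfolding dl_def by (rule borel_measurable_lim_metric[OF dm])
 have dl: "(\<lambda>i. d i s) \<longlonglongrightarrow> dl s" if "0 < s" "s < 1" for s
  using conv[OF that] unfolding dl_def by (simp add: convergent_LIMSEQ_iff)
 have "(\<lambda>i. \<E> s. d i s) \<longlonglongrightarrow> (\<E> s. dl s)"
 proof (rule integral_dominated_convergence[where w="\<lambda>s. \<bar>d 0 s\<bar>"])
  show "integrable unif (\<lambda>s. \<bar>d 0 s\<bar>)" by (rule integrable_abs[OF di])
  show "AE s in unif. (\<lambda>i. d i s) \<longlonglongrightarrow> dl s" by (rule AE_unifI) (rule dl)
  show "AE s in unif. norm (d i s) <= \<bar>d 0 s\<bar>" for i by (rule AE_unifI) (use bound in simp)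
 qed simp_all
 moreover have "(\<lambda>i. (\<E> s. V0 s) + (\<E> s. X 0 s) / real (Suc i)) \<longlonglongrightarrow> (\<E> s. V0 s) + 0"
  by (intro tendsto_add tendsto_const tendsto_div_nat)
 moreover have "n i (1/2) = (\<E> s. V0 s) + (\<E> s. X 0 s) / real (Suc i) - (\<E> s. d i s)" for i
 proof -
  define t where "t = real (Suc i)"
  have t: "0 < t" "0 <= t" by (auto simp: t_def)
  have iV: "integrable unif V0" by (rule unif.integrable_of_square[OF _ V0_sq]) simp
  have "(\<E> s. d i s) = (\<E> s. n i s) - n i (1/2)"
   unfolding d_def using unif.integrable_of_square[OF _ n2[of i]] by simp
  moreover have "(\<E> s. n i s) = (\<E> s. X t s) / t" unfolding n_def t_def by (rule integral_divide_zero)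
  moreover have "t * (\<E> s. V0 s) + (\<E> s. X 0 s) - (\<E> s. X t s) = 0"
   using terminal_above(3)[OF t(2) order_refl] iV X_integrable[OF t(2)] X_integrable[OF order_refl] by simp
  then have "(\<E> s. X t s) / t = (t * (\<E> s. V0 s) + (\<E> s. X 0 s)) / t" by simp
  then have "(\<E> s. X t s) / t = (\<E> s. V0 s) + (\<E> s. X 0 s) / t" using t by (simp add: add_divide_distrib)
  ultimately show ?thesis unfolding t_def by simp
 qed
 ultimately have mid: "(\<lambda>i. n i (1/2)) \<longlonglongrightarrow> (\<E> s. V0 s) + 0 - (\<E> s. dl s)"
  by (simp only:) (rule tendsto_diff)
 define q where "q = (\<E> s. V0 s) + 0 - (\<E> s. dl s)"
 obtain Bc where Bc: "\<And>i. \<bar>n i (1/2)\<bar> <= Bc"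
  using convergent_imp_Bseq[OF convergentI[OF mid]] by (auto simp: Bseq_def)
 show thesis
 proof (rule that[of "\<lambda>s. dl s + q" "\<lambda>s. \<bar>d 0 s\<bar> + Bc"])
  show "(\<lambda>s. dl s + q) \<in> borel_measurable borel" "(\<lambda>s. \<bar>d 0 s\<bar> + Bc) \<in> borel_measurable borel" by measurable
  show "integrable unif (\<lambda>s. (\<bar>d 0 s\<bar> + Bc)\<^sup>2)"
  proof (rule integrable_square_add[OF _ _ _ c2])
   show "integrable unif (\<lambda>s. \<bar>d 0 s\<bar>\<^sup>2)" using d2[of 0] by simp
  qed simp_all
  show "\<bar>nrm (real (Suc i)) s\<bar> <= \<bar>d 0 s\<bar> + Bc" if "0 < s" "s < 1" for i s
   using bound[OF that, of i] Bc[of i] unfolding d_def n_def by linarith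
  show "(\<lambda>i. nrm (real (Suc i)) s) \<longlonglongrightarrow> dl s + q" if "0 < s" "s < 1" for s
   using tendsto_add[OF dl[OF that] mid] unfolding q_def d_def n_def by simp
 qed
qed

lemma rescaled_projection:
 obtains P where "P \<in> borel_measurable borel" "mono_on {0<..<1} P" "integrable unif (\<lambda>s. (P s)\<^sup>2)"
  "\<And>k :: real => real. k \<in> borel_measurable borel ==> mono_on {0<..<1} k ==> integrable unif (\<lambda>s. (k s)\<^sup>2) ==>
   (\<E> s. (V0 s - P s) * (k s - P s)) <= 0"
  "\<And>t. 0 < t ==> (\<E> s. (nrm t s - P s)\<^sup>2) <= (\<E> s. (X 0 s)\<^sup>2) / t\<^sup>2"
proof -
 obtain P D where Pm [measurable]: "P \<in> borel_measurable borel" and Dm [measurable]: "D \<in> borel_measurable borel"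
  and D2: "integrable unif (\<lambda>s. (D s)\<^sup>2)"
  and nD: "\<And>i s. 0 < s ==> s < 1 ==> \<bar>nrm (real (Suc i)) s\<bar> <= D s"
  and lim: "\<And>s. 0 < s ==> s < 1 ==> (\<lambda>i. nrm (real (Suc i)) s) \<longlonglongrightarrow> P s"
  using rescaled_limit by blast
 have PD: "\<bar>P s\<bar> <= D s" if s: "0 < s" "s < 1" for s
  by (rule LIMSEQ_le_const2[OF tendsto_rabs[OF lim[OF s]]]) (use nD[OF s] in auto)
 have P2: "integrable unif (\<lambda>s. (P s)\<^sup>2)"
 proof (rule Bochner_Integration.integrable_bound[OF D2])
  show "AE s in unif. norm ((P s)\<^sup>2) <= norm ((D s)\<^sup>2)"
  proof (rule AE_unifI)
   fix s :: real assume "0 < s" "s < 1"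
   then have "\<bar>P s\<bar> <= \<bar>D s\<bar>" using PD[of s] by linarith
   then show "norm ((P s)\<^sup>2) <= norm ((D s)\<^sup>2)" by (simp add: abs_le_square_iff)
  qed
 qed simp
 show thesis
 proof (rule that[OF Pm _ P2])
  show "mono_on {0<..<1} P"
  proof (rule mono_onI)
   fix s s' :: real assume s: "s \<in> {0<..<1}" "s' \<in> {0<..<1}" "s <= s'"
   have "nrm (real (Suc i)) s <= nrm (real (Suc i)) s'" for i
    using mono_onD[OF nrm_mono[of "real (Suc i)"] s] by simp
   then show "P s <= P s'" using s by (intro LIMSEQ_le[OF lim lim]) auto
  qed
 next
  fix k :: "real => real" assume km [measurable]: "k \<in> borel_measurable borel" and k: "mono_on {0<..<1} k" and k2: "integrable unif (\<lambda>s. (k s)\<^sup>2)"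
  define a where "a i s = X 0 s / real (Suc i) + V0 s - nrm (real (Suc i)) s" for i s
  define w where "w s = (\<bar>X 0 s\<bar> + \<bar>V0 s\<bar> + D s) * (\<bar>k s\<bar> + D s)" for s
  have "(\<lambda>i. \<E> s. a i s * (k s - nrm (real (Suc i)) s)) \<longlonglongrightarrow> (\<E> s. (V0 s - P s) * (k s - P s))"
  proof (rule integral_dominated_convergence[where w=w])
   show "integrable unif w"
    unfolding w_def
   proof (rule integrable_mult_of_squares)
    show "integrable unif (\<lambda>s. (\<bar>X 0 s\<bar> + \<bar>V0 s\<bar> + D s)\<^sup>2)"
     by (intro integrable_square_add) (use X0_sq V0_sq D2 in simp_all)
    show "integrable unif (\<lambda>s. (\<bar>k s\<bar> + D s)\<^sup>2)"
     by (intro integrable_square_add) (use k2 D2 in simp_all)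
   qed measurable
   show "AE s in unif. (\<lambda>i. a i s * (k s - nrm (real (Suc i)) s)) \<longlonglongrightarrow> (V0 s - P s) * (k s - P s)"
   proof (rule AE_unifI)
    fix s :: real assume s: "0 < s" "s < 1"
    have "(\<lambda>i. a i s * (k s - nrm (real (Suc i)) s)) \<longlonglongrightarrow> (0 + V0 s - P s) * (k s - P s)"
     unfolding a_def by (intro tendsto_mult tendsto_diff tendsto_add tendsto_const tendsto_div_nat lim[OF s])
    then show "(\<lambda>i. a i s * (k s - nrm (real (Suc i)) s)) \<longlonglongrightarrow> (V0 s - P s) * (k s - P s)" by simp
   qed
   show "AE s in unif. norm (a i s * (k s - nrm (real (Suc i)) s)) <= w s" for i
   proof (rule AE_unifI)
    fix s :: real assume s: "0 < s" "s < 1"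
    have "\<bar>X 0 s / real (Suc i)\<bar> <= \<bar>X 0 s\<bar> / 1" unfolding abs_divide by (intro divide_left_mono) auto
    then have "\<bar>a i s\<bar> <= \<bar>X 0 s\<bar> + \<bar>V0 s\<bar> + D s" unfolding a_def using nD[OF s, of i] by linarith
    moreover have "\<bar>k s - nrm (real (Suc i)) s\<bar> <= \<bar>k s\<bar> + D s" using nD[OF s, of i] by linarith
    ultimately show "norm (a i s * (k s - nrm (real (Suc i)) s)) <= w s"
     unfolding w_def real_norm_def abs_mult by (intro mult_mono) auto
   qed
  qed (unfold a_def w_def, measurable)
  then show "(\<E> s. (V0 s - P s) * (k s - P s)) <= 0"
   by (rule LIMSEQ_le_const2) (use variational[OF km k k2] in \<open>auto simp: a_def\<close>)
 next
  fix t :: real assume t: "0 < t"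
  have "(\<lambda>i. \<E> s. (nrm t s - nrm (real (Suc i)) s)\<^sup>2) \<longlonglongrightarrow> (\<E> s. (nrm t s - P s)\<^sup>2)"
  proof (rule integral_dominated_convergence[where w="\<lambda>s. (\<bar>nrm t s\<bar> + D s)\<^sup>2"])
   show "integrable unif (\<lambda>s. (\<bar>nrm t s\<bar> + D s)\<^sup>2)"
   proof (rule integrable_square_add[OF _ _ _ D2])
    show "integrable unif (\<lambda>s. \<bar>nrm t s\<bar>\<^sup>2)" unfolding power2_abs by (rule nrm_square[OF t])
   qed simp_all
   show "AE s in unif. (\<lambda>i. (nrm t s - nrm (real (Suc i)) s)\<^sup>2) \<longlonglongrightarrow> (nrm t s - P s)\<^sup>2"
    by (rule AE_unifI) (intro tendsto_power tendsto_diff tendsto_const lim)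
   show "AE s in unif. norm ((nrm t s - nrm (real (Suc i)) s)\<^sup>2) <= (\<bar>nrm t s\<bar> + D s)\<^sup>2" for i
   proof (rule AE_unifI)
    fix s :: real assume s: "0 < s" "s < 1"
    have "\<bar>nrm t s - nrm (real (Suc i)) s\<bar> <= \<bar>nrm t s\<bar> + D s" using nD[OF s, of i] by linarith
    then show "norm ((nrm t s - nrm (real (Suc i)) s)\<^sup>2) <= (\<bar>nrm t s\<bar> + D s)\<^sup>2"
     using power_mono[of "\<bar>nrm t s - nrm (real (Suc i)) s\<bar>" "\<bar>nrm t s\<bar> + D s" 2] by simp
   qed
  qed measurable
  moreover have "(\<lambda>i. (1 / real (Suc i) - 1 / t)\<^sup>2 * (\<E> s. (X 0 s)\<^sup>2)) \<longlonglongrightarrow> (0 - 1 / t)\<^sup>2 * (\<E> s. (X 0 s)\<^sup>2)"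
   by (intro tendsto_mult tendsto_power tendsto_diff tendsto_const tendsto_div_nat)
  ultimately have "(\<E> s. (nrm t s - P s)\<^sup>2) <= (0 - 1 / t)\<^sup>2 * (\<E> s. (X 0 s)\<^sup>2)"
   by (rule LIMSEQ_le) (use nrm_distance[OF _ t] in auto)
  then show "(\<E> s. (nrm t s - P s)\<^sup>2) <= (\<E> s. (X 0 s)\<^sup>2) / t\<^sup>2"
   by (simp add: power_divide)
 qed
qed

end

section \<open>Time-integrated form of the weak equations\<close>

lemma double_dominated_convergence:
 fixes W :: "real => real => real" and p :: "nat => real => real => real"
 assumes Wm [measurable]: "(\<lambda>(t, s). W t s) \<in> borel_measurable (borel \<Otimes>\<^sub>M borel)"
  and iW: "\<And>t. integrable unif (W t)" and Wg: "\<And>t. (\<E> s. \<bar>W t s\<bar>) <= g t" and g: "locint g"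
  and pm [measurable]: "\<And>n. (\<lambda>(t, s). p n t s) \<in> borel_measurable (borel \<Otimes>\<^sub>M borel)"
  and qm [measurable]: "(\<lambda>(t, s). q t s) \<in> borel_measurable (borel \<Otimes>\<^sub>M borel)"
  and pK: "\<And>n t s. 0 <= t ==> t <= b ==> \<bar>p n t s\<bar> <= K"
  and lim: "\<And>t s. 0 <= t ==> t <= b ==> (\<lambda>n. p n t s) \<longlonglongrightarrow> q t s"
 shows "(\<lambda>n. LINT t:{0..b}|lborel. (\<E> s. W t s * p n t s)) \<longlonglongrightarrow> (LINT t:{0..b}|lborel. (\<E> s. W t s * q t s))"
 unfolding set_lebesgue_integral_def
proof (rule integral_dominated_convergence[where w="\<lambda>t. indicator {0..b} t * (K * g t)"])
 have K0: "0 <= K" if "0 <= t" "t <= b" for t using pK[OF that, of 0 0] by linarith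
 have "set_integrable lborel {0..b} (\<lambda>t. K * g t)" using locint_cmult[OF g] by (simp add: locint_def)
 then show "integrable lborel (\<lambda>t. indicator {0..b} t * (K * g t))" by (simp add: set_integrable_def)
 have wmeas: "(\<lambda>t. W t s * p n t s) \<in> borel_measurable borel" for s n by measurable
 have Wt [measurable]: "W t \<in> borel_measurable borel" and pt [measurable]: "p n t \<in> borel_measurable borel"
  and qt [measurable]: "q t \<in> borel_measurable borel" for t n
  using measurable_compose[OF measurable_Pair1'[of t borel borel] Wm] measurable_compose[OF measurable_Pair1'[of t borel borel] pm]
   measurable_compose[OF measurable_Pair1'[of t borel borel] qm] by simp_all
 have m1: "(\<lambda>(t, s). W t s * p n t s) \<in> borel_measurable (borel \<Otimes>\<^sub>M unif)" for n
  using pm[of n] by measurable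
 have m2: "(\<lambda>(t, s). W t s * q t s) \<in> borel_measurable (borel \<Otimes>\<^sub>M unif)" by measurable
 have a1: "(\<lambda>t. \<E> s. W t s * p n t s) \<in> borel_measurable borel" for n
  by (rule unif.borel_measurable_lebesgue_integral[OF m1])
 have a2: "(\<lambda>t. \<E> s. W t s * q t s) \<in> borel_measurable borel"
  by (rule unif.borel_measurable_lebesgue_integral[OF m2])
 show "(\<lambda>t. indicator {0..b} t *\<^sub>R (\<E> s. W t s * p n t s)) \<in> borel_measurable lborel" for n using a1[of n] by simp
 show "(\<lambda>t. indicator {0..b} t *\<^sub>R (\<E> s. W t s * q t s)) \<in> borel_measurable lborel" using a2 by simp
 show "AE t in lborel. (\<lambda>n. indicator {0..b} t *\<^sub>R (\<E> s. W t s * p n t s)) \<longlonglongrightarrow> indicator {0..b} t *\<^sub>R (\<E> s. W t s * q t s)"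
 proof (rule AE_I2)
  fix t
  show "(\<lambda>n. indicator {0..b} t *\<^sub>R (\<E> s. W t s * p n t s)) \<longlonglongrightarrow> indicator {0..b} t *\<^sub>R (\<E> s. W t s * q t s)"
  proof (cases "0 <= t \<and> t <= b")
   case True
   have "(\<lambda>n. \<E> s. W t s * p n t s) \<longlonglongrightarrow> (\<E> s. W t s * q t s)"
   proof (rule integral_dominated_convergence[where w="\<lambda>s. K * \<bar>W t s\<bar>"])
    show "integrable unif (\<lambda>s. K * \<bar>W t s\<bar>)" by (rule integrable_mult_right[OF integrable_abs[OF iW]])
    show "AE s in unif. (\<lambda>n. W t s * p n t s) \<longlonglongrightarrow> W t s * q t s"
     using True by (intro AE_I2 tendsto_mult tendsto_const lim) auto
    show "AE s in unif. norm (W t s * p n t s) <= K * \<bar>W t s\<bar>" for n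
    proof (rule AE_I2)
     fix s
     have "\<bar>p n t s\<bar> * \<bar>W t s\<bar> <= K * \<bar>W t s\<bar>" using True by (intro mult_right_mono pK) auto
     then show "norm (W t s * p n t s) <= K * \<bar>W t s\<bar>" by (simp add: abs_mult mult.commute)
    qed
   qed simp_all
   then show ?thesis by (rule tendsto_scaleR[OF tendsto_const])
  qed (auto simp: indicator_def)
 qed
 show "AE t in lborel. norm (indicator {0..b} t *\<^sub>R (\<E> s. W t s * p n t s)) <= indicator {0..b} t * (K * g t)" for n
 proof (rule AE_I2)
  fix t
  show "norm (indicator {0..b} t *\<^sub>R (\<E> s. W t s * p n t s)) <= indicator {0..b} t * (K * g t)"
  proof (cases "0 <= t \<and> t <= b")
   case True
   then have t: "0 <= t" "t <= b" by auto
   have iK: "integrable unif (\<lambda>s. K * \<bar>W t s\<bar>)" by (rule integrable_mult_right[OF integrable_abs[OF iW]])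
   have le: "norm (W t s * p n t s) <= K * \<bar>W t s\<bar>" for s
   proof -
    have "\<bar>p n t s\<bar> * \<bar>W t s\<bar> <= K * \<bar>W t s\<bar>" using t by (intro mult_right_mono pK) auto
    then show ?thesis by (simp add: abs_mult mult.commute)
   qed
   have iWp: "integrable unif (\<lambda>s. W t s * p n t s)"
   proof (rule Bochner_Integration.integrable_bound[OF iK])
    show "AE s in unif. norm (W t s * p n t s) <= norm (K * \<bar>W t s\<bar>)"
     by (rule AE_I2, rule order_trans[OF le]) simp
   qed simp
   have "norm (\<E> s. W t s * p n t s) <= (\<E> s. K * \<bar>W t s\<bar>)"
    by (rule order_trans[OF integral_norm_bound integral_mono[OF integrable_norm[OF iWp] iK le]])
   also have "... = K * (\<E> s. \<bar>W t s\<bar>)" by (rule integral_mult_right_zero)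
   also have "... <= K * g t" by (rule mult_left_mono[OF Wg K0[OF t]])
   finally show ?thesis using True by simp
  qed (auto simp: indicator_def)
 qed
qed

text \<open>As \<open>\<epsilon> \<rightarrow> 0\<close> these test functions turn into \<open>(b -
 t)\<close> times a translate of \<open>\<phi>\<close> on \<open>[0, b]\<close>.\<close>

lemma C1c_test_tensor:
 assumes \<phi>: "\<And>y. DERIV \<phi> y :> \<phi>' y" and c\<phi>': "continuous_on UNIV \<phi>'" and supp: "\<And>y. R < \<bar>y\<bar> ==> \<phi> y = 0" and e: "\<epsilon> > 0"
  and b: "0 <= b"
 shows "C1c_test (\<lambda>t y. soft_pos \<epsilon> (b - t) * \<phi> (y - l * t))
  (\<lambda>t y. - soft_pos' \<epsilon> (b - t) * \<phi> (y - l * t) - l * (soft_pos \<epsilon> (b - t) * \<phi>' (y - l * t)))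
  (\<lambda>t y. soft_pos \<epsilon> (b - t) * \<phi>' (y - l * t))"
proof -
 have c\<phi>: "continuous_on UNIV \<phi>" using \<phi> by (intro continuous_at_imp_continuous_on ballI DERIV_isCont) blast
 have cs: "continuous_on UNIV (soft_pos \<epsilon>)"
  using DERIV_soft_pos[OF e] by (intro continuous_at_imp_continuous_on ballI DERIV_isCont) blast
 have cs': "continuous_on UNIV (soft_pos' \<epsilon>)" by (rule continuous_on_soft_pos'[OF e])
 have comp': "continuous_on S (\<lambda>p. f (h p))" if "continuous_on UNIV f" "continuous_on S h" for f :: "real => real" and h and S :: "(real \<times> real) set"
  by (rule continuous_on_compose2[OF that]) simp
 have c1: "continuous_on half_plane (\<lambda>p. soft_pos \<epsilon> (b - fst p))" "continuous_on half_plane (\<lambda>p. soft_pos' \<epsilon> (b - fst p))"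
  "continuous_on half_plane (\<lambda>p. \<phi> (snd p - l * fst p))" "continuous_on half_plane (\<lambda>p. \<phi>' (snd p - l * fst p))"
  by (rule comp'[OF cs] comp'[OF cs'] comp'[OF c\<phi>] comp'[OF c\<phi>'], intro continuous_intros)+
 have der: "((\<lambda>p. soft_pos \<epsilon> (b - fst p) * \<phi> (snd p - l * fst p)) has_derivative
   (\<lambda>h. (- soft_pos' \<epsilon> (b - fst q) * \<phi> (snd q - l * fst q) - l * (soft_pos \<epsilon> (b - fst q) * \<phi>' (snd q - l * fst q))) * fst h
    + soft_pos \<epsilon> (b - fst q) * \<phi>' (snd q - l * fst q) * snd h)) (at q within half_plane)" for q
 proof -
  have d1: "((\<lambda>p. soft_pos \<epsilon> (b - fst p)) has_derivative (\<lambda>h. (0 - fst h) * soft_pos' \<epsilon> (b - fst q))) (at q within half_plane)"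
   by (rule DERIV_compose_FDERIV[OF DERIV_soft_pos[OF e]]) (intro has_derivative_diff has_derivative_const has_derivative_fst has_derivative_ident)
  have d2: "((\<lambda>p. \<phi> (snd p - l * fst p)) has_derivative (\<lambda>h. (snd h - l * fst h) * \<phi>' (snd q - l * fst q))) (at q within half_plane)"
   by (rule DERIV_compose_FDERIV[OF \<phi>]) (intro has_derivative_diff has_derivative_mult_right has_derivative_snd has_derivative_fst has_derivative_ident)
  show ?thesis
   by (rule has_derivative_eq_rhs[OF has_derivative_mult[OF d1 d2]]) (auto simp: algebra_simps)
 qed
 have "bounded {(t, y). (t, y) \<in> half_plane \<and> soft_pos \<epsilon> (b - t) * \<phi> (y - l * t) \<noteq> 0}"
 proof (rule bounded_subset)
  show "bounded (cbox (0, - (R + \<bar>l\<bar> * b)) (b, R + \<bar>l\<bar> * b))" by (rule bounded_cbox)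
  show "{(t, y). (t, y) \<in> half_plane \<and> soft_pos \<epsilon> (b - t) * \<phi> (y - l * t) \<noteq> 0} \<subseteq> cbox (0, - (R + \<bar>l\<bar> * b)) (b, R + \<bar>l\<bar> * b)"
  proof
   fix x assume "x \<in> {(t, y). (t, y) \<in> half_plane \<and> soft_pos \<epsilon> (b - t) * \<phi> (y - l * t) \<noteq> 0}"
   then obtain t y where x: "x = (t, y)" and t: "0 <= t" and n: "soft_pos \<epsilon> (b - t) \<noteq> 0" "\<phi> (y - l * t) \<noteq> 0" by auto
   have tb: "t <= b" using soft_pos_bounds(5)[OF e, of "b - t"] n(1) by linarith
   have R: "\<bar>y - l * t\<bar> <= R" using supp[of "y - l * t"] n(2) by linarith
   have "\<bar>l * t\<bar> <= \<bar>l\<bar> * b" unfolding abs_mult using t tb by (intro mult_left_mono) auto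
   then have "- (R + \<bar>l\<bar> * b) <= y" "y <= R + \<bar>l\<bar> * b" using R by linarith+
   then show "x \<in> cbox (0, - (R + \<bar>l\<bar> * b)) (b, R + \<bar>l\<bar> * b)" using t tb by (simp add: x cbox_Pair_iff)
  qed
 qed
 then have "compact (closure {(t, y). (t, y) \<in> half_plane \<and> soft_pos \<epsilon> (b - t) * \<phi> (y - l * t) \<noteq> 0})" by simp
 moreover have "continuous_on half_plane (\<lambda>p. - soft_pos' \<epsilon> (b - fst p) * \<phi> (snd p - l * fst p) - l * (soft_pos \<epsilon> (b - fst p) * \<phi>' (snd p - l * fst p)))"
  "continuous_on half_plane (\<lambda>p. soft_pos \<epsilon> (b - fst p) * \<phi>' (snd p - l * fst p))"
  by (intro continuous_on_diff continuous_on_mult continuous_on_minus continuous_on_const c1)+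
 ultimately show ?thesis
  unfolding C1c_test_def
 proof (intro conjI allI impI)
  fix t y :: real
  show "((\<lambda>(s, x). soft_pos \<epsilon> (b - s) * \<phi> (x - l * s)) has_derivative
    (\<lambda>(h, k). (- soft_pos' \<epsilon> (b - t) * \<phi> (y - l * t) - l * (soft_pos \<epsilon> (b - t) * \<phi>' (y - l * t))) * h
     + soft_pos \<epsilon> (b - t) * \<phi>' (y - l * t) * k)) (at (t, y) within half_plane)"
   using der[of "(t, y)"] by (simp only: split_beta' fst_conv snd_conv)
 qed (simp_all only: split_beta')
qed

text \<open>The conservation of mass is the case \<open>U = 1\<close>, that of momentum the case \<open>U = V\<close>.\<close>

locale weak_transport =
 fixes X V U :: "real => real => real" and c g :: "real => real" and \<rho>0 :: "real measure" and Bc :: real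
 assumes Xj [measurable]: "(\<lambda>(t, s). X t s) \<in> borel_measurable (borel \<Otimes>\<^sub>M borel)"
  and Vj [measurable]: "(\<lambda>(t, s). V t s) \<in> borel_measurable (borel \<Otimes>\<^sub>M borel)"
  and Uj [measurable]: "(\<lambda>(t, s). U t s) \<in> borel_measurable (borel \<Otimes>\<^sub>M borel)"
  and iU: "integrable unif (U t)" and iUV: "integrable unif (\<lambda>s. U t s * V t s)"
  and Ug: "(\<E> s. \<bar>U t s\<bar>) <= g t" and UVg: "(\<E> s. \<bar>U t s * V t s\<bar>) <= g t" and g: "locint g"
  and \<rho>0: "real_distribution \<rho>0" and cm [measurable]: "c \<in> borel_measurable borel" and cb: "\<bar>c y\<bar> <= Bc"
  and weak: "C1c_test \<phi> \<phi>t \<phi>y ==>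
   (LINT t:{0..}|lborel. (\<E> s. U t s * \<phi>t t (X t s) + U t s * V t s * \<phi>y t (X t s))) + (\<integral>y. \<phi> 0 y * c y \<partial>\<rho>0) = 0"
begin

lemma meas_slices [measurable (raw)]:
 assumes [measurable]: "f \<in> borel_measurable M" "h \<in> borel_measurable M"
 shows "(\<lambda>x. X (f x) (h x)) \<in> borel_measurable M" "(\<lambda>x. V (f x) (h x)) \<in> borel_measurable M" "(\<lambda>x. U (f x) (h x)) \<in> borel_measurable M"
 using measurable_compose[OF measurable_Pair[OF assms] Xj] measurable_compose[OF measurable_Pair[OF assms] Vj]
  measurable_compose[OF measurable_Pair[OF assms] Uj] by simp_all

lemma relative_velocity:
 shows "integrable unif (\<lambda>s. U t s * (V t s - l))"
  and "(\<E> s. \<bar>U t s * (V t s - l)\<bar>) <= (1 + \<bar>l\<bar>) * g t" and "locint (\<lambda>t. (1 + \<bar>l\<bar>) * g t)"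
proof -
 have eq: "U t s * (V t s - l) = U t s * V t s - l * U t s" for s by (simp add: algebra_simps)
 show i: "integrable unif (\<lambda>s. U t s * (V t s - l))" unfolding eq by (intro Bochner_Integration.integrable_diff iUV integrable_mult_right iU)
 have "(\<E> s. \<bar>U t s * (V t s - l)\<bar>) <= (\<E> s. \<bar>U t s * V t s\<bar> + \<bar>l\<bar> * \<bar>U t s\<bar>)"
 proof (rule integral_mono)
  show "integrable unif (\<lambda>s. \<bar>U t s * V t s\<bar> + \<bar>l\<bar> * \<bar>U t s\<bar>)"
   by (intro Bochner_Integration.integrable_add integrable_mult_right integrable_abs iUV iU)
  show "\<bar>U t s * (V t s - l)\<bar> <= \<bar>U t s * V t s\<bar> + \<bar>l\<bar> * \<bar>U t s\<bar>" for s
   unfolding eq using abs_triangle_ineq4[of "U t s * V t s" "l * U t s"] by (simp only: abs_mult)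
 qed (rule integrable_abs[OF i])
 also have "... = (\<E> s. \<bar>U t s * V t s\<bar>) + \<bar>l\<bar> * (\<E> s. \<bar>U t s\<bar>)"
  by (simp only: Bochner_Integration.integral_add[OF integrable_abs[OF iUV] integrable_mult_right[OF integrable_abs[OF iU]]] integral_mult_right_zero)
 also have "... <= g t + \<bar>l\<bar> * g t" by (intro add_mono UVg mult_left_mono Ug) simp
 finally show "(\<E> s. \<bar>U t s * (V t s - l)\<bar>) <= (1 + \<bar>l\<bar>) * g t" by (simp add: distrib_right)
 show "locint (\<lambda>t. (1 + \<bar>l\<bar>) * g t)" by (rule locint_cmult[OF g])
qed

lemma integrable_bounded_weight:
 fixes W k :: "real => real"
 assumes W: "integrable unif W" and [measurable]: "k \<in> borel_measurable borel" and k: "\<And>s. \<bar>k s\<bar> <= B"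
 shows "integrable unif (\<lambda>s. W s * k s)"
proof (rule Bochner_Integration.integrable_bound[OF integrable_mult_right[OF integrable_abs[OF W], of B]])
 show "(\<lambda>s. W s * k s) \<in> borel_measurable unif" using borel_measurable_integrable[OF W] by measurable
 show "AE s in unif. norm (W s * k s) <= norm (B * \<bar>W s\<bar>)"
 proof (rule AE_I2)
  fix s
  have "\<bar>k s\<bar> * \<bar>W s\<bar> <= \<bar>B\<bar> * \<bar>W s\<bar>" using k[of s] by (intro mult_right_mono) auto
  then show "norm (W s * k s) <= norm (B * \<bar>W s\<bar>)" by (simp add: abs_mult mult.commute)
 qed
qed

lemma balance_compact:
 assumes \<phi>: "C1b \<phi> \<phi>' L" and supp: "\<And>y. R < \<bar>y\<bar> ==> \<phi> y = 0" and b: "0 <= b"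
 shows "(LINT t:{0..b}|lborel. (\<E> s. U t s * \<phi> (X t s - l * t)))
   - (LINT t:{0..b}|lborel. (\<E> s. U t s * (V t s - l) * ((b - t) * \<phi>' (X t s - l * t))))
  = b * (\<integral>y. \<phi> y * c y \<partial>\<rho>0)"
proof -
 obtain B where B: "\<And>y. \<bar>\<phi> y\<bar> <= B" using \<phi> by (auto simp: C1b_def)
 have L: "\<And>y. \<bar>\<phi>' y\<bar> <= L" and d\<phi>: "\<And>y. DERIV \<phi> y :> \<phi>' y" and c\<phi>': "continuous_on UNIV \<phi>'" using \<phi> by (auto simp: C1b_def)
 have B0: "0 <= B" and L0: "0 <= L" using B[of 0] L[of 0] by linarith+
 have [measurable]: "\<phi> \<in> borel_measurable borel" by (rule borel_measurable_continuous_onI[OF C1b_continuous[OF \<phi>]])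
 have [measurable]: "\<phi>' \<in> borel_measurable borel" by (rule borel_measurable_continuous_onI[OF c\<phi>'])
 define \<epsilon> where "\<epsilon> n = 1 / real (Suc n)" for n
 have e: "\<epsilon> n > 0" for n by (simp add: \<epsilon>_def)
 have spm [measurable]: "soft_pos (\<epsilon> n) \<in> borel_measurable borel" for n
  using DERIV_soft_pos[OF e] by (intro borel_measurable_continuous_onI continuous_at_imp_continuous_on ballI DERIV_isCont) blast
 have spm' [measurable]: "soft_pos' (\<epsilon> n) \<in> borel_measurable borel" for n
  by (rule borel_measurable_continuous_onI[OF continuous_on_soft_pos'[OF e]])
 define p where "p n t s = soft_pos' (\<epsilon> n) (b - t) * \<phi> (X t s - l * t)" for n t s
 define p' where "p' n t s = soft_pos (\<epsilon> n) (b - t) * \<phi>' (X t s - l * t)" for n t s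
 define q where "q t s = (if b - t > 0 then 1 else 0) * \<phi> (X t s - l * t)" for t s
 define q' where "q' t s = max 0 (b - t) * \<phi>' (X t s - l * t)" for t s
 have pm [measurable]: "(\<lambda>(t, s). p n t s) \<in> borel_measurable (borel \<Otimes>\<^sub>M borel)" for n unfolding p_def by measurable
 have pm' [measurable]: "(\<lambda>(t, s). p' n t s) \<in> borel_measurable (borel \<Otimes>\<^sub>M borel)" for n unfolding p'_def by measurable
 have qm [measurable]: "(\<lambda>(t, s). q t s) \<in> borel_measurable (borel \<Otimes>\<^sub>M borel)" unfolding q_def by measurable
 have qm' [measurable]: "(\<lambda>(t, s). q' t s) \<in> borel_measurable (borel \<Otimes>\<^sub>M borel)" unfolding q'_def by measurable
 have Wm: "(\<lambda>(t, s). U t s * (V t s - l)) \<in> borel_measurable (borel \<Otimes>\<^sub>M borel)" by measurable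
 have pb: "\<bar>p n t s\<bar> <= B" for n t s
 proof -
  have "\<bar>soft_pos' (\<epsilon> n) (b - t)\<bar> * \<bar>\<phi> (X t s - l * t)\<bar> <= 1 * B"
   using soft_pos_bounds(3,4)[OF e, of n "b - t"] B B0 by (intro mult_mono) auto
  then show ?thesis by (simp add: p_def abs_mult)
 qed
 have spb: "\<bar>soft_pos (\<epsilon> n) (b - t)\<bar> <= b" if "0 <= t" for n t
  using soft_pos_bounds(1,2)[OF e, of n "b - t"] that b by (auto simp: max_def split: if_splits)
 have pb': "\<bar>p' n t s\<bar> <= b * L" if "0 <= t" for n t s
  unfolding p'_def abs_mult using spb[OF that] L b by (intro mult_mono) auto
 have lim1: "(\<lambda>n. LINT t:{0..b}|lborel. (\<E> s. U t s * p n t s)) \<longlonglongrightarrow> (LINT t:{0..b}|lborel. (\<E> s. U t s * q t s))"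
 proof (rule double_dominated_convergence[OF Uj iU Ug g pm qm pb])
  show "(\<lambda>n. p n t s) \<longlonglongrightarrow> q t s" for t s
   unfolding p_def q_def \<epsilon>_def by (intro tendsto_mult tendsto_const soft_pos_tendsto(2))
 qed
 have lim2: "(\<lambda>n. LINT t:{0..b}|lborel. (\<E> s. U t s * (V t s - l) * p' n t s))
   \<longlonglongrightarrow> (LINT t:{0..b}|lborel. (\<E> s. U t s * (V t s - l) * q' t s))"
 proof (rule double_dominated_convergence[OF Wm relative_velocity pm' qm' pb'])
  show "(\<lambda>n. p' n t s) \<longlonglongrightarrow> q' t s" for t s
   unfolding p'_def q'_def \<epsilon>_def by (intro tendsto_mult tendsto_const soft_pos_tendsto(1))
 qed
 have eq: "(LINT t:{0..b}|lborel. (\<E> s. U t s * p n t s)) - (LINT t:{0..b}|lborel. (\<E> s. U t s * (V t s - l) * p' n t s))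
   = soft_pos (\<epsilon> n) b * (\<integral>y. \<phi> y * c y \<partial>\<rho>0)" for n
 proof -
  have pt [measurable]: "p n t \<in> borel_measurable borel" and pt' [measurable]: "p' n t \<in> borel_measurable borel" for t
   unfolding p_def p'_def by measurable
  have i1: "integrable unif (\<lambda>s. U t s * p n t s)" for t by (rule integrable_bounded_weight[OF iU pt pb])
  have i2: "integrable unif (\<lambda>s. U t s * (V t s - l) * p' n t s)" if "0 <= t" for t
   by (rule integrable_bounded_weight[OF relative_velocity(1) pt' pb'[OF that]])
  define G where "G t = (\<E> s. U t s * (V t s - l) * p' n t s) - (\<E> s. U t s * p n t s)" for t
  define lhs where "lhs t = (\<E> s. U t s * (- soft_pos' (\<epsilon> n) (b - t) * \<phi> (X t s - l * t) - l * (soft_pos (\<epsilon> n) (b - t) * \<phi>' (X t s - l * t)))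
    + U t s * V t s * (soft_pos (\<epsilon> n) (b - t) * \<phi>' (X t s - l * t)))" for t
  have G: "lhs t = G t" if "0 <= t" for t
  proof -
   have "lhs t = (\<E> s. U t s * (V t s - l) * p' n t s - U t s * p n t s)"
    unfolding lhs_def p_def p'_def by (intro Bochner_Integration.integral_cong refl) (simp add: algebra_simps)
   also have "... = G t" unfolding G_def by (rule Bochner_Integration.integral_diff[OF i2[OF that] i1])
   finally show ?thesis .
  qed
  have G0: "G t = 0" if "b < t" for t
   using soft_pos_bounds(5,6)[OF e, of "b - t" n] that by (simp add: G_def p_def p'_def)
  have "(LINT t:{0..}|lborel. lhs t) + (\<integral>y. soft_pos (\<epsilon> n) (b - 0) * \<phi> (y - l * 0) * c y \<partial>\<rho>0) = 0"
   unfolding lhs_def by (rule weak[OF C1c_test_tensor[OF d\<phi> c\<phi>' supp e b]])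
  moreover have "(LINT t:{0..}|lborel. lhs t) = (LINT t:{0..}|lborel. G t)"
  proof (rule set_lebesgue_integral_cong)
   show "\<forall>t. t \<in> {0..} \<longrightarrow> lhs t = G t" using G by (simp only: atLeast_iff) blast
  qed simp
  moreover have "(LINT t:{0..}|lborel. G t) = (LINT t:{0..b}|lborel. G t)"
   unfolding set_lebesgue_integral_def using G0 by (intro Bochner_Integration.integral_cong refl) (auto simp: indicator_def not_le)
  moreover have "(\<integral>y. soft_pos (\<epsilon> n) (b - 0) * \<phi> (y - l * 0) * c y \<partial>\<rho>0) = soft_pos (\<epsilon> n) b * (\<integral>y. \<phi> y * c y \<partial>\<rho>0)"
   by (simp add: mult.assoc)
  moreover have "(LINT t:{0..b}|lborel. G t)
    = (LINT t:{0..b}|lborel. (\<E> s. U t s * (V t s - l) * p' n t s)) - (LINT t:{0..b}|lborel. (\<E> s. U t s * p n t s))"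
   unfolding G_def
  proof (rule set_integral_diff(2))
   have mm1: "(\<lambda>(t, s). U t s * p n t s) \<in> borel_measurable (borel \<Otimes>\<^sub>M unif)" using pm[of n] by measurable
   have mm2: "(\<lambda>(t, s). U t s * (V t s - l) * p' n t s) \<in> borel_measurable (borel \<Otimes>\<^sub>M unif)" using pm'[of n] by measurable
   have bd: "\<bar>\<E> s. W s * k s\<bar> <= K * g'" if W: "integrable unif W" and km: "k \<in> borel_measurable borel" and k: "\<And>s. \<bar>k s\<bar> <= K"
    and g': "(\<E> s. \<bar>W s\<bar>) <= g'" for W k :: "real => real" and K g' :: real
   proof -
    have K: "0 <= K" using k[of 0] by linarith
    have le: "norm (W s * k s) <= K * \<bar>W s\<bar>" for s
    proof -
     have "\<bar>k s\<bar> * \<bar>W s\<bar> <= K * \<bar>W s\<bar>" by (intro mult_right_mono k) simp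
     then show ?thesis by (simp add: abs_mult mult.commute)
    qed
    have "norm (\<E> s. W s * k s) <= (\<E> s. K * \<bar>W s\<bar>)"
     by (rule order_trans[OF integral_norm_bound integral_mono[OF integrable_norm[OF integrable_bounded_weight[OF W km k]] integrable_mult_right[OF integrable_abs[OF W]] le]])
    also have "... = K * (\<E> s. \<bar>W s\<bar>)" by (rule integral_mult_right_zero)
    also have "... <= K * g'" by (rule mult_left_mono[OF g' K])
    finally show ?thesis by simp
   qed
   have "locint (\<lambda>t. \<E> s. U t s * p n t s)"
    by (rule locint_bound[OF locint_cmult[OF g, of B] unif.borel_measurable_lebesgue_integral[OF mm1] bd[OF iU pt pb Ug]])
   then show "set_integrable lborel {0..b} (\<lambda>t. \<E> s. U t s * p n t s)" by (simp add: locint_def)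
   have "locint (\<lambda>t. \<E> s. U t s * (V t s - l) * p' n t s)"
    by (rule locint_bound[OF locint_cmult[OF relative_velocity(3), of "b * L"] unif.borel_measurable_lebesgue_integral[OF mm2]
      bd[OF relative_velocity(1) pt' pb' relative_velocity(2)]])
   then show "set_integrable lborel {0..b} (\<lambda>t. \<E> s. U t s * (V t s - l) * p' n t s)" by (simp add: locint_def)
  qed
  ultimately show ?thesis by linarith
 qed
 have "(\<lambda>n. soft_pos (\<epsilon> n) b * (\<integral>y. \<phi> y * c y \<partial>\<rho>0)) \<longlonglongrightarrow> max 0 b * (\<integral>y. \<phi> y * c y \<partial>\<rho>0)"
  unfolding \<epsilon>_def by (intro tendsto_mult tendsto_const soft_pos_tendsto(1))
 from LIMSEQ_unique[OF tendsto_diff[OF lim1 lim2, unfolded eq] this]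
 have fin: "(LINT t:{0..b}|lborel. (\<E> s. U t s * q t s)) - (LINT t:{0..b}|lborel. (\<E> s. U t s * (V t s - l) * q' t s))
   = max 0 b * (\<integral>y. \<phi> y * c y \<partial>\<rho>0)" .
 have "(LINT t:{0..b}|lborel. (\<E> s. U t s * q t s)) = (LINT t:{0..b}|lborel. (\<E> s. U t s * \<phi> (X t s - l * t)))"
 proof (rule set_lebesgue_integral_cong_AE)
  show "AE t\<in>{0..b} in lborel. (\<E> s. U t s * q t s) = (\<E> s. U t s * \<phi> (X t s - l * t))"
   using AE_lborel_singleton[of b] by eventually_elim (auto simp: q_def)
  have "(\<lambda>(t, s). U t s * q t s) \<in> borel_measurable (borel \<Otimes>\<^sub>M unif)" by measurable
  then show "(\<lambda>t. \<E> s. U t s * q t s) \<in> borel_measurable lborel" using unif.borel_measurable_lebesgue_integral by simp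
  have "(\<lambda>(t, s). U t s * \<phi> (X t s - l * t)) \<in> borel_measurable (borel \<Otimes>\<^sub>M unif)" by measurable
  then show "(\<lambda>t. \<E> s. U t s * \<phi> (X t s - l * t)) \<in> borel_measurable lborel" using unif.borel_measurable_lebesgue_integral by simp
 qed simp
 moreover have "(LINT t:{0..b}|lborel. (\<E> s. U t s * (V t s - l) * q' t s))
   = (LINT t:{0..b}|lborel. (\<E> s. U t s * (V t s - l) * ((b - t) * \<phi>' (X t s - l * t))))"
  by (rule set_lebesgue_integral_cong) (auto simp: q'_def)
 ultimately show ?thesis using fin b by simp
qed

lemma balance:
 assumes \<phi>: "C1b \<phi> \<phi>' L" and b: "0 <= b"
 shows "prim (\<lambda>t. \<E> s. U t s * \<phi> (X t s - l * t)) b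
  = (\<integral>y. \<phi> y * c y \<partial>\<rho>0) * b + prim (prim (\<lambda>t. \<E> s. U t s * (V t s - l) * \<phi>' (X t s - l * t))) b"
  and "locint (\<lambda>t. \<E> s. U t s * (V t s - l) * \<phi>' (X t s - l * t))"
proof -
 interpret \<rho>0: real_distribution \<rho>0 by (rule \<rho>0)
 obtain B where B: "\<And>y. \<bar>\<phi> y\<bar> <= B" using \<phi> by (auto simp: C1b_def)
 have L: "\<And>y. \<bar>\<phi>' y\<bar> <= L" and d\<phi>: "\<And>y. DERIV \<phi> y :> \<phi>' y" and c\<phi>': "continuous_on UNIV \<phi>'" using \<phi> by (auto simp: C1b_def)
 have B0: "0 <= B" and L0: "0 <= L" using B[of 0] L[of 0] by linarith+
 have m\<phi> [measurable]: "\<phi> \<in> borel_measurable borel" by (rule borel_measurable_continuous_onI[OF C1b_continuous[OF \<phi>]])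
 have m\<phi>' [measurable]: "\<phi>' \<in> borel_measurable borel" by (rule borel_measurable_continuous_onI[OF c\<phi>'])
 define F where "F n y = cutoff n y * \<phi> y" for n y
 define F' where "F' n y = cutoff' n y * \<phi> y + \<phi>' y * cutoff n y" for n y
 have cc: "continuous_on UNIV (cutoff n)" for n
  using DERIV_cutoff[of n] by (intro continuous_at_imp_continuous_on ballI DERIV_isCont) blast
 have FB: "\<bar>F n y\<bar> <= B" for n y
 proof -
  have "\<bar>cutoff n y\<bar> * \<bar>\<phi> y\<bar> <= 1 * B" using cutoff_bounds(1,2)[of n y] B by (intro mult_mono) auto
  then show ?thesis by (simp add: F_def abs_mult)
 qed
 have FB': "\<bar>F' n y\<bar> <= 4 * B + L" for n y
 proof -
  have "\<bar>cutoff' n y\<bar> * \<bar>\<phi> y\<bar> <= 4 * B" using cutoff_bounds(4)[of n y] B by (intro mult_mono) auto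
  moreover have "\<bar>\<phi>' y\<bar> * \<bar>cutoff n y\<bar> <= L * 1" using cutoff_bounds(1,2)[of n y] L L0 by (intro mult_mono) auto
  ultimately show ?thesis unfolding F'_def using abs_triangle_ineq[of "cutoff' n y * \<phi> y" "\<phi>' y * cutoff n y"] by (simp add: abs_mult)
 qed
 have C: "C1b (F n) (F' n) (4 * B + L)" for n
  unfolding C1b_def
 proof (intro conjI allI)
  show "DERIV (F n) y :> F' n y" for y unfolding F_def[abs_def] F'_def by (rule DERIV_mult[OF DERIV_cutoff d\<phi>])
  show "continuous_on UNIV (F' n)" unfolding F'_def[abs_def]
   by (intro continuous_on_add continuous_on_mult continuous_on_cutoff' cc c\<phi>' C1b_continuous[OF \<phi>])
  show "\<exists>B. \<forall>y. \<bar>F n y\<bar> <= B" using FB by blast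
 qed (rule FB')
 have Fm [measurable]: "F n \<in> borel_measurable borel" for n by (rule borel_measurable_continuous_onI[OF C1b_continuous[OF C]])
 have F'm [measurable]: "F' n \<in> borel_measurable borel" for n
  by (rule borel_measurable_continuous_onI) (use C[of n] in \<open>simp add: C1b_def\<close>)
 have Fl: "(\<lambda>n. F n y) \<longlonglongrightarrow> \<phi> y" for y
  using tendsto_mult[OF cutoff_tendsto(1)[of y] tendsto_const[of "\<phi> y"]] by (simp add: F_def)
 have F'l: "(\<lambda>n. F' n y) \<longlonglongrightarrow> \<phi>' y" for y
  using tendsto_add[OF tendsto_mult[OF cutoff_tendsto(2)[of y] tendsto_const[of "\<phi> y"]] tendsto_mult[OF tendsto_const[of "\<phi>' y"] cutoff_tendsto(1)[of y]]]
  by (simp add: F'_def)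
 have lim1: "(\<lambda>n. LINT t:{0..b}|lborel. (\<E> s. U t s * F n (X t s - l * t)))
   \<longlonglongrightarrow> (LINT t:{0..b}|lborel. (\<E> s. U t s * \<phi> (X t s - l * t)))"
  by (rule double_dominated_convergence[OF Uj iU Ug g _ _ FB Fl]; measurable)
 have Wm: "(\<lambda>(t, s). U t s * (V t s - l)) \<in> borel_measurable (borel \<Otimes>\<^sub>M borel)" by measurable
 have lim2: "(\<lambda>n. LINT t:{0..b}|lborel. (\<E> s. U t s * (V t s - l) * ((b - t) * F' n (X t s - l * t))))
   \<longlonglongrightarrow> (LINT t:{0..b}|lborel. (\<E> s. U t s * (V t s - l) * ((b - t) * \<phi>' (X t s - l * t))))"
 proof (rule double_dominated_convergence[OF Wm relative_velocity, where K="b * (4 * B + L)"])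
  show "(\<lambda>(t, s). (b - t) * F' n (X t s - l * t)) \<in> borel_measurable (borel \<Otimes>\<^sub>M borel)" for n by measurable
  show "(\<lambda>(t, s). (b - t) * \<phi>' (X t s - l * t)) \<in> borel_measurable (borel \<Otimes>\<^sub>M borel)" by measurable
  show "\<bar>(b - t) * F' n (X t s - l * t)\<bar> <= b * (4 * B + L)" if "0 <= t" "t <= b" for n t s
   unfolding abs_mult using that FB' by (intro mult_mono) auto
  show "(\<lambda>n. (b - t) * F' n (X t s - l * t)) \<longlonglongrightarrow> (b - t) * \<phi>' (X t s - l * t)" for t s
   by (intro tendsto_mult tendsto_const F'l)
 qed
 have lim3: "(\<lambda>n. b * (\<integral>y. F n y * c y \<partial>\<rho>0)) \<longlonglongrightarrow> b * (\<integral>y. \<phi> y * c y \<partial>\<rho>0)"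
 proof (intro tendsto_mult tendsto_const integral_dominated_convergence[where w="\<lambda>_. B * Bc"])
  show "AE y in \<rho>0. (\<lambda>n. F n y * c y) \<longlonglongrightarrow> \<phi> y * c y" by (intro AE_I2 tendsto_mult tendsto_const Fl)
  show "AE y in \<rho>0. norm (F n y * c y) <= B * Bc" for n
   unfolding real_norm_def abs_mult using FB cb B0 by (intro AE_I2 mult_mono) auto
 qed simp_all
 have eq: "(LINT t:{0..b}|lborel. (\<E> s. U t s * F n (X t s - l * t)))
   - (LINT t:{0..b}|lborel. (\<E> s. U t s * (V t s - l) * ((b - t) * F' n (X t s - l * t)))) = b * (\<integral>y. F n y * c y \<partial>\<rho>0)" for n
  by (rule balance_compact[OF C _ b, of "real (Suc n)"]) (simp add: F_def cutoff_bounds(5))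
 from LIMSEQ_unique[OF tendsto_diff[OF lim1 lim2, unfolded eq] lim3]
 have fin: "(LINT t:{0..b}|lborel. (\<E> s. U t s * \<phi> (X t s - l * t)))
   - (LINT t:{0..b}|lborel. (\<E> s. U t s * (V t s - l) * ((b - t) * \<phi>' (X t s - l * t)))) = b * (\<integral>y. \<phi> y * c y \<partial>\<rho>0)" .
 define A where "A t = (\<E> s. U t s * (V t s - l) * \<phi>' (X t s - l * t))" for t
 have lA: "locint A"
 proof (rule locint_bound[OF locint_cmult[OF relative_velocity(3), of L]])
  have "(\<lambda>(t, s). U t s * (V t s - l) * \<phi>' (X t s - l * t)) \<in> borel_measurable (borel \<Otimes>\<^sub>M unif)" by measurable
  then show "A \<in> borel_measurable borel" unfolding A_def by (rule unif.borel_measurable_lebesgue_integral)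
  fix t :: real
  have km: "(\<lambda>s. \<phi>' (X t s - l * t)) \<in> borel_measurable borel" by measurable
  have i: "integrable unif (\<lambda>s. U t s * (V t s - l) * \<phi>' (X t s - l * t))"
   by (rule integrable_bounded_weight[OF relative_velocity(1) km L])
  have "norm (A t) <= (\<E> s. L * \<bar>U t s * (V t s - l)\<bar>)"
   unfolding A_def
  proof (rule order_trans[OF integral_norm_bound integral_mono[OF integrable_norm[OF i] integrable_mult_right[OF integrable_abs[OF relative_velocity(1)]]]])
   fix s
   have "\<bar>\<phi>' (X t s - l * t)\<bar> * \<bar>U t s * (V t s - l)\<bar> <= L * \<bar>U t s * (V t s - l)\<bar>" by (intro mult_right_mono L) simp
   then show "norm (U t s * (V t s - l) * \<phi>' (X t s - l * t)) <= L * \<bar>U t s * (V t s - l)\<bar>"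
    by (simp only: real_norm_def abs_mult mult.commute)
  qed
  also have "... = L * (\<E> s. \<bar>U t s * (V t s - l)\<bar>)" by (rule integral_mult_right_zero)
  also have "... <= L * ((1 + \<bar>l\<bar>) * g t)" by (rule mult_left_mono[OF relative_velocity(2) L0])
  finally show "\<bar>A t\<bar> <= L * ((1 + \<bar>l\<bar>) * g t)" by simp
 qed
 have "(\<E> s. U t s * (V t s - l) * ((b - t) * \<phi>' (X t s - l * t))) = (b - t) * A t" for t
 proof -
  have "(b - t) * A t = (\<E> s. (b - t) * (U t s * (V t s - l) * \<phi>' (X t s - l * t)))"
   unfolding A_def by (rule integral_mult_right_zero[symmetric])
  also have "... = (\<E> s. U t s * (V t s - l) * ((b - t) * \<phi>' (X t s - l * t)))"
   by (intro Bochner_Integration.integral_cong refl) (rule mult.left_commute)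
  finally show ?thesis by (rule sym)
 qed
 then have Y: "(LINT t:{0..b}|lborel. (\<E> s. U t s * (V t s - l) * ((b - t) * \<phi>' (X t s - l * t)))) = prim (prim A) b"
  by (simp only: prim_Fubini[OF lA b])
 have "prim (\<lambda>t. \<E> s. U t s * \<phi> (X t s - l * t)) b = b * (\<integral>y. \<phi> y * c y \<partial>\<rho>0) + prim (prim A) b"
  using fin unfolding Y prim_def[of "\<lambda>t. \<E> s. U t s * \<phi> (X t s - l * t)"] by (simp only: diff_eq_eq)
 from trans[OF this arg_cong2[where f="(+)", OF mult.commute refl]]
 show "prim (\<lambda>t. \<E> s. U t s * \<phi> (X t s - l * t)) b
  = (\<integral>y. \<phi> y * c y \<partial>\<rho>0) * b + prim (prim (\<lambda>t. \<E> s. U t s * (V t s - l) * \<phi>' (X t s - l * t))) b"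
  by (simp only: A_def[abs_def])
 show "locint (\<lambda>t. \<E> s. U t s * (V t s - l) * \<phi>' (X t s - l * t))"
  using lA by (simp only: A_def[abs_def])
qed

end

section \<open>Monotone rearrangements\<close>

lemma borel_measurable_mono_truncated:
 fixes f :: "real => real"
 assumes "mono_on {0<..<1} f"
 shows "(\<lambda>s. if 0 < s \<and> s < 1 then f s else 0) \<in> borel_measurable borel"
proof -
 have "f \<in> borel_measurable (restrict_space borel {0<..<1})" by (rule borel_measurable_mono_on_fnc[OF assms])
 then have "(\<lambda>s. indicator {0<..<1} s *\<^sub>R f s) \<in> borel_measurable borel"
  by (subst (asm) borel_measurable_restrict_space_iff) auto
 moreover have "(\<lambda>s. indicator {0<..<1} s *\<^sub>R f s) = (\<lambda>s. if 0 < s \<and> s < 1 then f s else 0)"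
  by (auto simp: indicator_def)
 ultimately show ?thesis by simp
qed

lemma measurable_leb01_of_borel: "h \<in> borel_measurable borel ==> h \<in> borel_measurable leb01"
 for h :: "real => real"
 by (rule measurable_restrict_space1[OF measurable_completion]) simp

lemma measurable_leb01_cong:
 fixes f h :: "real => real"
 assumes "h \<in> borel_measurable borel" "\<And>s. 0 < s ==> s < 1 ==> f s = h s"
 shows "f \<in> borel_measurable leb01"
 using measurable_leb01_of_borel[OF assms(1)] assms(2) by (subst measurable_cong[where g=h]) auto

lemma distr_truncated:
 assumes "monotone_rearrangement \<mu> f"
 shows "distr unif borel (\<lambda>s. if 0 < s \<and> s < 1 then f s else 0) = \<mu>"
proof -
 define h where "h s = (if 0 < s \<and> s < 1 then f s else 0)" for s
 have hm [measurable]: "h \<in> borel_measurable borel"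
  unfolding h_def by (rule borel_measurable_mono_truncated) (use assms in \<open>simp add: monotone_rearrangement_def\<close>)
 have hl [measurable]: "h \<in> borel_measurable leb01" by (rule measurable_leb01_of_borel[OF hm])
 have fin: "finite_measure leb01" by (rule finite_measure_lebesgue_on) simp
 have "distr unif borel h = distr leb01 borel h"
 proof (rule measure_eqI)
  fix A assume "A \<in> sets (distr unif borel h)"
  then have A [measurable]: "A \<in> sets borel" by simp
  have m: "measure (distr M borel h) A = (\<integral>s. indicator A (h s) \<partial>M)" if "h \<in> borel_measurable M" for M
   using that by (simp add: measure_distr flip: indicator_vimage)
  have "measure (distr unif borel h) A = measure (distr leb01 borel h) A"
   using integral_unif_leb01(1)[of "\<lambda>s. indicator A (h s)"] m[of unif] m[of leb01] by simp
  moreover have "finite_measure (distr unif borel h)" "finite_measure (distr leb01 borel h)"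
   by (auto intro!: finite_measure.finite_measure_distr fin unif.finite_measure_distr)
  ultimately show "emeasure (distr unif borel h) A = emeasure (distr leb01 borel h) A"
   by (simp add: finite_measure.emeasure_eq_measure)
 qed simp
 also have "... = distr leb01 borel f" by (rule distr_cong) (auto simp: h_def)
 also have "... = \<mu>" using assms by (simp add: monotone_rearrangement_def)
 finally show ?thesis by (simp add: h_def[abs_def])
qed

lemma unif_lessThan: "(\<E> s. indicator {..<p} s) = p" if "0 < p" "p < 1"
proof -
 have "measure unif {..<p} = p"
 proof -
  have "{0<..<1} \<inter> {..<p} = {0<..<p}" using that by auto
  then show ?thesis using that unfolding unif_def by (subst measure_uniform_measure) auto
 qed
 then show ?thesis by simp
qed

section \<open>The flow of a sticky particles solution\<close>

locale sps =
 fixes \<rho>0 :: "real measure" and v0 :: "real => real" and \<rho> :: "real => real measure"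
  and v N :: "real => real => real"
 assumes P2: "\<rho>0 \<in> P2" and v0b: "v0 \<in> bcontfun" and sol: "sticky_particles_solution \<rho>0 v0 \<rho> v"
  and N: "\<And>t. 0 <= t ==> monotone_rearrangement (\<rho> t) (N t)"
begin

definition X :: "real => real => real" where
 "X t s = (if 0 <= t \<and> 0 < s \<and> s < 1 then N t s else 0)"

text \<open>Outside the half plane the velocity is unconstrained; it is set to 0 there.\<close>

definition vt :: "real => real => real" where
 "vt t y = indicator half_plane (t, y) *\<^sub>R v t y"

definition h :: "real => ennreal" where
 "h t = (\<integral>\<^sup>+s. ennreal ((vt t (X t s))\<^sup>2) \<partial>unif)"

text \<open>At times of infinite energy, which form a null set, and at time 0 the velocity is replaced by 0. This keeps the one-sided Lipschitz bound and makes every velocity profile square integrable.\<close>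

definition vv :: "real => real => real" where
 "vv t y = (if 0 < t \<and> h t \<noteq> \<infinity> then vt t y else 0)"

lemma X_borel [measurable]: "X t \<in> borel_measurable borel"
 using borel_measurable_mono_truncated[of "N t"] N[of t] by (cases "0 <= t") (simp_all add: X_def[abs_def] monotone_rearrangement_def)

lemma law: "0 <= t ==> distr unif borel (X t) = \<rho> t"
 using distr_truncated[OF N[of t]] by (simp add: X_def[abs_def])

lemma E_law:
 fixes f :: "real => real"
 assumes "0 <= t" and [measurable]: "f \<in> borel_measurable borel"
 shows "(\<integral>y. f y \<partial>\<rho> t) = (\<E> s. f (X t s))" and "integrable (\<rho> t) f \<longleftrightarrow> integrable unif (\<lambda>s. f (X t s))"
  and "(\<integral>\<^sup>+y. ennreal (f y) \<partial>\<rho> t) = (\<integral>\<^sup>+s. ennreal (f (X t s)) \<partial>unif)"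
 unfolding law[OF assms(1), symmetric]
 by (rule integral_distr integrable_distr_eq nn_integral_distr; simp)+

lemma narrow_X:
 fixes \<phi> :: "real => real"
 assumes "continuous_on UNIV \<phi>" "\<And>y. \<bar>\<phi> y\<bar> <= B"
 shows "continuous_on {0..} (\<lambda>t. \<E> s. \<phi> (X t s))"
proof (rule continuous_on_eq)
 have "\<phi> \<in> bcontfun" using assms by (auto simp: bcontfun_def bounded_iff intro!: exI[of _ B])
 then show "continuous_on {0..} (\<lambda>t. \<integral>y. \<phi> y \<partial>\<rho> t)"
  using sol unfolding sticky_particles_solution_def narrowly_continuous_def by blast
 show "(\<integral>y. \<phi> y \<partial>\<rho> t) = (\<E> s. \<phi> (X t s))" if "t \<in> {0..}" for t
  using that by (intro E_law borel_measurable_continuous_onI assms) simp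
qed

lemma X_mono: "mono_on {0<..<1} (X t)"
 using N[of t] by (cases "0 <= t") (auto simp: X_def monotone_rearrangement_def mono_on_def)

lemma X_right_cont:
 assumes "0 < s" "s < 1" shows "continuous (at_right s) (X t)"
proof (cases "0 <= t")
 case True
 have "(N t \<longlongrightarrow> N t s) (at_right s)" using N[OF True] assms by (auto simp: monotone_rearrangement_def continuous_within)
 moreover have "\<forall>\<^sub>F x in at_right s. N t x = X t x"
  unfolding eventually_at_right_field using assms True by (intro exI[of _ 1]) (auto simp: X_def)
 ultimately have "(X t \<longlongrightarrow> N t s) (at_right s)" by (rule Lim_transform_eventually)
 then show ?thesis using assms True by (simp add: continuous_within X_def)
qed (simp add: X_def[abs_def])

text \<open>Right continuity at \<open>s\<close> is what makes both directions hold with strict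
 inequalities.\<close>

lemma X_level:
 assumes s: "0 < s" "s < 1"
 shows "X t s < y \<longleftrightarrow> s < (\<E> x. indicator {..<y} (X t x))"
proof
 have ii: "integrable unif (\<lambda>x. indicator {..<y} (X t x) :: real)" "integrable unif (\<lambda>x. indicator {..<p} x :: real)" for p
  by (rule unif.integrable_const_bound[of _ 1]; auto simp: indicator_def)+
 show "s < (\<E> x. indicator {..<y} (X t x))" if l: "X t s < y"
 proof -
  have "(X t \<longlongrightarrow> X t s) (at_right s)" using X_right_cont[OF s] by (simp add: continuous_within)
  then have "\<forall>\<^sub>F x in at_right s. X t x < y" by (rule order_tendstoD(2)[OF _ l])
  then obtain d where d: "s < d" "\<And>x. s < x ==> x < d ==> X t x < y" unfolding eventually_at_right_field by blast
  define p where "p = (s + min d 1) / 2"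
  have p: "s < p" "p < d" "p < 1" using d(1) s by (auto simp: p_def min_def)
  have "p = (\<E> x. indicator {..<p} x)" by (rule unif_lessThan[symmetric]) (use p s in auto)
  also have "... <= (\<E> x. indicator {..<y} (X t x))"
  proof (rule integral_mono_AE[OF ii(2) ii(1)], rule AE_unifI)
   fix x :: real assume x: "0 < x" "x < 1"
   have "X t x < y" if "x < p"
    using mono_onD[OF X_mono, of x p t] d(2)[OF p(1,2)] x p s that by auto
   then show "indicator {..<p} x <= (indicator {..<y} (X t x) :: real)" by (auto simp: indicator_def)
  qed
  finally show ?thesis using p by simp
 qed
 show "X t s < y" if l: "s < (\<E> x. indicator {..<y} (X t x))"
 proof (rule ccontr)
  assume n: "\<not> X t s < y"
  have "(\<E> x. indicator {..<y} (X t x)) <= (\<E> x. indicator {..<s} x :: real)"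
  proof (rule integral_mono_AE[OF ii(1) ii(2)], rule AE_unifI)
   fix x :: real assume x: "0 < x" "x < 1"
   have "X t s <= X t x" if "s <= x" using mono_onD[OF X_mono, of s x t] x s that by auto
   then show "indicator {..<y} (X t x) <= (indicator {..<s} x :: real)" using n by (force simp: indicator_def)
  qed
  also have "... = s" by (rule unif_lessThan[OF s])
  finally show False using l by simp
 qed
qed

lemma level_mass_measurable:
 "(\<lambda>t. indicator {0..} t *\<^sub>R (\<E> x. indicator {..<y} (X t x) :: real)) \<in> borel_measurable borel"
proof (rule borel_measurable_LIMSEQ_real)
 define \<psi> where "\<psi> n z = min 1 (max 0 (real (Suc n) * (y - z)))" for n z
 have c: "continuous_on UNIV (\<psi> n)" for n unfolding \<psi>_def by (intro continuous_intros)
 have b: "\<bar>\<psi> n z\<bar> <= 1" for n z by (simp add: \<psi>_def min_def max_def)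
 have [measurable]: "\<psi> n \<in> borel_measurable borel" for n by (rule borel_measurable_continuous_onI[OF c])
 have l: "(\<lambda>n. \<psi> n z) \<longlonglongrightarrow> indicator {..<y} z" for z
 proof (rule tendsto_eventually, cases "z < y")
  case True
  then show "\<forall>\<^sub>F n in sequentially. \<psi> n z = indicator {..<y} z"
   using eventually_Suc_mult_gt_1[of "y - z"] by (auto elim!: eventually_mono simp: \<psi>_def)
 next
  case False
  then have le: "real (Suc n) * (y - z) <= 0" for n by (intro mult_nonneg_nonpos) auto
  have "\<psi> n z = 0" for n unfolding \<psi>_def max.absorb1[OF le] by simp
  then show "\<forall>\<^sub>F n in sequentially. \<psi> n z = indicator {..<y} z" using False by simp
 qed
 show "(\<lambda>t. indicator {0..} t *\<^sub>R (\<E> x. \<psi> n (X t x))) \<in> borel_measurable borel" for n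
  by (rule borel_measurable_continuous_on_indicator[OF _ narrow_X[OF c b]]) simp
 show "(\<lambda>n. indicator {0..} t *\<^sub>R (\<E> x. \<psi> n (X t x))) \<longlonglongrightarrow> indicator {0..} t *\<^sub>R (\<E> x. indicator {..<y} (X t x))" for t
 proof (intro tendsto_scaleR tendsto_const integral_dominated_convergence[where w="\<lambda>_. 1"])
  show "AE x in unif. (\<lambda>n. \<psi> n (X t x)) \<longlonglongrightarrow> indicator {..<y} (X t x)" by (rule AE_I2[OF l])
  show "AE x in unif. norm (\<psi> n (X t x)) <= 1" for n by (rule AE_I2) (use b in simp)
 qed simp_all
qed

lemma X_slice: "(\<lambda>t. X t s) \<in> borel_measurable borel"
proof (cases "0 < s \<and> s < 1")
 case True
 note [measurable] = level_mass_measurable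
 show ?thesis
 proof (rule borel_measurableI_less)
  fix y
  have "{t \<in> space borel. X t s < y}
   = {t. 0 <= t \<and> s < indicator {0..} t *\<^sub>R (\<E> x. indicator {..<y} (X t x))} \<union> {t. t < 0 \<and> 0 < y}"
  proof (intro set_eqI)
   fix t
   show "t \<in> {t \<in> space borel. X t s < y} \<longleftrightarrow>
     t \<in> {t. 0 <= t \<and> s < indicator {0..} t *\<^sub>R (\<E> x. indicator {..<y} (X t x))} \<union> {t. t < 0 \<and> 0 < y}"
    using X_level[of s t y] True by (cases "0 <= t") (auto simp: X_def[of t s])
  qed
  also have "... \<in> sets borel" by measurable
  finally show "{t \<in> space borel. X t s < y} \<in> sets borel" .
 qed
next
 case False
 then have "(\<lambda>t. X t s) = (\<lambda>_. 0)" by (auto simp: X_def)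
 then show ?thesis by simp
qed

text \<open>A right-continuous function of \<open>s\<close> is the limit of its values at grid points to
 the right of \<open>s\<close>.\<close>

lemma X_joint: "(\<lambda>(t, s). X t s) \<in> borel_measurable (borel \<Otimes>\<^sub>M borel)"
proof (rule borel_measurable_LIMSEQ_real)
 \<comment> \<open>The summand 1 puts the grid point strictly to the right of \<open>s\<close>.\<close>
 define \<pi> where "\<pi> n s = (of_int (\<lfloor>s * real (Suc n)\<rfloor> + 1) :: real) / real (Suc n)" for n s
 show "(\<lambda>(t, s). if 0 < s \<and> s < 1 then X t (\<pi> n s) else 0) \<in> borel_measurable (borel \<Otimes>\<^sub>M borel)" for n
 proof -
  have "(\<lambda>p. (\<lambda>i p. X (fst p) (of_int (i + 1) / real (Suc n))) \<lfloor>snd p * real (Suc n)\<rfloor> p) \<in> borel_measurable (borel \<Otimes>\<^sub>M borel)"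
  proof (rule measurable_compose_countable[where f="\<lambda>i p. X (fst p) (of_int (i + 1) / real (Suc n))"
     and g="\<lambda>p. \<lfloor>snd p * real (Suc n)\<rfloor>"])
   show "(\<lambda>p. X (fst p) (of_int (i + 1) / real (Suc n))) \<in> borel_measurable (borel \<Otimes>\<^sub>M borel)" for i :: int
    by (rule measurable_compose[OF measurable_fst X_slice])
   show "(\<lambda>p. \<lfloor>snd p * real (Suc n)\<rfloor>) \<in> borel \<Otimes>\<^sub>M borel \<rightarrow>\<^sub>M count_space UNIV" by measurable
  qed
  then have [measurable]: "(\<lambda>p. X (fst p) (\<pi> n (snd p))) \<in> borel_measurable (borel \<Otimes>\<^sub>M borel)" by (simp add: \<pi>_def)
  show ?thesis unfolding split_beta' by measurable
 qed
 fix p :: "real \<times> real"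
 obtain t s where p: "p = (t, s)" by (cases p)
 show "(\<lambda>n. (case p of (t, s) => if 0 < s \<and> s < 1 then X t (\<pi> n s) else 0)) \<longlonglongrightarrow> (case p of (t, s) => X t s)"
 proof (cases "0 < s \<and> s < 1")
  case True
  have gt: "s < \<pi> n s" and le: "\<pi> n s <= s + 1 / real (Suc n)" for n
  proof -
   have "s * real (Suc n) < of_int (\<lfloor>s * real (Suc n)\<rfloor> + 1)" "of_int (\<lfloor>s * real (Suc n)\<rfloor> + 1) <= s * real (Suc n) + 1"
    using floor_correct[of "s * real (Suc n)"] by simp_all
   then show "s < \<pi> n s" unfolding \<pi>_def by (simp only: pos_less_divide_eq of_nat_0_less_iff zero_less_Suc)
   have "\<pi> n s <= (s * real (Suc n) + 1) / real (Suc n)"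
    unfolding \<pi>_def by (rule divide_right_mono[OF \<open>of_int (\<lfloor>s * real (Suc n)\<rfloor> + 1) <= s * real (Suc n) + 1\<close>]) simp
   also have "... = s + 1 / real (Suc n)" by (simp add: add_divide_distrib del: of_nat_Suc)
   finally show "\<pi> n s <= s + 1 / real (Suc n)" .
  qed
  have "filterlim (\<lambda>n. \<pi> n s) (at_right s) sequentially"
  proof (rule tendsto_imp_filterlim_at_right)
   have "(\<lambda>n. s + 1 / real (Suc n)) \<longlonglongrightarrow> s + 0" by (intro tendsto_add tendsto_const tendsto_div_nat)
   then have u: "(\<lambda>n. s + 1 / real (Suc n)) \<longlonglongrightarrow> s" by simp
   show "(\<lambda>n. \<pi> n s) \<longlonglongrightarrow> s"
    by (rule tendsto_sandwich[OF _ _ tendsto_const u]) (use gt le in \<open>auto intro!: always_eventually less_imp_le\<close>)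
  qed (use gt in simp)
  moreover have "(X t \<longlongrightarrow> X t s) (at_right s)" using X_right_cont True by (simp add: continuous_within)
  ultimately have "(\<lambda>n. X t (\<pi> n s)) \<longlonglongrightarrow> X t s" by (rule filterlim_compose[rotated])
  then show ?thesis using True by (simp add: p)
 qed (auto simp: p X_def)
qed

lemma vt_joint [measurable]: "(\<lambda>(t, y). vt t y) \<in> borel_measurable (borel \<Otimes>\<^sub>M borel)"
proof -
 have "(\<lambda>(t, y). v t y) \<in> borel_measurable (restrict_space borel half_plane)" using sol by (simp add: sticky_particles_solution_def)
 moreover have "half_plane \<inter> space borel \<in> sets (borel :: (real \<times> real) measure)"
  by (auto intro!: borel_closed closed_Times)
 ultimately have "(\<lambda>x. indicator half_plane x *\<^sub>R (case x of (t, y) => v t y)) \<in> borel_measurable borel"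
  by (simp add: borel_measurable_restrict_space_iff)
 then show ?thesis unfolding borel_prod by (simp add: vt_def split_beta' cong: if_cong)
qed

lemmas X_joint' [measurable] = X_joint

lemma slices [measurable (raw)]:
 assumes [measurable]: "f \<in> borel_measurable M" "g \<in> borel_measurable M"
 shows "(\<lambda>x. X (f x) (g x)) \<in> borel_measurable M" "(\<lambda>x. vt (f x) (g x)) \<in> borel_measurable M"
 using measurable_compose[OF measurable_Pair[OF assms] X_joint] measurable_compose[OF measurable_Pair[OF assms] vt_joint] by simp_all

lemma h_measurable [measurable]: "h \<in> borel_measurable borel"
proof -
 have "(\<lambda>(t, s). ennreal ((vt t (X t s))\<^sup>2)) \<in> borel_measurable (borel \<Otimes>\<^sub>M unif)" by measurable
 then show ?thesis unfolding h_def by (rule unif.borel_measurable_nn_integral)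
qed

lemma vv_joint [measurable]: "(\<lambda>(t, y). vv t y) \<in> borel_measurable (borel \<Otimes>\<^sub>M borel)"
 unfolding vv_def split_beta' by measurable

lemma slices' [measurable (raw)]:
 assumes [measurable]: "f \<in> borel_measurable M" "g \<in> borel_measurable M"
 shows "(\<lambda>x. vv (f x) (g x)) \<in> borel_measurable M"
 using measurable_compose[OF measurable_Pair[OF assms] vv_joint] by simp

lemma vt_eq: "0 <= t ==> vt t y = v t y"
 by (simp add: vt_def)

lemma vt_slice [measurable]: "vt t \<in> borel_measurable borel" by measurable

lemma h_energy:
 assumes t: "0 <= t" shows "h t = (\<integral>\<^sup>+y. ennreal ((v t y)\<^sup>2) \<partial>\<rho> t)"
proof -
 have "(\<integral>\<^sup>+y. ennreal ((vt t y)\<^sup>2) \<partial>\<rho> t) = h t" unfolding h_def by (rule E_law(3)[OF t]) measurable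
 then show ?thesis using t by (simp add: vt_eq)
qed

lemma h_finite_integral: "(\<integral>\<^sup>+t. h t * indicator {0..T} t \<partial>lborel) < \<infinity>"
proof -
 have "(\<integral>\<^sup>+t. h t * indicator {0..T} t \<partial>lborel) <= (\<integral>\<^sup>+t. h t * indicator {0..max T 1} t \<partial>lborel)"
  by (intro nn_integral_mono) (auto simp: indicator_def)
 also have "... = (\<integral>\<^sup>+t\<in>{0..max T 1}. (\<integral>\<^sup>+y. ennreal ((v t y)\<^sup>2) \<partial>\<rho> t) \<partial>lborel)"
  by (intro nn_integral_cong) (auto simp: indicator_def h_energy)
 also have "... < \<infinity>" using sol unfolding sticky_particles_solution_def by auto
 finally show ?thesis .
qed

lemma AE_vv: "AE t in lborel. 0 <= t \<longrightarrow> (\<forall>y. vv t y = v t y)"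
proof -
 have "AE t in lborel. \<forall>n::nat. h t * indicator {0..real n} t \<noteq> \<infinity>"
  unfolding AE_all_countable using h_finite_integral
  by (intro allI nn_integral_PInf_AE) (auto simp: top_unique less_top)
 with AE_lborel_singleton[of 0] show ?thesis
 proof eventually_elim
  case (elim t)
  show ?case
  proof (intro impI allI)
   fix y assume t: "0 <= t"
   obtain n :: nat where "t <= real n" using real_arch_simple by blast
   then have "h t \<noteq> \<infinity>" using elim(2)[rule_format, of n] t by (auto simp: indicator_def)
   then show "vv t y = v t y" using t elim(1) by (simp add: vv_def vt_eq)
  qed
 qed
qed

lemma vv_square: "integrable unif (\<lambda>s. (vv t (X t s))\<^sup>2)"
proof (cases "0 < t \<and> h t \<noteq> \<infinity>")
 case True
 then have "integrable unif (\<lambda>s. (vt t (X t s))\<^sup>2)"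
  by (intro integrableI_nonneg) (auto simp: h_def less_top)
 then show ?thesis using True by (simp add: vv_def)
next
 case False
 then have "vv t y = 0" for y by (auto simp: vv_def)
 then show ?thesis by simp
qed

lemma vv_energy: "locint (\<lambda>t. \<E> s. (vv t (X t s))\<^sup>2)"
 unfolding locint_def set_integrable_def
proof (rule allI, rule integrableI_bounded)
 fix T :: real
 have "(\<lambda>(t, s). (vv t (X t s))\<^sup>2) \<in> borel_measurable (borel \<Otimes>\<^sub>M unif)" by measurable
 then have "(\<lambda>t. \<E> s. (vv t (X t s))\<^sup>2) \<in> borel_measurable borel" by (rule unif.borel_measurable_lebesgue_integral)
 then show "(\<lambda>t. indicator {0..T} t *\<^sub>R (\<E> s. (vv t (X t s))\<^sup>2)) \<in> borel_measurable lborel" by simp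
 have le: "ennreal (\<E> s. (vv t (X t s))\<^sup>2) <= h t" for t
 proof -
  have "ennreal (\<E> s. (vv t (X t s))\<^sup>2) = (\<integral>\<^sup>+s. ennreal ((vv t (X t s))\<^sup>2) \<partial>unif)"
   by (rule nn_integral_eq_integral[symmetric, OF vv_square]) simp
  also have "... <= h t" unfolding h_def by (intro nn_integral_mono) (auto simp: vv_def)
  finally show ?thesis .
 qed
 have "(\<integral>\<^sup>+t. ennreal (norm (indicator {0..T} t *\<^sub>R (\<E> s. (vv t (X t s))\<^sup>2))) \<partial>lborel) <= (\<integral>\<^sup>+t. h t * indicator {0..T} t \<partial>lborel)"
  by (intro nn_integral_mono) (auto simp: indicator_def le)
 also have "... < \<infinity>" by (rule h_finite_integral)
 finally show "(\<integral>\<^sup>+t. ennreal (norm (indicator {0..T} t *\<^sub>R (\<E> s. (vv t (X t s))\<^sup>2))) \<partial>lborel) < \<infinity>" .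
qed

lemma weak_vv:
 assumes \<alpha>m [measurable]: "\<alpha> \<in> borel_measurable borel" and T: "C1c_test \<phi> \<phi>t \<phi>y"
 shows "(LINT t:{0..}|lborel. (\<integral>y. \<alpha> (v t y) * \<phi>t t y + \<alpha> (v t y) * v t y * \<phi>y t y \<partial>\<rho> t))
  = (LINT t:{0..}|lborel. (\<E> s. \<alpha> (vv t (X t s)) * \<phi>t t (X t s) + \<alpha> (vv t (X t s)) * vv t (X t s) * \<phi>y t (X t s)))"
proof -
 define pt where "pt t y = indicator half_plane (t, y) *\<^sub>R \<phi>t t y" for t y
 define py where "py t y = indicator half_plane (t, y) *\<^sub>R \<phi>y t y" for t y
 have cl: "half_plane \<in> sets (borel :: (real \<times> real) measure)" by (auto intro!: borel_closed closed_Times)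
 have ptj: "(\<lambda>(t, y). pt t y) \<in> borel_measurable (borel \<Otimes>\<^sub>M borel)" "(\<lambda>(t, y). py t y) \<in> borel_measurable (borel \<Otimes>\<^sub>M borel)"
  unfolding borel_prod using T borel_measurable_continuous_on_indicator[OF cl, of "\<lambda>(t, y). \<phi>t t y"]
   borel_measurable_continuous_on_indicator[OF cl, of "\<lambda>(t, y). \<phi>y t y"]
  by (simp_all add: C1c_test_def pt_def py_def split_beta')
 have [measurable (raw)]: "(\<lambda>x. pt (f x) (g x)) \<in> borel_measurable M" "(\<lambda>x. py (f x) (g x)) \<in> borel_measurable M"
  if "f \<in> borel_measurable M" "g \<in> borel_measurable M" for f g and M :: "'c measure"
  using measurable_compose[OF measurable_Pair[OF that] ptj(1)] measurable_compose[OF measurable_Pair[OF that] ptj(2)] by simp_all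
 define I where "I w t = (\<E> s. \<alpha> (w t (X t s)) * pt t (X t s) + \<alpha> (w t (X t s)) * w t (X t s) * py t (X t s))"
  for w :: "real => real => real" and t
 have 1: "(LINT t:{0..}|lborel. (\<integral>y. \<alpha> (v t y) * \<phi>t t y + \<alpha> (v t y) * v t y * \<phi>y t y \<partial>\<rho> t)) = (LINT t:{0..}|lborel. I vt t)"
 proof (rule set_lebesgue_integral_cong)
  show "\<forall>t. t \<in> {0..} \<longrightarrow> (\<integral>y. \<alpha> (v t y) * \<phi>t t y + \<alpha> (v t y) * v t y * \<phi>y t y \<partial>\<rho> t) = I vt t"
  proof (intro allI impI)
   fix t :: real assume "t \<in> {0..}"
   then have t: "0 <= t" by simp
   have "(\<integral>y. \<alpha> (v t y) * \<phi>t t y + \<alpha> (v t y) * v t y * \<phi>y t y \<partial>\<rho> t) = (\<integral>y. \<alpha> (vt t y) * pt t y + \<alpha> (vt t y) * vt t y * py t y \<partial>\<rho> t)"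
    using t by (simp add: vt_eq pt_def py_def)
   also have "... = I vt t" unfolding I_def by (rule E_law(1)[OF t]) measurable
   finally show "(\<integral>y. \<alpha> (v t y) * \<phi>t t y + \<alpha> (v t y) * v t y * \<phi>y t y \<partial>\<rho> t) = I vt t" .
  qed
 qed simp
 have m1: "(\<lambda>(t, s). \<alpha> (vt t (X t s)) * pt t (X t s) + \<alpha> (vt t (X t s)) * vt t (X t s) * py t (X t s)) \<in> borel_measurable (borel \<Otimes>\<^sub>M unif)"
  by measurable
 have m2: "(\<lambda>(t, s). \<alpha> (vv t (X t s)) * pt t (X t s) + \<alpha> (vv t (X t s)) * vv t (X t s) * py t (X t s)) \<in> borel_measurable (borel \<Otimes>\<^sub>M unif)"
  by measurable
 have 2: "(LINT t:{0..}|lborel. I vt t) = (LINT t:{0..}|lborel. I vv t)"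
 proof (rule set_lebesgue_integral_cong_AE)
  show "I vt \<in> borel_measurable lborel" "I vv \<in> borel_measurable lborel"
   unfolding I_def using unif.borel_measurable_lebesgue_integral[OF m1] unif.borel_measurable_lebesgue_integral[OF m2] by simp_all
  show "AE t\<in>{0..} in lborel. I vt t = I vv t"
   using AE_vv by eventually_elim (auto simp: I_def vt_eq)
 qed simp
 have 3: "(LINT t:{0..}|lborel. I vv t)
  = (LINT t:{0..}|lborel. (\<E> s. \<alpha> (vv t (X t s)) * \<phi>t t (X t s) + \<alpha> (vv t (X t s)) * vv t (X t s) * \<phi>y t (X t s)))"
  by (rule set_lebesgue_integral_cong) (auto simp: I_def pt_def py_def)
 show ?thesis unfolding 1 2 3 ..
qed

end

context sps
begin

lemma v0_continuous: "continuous_on UNIV v0"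
 using v0b by (simp add: bcontfun_def)

lemma v0_bounded: "\<exists>B. \<forall>y. \<bar>v0 y\<bar> <= B"
 using v0b by (auto simp: bcontfun_def bounded_iff)

lemma v0_meas [measurable]: "v0 \<in> borel_measurable borel"
 by (rule borel_measurable_continuous_onI[OF v0_continuous])

lemma \<rho>0_distribution: "real_distribution \<rho>0"
 using P2 by (simp add: P2_def)

abbreviation en :: "real => real" where "en t \<equiv> (\<E> s. (vv t (X t s))\<^sup>2)"

lemma abs_le_one_square: "\<bar>x\<bar> <= 1 + x\<^sup>2" for x :: real
 using young_ineq[of 1 x 1] sum_squares_ge_zero[of x 0] by (simp add: power2_eq_square)

lemma V_bounds:
 shows "integrable unif (\<lambda>s. vv t (X t s))" and "(\<E> s. \<bar>vv t (X t s)\<bar>) <= 1 + en t"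
  and "integrable unif (\<lambda>s. vv t (X t s) * vv t (X t s))" and "(\<E> s. \<bar>vv t (X t s) * vv t (X t s)\<bar>) <= 1 + en t"
  and "0 <= en t"
proof -
 show i: "integrable unif (\<lambda>s. vv t (X t s))" by (rule unif.integrable_of_square[OF _ vv_square]) measurable
 have "(\<E> s. \<bar>vv t (X t s)\<bar>) <= (\<E> s. 1 + (vv t (X t s))\<^sup>2)"
  by (rule integral_mono) (use i vv_square abs_le_one_square in auto)
 also have "... = 1 + en t" using vv_square[of t] by (simp add: unif.prob_space[unfolded space_unif])
 finally show "(\<E> s. \<bar>vv t (X t s)\<bar>) <= 1 + en t" .
 show "integrable unif (\<lambda>s. vv t (X t s) * vv t (X t s))" using vv_square[of t] by (simp add: power2_eq_square)
 show "(\<E> s. \<bar>vv t (X t s) * vv t (X t s)\<bar>) <= 1 + en t" by (simp add: power2_eq_square)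
 show "0 <= en t" by simp
qed

lemma V_joint: "(\<lambda>(t, s). vv t (X t s)) \<in> borel_measurable (borel \<Otimes>\<^sub>M borel)"
 by measurable

lemma locint_bound_en: "locint (\<lambda>t. 1 + en t)"
 by (rule locint_add[OF locint_const vv_energy])

lemma transport_mass: "weak_transport X (\<lambda>t s. vv t (X t s)) (\<lambda>t s. 1) (\<lambda>_. 1) (\<lambda>t. 1 + en t) \<rho>0 1"
proof (rule weak_transport.intro)
 show "(\<E> s. \<bar>1 :: real\<bar>) <= 1 + en t" for t using V_bounds(5)[of t] by (simp add: unif.prob_space[unfolded space_unif])
 show "(LINT t:{0..}|lborel. (\<E> s. 1 * \<phi>t t (X t s) + 1 * vv t (X t s) * \<phi>y t (X t s))) + (\<integral>y. \<phi> 0 y * 1 \<partial>\<rho>0) = 0"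
  if T: "C1c_test \<phi> \<phi>t \<phi>y" for \<phi> \<phi>t \<phi>y
 proof -
  have "(LINT t:{0..}|lborel. (\<integral>y. \<phi>t t y + v t y * \<phi>y t y \<partial>\<rho> t)) + (\<integral>y. \<phi> 0 y \<partial>\<rho>0) = 0"
   using sol T unfolding sticky_particles_solution_def by blast
  then show ?thesis using weak_vv[OF _ T, of "\<lambda>_. 1"] by simp
 qed
qed (use X_joint V_joint V_bounds locint_bound_en \<rho>0_distribution in simp_all)

lemma transport_momentum:
 assumes B: "\<And>y. \<bar>v0 y\<bar> <= B"
 shows "weak_transport X (\<lambda>t s. vv t (X t s)) (\<lambda>t s. vv t (X t s)) v0 (\<lambda>t. 1 + en t) \<rho>0 B"
proof (rule weak_transport.intro)
 show "(LINT t:{0..}|lborel. (\<E> s. vv t (X t s) * \<phi>t t (X t s) + vv t (X t s) * vv t (X t s) * \<phi>y t (X t s))) + (\<integral>y. \<phi> 0 y * v0 y \<partial>\<rho>0) = 0"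
  if T: "C1c_test \<phi> \<phi>t \<phi>y" for \<phi> \<phi>t \<phi>y
 proof -
  have "(LINT t:{0..}|lborel. (\<integral>y. v t y * \<phi>t t y + (v t y)\<^sup>2 * \<phi>y t y \<partial>\<rho> t)) + (\<integral>y. \<phi> 0 y * v0 y \<partial>\<rho>0) = 0"
   using sol T unfolding sticky_particles_solution_def by blast
  then show ?thesis using weak_vv[OF _ T, of "\<lambda>z. z"] by (simp add: power2_eq_square)
 qed
qed (fact X_joint V_joint V_bounds locint_bound_en \<rho>0_distribution v0_meas B)+

text \<open>Both sides are the limit at time 0 of the integrated mass equation, since the flow is
 narrowly continuous.\<close>

lemma initial_C1b:
 assumes \<phi>: "C1b \<phi> \<phi>' L"
 shows "(\<E> s. \<phi> (X 0 s)) = (\<integral>y. \<phi> y \<partial>\<rho>0)"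
proof -
 interpret W: weak_transport X "\<lambda>t s. vv t (X t s)" "\<lambda>t s. 1" "\<lambda>_. 1" "\<lambda>t. 1 + en t" \<rho>0 1 by (rule transport_mass)
 obtain B where B: "\<And>y. \<bar>\<phi> y\<bar> <= B" using \<phi> by (auto simp: C1b_def)
 define A where "A t = (\<E> s. \<phi> (X t s))" for t
 define D where "D t = (\<E> s. 1 * (vv t (X t s) - 0) * \<phi>' (X t s - 0 * t))" for t
 define C where "C = (\<integral>y. \<phi> y \<partial>\<rho>0)"
 have lD: "locint D" unfolding D_def[abs_def] by (rule W.balance(2)[OF \<phi> order_refl])
 have cA: "continuous_on {0..} A" unfolding A_def[abs_def] by (rule narrow_X[OF C1b_continuous[OF \<phi>] B])
 have cD: "continuous_on {0..} (\<lambda>t. C + prim D t)" by (intro continuous_on_add continuous_on_const continuous_on_prim lD)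
 have "A 0 = C + prim D 0"
 proof (rule continuous_eq_of_prim_eq[OF cA cD _ order_refl])
  fix b :: real assume b: "0 <= b"
  have "prim (\<lambda>t. C + prim D t) b = C * b + prim (prim D) b"
   by (simp only: prim_add[OF locint_const locint_continuous[OF continuous_on_prim[OF lD]]] prim_const[OF b])
  moreover have "prim A b = C * b + prim (prim D) b"
   using W.balance(1)[OF \<phi> b, of 0] unfolding A_def[abs_def] D_def[abs_def] C_def by simp
  ultimately show "prim A b = prim (\<lambda>t. C + prim D t) b" by simp
 qed
 then show ?thesis by (simp add: A_def C_def)
qed

lemma initial_law:
 fixes g :: "real => real"
 assumes c: "continuous_on UNIV g" and B: "\<And>y. \<bar>g y\<bar> <= B"
 shows "(\<E> s. g (X 0 s)) = (\<integral>y. g y \<partial>\<rho>0)"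
proof -
 interpret \<rho>0: real_distribution \<rho>0 by (rule \<rho>0_distribution)
 obtain G G' :: "nat => real => real" and L where G: "\<And>n. C1b (G n) (G' n) (L n)" "\<And>n y. \<bar>G n y\<bar> <= B" "\<And>y. (\<lambda>n. G n y) \<longlonglongrightarrow> g y"
  by (rule continuous_smooth_approx[OF c B]) (rule that)
 have Gm [measurable]: "G n \<in> borel_measurable borel" for n by (rule borel_measurable_continuous_onI[OF C1b_continuous[OF G(1)]])
 have gm [measurable]: "g \<in> borel_measurable borel" by (rule borel_measurable_continuous_onI[OF c])
 have 1: "(\<lambda>n. \<E> s. G n (X 0 s)) \<longlonglongrightarrow> (\<E> s. g (X 0 s))"
 proof (rule integral_dominated_convergence[where w="\<lambda>_. B"])
  show "AE s in unif. (\<lambda>n. G n (X 0 s)) \<longlonglongrightarrow> g (X 0 s)" by (rule AE_I2) (rule G(3))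
  show "AE s in unif. norm (G n (X 0 s)) <= B" for n by (rule AE_I2) (simp add: G(2))
 qed simp_all
 have 2: "(\<lambda>n. \<integral>y. G n y \<partial>\<rho>0) \<longlonglongrightarrow> (\<integral>y. g y \<partial>\<rho>0)"
 proof (rule integral_dominated_convergence[where w="\<lambda>_. B"])
  show "AE y in \<rho>0. (\<lambda>n. G n y) \<longlonglongrightarrow> g y" by (rule AE_I2) (rule G(3))
  show "AE y in \<rho>0. norm (G n y) <= B" for n by (rule AE_I2) (simp add: G(2))
 qed simp_all
 show ?thesis by (rule LIMSEQ_unique[OF 1]) (use 2 initial_C1b[OF G(1)] in simp)
qed

text \<open>The initial laws agree on bounded continuous functions; second moments are reached by
 truncation.\<close>

lemma X0_square: "integrable unif (\<lambda>s. (X 0 s)\<^sup>2)"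
proof (rule integrable_monotone_convergence)
 interpret \<rho>0: real_distribution \<rho>0 by (rule \<rho>0_distribution)
 have lim: "(\<lambda>i. min (x\<^sup>2) (real i)) \<longlonglongrightarrow> x\<^sup>2" for x :: real
 proof (rule tendsto_eventually)
  obtain n :: nat where "x\<^sup>2 <= real n" using real_arch_simple by blast
  then show "\<forall>\<^sub>F i in sequentially. min (x\<^sup>2) (real i) = x\<^sup>2" by (intro eventually_sequentiallyI[of n]) auto
 qed
 have bd: "\<bar>min (x\<^sup>2) (real i)\<bar> <= real i" for x i by (simp add: min_def)
 show "integrable unif (\<lambda>s. min ((X 0 s)\<^sup>2) (real i))" for i
  by (rule unif.integrable_const_bound[of _ "real i"]) (use bd in auto)
 show "AE s in unif. mono (\<lambda>i. min ((X 0 s)\<^sup>2) (real i))" by (rule AE_I2) (auto simp: mono_def min_def)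
 show "AE s in unif. (\<lambda>i. min ((X 0 s)\<^sup>2) (real i)) \<longlonglongrightarrow> (X 0 s)\<^sup>2" by (rule AE_I2[OF lim])
 have "(\<lambda>i. \<integral>y. min (y\<^sup>2) (real i) \<partial>\<rho>0) \<longlonglongrightarrow> (\<integral>y. y\<^sup>2 \<partial>\<rho>0)"
 proof (rule integral_dominated_convergence[where w="\<lambda>y. y\<^sup>2"])
  show "integrable \<rho>0 (\<lambda>y. y\<^sup>2)" using P2 by (simp add: P2_def)
  show "AE y in \<rho>0. (\<lambda>i. min (y\<^sup>2) (real i)) \<longlonglongrightarrow> y\<^sup>2" by (rule AE_I2[OF lim])
  show "AE y in \<rho>0. norm (min (y\<^sup>2) (real i)) <= y\<^sup>2" for i by (rule AE_I2) (simp add: min_def)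
 qed simp_all
 moreover have "(\<E> s. min ((X 0 s)\<^sup>2) (real i)) = (\<integral>y. min (y\<^sup>2) (real i) \<partial>\<rho>0)" for i
  by (rule initial_law[OF _ bd]) (intro continuous_intros)
 ultimately show "(\<lambda>i. \<E> s. min ((X 0 s)\<^sup>2) (real i)) \<longlonglongrightarrow> (\<integral>y. y\<^sup>2 \<partial>\<rho>0)" by simp
qed measurable

lemma vv_oleinik:
 assumes t: "0 < t" and y: "y1 <= y2" shows "vv t y2 - vv t y1 <= (y2 - y1) / t"
proof (cases "h t \<noteq> \<infinity> \<and> y1 < y2")
 case True
 have "\<forall>t>0. \<forall>y1 y2. y1 < y2 \<longrightarrow> (v t y2 - v t y1) / (y2 - y1) <= 1 / t"
  by (rule sol[unfolded sticky_particles_solution_def, THEN conjunct2, THEN conjunct2, THEN conjunct2, THEN conjunct2,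
    THEN conjunct2, THEN conjunct2, THEN conjunct1])
 then have "(v t y2 - v t y1) / (y2 - y1) <= 1 / t" using t True by blast
 then have "v t y2 - v t y1 <= 1 / t * (y2 - y1)" using True by (simp only: pos_divide_le_eq diff_gt_0_iff_gt)
 then show ?thesis using True t by (simp add: vv_def vt_eq)
next
 case False
 then have "vv t y2 - vv t y1 = 0" using y by (auto simp: vv_def)
 then show ?thesis using t y by simp
qed

lemma en_initial: "(en \<longlongrightarrow> (\<E> s. (v0 (X 0 s))\<^sup>2)) (at_right 0)"
proof -
 obtain B where B: "\<And>y. \<bar>v0 y\<bar> <= B" using v0_bounded by blast
 have "(\<E> s. (v0 (X 0 s))\<^sup>2) = (\<integral>y. (v0 y)\<^sup>2 \<partial>\<rho>0)"
 proof (rule initial_law)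
  show "continuous_on UNIV (\<lambda>y. (v0 y)\<^sup>2)" by (intro continuous_on_power v0_continuous)
  show "\<bar>(v0 y)\<^sup>2\<bar> <= B\<^sup>2" for y using power_mono[OF B[of y], of 2] by simp
 qed
 moreover have one: "(\<lambda>_. 1 :: real) \<in> (bcontfun :: (real => real) set)" by (auto simp: bcontfun_def bounded_iff)
 have "((\<lambda>t. \<integral>y. (v t y)\<^sup>2 * 1 \<partial>\<rho> t) \<longlongrightarrow> (\<integral>y. (v0 y)\<^sup>2 * 1 \<partial>\<rho>0)) (at_right 0)"
  by (rule bspec[OF sol[unfolded sticky_particles_solution_def, THEN conjunct2, THEN conjunct2, THEN conjunct2, THEN conjunct2,
    THEN conjunct2, THEN conjunct2, THEN conjunct2, THEN conjunct2] one])
 then have lim: "((\<lambda>t. \<integral>y. (v t y)\<^sup>2 \<partial>\<rho> t) \<longlongrightarrow> (\<integral>y. (v0 y)\<^sup>2 \<partial>\<rho>0)) (at_right 0)" by simp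
 have int: "\<forall>\<^sub>F t in at_right 0. integrable (\<rho> t) (\<lambda>y. (v t y)\<^sup>2)"
  using sol unfolding sticky_particles_solution_def by blast
 have "\<forall>\<^sub>F t in at_right 0. (\<integral>y. (v t y)\<^sup>2 \<partial>\<rho> t) = en t"
  using int eventually_at_right_less
 proof eventually_elim
  case (elim t)
  then have t: "0 <= t" by simp
  have "h t = ennreal (\<integral>y. (v t y)\<^sup>2 \<partial>\<rho> t)" unfolding h_energy[OF t] by (rule nn_integral_eq_integral[OF elim(1)]) simp
  then have "vv t y = vt t y" for y using elim by (simp add: vv_def)
  moreover have "(\<integral>y. (vt t y)\<^sup>2 \<partial>\<rho> t) = (\<E> s. (vt t (X t s))\<^sup>2)" by (rule E_law(1)[OF t]) measurable
  ultimately show ?case using t by (simp add: vt_eq)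
 qed
 from Lim_transform_eventually[OF lim this] show ?thesis using calculation by simp
qed

lemma flow: "sticky_flow X vv v0"
proof (rule sticky_flow.intro)
 interpret W: weak_transport X "\<lambda>t s. vv t (X t s)" "\<lambda>t s. 1" "\<lambda>_. 1" "\<lambda>t. 1 + en t" \<rho>0 1 by (rule transport_mass)
 show "prim (\<lambda>t. \<E> s. \<phi> (X t s - l * t)) b = (\<E> s. \<phi> (X 0 s)) * b
   + prim (prim (\<lambda>t. \<E> s. (vv t (X t s) - l) * \<phi>' (X t s - l * t))) b"
  if \<phi>: "C1b \<phi> \<phi>' L" and b: "0 <= b" for \<phi> \<phi>' L b l
  using W.balance(1)[OF \<phi> b, of l] unfolding initial_C1b[OF \<phi>] by (simp only: mult_1_left mult_1_right)
 obtain B where B: "\<And>y. \<bar>v0 y\<bar> <= B" using v0_bounded by blast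
 interpret Z: weak_transport X "\<lambda>t s. vv t (X t s)" "\<lambda>t s. vv t (X t s)" v0 "\<lambda>t. 1 + en t" \<rho>0 B by (rule transport_momentum[OF B])
 show "prim (\<lambda>t. \<E> s. vv t (X t s) * \<phi> (X t s)) b = (\<E> s. v0 (X 0 s) * \<phi> (X 0 s)) * b
   + prim (prim (\<lambda>t. \<E> s. (vv t (X t s))\<^sup>2 * \<phi>' (X t s))) b"
  if \<phi>: "C1b \<phi> \<phi>' L" and b: "0 <= b" for \<phi> \<phi>' L b
 proof -
  obtain K where K: "\<And>y. \<bar>\<phi> y\<bar> <= K" using \<phi> by (auto simp: C1b_def)
  have "(\<E> s. v0 (X 0 s) * \<phi> (X 0 s)) = (\<integral>y. v0 y * \<phi> y \<partial>\<rho>0)"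
  proof (rule initial_law)
   show "continuous_on UNIV (\<lambda>y. v0 y * \<phi> y)" by (intro continuous_on_mult v0_continuous C1b_continuous[OF \<phi>])
   show "\<bar>v0 y * \<phi> y\<bar> <= B * K" for y
    unfolding abs_mult by (rule mult_mono[OF B K order_trans[OF abs_ge_zero B] abs_ge_zero])
  qed
  then show ?thesis using Z.balance(1)[OF \<phi> b, of 0] by (simp add: power2_eq_square mult.commute[of "v0 _"])
 qed
qed (rule X_joint vv_joint X_mono X_right_cont X0_square vv_square vv_energy v0_continuous v0_bounded narrow_X vv_oleinik en_initial;
  assumption?)+

end

section \<open>Identification of the metric projection\<close>

lemma AE_unif_imp_leb01: "(AE s in unif. Q s) ==> (AE s in leb01. Q s)"
 unfolding unif_density AE_leb01_iff by (subst (asm) AE_density) (auto dest: AE_completion simp: indicator_def)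

lemma mono_cone_representative:
 assumes "g \<in> mono_cone"
 obtains k where "k \<in> borel_measurable borel" "mono_on {0<..<1} k" "integrable unif (\<lambda>s. (k s)\<^sup>2)" "AE s in leb01. g s = k s"
proof -
 obtain g' where g': "mono_on {0<..<1} g'" "AE s in leb01. g s = g' s" and L2: "g \<in> L2" using assms by (auto simp: mono_cone_def)
 define k where "k s = (if 0 < s \<and> s < 1 then g' s else 0)" for s
 have km [measurable]: "k \<in> borel_measurable borel" unfolding k_def by (rule borel_measurable_mono_truncated[OF g'(1)])
 have ae: "AE s in leb01. g s = k s" using g'(2) AE_space by eventually_elim (simp add: k_def)
 have gm: "g \<in> borel_measurable leb01" and gi: "integrable leb01 (\<lambda>s. (g s)\<^sup>2)" using L2 by (auto simp: L2_def)
 note [measurable] = measurable_leb01_of_borel[OF km] gm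
 have "integrable leb01 (\<lambda>s. (k s)\<^sup>2) \<longleftrightarrow> integrable leb01 (\<lambda>s. (g s)\<^sup>2)"
 proof (rule integrable_cong_AE)
  show "AE s in leb01. (k s)\<^sup>2 = (g s)\<^sup>2" using ae by eventually_elim simp
 qed measurable
 then have "integrable unif (\<lambda>s. (k s)\<^sup>2)" using gi integral_unif_leb01(2)[of "\<lambda>s. (k s)\<^sup>2"] by simp
 moreover have "mono_on {0<..<1} k" using g'(1) by (auto simp: k_def mono_on_def)
 ultimately show thesis using that km ae by blast
qed

lemma L2_norm_AE:
 fixes F k f g :: "real => real"
 assumes [measurable]: "f \<in> borel_measurable leb01" "g \<in> borel_measurable leb01" "F \<in> borel_measurable borel" "k \<in> borel_measurable borel"
  and "AE s in leb01. f s - g s = F s - k s"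
 shows "L2_norm (\<lambda>s. f s - g s) = sqrt (\<E> s. (F s - k s)\<^sup>2)"
proof -
 note [measurable] = measurable_leb01_of_borel[OF assms(3)] measurable_leb01_of_borel[OF assms(4)]
 have "(\<integral>s. (f s - g s)\<^sup>2 \<partial>leb01) = (\<integral>s. (F s - k s)\<^sup>2 \<partial>leb01)"
 proof (rule integral_cong_AE)
  show "AE s in leb01. (f s - g s)\<^sup>2 = (F s - k s)\<^sup>2" using assms(5) by eventually_elim simp
 qed measurable
 also have "... = (\<E> s. (F s - k s)\<^sup>2)" by (rule integral_unif_leb01(1)[symmetric]) measurable
 finally show ?thesis by (simp add: L2_norm_def)
qed

text \<open>By the variational inequality every competitor is at least as far from \<open>F\<close> as
 \<open>P\<close>, the excess being its squared distance to \<open>P\<close>.\<close>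

lemma proj_mono_cone_eq:
 fixes F P f :: "real => real"
 assumes Fm [measurable]: "F \<in> borel_measurable borel" and F2: "integrable unif (\<lambda>s. (F s)\<^sup>2)"
  and Pm [measurable]: "P \<in> borel_measurable borel" and Pmono: "mono_on {0<..<1} P" and P2: "integrable unif (\<lambda>s. (P s)\<^sup>2)"
  and var: "\<And>k :: real => real. k \<in> borel_measurable borel ==> mono_on {0<..<1} k ==> integrable unif (\<lambda>s. (k s)\<^sup>2) ==>
   (\<E> s. (F s - P s) * (k s - P s)) <= 0"
  and f: "\<And>s. 0 < s ==> s < 1 ==> f s = F s"
 shows "proj_mono_cone f \<in> mono_cone" and "AE s in leb01. proj_mono_cone f s = P s"
proof -
 define J where "J g = L2_norm (\<lambda>s. f s - g s)" for g
 have fm: "f \<in> borel_measurable leb01" by (rule measurable_leb01_cong[OF Fm f])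
 have fF: "AE s in leb01. f s = F s" using AE_space by eventually_elim (simp add: f)
 have PL: "P \<in> mono_cone"
  using measurable_leb01_of_borel[OF Pm] P2 integral_unif_leb01(2)[of "\<lambda>s. (P s)\<^sup>2"] Pmono
  by (auto simp: mono_cone_def L2_def)
 have J: "J g = sqrt (\<E> s. (F s - k s)\<^sup>2)"
  if "g \<in> mono_cone" "k \<in> borel_measurable borel" "AE s in leb01. g s = k s" for g k
  unfolding J_def
 proof (rule L2_norm_AE[OF fm _ Fm that(2)])
  show "g \<in> borel_measurable leb01" using that(1) by (simp add: mono_cone_def L2_def)
  show "AE s in leb01. f s - g s = F s - k s" using fF that(3) by eventually_elim simp
 qed
 have JP: "J P = sqrt (\<E> s. (F s - P s)\<^sup>2)" by (rule J[OF PL Pm]) simp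
 have pyth: "(\<E> s. (F s - P s)\<^sup>2) + (\<E> s. (k s - P s)\<^sup>2) <= (\<E> s. (F s - k s)\<^sup>2)"
  and ik: "integrable unif (\<lambda>s. (k s - P s)\<^sup>2)"
  if km [measurable]: "k \<in> borel_measurable borel" and k: "mono_on {0<..<1} k" and k2: "integrable unif (\<lambda>s. (k s)\<^sup>2)" for k :: "real => real"
 proof -
  have i1: "integrable unif (\<lambda>s. (F s - P s)\<^sup>2)" by (rule integrable_square_diff[OF _ _ F2 P2]) simp_all
  show i2: "integrable unif (\<lambda>s. (k s - P s)\<^sup>2)" by (rule integrable_square_diff[OF _ _ k2 P2]) simp_all
  have i3: "integrable unif (\<lambda>s. (F s - P s) * (k s - P s))" by (rule integrable_mult_of_squares[OF _ _ i1 i2]) simp_all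
  have "(\<E> s. (F s - k s)\<^sup>2) = (\<E> s. (F s - P s)\<^sup>2 + (k s - P s)\<^sup>2 - 2 * ((F s - P s) * (k s - P s)))"
   by (intro Bochner_Integration.integral_cong refl) (simp add: power2_eq_square algebra_simps)
  also have "... = (\<E> s. (F s - P s)\<^sup>2) + (\<E> s. (k s - P s)\<^sup>2) - 2 * (\<E> s. (F s - P s) * (k s - P s))"
   using i1 i2 i3 by simp
  finally show "(\<E> s. (F s - P s)\<^sup>2) + (\<E> s. (k s - P s)\<^sup>2) <= (\<E> s. (F s - k s)\<^sup>2)" using var[OF km k k2] by simp
 qed
 have "is_arg_min J (\<lambda>g. g \<in> mono_cone) P"
  unfolding is_arg_min_def
 proof (intro conjI PL notI)
  assume "\<exists>g. g \<in> mono_cone \<and> J g < J P"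
  then obtain g where g: "g \<in> mono_cone" "J g < J P" by blast
  obtain k where k: "k \<in> borel_measurable borel" "mono_on {0<..<1} k" "integrable unif (\<lambda>s. (k s)\<^sup>2)" "AE s in leb01. g s = k s"
   by (rule mono_cone_representative[OF g(1)]) (rule that)
  have "0 <= (\<E> s. (k s - P s)\<^sup>2)" by simp
  then have "J P <= J g" unfolding JP J[OF g(1) k(1,4)] using pyth[OF k(1-3)] by (intro real_sqrt_le_mono) linarith
  then show False using g(2) by simp
 qed
 then have "is_arg_min J (\<lambda>g. g \<in> mono_cone) (proj_mono_cone f)"
  unfolding proj_mono_cone_def J_def[abs_def] arg_min_on_def arg_min_def
  by (rule someI[where P="is_arg_min (\<lambda>g. L2_norm (\<lambda>s. f s - g s)) (\<lambda>g. g \<in> mono_cone)"])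
 then have pc: "proj_mono_cone f \<in> mono_cone" and min: "J (proj_mono_cone f) <= J P"
  using PL by (auto simp: is_arg_min_def not_less)
 show "proj_mono_cone f \<in> mono_cone" by (rule pc)
 obtain k where k: "k \<in> borel_measurable borel" "mono_on {0<..<1} k" "integrable unif (\<lambda>s. (k s)\<^sup>2)" "AE s in leb01. proj_mono_cone f s = k s"
  by (rule mono_cone_representative[OF pc]) (rule that)
 have "(\<E> s. (F s - k s)\<^sup>2) <= (\<E> s. (F s - P s)\<^sup>2)" using min unfolding JP J[OF pc k(1,4)] by simp
 then have "(\<E> s. (k s - P s)\<^sup>2) <= 0" using pyth[OF k(1-3)] by linarith
 moreover have "0 <= (\<E> s. (k s - P s)\<^sup>2)" by simp
 ultimately have "(\<E> s. (k s - P s)\<^sup>2) = 0" by linarith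
 then have "AE s in unif. (k s - P s)\<^sup>2 = 0" using ik[OF k(1-3)] by (subst (asm) integral_nonneg_eq_0_iff_AE) auto
 then have "AE s in unif. k s = P s" by eventually_elim simp
 then have "AE s in leb01. k s = P s" by (rule AE_unif_imp_leb01)
 with k(4) show "AE s in leb01. proj_mono_cone f s = P s" by eventually_elim simp
qed

theorem mainTheorem4:
  fixes \<rho>\<^sub>0 :: "real measure" and v\<^sub>0 :: "real \<Rightarrow> real"
    and \<rho> :: "real \<Rightarrow> real measure" and v :: "real \<Rightarrow> real \<Rightarrow> real"
    and N :: "real \<Rightarrow> real \<Rightarrow> real"
  assumes "\<rho>\<^sub>0 \<in> P2"
    and "v\<^sub>0 \<in> bcontfun"
    and "sticky_particles_solution \<rho>\<^sub>0 v\<^sub>0 \<rho> v"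
    and "\<And>t. t \<ge> 0 \<Longrightarrow> monotone_rearrangement (\<rho> t) (N t)"
  shows "\<forall>t>0. (\<lambda>s. N t s / t - proj_mono_cone (v\<^sub>0 \<circ> N 0) s) \<in> L2 \<and>
           L2_norm (\<lambda>s. N t s / t - proj_mono_cone (v\<^sub>0 \<circ> N 0) s) \<le> L2_norm (N 0) / t"
proof (intro allI impI)
 fix t :: real assume t: "0 < t"
 interpret S: sps \<rho>\<^sub>0 v\<^sub>0 \<rho> v N by (rule sps.intro) (use assms in auto)
 interpret F: sticky_flow S.X S.vv v\<^sub>0 by (rule S.flow)
 obtain P where P: "P \<in> borel_measurable borel" "mono_on {0<..<1} P" "integrable unif (\<lambda>s. (P s)\<^sup>2)"
  "\<And>k :: real => real. k \<in> borel_measurable borel ==> mono_on {0<..<1} k ==> integrable unif (\<lambda>s. (k s)\<^sup>2) ==>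
   (\<E> s. (v\<^sub>0 (S.X 0 s) - P s) * (k s - P s)) <= 0"
  "\<And>t. 0 < t ==> (\<E> s. (S.X t s / t - P s)\<^sup>2) <= (\<E> s. (S.X 0 s)\<^sup>2) / t\<^sup>2"
  by (rule F.rescaled_projection) (rule that)
 have V0m: "(\<lambda>s. v\<^sub>0 (S.X 0 s)) \<in> borel_measurable borel" by measurable
 define p where "p = proj_mono_cone (v\<^sub>0 \<circ> N 0)"
 have XN: "S.X q s = N q s" if "0 <= q" "0 < s" "s < 1" for q s using that by (simp add: S.X_def)
 have eq: "(v\<^sub>0 \<circ> N 0) s = v\<^sub>0 (S.X 0 s)" if "0 < s" "s < 1" for s using that by (simp add: XN)
 have pc: "p \<in> mono_cone" and pP: "AE s in leb01. p s = P s"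
  unfolding p_def by (rule proj_mono_cone_eq[OF V0m F.V0_sq P(1-3) P(4) eq]; assumption)+
 have pm: "p \<in> borel_measurable leb01" using pc by (simp add: mono_cone_def L2_def)
 have Xtm: "(\<lambda>s. S.X t s / t) \<in> borel_measurable borel" by measurable
 have Nm: "(\<lambda>s. N t s / t) \<in> borel_measurable leb01"
  by (rule measurable_leb01_cong[OF Xtm]) (use t in \<open>simp add: XN\<close>)
 have ae: "AE s in leb01. N t s / t - p s = S.X t s / t - P s"
  using pP AE_space by eventually_elim (use t in \<open>simp add: XN\<close>)
 have norm: "L2_norm (\<lambda>s. N t s / t - p s) = sqrt (\<E> s. (S.X t s / t - P s)\<^sup>2)"
  by (rule L2_norm_AE[OF Nm pm Xtm P(1) ae])
 have norm0: "L2_norm (N 0) = sqrt (\<E> s. (S.X 0 s)\<^sup>2)"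
 proof -
  have "(\<integral>s. (N 0 s)\<^sup>2 \<partial>leb01) = (\<integral>s. (S.X 0 s)\<^sup>2 \<partial>leb01)" by (rule Bochner_Integration.integral_cong[OF refl]) (simp add: XN)
  also have "... = (\<E> s. (S.X 0 s)\<^sup>2)" by (rule integral_unif_leb01(1)[symmetric]) measurable
  finally show ?thesis by (simp add: L2_norm_def)
 qed
 have "(\<lambda>s. N t s / t - p s) \<in> L2"
 proof -
  have m: "(\<lambda>s. N t s / t - p s) \<in> borel_measurable leb01" by (intro borel_measurable_diff Nm pm)
  have mX: "(\<lambda>s. S.X t s / t - P s) \<in> borel_measurable borel" by (intro borel_measurable_diff Xtm P(1))
  have "integrable unif (\<lambda>s. (S.X t s / t - P s)\<^sup>2)"
   by (rule integrable_square_diff[OF _ _ F.nrm_square[OF t] P(3)]) (use Xtm P(1) in simp_all)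
  then have "integrable leb01 (\<lambda>s. (S.X t s / t - P s)\<^sup>2)" using integral_unif_leb01(2)[of "\<lambda>s. (S.X t s / t - P s)\<^sup>2"] mX by simp
  moreover have "integrable leb01 (\<lambda>s. (N t s / t - p s)\<^sup>2) \<longleftrightarrow> integrable leb01 (\<lambda>s. (S.X t s / t - P s)\<^sup>2)"
  proof (rule integrable_cong_AE)
   show "AE s in leb01. (N t s / t - p s)\<^sup>2 = (S.X t s / t - P s)\<^sup>2" using ae by eventually_elim simp
  qed (intro borel_measurable_power m measurable_leb01_of_borel[OF mX])+
  ultimately show ?thesis using m by (simp add: L2_def)
 qed
 moreover have "L2_norm (\<lambda>s. N t s / t - p s) <= L2_norm (N 0) / t"
 proof -
  have "sqrt (\<E> s. (S.X t s / t - P s)\<^sup>2) <= sqrt ((\<E> s. (S.X 0 s)\<^sup>2) / t\<^sup>2)"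
   by (rule real_sqrt_le_mono[OF P(5)[OF t]])
  also have "... = sqrt (\<E> s. (S.X 0 s)\<^sup>2) / t" using t by (simp add: real_sqrt_divide)
  finally show ?thesis unfolding norm norm0 .
 qed
 ultimately show "(\<lambda>s. N t s / t - proj_mono_cone (v\<^sub>0 \<circ> N 0) s) \<in> L2 \<and>
     L2_norm (\<lambda>s. N t s / t - proj_mono_cone (v\<^sub>0 \<circ> N 0) s) <= L2_norm (N 0) / t"
  unfolding p_def by blast
qed

end
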